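(* If $\mathcal A$ is an indecomposable Kronecker pair, then $\langle\mathcal A\rangle^{\vee}$ is a one-element set; it consists of the orbit of $\mathcal A$. The lower cones of direct sums of two indecomposable Kronecker pairs are the following ($\varepsilon$ is an arbitrary nonzero complex number, and $\Delta_r=\Delta_r(\varepsilon)$, $\nabla_r=\nabla_r(\varepsilon)$; summands $\mathcal D_0(\lambda)$ are omitted). (i) $\langle\mathcal L_m^T\oplus\mathcal L_n^T\rangle^{\vee}$ with $1\le m\le n$ consists of the orbits of $\mathcal L_{m+r}^T\oplus\mathcal L_{n-r}^T$, in which $r\ge0$ and $m+r\le n-r$. Each such pair is the Kronecker canonical form of $$\left(\begin{bmatrix}L_m^T&0\\0&L_n^T\end{bmatrix},\begin{bmatrix}R_m^T&\Delta_r\\0&R_n^T\end{bmatrix}\right).$$ (ii) $\langle\mathcal L_m\oplus\mathcal L_n\rangle^{\vee}$ with $1\le m\le n$ consists of the orbits of $\mathcal L_{m+r}\oplus\mathcal L_{n-r}$, in which $r\ge0$ and $m+r\le n-r$. Each such pair is the Kronecker canonical form of $$\left(\begin{bmatrix}L_m&0\\0&L_n\end{bmatrix},\begin{bmatrix}R_m&0\\\Delta_r^T&R_n\end{bmatrix}\right).$$ (iii) $\langle\mathcal L_m^T\oplus\mathcal D_n(\lambda)\rangle^{\vee}$ with $m\ge1$, $n\ge1$, and $\lambda\in\mathbb C\cup\{\infty\}$ consists of the orbits of $\mathcal L_{m+r}^T\oplus\mathcal D_{n-r}(\lambda)$, in which $0\le r\le n$. Each such pair with $r>0$ is the Kronecker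 canonical form of $$\left(\begin{bmatrix}L_m^T&0\\0&I_n\end{bmatrix},\begin{bmatrix}R_m^T&\Delta_{n-r+1}\\0&J_n(\lambda)\end{bmatrix}\right)\text{ if }\lambda\in\mathbb C,\qquad\left(\begin{bmatrix}L_m^T&\nabla_{n-r+1}\\0&J_n(0)\end{bmatrix},\begin{bmatrix}R_m^T&0\\0&I_n\end{bmatrix}\right)\text{ if }\lambda=\infty.$$ (iv) $\langle\mathcal L_m\oplus\mathcal D_n(\lambda)\rangle^{\vee}$ with $m\ge1$, $n\ge1$, and $\lambda\in\mathbb C\cup\{\infty\}$ consists of the orbits of $\mathcal L_{m+r}\oplus\mathcal D_{n-r}(\lambda)$, in which $0\le r\le n$. Each such pair with $r>0$ is the Kronecker canonical form of $$\left(\begin{bmatrix}L_m&0\\0&I_n\end{bmatrix},\begin{bmatrix}R_m&0\\\Delta_r^T&J_n(\lambda)\end{bmatrix}\right)\text{ if }\lambda\in\mathbb C,\qquad\left(\begin{bmatrix}J_n(0)&\nabla_r^T\\0&L_m\end{bmatrix},\begin{bmatrix}I_n&0\\0&R_m\end{bmatrix}\right)\text{ if }\lambda=\infty.$$ (v) $\langle\mathcal D_m(\lambda)\oplus\mathcal D_n(\lambda)\rangle^{\vee}$ with $1\le m\le n$ and $\lambda\in\mathbb C\cup\{\infty\}$ consists of the orbits of $\mathcal D_{m-r}(\lambda)\oplus\mathcal D_{n+r}(\lambda)$, in which $0\le r\le m$. Each such pair with $r>0$ is the Kronecker canonical form of $$\left(I_{m+n},\begin{bmatrix}J_m(\lambda)&\Delta_r^T\\0&J_n(\lambda)\end{bmatrix}\right)\text{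 if }\lambda\in\mathbb C,\qquad\left(\begin{bmatrix}J_m(0)&\Delta_r^T\\0&J_n(0)\end{bmatrix},I_{m+n}\right)\text{ if }\lambda=\infty.$$ (vi) $\langle\mathcal L_m^T\oplus\mathcal L_n\rangle^{\vee}$ with $m\ge1$ and $n\ge1$ consists of $\langle\mathcal L_m^T\oplus\mathcal L_n\rangle$ and the orbits of $$\mathcal D_{r_1}(\mu_1)\oplus\dots\oplus\mathcal D_{r_k}(\mu_k),\qquad r_1+\dots+r_k=m+n-1,\quad\mu_1,\dots,\mu_k\in\mathbb C\cup\{\infty\}\text{ distinct}.$$ Each such pair $\mathcal D_{r_1}(\mu_1)\oplus\dots\oplus\mathcal D_{r_k}(\mu_k)$ is the Kronecker canonical form of $$\left(\begin{bmatrix}L_m^T&P\\0&L_n\end{bmatrix},\begin{bmatrix}R_m^T&Q\\0&R_n\end{bmatrix}\right),$$ in which $P$ is the $m\times n$ matrix whose last column is $(\alpha_1,\dots,\alpha_m)^T$ and whose other entries are zero, $Q$ is the $m\times n$ matrix whose first row is $(\beta_1,\dots,\beta_n)$ and whose other entries are zero, $$(-\beta_1,\dots,-\beta_n,\alpha_1,\dots,\alpha_m):=\varepsilon\,(c_0,\dots,c_{r-1},1,0,\dots,0),$$ and $r$ and $c_0,\dots,c_{r-1}$ are defined by $c_0+c_1x+\dots+c_{r-1}x^{r-1}+x^r:=\prod_{\mu_i\ne\infty}(x-\mu_i)^{r_i}$.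
   Context: All matrices are complex, and both matrices in each matrix pair have the same size; sizes with zero rows or zero columns are allowed. Two pairs $(A,B)$ and $(A',B')$ are equivalent if $(A',B')=(SAR,SBR)$ for some nonsingular $S,R$. The orbit $\langle\mathcal A\rangle$ is the set of all pairs equivalent to $\mathcal A$. One writes $\langle\mathcal A\rangle\le\langle\mathcal B\rangle$ if $\langle\mathcal A\rangle$ is contained in the closure of $\langle\mathcal B\rangle$. The lower cone of $\langle\mathcal A\rangle$ is the set $\langle\mathcal A\rangle^{\vee}$ of all orbits $\langle\mathcal B\rangle$ such that $\langle\mathcal A\rangle\le\langle\mathcal B\rangle$. Direct sums of pairs are taken componentwise. For $n\ge1$, $L_n$ and $R_n$ are the $(n-1)\times n$ matrices $L_n=[I_{n-1}\;0]$ and $R_n=[0\;I_{n-1}]$; $L_1=R_1$ is the $0\times1$ matrix. $J_n(\lambda)$ is the $n\times n$ upper triangular Jordan block with eigenvalue $\lambda$. The indecomposable Kronecker pairs are $\mathcal L_n:=(L_n,R_n)$, $\mathcal L_n^T:=(L_n^T,R_n^T)$, and $\mathcal D_n(\lambda):=(I_n,J_n(\lambda))$ for $\lambda\in\mathbb C$, $\mathcal D_n(\infty):=(J_n(0),I_n)$, where $n\ge1$. Every pair is equivalent to a direct sum of indecomposable Kronecker pairs, its Kronecker canonical form, unique up to permutations of direct summands. For $r\ge1$ and $\varepsilon\ne0$, $\Delta_r(\varepsilon)$ (respectively, $\nabla_r(\varepsilon)$) denotes the matrix, of size clear from the context, all of whose entries are zero except for the $r$th entry of the first row (respectively, of the last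 row), which equals $\varepsilon$. Also $\Delta_0=\nabla_0:=0$. *)

theory Defs
  imports
    "HOL-Analysis.Function_Topology"
    "Jordan_Normal_Form.Jordan_Normal_Form"
begin

section \<open>Matrix pairs, equivalence, orbits and closures\<close>

type_synonym mpair = "complex mat \<times> complex mat"

definition matrix_pairs :: "nat \<Rightarrow> nat \<Rightarrow> mpair set" where
  "matrix_pairs p q = carrier_mat p q \<times> carrier_mat p q"

definition is_matrix_pair :: "mpair \<Rightarrow> bool" where
  "is_matrix_pair X \<longleftrightarrow> (\<exists>p q. X \<in> matrix_pairs p q)"

definition pair_equiv :: "mpair \<Rightarrow> mpair \<Rightarrow> bool" where
  "pair_equiv X Y \<longleftrightarrow>
     (\<exists>p q S R. X \<in> matrix_pairs p q \<and>
        S \<in> carrier_mat p p \<and> invertible_mat S \<and>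
        R \<in> carrier_mat q q \<and> invertible_mat R \<and>
        Y = (S * fst X * R, S * snd X * R))"

definition pair_orbit :: "mpair \<Rightarrow> mpair set" where
  "pair_orbit X = {Y. pair_equiv X Y}"

text \<open>The type of matrices carries no topology. The space of pairs of \<open>p \<times> q\<close> matrices gets
  the usual topology of \<open>\<complex>\<^sup>2\<^sup>p\<^sup>q\<close>, that is, the one of entrywise convergence.\<close>

definition matrix_pair_topology :: "nat \<Rightarrow> nat \<Rightarrow> mpair topology" where
  "matrix_pair_topology p q =
     pullback_topology (matrix_pairs p q)
       (\<lambda>(A, B). \<lambda>ij\<in>{..<p} \<times> {..<q}. (A $$ ij, B $$ ij))
       (product_topology (\<lambda>_. euclidean :: (complex \<times> complex) topology) ({..<p} \<times> {..<q}))"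

text \<open>An orbit is nonempty and all its members have the same size, and \<open>closure_of\<close> only yields
  members of the ambient space; so for orbits \<open>p\<close> and \<open>q\<close> below are forced to be the size
  of the members of \<open>U\<close>, and \<open>V\<close> must consist of pairs of that size, too.\<close>

definition orbit_le :: "mpair set \<Rightarrow> mpair set \<Rightarrow> bool" where
  "orbit_le U V \<longleftrightarrow> (\<exists>p q. U \<subseteq> matrix_pair_topology p q closure_of V)"

definition lower_cone :: "mpair set \<Rightarrow> mpair set set" where
  "lower_cone U = {pair_orbit Y | Y. is_matrix_pair Y \<and> orbit_le U (pair_orbit Y)}"


section \<open>Kronecker pairs\<close>

definition direct_sum :: "mpair list \<Rightarrow> mpair" where
  "direct_sum Xs = (diag_block_mat (map fst Xs), diag_block_mat (map snd Xs))"

definition L_mat :: "nat \<Rightarrow> complex mat" where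
  "L_mat n = mat (n - 1) n (\<lambda>(i, j). if j = i then 1 else 0)"

definition R_mat :: "nat \<Rightarrow> complex mat" where
  "R_mat n = mat (n - 1) n (\<lambda>(i, j). if j = Suc i then 1 else 0)"

datatype ext_complex = Fin complex | Infty

definition kron_L :: "nat \<Rightarrow> mpair" where
  "kron_L n = (L_mat n, R_mat n)"

definition kron_LT :: "nat \<Rightarrow> mpair" where
  "kron_LT n = (transpose_mat (L_mat n), transpose_mat (R_mat n))"

text \<open>For \<open>n = 0\<close> this is the pair of \<open>0 \<times> 0\<close> matrices, which is neutral for direct sums;
  this implements the convention that summands of index zero are omitted.\<close>

fun kron_D :: "nat \<Rightarrow> ext_complex \<Rightarrow> mpair" where
  "kron_D n (Fin z) = (1\<^sub>m n, jordan_block n z)"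
| "kron_D n Infty = (jordan_block n 0, 1\<^sub>m n)"

definition indecomposable_kronecker_pairs :: "mpair set" where
  "indecomposable_kronecker_pairs =
     {kron_L n | n. n \<ge> 1} \<union> {kron_LT n | n. n \<ge> 1} \<union> {kron_D n \<mu> | n \<mu>. n \<ge> 1}"

text \<open>The canonical form is unique only up to the order of the summands, hence a relation.\<close>

definition is_kronecker_canonical_form_of :: "mpair \<Rightarrow> mpair \<Rightarrow> bool" where
  "is_kronecker_canonical_form_of K X \<longleftrightarrow>
     (\<exists>Ks. set Ks \<subseteq> indecomposable_kronecker_pairs \<and> K = direct_sum Ks) \<and> pair_equiv X K"


section \<open>Perturbation matrices\<close>

text \<open>Matrix indices start at 0, but \<open>r\<close> counts from 1; for \<open>r = 0\<close> these are zero matrices.\<close>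

definition Delta_mat :: "nat \<Rightarrow> nat \<Rightarrow> nat \<Rightarrow> complex \<Rightarrow> complex mat" where
  "Delta_mat p q r \<epsilon> = mat p q (\<lambda>(i, j). if i = 0 \<and> Suc j = r then \<epsilon> else 0)"

definition Nabla_mat :: "nat \<Rightarrow> nat \<Rightarrow> nat \<Rightarrow> complex \<Rightarrow> complex mat" where
  "Nabla_mat p q r \<epsilon> = mat p q (\<lambda>(i, j). if Suc i = p \<and> Suc j = r then \<epsilon> else 0)"

definition last_col_mat :: "nat \<Rightarrow> nat \<Rightarrow> (nat \<Rightarrow> complex) \<Rightarrow> complex mat" where
  "last_col_mat p q \<alpha> = mat p q (\<lambda>(i, j). if Suc j = q then \<alpha> i else 0)"

definition first_row_mat :: "nat \<Rightarrow> nat \<Rightarrow> (nat \<Rightarrow> complex) \<Rightarrow> complex mat" where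
  "first_row_mat p q \<beta> = mat p q (\<lambda>(i, j). if i = 0 then \<beta> j else 0)"

text \<open>The product of the \<open>(x - \<mu>\<^sub>i)\<^sup>r\<^sub>i\<close> over the finite \<open>\<mu>\<^sub>i\<close>, for the list of the
  \<open>(r\<^sub>i, \<mu>\<^sub>i)\<close>. It is monic, so its coefficients, continued by zeros, are
  \<open>c\<^sub>0, \<dots>, c\<^sub>r\<^sub>-\<^sub>1, 1, 0, \<dots>, 0\<close>.\<close>

definition finite_part_poly :: "(nat \<times> ext_complex) list \<Rightarrow> complex poly" where
  "finite_part_poly rs =
     (\<Prod>(k, \<mu>)\<leftarrow>rs. case \<mu> of Fin z \<Rightarrow> [:- z, 1:] ^ k | Infty \<Rightarrow> 1)"

text \<open>The data of a direct sum of \<open>\<D>\<close>-pairs of total size \<open>N\<close> with distinct eigenvalues.\<close>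

definition distinct_eigenvalue_data :: "nat \<Rightarrow> (nat \<times> ext_complex) list \<Rightarrow> bool" where
  "distinct_eigenvalue_data N rs \<longleftrightarrow>
     (\<forall>(k, \<mu>)\<in>set rs. k \<ge> 1) \<and> distinct (map snd rs) \<and> sum_list (map fst rs) = N"

definition kron_D_sum :: "(nat \<times> ext_complex) list \<Rightarrow> mpair" where
  "kron_D_sum rs = direct_sum (map (\<lambda>(k, \<mu>). kron_D k \<mu>) rs)"

end

theory Submission
  imports "HOL-Analysis.Elementary_Metric_Spaces" "HOL-Analysis.Product_Vector" "Jordan_Normal_Form.Jordan_Normal_Form_Existence" Defs
begin

text \<open>A pair \<open>Y\<close> has \<open>X\<close> in the closure of its orbit iff pairs equivalent to \<open>Y\<close> approximate \<open>X\<close>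
  entrywise. The corank of every member \<open>aA + bB\<close> of the pencil and the existence of a polynomial
  null vector of degree at most \<open>d\<close> are inherited by \<open>X\<close> from \<open>Y\<close>, as a homogeneous linear
  system without nonzero solutions has none after a small perturbation. Conversely, a null vector
  of least degree \<open>d\<close> of \<open>Y\<close> splits off a summand \<open>\<L>\<^sub>d\<^sub>+\<^sub>1\<close> (the equations for a retraction are
  solvable by the Fredholm alternative), and the regular part is the canonical form of one matrix.
  So the coranks and null degrees of \<open>X\<close> leave only the listed orbits.

  Scaling the off-diagonal block of a block triangular pair by \<open>t \<rightarrow> 0\<close> does not change its orbit;
  so each explicit pair has the direct sum of its diagonal blocks in the closure of its orbit, and
  hence occurs in the list. Its place there is read off the least null degree in (i) to (iv), the
  nilpotency index at \<open>\<lambda>\<close> in (v), and the determinant of the pencil in (vi).\<close>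

section \<open>Linear systems over finite index sets\<close>

text \<open>Ranks at single points do not separate the candidates: all sums of two
  \<open>kron_LT\<close> of a given size have full column rank at every point, and all sums of two
  nonempty \<open>kron_D\<close> with the same eigenvalue have the same coranks. This is why degrees
  of polynomial null vectors and, in (v), the nilpotency index are needed. Every semicontinuity
  statement is an instance of one fact, the openness of injectivity of a finite linear system, so
  each invariant is encoded as such a system: the corank by extra functionals that cut the kernel
  down to zero, the null degree by the coefficients of a null vector, the nilpotency index by chains
  of vectors that involve no inverse matrix. Two symmetries save work in (i) to (v): transposition
  exchanges \<open>kron_L\<close> and \<open>kron_LT\<close>, and swapping the components exchanges
  the eigenvalues 0 and infinity. In (vi) a singular pair that degenerates to
  \<open>kron_LT m \<boxplus> kron_L n\<close> has both its left and its right null degree bounded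
  below, while the size fixes their sum; this leaves the pair itself. The regular ones are told
  apart by the roots of the determinant, the block at infinity by the total size.\<close>

text \<open>One unknown is added at a time: if no value of the new unknown makes the rest solvable,
  two obstructing functionals combine into one that also kills the new column.\<close>

lemma fredholm_alternative:
  fixes a :: "'i \<Rightarrow> 'j \<Rightarrow> 'f :: field"
  assumes "finite J" and I: "finite I"
  shows "(\<exists>x. \<forall>i\<in>I. (\<Sum>j\<in>J. a i j * x j) = y i) \<or>
         (\<exists>f. (\<forall>j\<in>J. (\<Sum>i\<in>I. f i * a i j) = 0) \<and> (\<Sum>i\<in>I. f i * y i) \<noteq> 0)"
  using assms(1)
proof (induction J arbitrary: y rule: finite_induct)
  case empty
  show ?case
  proof (cases "\<forall>i\<in>I. y i = 0")
    case True
    then show ?thesis by auto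
  next
    case False
    then obtain i where i: "i \<in> I" "y i \<noteq> 0" by auto
    have "(\<Sum>k\<in>I. (if k = i then 1 else 0) * y k) = y i"
      using I i by (simp add: if_distrib [of "\<lambda>c. c * _"] sum.delta cong: if_cong)
    with i show ?thesis by (intro disjI2 exI[of _ "\<lambda>k. if k = i then 1 else 0"]) auto
  qed
next
  case (insert k J)
  have sumJ: "(\<Sum>j\<in>J. a i j * (if j = k then c else x j)) = (\<Sum>j\<in>J. a i j * x j)" for i c x
    using insert.hyps by (intro sum.cong) auto
  have solve: "\<exists>x. \<forall>i\<in>I. (\<Sum>j\<in>insert k J. a i j * x j) = y i"
    if "\<forall>i\<in>I. (\<Sum>j\<in>J. a i j * x j) = y i - c * a i k" for x c
    using that insert.hyps
    by (intro exI[of _ "\<lambda>j. if j = k then c else x j"]) (simp add: sumJ)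
  from insert.IH[of y] show ?case
  proof (elim disjE exE conjE)
    fix x assume "\<forall>i\<in>I. (\<Sum>j\<in>J. a i j * x j) = y i"
    then show ?thesis using solve[of x 0] by simp
  next
    fix f assume f: "\<forall>j\<in>J. (\<Sum>i\<in>I. f i * a i j) = 0" "(\<Sum>i\<in>I. f i * y i) \<noteq> 0"
    \<comment> \<open>\<open>t\<close> and \<open>s\<close> are the values of the obstruction
      \<open>f\<close> on the new column and on the right-hand side; for \<open>t = 0\<close> it
      remains an obstruction.\<close>
    define t where "t = (\<Sum>i\<in>I. f i * a i k)"
    define s where "s = (\<Sum>i\<in>I. f i * y i)"
    show ?thesis
    proof (cases "t = 0")
      case True
      then show ?thesis using f by (auto simp: t_def intro!: disjI2 exI[of _ f])
    next
      case False
      \<comment> \<open>The obstruction \<open>f\<close> permits only the value \<open>s / t\<close>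
        for the new unknown; if this value fails too, it yields a second obstruction
        \<open>g\<close>.\<close>
      from insert.IH[of "\<lambda>i. y i - s / t * a i k"] show ?thesis
      proof (elim disjE exE conjE)
        fix x assume "\<forall>i\<in>I. (\<Sum>j\<in>J. a i j * x j) = y i - s / t * a i k"
        then show ?thesis using solve by blast
      next
        fix g assume g: "\<forall>j\<in>J. (\<Sum>i\<in>I. g i * a i j) = 0"
          "(\<Sum>i\<in>I. g i * (y i - s / t * a i k)) \<noteq> 0"
        define u where "u = (\<Sum>i\<in>I. g i * a i k)"
        \<comment> \<open>\<open>h\<close> kills the new column, and its value on \<open>y\<close>
          equals that of \<open>g\<close> on the right-hand side of the second system.\<close>
        define h where "h = (\<lambda>i. g i - u / t * f i)"
        have h: "(\<Sum>i\<in>I. h i * z i) = (\<Sum>i\<in>I. g i * z i) - u / t * (\<Sum>i\<in>I. f i * z i)" for z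
          by (simp add: h_def left_diff_distrib sum_subtractf sum_distrib_left mult.assoc)
        have "(\<Sum>i\<in>I. g i * (y i - s / t * a i k)) = (\<Sum>i\<in>I. g i * y i) - s / t * u"
          by (simp add: u_def right_diff_distrib sum_subtractf sum_distrib_left ac_simps)
        with g(2) have "(\<Sum>i\<in>I. g i * y i) - s / t * u \<noteq> 0" by metis
        then have "(\<Sum>i\<in>I. h i * y i) \<noteq> 0"
          by (simp add: h s_def[symmetric] mult.commute)
        moreover have "(\<Sum>i\<in>I. h i * a i k) = 0"
          using False by (simp add: h t_def[symmetric] u_def[symmetric])
        moreover have "\<forall>j\<in>J. (\<Sum>i\<in>I. h i * a i j) = 0"
          using f g by (simp add: h)
        ultimately show ?thesis by (intro disjI2 exI[of _ h]) auto
      qed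
    qed
  qed
qed

text \<open>Gaussian elimination: an equation with a nonzero coefficient removes one unknown, so the
  surplus of unknowns persists until no equation is left.\<close>

lemma wide_system_has_solution:
  fixes a :: "'i \<Rightarrow> 'j \<Rightarrow> 'f :: field"
  assumes "finite I" "finite J" "card I < card J"
  shows "\<exists>x. (\<forall>i\<in>I. (\<Sum>j\<in>J. a i j * x j) = 0) \<and> (\<exists>j\<in>J. x j \<noteq> 0)"
  using assms
proof (induction I arbitrary: J a rule: finite_induct)
  case empty
  then have "J \<noteq> {}" by auto
  then show ?case by (intro exI[of _ "\<lambda>_. 1"]) auto
next
  case (insert k I)
  show ?case
  proof (cases "\<forall>j\<in>J. a k j = 0")
    case True
    have "card I < card J" using insert by simp
    from insert.IH[OF insert.prems(1) this, of a] True show ?thesis by auto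
  next
    case False
    then obtain l where l: "l \<in> J" "a k l \<noteq> 0" by auto
    define J' where "J' = J - {l}"
    have J': "finite J'" "card I < card J'" "J = insert l J'" "l \<notin> J'"
      using insert l by (auto simp: J'_def)
    \<comment> \<open>The system after elimination of the unknown \<open>l\<close> by equation
      \<open>k\<close>, whose pivot is \<open>a k l\<close>.\<close>
    from insert.IH[OF J'(1,2), of "\<lambda>i j. a i j - a i l * a k j / a k l"]
    obtain x where x: "\<And>i. i \<in> I \<Longrightarrow> (\<Sum>j\<in>J'. (a i j - a i l * a k j / a k l) * x j) = 0"
      "\<exists>j\<in>J'. x j \<noteq> 0" by auto
    define c where "c = - (\<Sum>j\<in>J'. a k j * x j) / a k l"
    define x' where "x' = (\<lambda>j. if j = l then c else x j)"
    have s: "(\<Sum>j\<in>J. a i j * x' j) = a i l * c + (\<Sum>j\<in>J'. a i j * x j)" for i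
    proof -
      have "(\<Sum>j\<in>J'. a i j * x' j) = (\<Sum>j\<in>J'. a i j * x j)"
        using J'(4) by (intro sum.cong) (auto simp: x'_def)
      then show ?thesis using J' by (simp add: x'_def)
    qed
    have "(\<Sum>j\<in>J. a k j * x' j) = 0" using l by (simp add: s c_def)
    moreover have "(\<Sum>j\<in>J. a i j * x' j) = 0" if "i \<in> I" for i
    proof -
      have "(\<Sum>j\<in>J'. (a i j - a i l * a k j / a k l) * x j)
          = (\<Sum>j\<in>J'. a i j * x j) - a i l / a k l * (\<Sum>j\<in>J'. a k j * x j)"
        by (simp add: left_diff_distrib sum_subtractf sum_distrib_left mult.assoc)
      with x(1)[OF that] show ?thesis by (simp add: s c_def)
    qed
    moreover have "\<exists>j\<in>J. x' j \<noteq> 0"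
      using x(2) J'(3,4) by (auto simp: x'_def)
    ultimately show ?thesis by (intro exI[of _ x']) auto
  qed
qed

text \<open>The index types are arbitrary so that equations of different kinds can be joined in one
  system: rows of a pencil, extra functionals, normalizations.\<close>

definition injective_system :: "'i set \<Rightarrow> 'j set \<Rightarrow> ('i \<Rightarrow> 'j \<Rightarrow> 'f :: field) \<Rightarrow> bool" where
  "injective_system I J a \<longleftrightarrow>
     (\<forall>x. (\<forall>i\<in>I. (\<Sum>j\<in>J. a i j * x j) = 0) \<longrightarrow> (\<forall>j\<in>J. x j = 0))"

lemma injective_system_left_inverse:
  fixes a :: "'i \<Rightarrow> 'j \<Rightarrow> 'f :: field"
  assumes "finite I" "finite J" "injective_system I J a" "j \<in> J"
  shows "\<exists>f. \<forall>k\<in>J. (\<Sum>i\<in>I. f i * a i k) = (if k = j then 1 else 0)"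
proof -
  have fin: "finite (J - {j})" using assms by auto
  have "\<not> (\<exists>x. \<forall>i\<in>I. (\<Sum>k\<in>J - {j}. a i k * x k) = a i j)"
  proof
    assume "\<exists>x. \<forall>i\<in>I. (\<Sum>k\<in>J - {j}. a i k * x k) = a i j"
    then obtain x where x: "\<And>i. i \<in> I \<Longrightarrow> (\<Sum>k\<in>J - {j}. a i k * x k) = a i j" by auto
    \<comment> \<open>A representation of column \<open>j\<close> by the other columns is a kernel
      vector with entry -1 at \<open>j\<close>.\<close>
    define x' where "x' = (\<lambda>k. if k = j then - 1 else x k)"
    have "(\<Sum>k\<in>J. a i k * x' k) = 0" if "i \<in> I" for i
    proof -
      have "(\<Sum>k\<in>J. a i k * x' k) = a i j * x' j + (\<Sum>k\<in>J - {j}. a i k * x' k)"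
        using assms by (subst sum.remove[of J j]) auto
      also have "(\<Sum>k\<in>J - {j}. a i k * x' k) = (\<Sum>k\<in>J - {j}. a i k * x k)"
        by (intro sum.cong) (auto simp: x'_def)
      finally show ?thesis using x[OF that] by (simp add: x'_def)
    qed
    then have "x' j = 0" using assms unfolding injective_system_def by blast
    then show False by (simp add: x'_def)
  qed
  with fredholm_alternative[OF fin assms(1), of a "\<lambda>i. a i j"]
  obtain f where f: "\<forall>k\<in>J - {j}. (\<Sum>i\<in>I. f i * a i k) = 0" "(\<Sum>i\<in>I. f i * a i j) \<noteq> 0" by auto
  then show ?thesis
    by (intro exI[of _ "\<lambda>i. f i / (\<Sum>i\<in>I. f i * a i j)"])
       (auto simp: sum_divide_distrib[symmetric])
qed

text \<open>A left inverse \<open>f\<close> of \<open>a\<close> gives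
  \<open>x = - f (b - a) x\<close> for every kernel vector \<open>x\<close> of \<open>b\<close>; if
  \<open>b\<close> is close to \<open>a\<close>, a largest coordinate of a nonzero \<open>x\<close>
  contradicts this.\<close>

lemma injective_system_open:
  fixes a :: "'i \<Rightarrow> 'j \<Rightarrow> complex"
  assumes fin: "finite I" "finite J" and inj: "injective_system I J a"
  shows "\<exists>d>0. \<forall>b. (\<forall>i\<in>I. \<forall>j\<in>J. cmod (b i j - a i j) < d) \<longrightarrow> injective_system I J b"
proof -
  from injective_system_left_inverse[OF fin inj]
  obtain f where f: "\<And>j k. j \<in> J \<Longrightarrow> k \<in> J \<Longrightarrow> (\<Sum>i\<in>I. f j i * a i k) = (if k = j then 1 else 0)"
    by metis
  \<comment> \<open>The summation over \<open>k\<close> repeats each row norm \<open>card J\<close>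
    times, because the error in a row is added up over all columns.\<close>
  define C where "C = (\<Sum>j\<in>J. \<Sum>k\<in>J. \<Sum>i\<in>I. cmod (f j i))"
  have C0: "C \<ge> 0" unfolding C_def by (intro sum_nonneg norm_ge_zero)
  have Cj: "(\<Sum>k\<in>J. \<Sum>i\<in>I. cmod (f j i)) \<le> C" if "j \<in> J" for j
    unfolding C_def using that fin(2)
    by (intro member_le_sum[of j J "\<lambda>j. \<Sum>k\<in>J. \<Sum>i\<in>I. cmod (f j i)"]) (auto intro!: sum_nonneg mult_nonneg_nonneg)
  define d where "d = 1 / (1 + C)"
  have d: "d > 0" "C * d < 1" using C0 by (auto simp: d_def field_simps)
  show ?thesis
  proof (intro exI[of _ d] conjI allI impI d(1))
    fix b assume b: "\<forall>i\<in>I. \<forall>j\<in>J. cmod (b i j - a i j) < d"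
    show "injective_system I J b" unfolding injective_system_def
    proof (intro allI impI, rule ccontr)
      fix x assume x: "\<forall>i\<in>I. (\<Sum>j\<in>J. b i j * x j) = 0" and "\<not> (\<forall>j\<in>J. x j = 0)"
      then have ne: "J \<noteq> {}" "\<exists>j\<in>J. x j \<noteq> 0" by auto
      define M where "M = Max ((\<lambda>j. cmod (x j)) ` J)"
      have "M \<in> (\<lambda>j. cmod (x j)) ` J" unfolding M_def using ne fin by (intro Max_in) auto
      then obtain j where j: "j \<in> J" "M = cmod (x j)" by auto
      have M: "cmod (x k) \<le> M" if "k \<in> J" for k unfolding M_def using that fin by (intro Max_ge) auto
      have Mpos: "M > 0"
      proof -
        from ne(2) obtain l where "l \<in> J" "x l \<noteq> 0" by auto
        then show ?thesis using M[of l] by (intro less_le_trans[of 0 "cmod (x l)" M]) auto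
      qed
      \<comment> \<open>Row \<open>j\<close> of the left inverse is applied to
        \<open>b x = 0\<close>, where \<open>j\<close> is a coordinate of maximal modulus.\<close>
      have "0 = (\<Sum>i\<in>I. f j i * (\<Sum>k\<in>J. b i k * x k))" using x by simp
      also have "\<dots> = (\<Sum>k\<in>J. (\<Sum>i\<in>I. f j i * b i k) * x k)"
        by (simp add: sum_distrib_left sum_distrib_right mult.assoc, subst sum.swap) simp
      also have "\<dots> = (\<Sum>k\<in>J. (\<Sum>i\<in>I. f j i * a i k) * x k)
                   + (\<Sum>k\<in>J. (\<Sum>i\<in>I. f j i * (b i k - a i k)) * x k)"
        unfolding sum.distrib[symmetric] distrib_right[symmetric] distrib_left[symmetric] by simp
      also have "(\<Sum>k\<in>J. (\<Sum>i\<in>I. f j i * a i k) * x k) = (\<Sum>k\<in>J. (if k = j then 1 else 0) * x k)"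
        using f[OF j(1)] by (intro sum.cong) auto
      also have "\<dots> = x j"
        using fin j by (simp add: if_distrib [of "\<lambda>c. c * _"] sum.delta cong: if_cong)
      finally have "x j = - (\<Sum>k\<in>J. (\<Sum>i\<in>I. f j i * (b i k - a i k)) * x k)"
        by (simp add: eq_neg_iff_add_eq_0)
      then have "M = cmod (\<Sum>k\<in>J. (\<Sum>i\<in>I. f j i * (b i k - a i k)) * x k)"
        using j by (simp add: norm_minus_cancel)
      also have "\<dots> \<le> (\<Sum>k\<in>J. (\<Sum>i\<in>I. cmod (f j i) * d) * M)"
      proof (intro order_trans[OF norm_sum] sum_mono)
        fix k assume k: "k \<in> J"
        have "cmod (\<Sum>i\<in>I. f j i * (b i k - a i k)) \<le> (\<Sum>i\<in>I. cmod (f j i) * d)"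
          using b k by (intro order_trans[OF norm_sum] sum_mono)
            (simp add: norm_mult mult_left_mono less_imp_le)
        then show "cmod ((\<Sum>i\<in>I. f j i * (b i k - a i k)) * x k) \<le> (\<Sum>i\<in>I. cmod (f j i) * d) * M"
          unfolding norm_mult using M[OF k]
          by (intro mult_mono) (auto intro: order_trans[OF norm_ge_zero])
      qed
      also have "\<dots> = (\<Sum>k\<in>J. \<Sum>i\<in>I. cmod (f j i)) * d * M"
        by (simp only: sum_distrib_right)
      also have "\<dots> \<le> C * d * M"
        using Cj[OF j(1)] d Mpos by (intro mult_right_mono) auto
      also have "\<dots> < 1 * M" using d Mpos by (intro mult_strict_right_mono) auto
      finally show False by simp
    qed
  qed
qed

section \<open>Equivalence and direct sums of matrix pairs\<close>

lemma matrix_pairs_iff: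
  "X \<in> matrix_pairs p q \<longleftrightarrow> fst X \<in> carrier_mat p q \<and> snd X \<in> carrier_mat p q"
  by (simp add: matrix_pairs_def mem_Times_iff)

lemma invertible_matI:
  fixes S :: "'a :: field mat"
  assumes "S \<in> carrier_mat n n" "S' \<in> carrier_mat n n" "S * S' = 1\<^sub>m n"
  shows "invertible_mat S"
proof -
  have "S' * S = 1\<^sub>m n" using mat_mult_left_right_inverse assms by blast
  then show ?thesis using assms unfolding invertible_mat_def inverts_mat_def by auto
qed

lemma invertible_matE:
  fixes S :: "'a :: field mat"
  assumes "invertible_mat S" "S \<in> carrier_mat n n"
  obtains S' where "S' \<in> carrier_mat n n" "S * S' = 1\<^sub>m n" "S' * S = 1\<^sub>m n"
proof -
  from assms obtain S' where S': "S * S' = 1\<^sub>m n" "S' * S = 1\<^sub>m (dim_row S')"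
    unfolding invertible_mat_def inverts_mat_def by auto
  have "dim_col S' = n" using arg_cong[OF S'(1), of dim_col] by simp
  moreover have "dim_row S' = n" using arg_cong[OF S'(2), of dim_col] assms by simp
  ultimately show ?thesis using S' that[of S'] by auto
qed

lemma pair_equiv_elim:
  assumes "pair_equiv X Y"
  obtains p q S S' R R' where
    "X \<in> matrix_pairs p q" "Y \<in> matrix_pairs p q"
    "S \<in> carrier_mat p p" "S' \<in> carrier_mat p p" "S * S' = 1\<^sub>m p" "S' * S = 1\<^sub>m p"
    "R \<in> carrier_mat q q" "R' \<in> carrier_mat q q" "R * R' = 1\<^sub>m q" "R' * R = 1\<^sub>m q"
    "fst Y = S * fst X * R" "snd Y = S * snd X * R"
proof -
  from assms obtain p q S R where *: "X \<in> matrix_pairs p q" "S \<in> carrier_mat p p"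
    "invertible_mat S" "R \<in> carrier_mat q q" "invertible_mat R"
    "Y = (S * fst X * R, S * snd X * R)" unfolding pair_equiv_def by blast
  moreover have "Y \<in> matrix_pairs p q" using * by (auto simp: matrix_pairs_iff)
  ultimately show ?thesis
    using invertible_matE[OF *(3,2)] invertible_matE[OF *(5,4)] that by (metis fst_conv snd_conv)
qed

lemma pair_equiv_intro:
  assumes "X \<in> matrix_pairs p q" "S \<in> carrier_mat p p" "S' \<in> carrier_mat p p" "S * S' = 1\<^sub>m p"
    "R \<in> carrier_mat q q" "R' \<in> carrier_mat q q" "R * R' = 1\<^sub>m q"
    "fst Y = S * fst X * R" "snd Y = S * snd X * R"
  shows "pair_equiv X Y"
  unfolding pair_equiv_def
  using assms invertible_matI[of S p S'] invertible_matI[of R q R']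
  by (intro exI[of _ p] exI[of _ q] exI[of _ S] exI[of _ R]) (auto simp: prod_eq_iff)

lemma mult_cancel_left_inverse:
  fixes S :: "'a :: field mat"
  assumes "S \<in> carrier_mat p p" "S' \<in> carrier_mat p p" "S' * S = 1\<^sub>m p" "A \<in> carrier_mat p q"
  shows "S' * (S * A) = A"
proof -
  have "S' * (S * A) = S' * S * A" by (rule assoc_mult_mat[OF assms(2,1,4), symmetric])
  then show ?thesis using assms by simp
qed

lemma mult_cancel_right_inverse:
  fixes R :: "'a :: field mat"
  assumes "R \<in> carrier_mat q q" "R' \<in> carrier_mat q q" "R * R' = 1\<^sub>m q" "A \<in> carrier_mat p q"
  shows "A * R * R' = A"
proof -
  have "A * R * R' = A * (R * R')" by (rule assoc_mult_mat[OF assms(4,1,2)])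
  then show ?thesis using assms by simp
qed

text \<open>Intertwining form of equivalence: only products with the explicit matrices
  \<open>R\<close> and \<open>S\<close> are compared, so no inverse has to be multiplied
  out.\<close>

lemma pair_equiv_intro_comm:
  assumes X: "X \<in> matrix_pairs p q" and Y: "Y \<in> matrix_pairs p q"
    and S: "S \<in> carrier_mat p p" "S' \<in> carrier_mat p p" "S * S' = 1\<^sub>m p"
    and R: "R \<in> carrier_mat q q" "R' \<in> carrier_mat q q" "R * R' = 1\<^sub>m q"
    and eq: "fst X * R = S * fst Y" "snd X * R = S * snd Y"
  shows "pair_equiv X Y"
proof -
  have S': "S' * S = 1\<^sub>m p" using mat_mult_left_right_inverse[OF S] .
  have *: "B = S' * A * R" if "A \<in> carrier_mat p q" "B \<in> carrier_mat p q" "A * R = S * B" for A B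
    using that S R mult_cancel_left_inverse[OF S(1,2) S', of B q] by (metis assoc_mult_mat)
  show ?thesis
    by (rule pair_equiv_intro[OF X S(2,1) S' R]) (use X Y eq in \<open>auto simp: matrix_pairs_iff intro!: *\<close>)
qed

lemma pair_equiv_refl: "X \<in> matrix_pairs p q \<Longrightarrow> pair_equiv X X"
  by (rule pair_equiv_intro[of X p q "1\<^sub>m p" "1\<^sub>m p" "1\<^sub>m q" "1\<^sub>m q"]) (auto simp: matrix_pairs_iff)

lemma pair_equiv_sym: "pair_equiv X Y \<Longrightarrow> pair_equiv Y X"
proof (elim pair_equiv_elim)
  fix p q S S' R R'
  assume a: "X \<in> matrix_pairs p q" "Y \<in> matrix_pairs p q"
    "S \<in> carrier_mat p p" "S' \<in> carrier_mat p p" "S * S' = 1\<^sub>m p" "S' * S = 1\<^sub>m p"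
    "R \<in> carrier_mat q q" "R' \<in> carrier_mat q q" "R * R' = 1\<^sub>m q" "R' * R = 1\<^sub>m q"
    "fst Y = S * fst X * R" "snd Y = S * snd X * R"
  then have c: "fst X \<in> carrier_mat p q" "snd X \<in> carrier_mat p q" by (auto simp: matrix_pairs_iff)
  show ?thesis
  proof (rule pair_equiv_intro_comm[OF a(2,1) a(3,4,5) a(8,7,10)])
    show "fst Y * R' = S * fst X" unfolding a(11)
      using a c by (intro mult_cancel_right_inverse) auto
    show "snd Y * R' = S * snd X" unfolding a(12)
      using a c by (intro mult_cancel_right_inverse) auto
  qed
qed

lemma pair_equiv_trans:
  assumes "pair_equiv X Y" "pair_equiv Y Z" shows "pair_equiv X Z"
proof -
  from assms(1) obtain p q S S' R R' where a:
    "X \<in> matrix_pairs p q" "Y \<in> matrix_pairs p q"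
    "S \<in> carrier_mat p p" "S' \<in> carrier_mat p p" "S * S' = 1\<^sub>m p" "S' * S = 1\<^sub>m p"
    "R \<in> carrier_mat q q" "R' \<in> carrier_mat q q" "R * R' = 1\<^sub>m q" "R' * R = 1\<^sub>m q"
    "fst Y = S * fst X * R" "snd Y = S * snd X * R"
    by (elim pair_equiv_elim)
  from assms(2) obtain p1 q1 T T' U U' where b1:
    "Y \<in> matrix_pairs p1 q1"
    and b: "T \<in> carrier_mat p1 p1" "T' \<in> carrier_mat p1 p1" "T * T' = 1\<^sub>m p1"
    "U \<in> carrier_mat q1 q1" "U' \<in> carrier_mat q1 q1" "U * U' = 1\<^sub>m q1"
    "fst Z = T * fst Y * U" "snd Z = T * snd Y * U"
    by (elim pair_equiv_elim) auto
  have [simp]: "p1 = p" "q1 = q" using b1 a(2) by (auto simp: matrix_pairs_iff)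
  note b = b[simplified]
  have asc: "T * (S * A * R) * U = (T * S) * A * (R * U)" if "A \<in> carrier_mat p q" for A
  proof -
    have "T * (S * A * R) = T * (S * A) * R"
      using that a b by (intro assoc_mult_mat[symmetric, of _ p p _ q _ q]) auto
    also have "T * (S * A) = T * S * A"
      using that a b by (intro assoc_mult_mat[symmetric, of _ p p _ p _ q]) auto
    finally have "T * (S * A * R) * U = T * S * A * R * U" by simp
    also have "\<dots> = T * S * A * (R * U)"
      using that a b by (intro assoc_mult_mat[of _ p q _ q _ q]) auto
    finally show ?thesis .
  qed
  have inv: "A * B * (B' * A') = 1\<^sub>m n" if "A \<in> carrier_mat n n" "B \<in> carrier_mat n n"
     "A' \<in> carrier_mat n n" "B' \<in> carrier_mat n n" "A * A' = 1\<^sub>m n" "B * B' = 1\<^sub>m n" for A B A' B' :: "complex mat" and n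
  proof -
    have "A * B * (B' * A') = A * (B * (B' * A'))" using that by (intro assoc_mult_mat) auto
    also have "B * (B' * A') = A'" using that by (intro mult_cancel_left_inverse) auto
    finally show ?thesis using that by simp
  qed
  show ?thesis
    by (rule pair_equiv_intro[OF a(1), of "T * S" "S' * T'" "R * U" "U' * R'"])
       (use a b in \<open>auto simp: matrix_pairs_iff asc intro!: inv\<close>)
qed

lemma matrix_pairs_unique:
  "X \<in> matrix_pairs p q \<Longrightarrow> X \<in> matrix_pairs p' q' \<longleftrightarrow> p' = p \<and> q' = q"
  by (auto simp: matrix_pairs_iff)

lemma pair_equiv_matrix_pairs:
  "pair_equiv X Y \<Longrightarrow> X \<in> matrix_pairs p q \<longleftrightarrow> Y \<in> matrix_pairs p q"
  by (elim pair_equiv_elim) (metis matrix_pairs_unique)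

lemma pair_orbit_eq_iff:
  assumes "is_matrix_pair X"
  shows "pair_orbit X = pair_orbit Y \<longleftrightarrow> pair_equiv X Y"
  using assms pair_equiv_refl pair_equiv_sym pair_equiv_trans
  unfolding pair_orbit_def is_matrix_pair_def by blast


section \<open>Transposition, swapping and linear change of the components\<close>

definition transpose_pair :: "mpair \<Rightarrow> mpair" where
  "transpose_pair X = ((fst X)\<^sup>T, (snd X)\<^sup>T)"

text \<open>A projective change of the pencil parameter; it moves a nonsingular member
  \<open>s A + B\<close> of a regular pencil into the first component.\<close>

definition pair_lincomb :: "complex \<Rightarrow> complex \<Rightarrow> complex \<Rightarrow> complex \<Rightarrow> mpair \<Rightarrow> mpair" where
  "pair_lincomb a b c d X = (a \<cdot>\<^sub>m fst X + b \<cdot>\<^sub>m snd X, c \<cdot>\<^sub>m fst X + d \<cdot>\<^sub>m snd X)"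

text \<open>Evaluation at a homogeneous point, which puts the eigenvalue infinity, located at (1,
  0), on the same footing as the finite ones.\<close>

definition pencil_at :: "complex \<Rightarrow> complex \<Rightarrow> mpair \<Rightarrow> complex mat" where
  "pencil_at a b X = a \<cdot>\<^sub>m fst X + b \<cdot>\<^sub>m snd X"

lemma transpose_pair_simps [simp]:
  "fst (transpose_pair X) = (fst X)\<^sup>T" "snd (transpose_pair X) = (snd X)\<^sup>T"
  "transpose_pair (transpose_pair X) = X"
  by (auto simp: transpose_pair_def)

lemma transpose_pair_carrier [simp]:
  "transpose_pair X \<in> matrix_pairs q p \<longleftrightarrow> X \<in> matrix_pairs p q"
  by (auto simp: matrix_pairs_iff)

lemma swap_carrier [simp]:
  "prod.swap X \<in> matrix_pairs p q \<longleftrightarrow> X \<in> matrix_pairs p q"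
  by (auto simp: matrix_pairs_iff)

lemma lincomb_carrier:
  "X \<in> matrix_pairs p q \<Longrightarrow> pair_lincomb a b c d X \<in> matrix_pairs p q"
  by (auto simp: matrix_pairs_iff pair_lincomb_def)

lemma pencil_at_carrier:
  "X \<in> matrix_pairs p q \<Longrightarrow> pencil_at a b X \<in> carrier_mat p q"
  by (auto simp: matrix_pairs_iff pencil_at_def)

lemma pair_equiv_transpose:
  assumes "pair_equiv X Y" shows "pair_equiv (transpose_pair X) (transpose_pair Y)"
proof -
  from assms obtain p q S S' R R' where a:
    "X \<in> matrix_pairs p q" "Y \<in> matrix_pairs p q"
    "S \<in> carrier_mat p p" "S' \<in> carrier_mat p p" "S * S' = 1\<^sub>m p" "S' * S = 1\<^sub>m p"
    "R \<in> carrier_mat q q" "R' \<in> carrier_mat q q" "R * R' = 1\<^sub>m q" "R' * R = 1\<^sub>m q"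
    "fst Y = S * fst X * R" "snd Y = S * snd X * R"
    by (elim pair_equiv_elim)
  have t: "(S * A * R)\<^sup>T = R\<^sup>T * A\<^sup>T * S\<^sup>T" if "A \<in> carrier_mat p q" for A
  proof -
    have "(S * A * R)\<^sup>T = R\<^sup>T * (S * A)\<^sup>T" using that a by (intro transpose_mult) auto
    also have "(S * A)\<^sup>T = A\<^sup>T * S\<^sup>T" using that a by (intro transpose_mult) auto
    finally show ?thesis using that a by (simp add: assoc_mult_mat[of "R\<^sup>T" q q "A\<^sup>T" p "S\<^sup>T" p])
  qed
  have inv: "M'\<^sup>T * M\<^sup>T = 1\<^sub>m n"
    if "M \<in> carrier_mat n n" "M' \<in> carrier_mat n n" "M * M' = 1\<^sub>m n" for M M' :: "complex mat" and n
    using transpose_mult[OF that(1,2)] that(3) by simp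
  show ?thesis
    by (rule pair_equiv_intro[of _ q p "R\<^sup>T" "R'\<^sup>T" "S\<^sup>T" "S'\<^sup>T"])
       (use a in \<open>auto simp: matrix_pairs_iff t intro!: inv\<close>)
qed

lemma pair_equiv_swap:
  assumes "pair_equiv X Y" shows "pair_equiv (prod.swap X) (prod.swap Y)"
  using assms by (elim pair_equiv_elim, intro pair_equiv_intro) auto

lemma lincomb_mult:
  fixes A B S R :: "complex mat"
  assumes "A \<in> carrier_mat p q" "B \<in> carrier_mat p q" "S \<in> carrier_mat p' p" "R \<in> carrier_mat q q'"
  shows "a \<cdot>\<^sub>m (S * A * R) + b \<cdot>\<^sub>m (S * B * R) = S * (a \<cdot>\<^sub>m A + b \<cdot>\<^sub>m B) * R"
proof -
  have "S * (a \<cdot>\<^sub>m A + b \<cdot>\<^sub>m B) = a \<cdot>\<^sub>m (S * A) + b \<cdot>\<^sub>m (S * B)"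
    using assms by (simp add: mult_add_distrib_mat[of S p' p _ q] mult_smult_distrib[of S p' p])
  moreover have "(a \<cdot>\<^sub>m (S * A) + b \<cdot>\<^sub>m (S * B)) * R = a \<cdot>\<^sub>m (S * A * R) + b \<cdot>\<^sub>m (S * B * R)"
    using assms by (simp add: add_mult_distrib_mat[of _ p' q _ R q'] mult_smult_assoc_mat[of _ p' q R q']
        del: assoc_mult_mat)
  ultimately show ?thesis by simp
qed

lemma pair_equiv_lincomb:
  assumes "pair_equiv X Y" shows "pair_equiv (pair_lincomb a b c d X) (pair_lincomb a b c d Y)"
proof -
  from assms obtain p q S S' R R' where e:
    "X \<in> matrix_pairs p q" "Y \<in> matrix_pairs p q"
    "S \<in> carrier_mat p p" "S' \<in> carrier_mat p p" "S * S' = 1\<^sub>m p" "S' * S = 1\<^sub>m p"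
    "R \<in> carrier_mat q q" "R' \<in> carrier_mat q q" "R * R' = 1\<^sub>m q" "R' * R = 1\<^sub>m q"
    "fst Y = S * fst X * R" "snd Y = S * snd X * R"
    by (elim pair_equiv_elim)
  note c = e(1)[unfolded matrix_pairs_iff, THEN conjunct1] e(1)[unfolded matrix_pairs_iff, THEN conjunct2]
  show ?thesis
    by (rule pair_equiv_intro[OF lincomb_carrier[OF e(1)] e(3-5,7-9)])
       (simp_all only: pair_lincomb_def fst_conv snd_conv e(11,12) lincomb_mult[OF c e(3,7)])
qed

lemma pencil_at_equiv:
  assumes "X \<in> matrix_pairs p q" "S \<in> carrier_mat p p" "R \<in> carrier_mat q q"
    "fst Y = S * fst X * R" "snd Y = S * snd X * R"
  shows "pencil_at a b Y = S * pencil_at a b X * R"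
  using assms by (auto simp: pencil_at_def lincomb_mult matrix_pairs_iff simp del: assoc_mult_mat)


section \<open>Direct sums up to equivalence\<close>

abbreviation pair_sum :: "mpair \<Rightarrow> mpair \<Rightarrow> mpair" (infixr \<open>\<boxplus>\<close> 65) where
  "X \<boxplus> Y \<equiv> direct_sum [X, Y]"

lemma four_block_mat_empty [simp]:
  "four_block_mat A (0\<^sub>m (dim_row A) 0) (0\<^sub>m 0 (dim_col A)) (0\<^sub>m 0 0) = A"
  "four_block_mat (0\<^sub>m 0 0) (0\<^sub>m 0 (dim_col A)) (0\<^sub>m (dim_row A) 0) A = A"
  by (auto intro!: eq_matI)

lemma pair_sum_eq:
  "X \<boxplus> Y = (four_block_mat (fst X) (0\<^sub>m (dim_row (fst X)) (dim_col (fst Y)))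
                (0\<^sub>m (dim_row (fst Y)) (dim_col (fst X))) (fst Y),
             four_block_mat (snd X) (0\<^sub>m (dim_row (snd X)) (dim_col (snd Y)))
                (0\<^sub>m (dim_row (snd Y)) (dim_col (snd X))) (snd Y))"
  by (simp add: direct_sum_def Let_def)

lemma direct_sum_Nil: "direct_sum [] = (0\<^sub>m 0 0, 0\<^sub>m 0 0)"
  by (simp add: direct_sum_def)

lemma direct_sum_append: "direct_sum (Xs @ Ys) = direct_sum Xs \<boxplus> direct_sum Ys"
  by (simp add: direct_sum_def diag_block_mat_append Let_def)

lemma direct_sum_Cons: "direct_sum (X # Xs) = X \<boxplus> direct_sum Xs"
  using direct_sum_append[of "[X]" Xs] by (simp add: direct_sum_def)

lemma direct_sum_single [simp]: "direct_sum [X] = X"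
  by (simp add: direct_sum_def)

lemma pair_sum_assoc: "(X \<boxplus> Y) \<boxplus> Z = X \<boxplus> Y \<boxplus> Z"
  using direct_sum_append[of "[X,Y]" "[Z]"] direct_sum_Cons[of X "[Y,Z]"] by simp

lemma pair_sum_empty [simp]: "X \<boxplus> (0\<^sub>m 0 0, 0\<^sub>m 0 0) = X" "(0\<^sub>m 0 0, 0\<^sub>m 0 0) \<boxplus> X = X"
  using direct_sum_append[of "[X]" "[]"] direct_sum_append[of "[]" "[X]"]
  by (simp_all add: direct_sum_Nil)

lemma pair_sum_carrier:
  "X \<in> matrix_pairs p q \<Longrightarrow> Y \<in> matrix_pairs p' q' \<Longrightarrow> X \<boxplus> Y \<in> matrix_pairs (p + p') (q + q')"
  by (auto simp: pair_sum_eq matrix_pairs_iff)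

lemma swap_direct_sum: "prod.swap (direct_sum Xs) = direct_sum (map prod.swap Xs)"
  by (simp add: direct_sum_def comp_def)

lemma transpose_pair_sum:
  "X \<in> matrix_pairs p q \<Longrightarrow> Y \<in> matrix_pairs p' q' \<Longrightarrow>
    transpose_pair (X \<boxplus> Y) = transpose_pair X \<boxplus> transpose_pair Y"
  by (auto simp: pair_sum_eq matrix_pairs_iff transpose_pair_def transpose_four_block_mat)

lemma mult_diag_four_block:
  fixes A :: "complex mat"
  assumes "A \<in> carrier_mat p n" "D \<in> carrier_mat p' n'" "A' \<in> carrier_mat n q" "D' \<in> carrier_mat n' q'"
  shows "four_block_mat A (0\<^sub>m p n') (0\<^sub>m p' n) D * four_block_mat A' (0\<^sub>m n q') (0\<^sub>m n' q) D'
    = four_block_mat (A * A') (0\<^sub>m p q') (0\<^sub>m p' q) (D * D')"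
  using assms by (subst mult_four_block_mat[of _ p n _ n' _ p' _ _ q _ q']) auto

lemma lincomb_diag_four_block:
  fixes A :: "complex mat"
  assumes "A \<in> carrier_mat p q" "D \<in> carrier_mat p' q'" "A' \<in> carrier_mat p q" "D' \<in> carrier_mat p' q'"
  shows "a \<cdot>\<^sub>m four_block_mat A (0\<^sub>m p q') (0\<^sub>m p' q) D + b \<cdot>\<^sub>m four_block_mat A' (0\<^sub>m p q') (0\<^sub>m p' q) D'
    = four_block_mat (a \<cdot>\<^sub>m A + b \<cdot>\<^sub>m A') (0\<^sub>m p q') (0\<^sub>m p' q) (a \<cdot>\<^sub>m D + b \<cdot>\<^sub>m D')"
  using assms by (intro eq_matI) auto

lemma pencil_at_pair_sum:
  assumes "X \<in> matrix_pairs p q" "Y \<in> matrix_pairs p' q'"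
  shows "pencil_at a b (X \<boxplus> Y) =
    four_block_mat (pencil_at a b X) (0\<^sub>m p q') (0\<^sub>m p' q) (pencil_at a b Y)"
  using assms lincomb_diag_four_block
  by (auto simp: pencil_at_def pair_sum_eq matrix_pairs_iff)

lemma lincomb_pair_sum:
  assumes "X \<in> matrix_pairs p q" "Y \<in> matrix_pairs p' q'"
  shows "pair_lincomb a b c d (X \<boxplus> Y) = pair_lincomb a b c d X \<boxplus> pair_lincomb a b c d Y"
  using assms lincomb_diag_four_block
  by (auto simp: pair_lincomb_def pair_sum_eq matrix_pairs_iff)

lemma pair_equiv_pair_sum:
  assumes "pair_equiv X X'" "pair_equiv Y Y'" shows "pair_equiv (X \<boxplus> Y) (X' \<boxplus> Y')"
proof -
  from assms(1) obtain p q S S' R R' where a: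
    "X \<in> matrix_pairs p q" "X' \<in> matrix_pairs p q"
    "S \<in> carrier_mat p p" "S' \<in> carrier_mat p p" "S * S' = 1\<^sub>m p" "S' * S = 1\<^sub>m p"
    "R \<in> carrier_mat q q" "R' \<in> carrier_mat q q" "R * R' = 1\<^sub>m q" "R' * R = 1\<^sub>m q"
    "fst X' = S * fst X * R" "snd X' = S * snd X * R"
    by (elim pair_equiv_elim)
  from assms(2) obtain m n T T' U U' where b:
    "Y \<in> matrix_pairs m n" "Y' \<in> matrix_pairs m n"
    "T \<in> carrier_mat m m" "T' \<in> carrier_mat m m" "T * T' = 1\<^sub>m m" "T' * T = 1\<^sub>m m"
    "U \<in> carrier_mat n n" "U' \<in> carrier_mat n n" "U * U' = 1\<^sub>m n" "U' * U = 1\<^sub>m n"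
    "fst Y' = T * fst Y * U" "snd Y' = T * snd Y * U"
    by (elim pair_equiv_elim)
  let ?d = "\<lambda>p m A B. four_block_mat A (0\<^sub>m p m) (0\<^sub>m m p) B"
  show ?thesis
    by (rule pair_equiv_intro[OF pair_sum_carrier[OF a(1) b(1)], of "?d p m S T" "?d p m S' T'"
          "?d q n R U" "?d q n R' U'"])
       (use a b in \<open>auto simp: mult_diag_four_block pair_sum_eq matrix_pairs_iff\<close>)
qed

lemma pair_sum_commute:
  assumes "X \<in> matrix_pairs p q" "Y \<in> matrix_pairs p' q'"
  shows "pair_equiv (X \<boxplus> Y) (Y \<boxplus> X)"
proof -
  \<comment> \<open>The permutation matrix that exchanges two consecutive index blocks.\<close>
  define E where "E = (\<lambda>m n. four_block_mat (0\<^sub>m m n) (1\<^sub>m m) (1\<^sub>m n) (0\<^sub>m n m) :: complex mat)"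
  have E: "E m n \<in> carrier_mat (m + n) (n + m)" for m n
    unfolding E_def by (rule four_block_carrier_mat) auto
  have EE: "E m n * E n m = 1\<^sub>m (m + n)" for m n
    unfolding E_def by (subst mult_four_block_mat[of _ m n _ m _ n _ _ m _ n]) auto
  have c: "four_block_mat A (0\<^sub>m p q') (0\<^sub>m p' q) B * E q q' = E p p' * four_block_mat B (0\<^sub>m p' q) (0\<^sub>m p q') A"
    if "A \<in> carrier_mat p q" "B \<in> carrier_mat p' q'" for A B
    using that unfolding E_def
    by (subst mult_four_block_mat[of _ p q _ q' _ p' _ _ q' _ q], simp_all)
       (subst mult_four_block_mat[of _ p p' _ p _ p' _ _ q' _ q], simp_all)
  have "pair_equiv (X \<boxplus> Y) (Y \<boxplus> X)"
    by (rule pair_equiv_intro_comm[of _ "p + p'" "q + q'" _ "E p p'" "E p' p" "E q q'" "E q' q"])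
       (use assms E[of p p'] E[of p' p] E[of q q'] E[of q' q] EE
        in \<open>auto simp: add.commute[of p' p] add.commute[of q' q] c pair_sum_eq matrix_pairs_iff\<close>)
  then show ?thesis .
qed

lemma pair_equiv_sum_left: "pair_equiv X X' \<Longrightarrow> Y \<in> matrix_pairs p q \<Longrightarrow> pair_equiv (X \<boxplus> Y) (X' \<boxplus> Y)"
  using pair_equiv_pair_sum pair_equiv_refl by blast

lemma pair_equiv_sum_right: "pair_equiv X X' \<Longrightarrow> Y \<in> matrix_pairs p q \<Longrightarrow> pair_equiv (Y \<boxplus> X) (Y \<boxplus> X')"
  using pair_equiv_pair_sum pair_equiv_refl by blast

lemma direct_sum_is_matrix_pair:
  "(\<And>X. X \<in> set Xs \<Longrightarrow> is_matrix_pair X) \<Longrightarrow> is_matrix_pair (direct_sum Xs)"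
proof (induction Xs)
  case Nil
  then show ?case by (auto simp: is_matrix_pair_def direct_sum_Nil matrix_pairs_iff)
next
  case (Cons X Xs)
  then show ?case unfolding direct_sum_Cons[of X Xs] is_matrix_pair_def
    using pair_sum_carrier by (metis list.set_intros)
qed

text \<open>The head of \<open>Xs\<close> occurs in \<open>Ys\<close> behind some \<open>Us\<close>;
  one exchange of two blocks brings it to its place.\<close>

lemma pair_equiv_direct_sum_permute:
  assumes "mset Xs = mset Ys" "\<And>X. X \<in> set Xs \<Longrightarrow> is_matrix_pair X"
  shows "pair_equiv (direct_sum Xs) (direct_sum Ys)"
  using assms
proof (induction Xs arbitrary: Ys)
  case Nil
  then show ?case by (auto simp: direct_sum_Nil matrix_pairs_iff intro: pair_equiv_refl[of _ 0 0])
next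
  case (Cons X Xs)
  then have "X \<in> set Ys" by (metis list.set_intros(1) mset_eq_setD)
  then obtain Us Vs where Ys: "Ys = Us @ X # Vs" by (meson split_list)
  have ms: "mset Xs = mset (Us @ Vs)" using Cons.prems(1) by (simp add: Ys)
  have IH: "pair_equiv (direct_sum Xs) (direct_sum (Us @ Vs))"
    using Cons.IH[OF ms] Cons.prems(2) by simp
  have setY: "set (Us @ Vs) = set Xs" using ms mset_eq_setD by metis
  have "is_matrix_pair X" using Cons.prems(2) by simp
  then obtain p q where X: "X \<in> matrix_pairs p q" by (auto simp: is_matrix_pair_def)
  have "is_matrix_pair (direct_sum Us)" "is_matrix_pair (direct_sum Vs)"
    using setY Cons.prems(2) by (auto intro!: direct_sum_is_matrix_pair)
  then obtain p1 q1 p2 q2 where U: "direct_sum Us \<in> matrix_pairs p1 q1"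
    and V: "direct_sum Vs \<in> matrix_pairs p2 q2" by (auto simp: is_matrix_pair_def)
  have "pair_equiv (direct_sum (X # Xs)) (X \<boxplus> direct_sum (Us @ Vs))"
    unfolding direct_sum_Cons[of X Xs] using IH X by (rule pair_equiv_sum_right)
  also have "X \<boxplus> direct_sum (Us @ Vs) = (X \<boxplus> direct_sum Us) \<boxplus> direct_sum Vs"
    by (simp add: direct_sum_append[of Us Vs] pair_sum_assoc)
  finally have "pair_equiv (direct_sum (X # Xs)) ((X \<boxplus> direct_sum Us) \<boxplus> direct_sum Vs)" .
  moreover have "pair_equiv \<dots> ((direct_sum Us \<boxplus> X) \<boxplus> direct_sum Vs)"
    using pair_sum_commute[OF X U] V by (rule pair_equiv_sum_left)
  moreover have "(direct_sum Us \<boxplus> X) \<boxplus> direct_sum Vs = direct_sum Ys"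
    by (simp add: Ys direct_sum_append[of Us "X # Vs"] direct_sum_Cons[of X Vs] pair_sum_assoc)
  ultimately show ?case using pair_equiv_trans by metis
qed

section \<open>Splitting off direct summands\<close>

lemma mult_mat_entry:
  assumes "A \<in> carrier_mat a b" "B \<in> carrier_mat b c" "i < a" "j < c"
  shows "(A * B) $$ (i, j) = (\<Sum>l<b. A $$ (i, l) * B $$ (l, j))"
  using assms by (auto simp: scalar_prod_def atLeast0LessThan intro!: sum.cong)

text \<open>A wide \<open>V\<close> has a nonzero kernel vector, which \<open>P * V = 1\<close>
  would have to fix.\<close>

lemma left_inverse_dim:
  fixes V :: "'a :: field mat"
  assumes V: "V \<in> carrier_mat q n" and P: "P \<in> carrier_mat n q" and PV: "P * V = 1\<^sub>m n"
  shows "n \<le> q"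
proof (rule ccontr)
  assume "\<not> n \<le> q"
  then obtain x j where x: "\<And>i. i < q \<Longrightarrow> (\<Sum>k<n. V $$ (i, k) * x k) = 0" and j: "j < n" "x j \<noteq> 0"
    using wide_system_has_solution[of "{..<q}" "{..<n}" "\<lambda>i k. V $$ (i, k)"] by auto
  have "0 = (\<Sum>i<q. P $$ (j, i) * (\<Sum>k<n. V $$ (i, k) * x k))" by (simp add: x)
  also have "\<dots> = (\<Sum>k<n. (\<Sum>i<q. P $$ (j, i) * V $$ (i, k)) * x k)"
    by (simp add: sum_distrib_left sum_distrib_right mult.assoc) (rule sum.swap)
  also have "\<dots> = (\<Sum>k<n. (if k = j then x k else 0))"
    proof (intro sum.cong refl)
      fix k assume "k \<in> {..<n}"
      then have k: "k < n" by simp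
      have "(\<Sum>i<q. P $$ (j, i) * V $$ (i, k)) = 1\<^sub>m n $$ (j, k)"
        unfolding PV[symmetric] by (rule mult_mat_entry[OF P V j(1) k, symmetric])
      then have "(\<Sum>i<q. P $$ (j, i) * V $$ (i, k)) = (if k = j then 1 else 0)"
        using j(1) k by auto
      then show "(\<Sum>i<q. P $$ (j, i) * V $$ (i, k)) * x k = (if k = j then x k else 0)" by simp
    qed
  also have "\<dots> = x j" using j by simp
  finally show False using j by simp
qed

text \<open>The new column is a kernel vector of \<open>P\<close>; the new row is a scaled row of
  the projection \<open>1 - V P\<close>, which kills the old columns.\<close>

lemma extend_left_inverse:
  fixes V :: "'a :: field mat"
  assumes V: "V \<in> carrier_mat q n" and P: "P \<in> carrier_mat n q" and PV: "P * V = 1\<^sub>m n"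
    and "n < q"
  shows "\<exists>V'\<in>carrier_mat q (Suc n). \<exists>P'\<in>carrier_mat (Suc n) q. P' * V' = 1\<^sub>m (Suc n) \<and>
    (\<forall>i<q. \<forall>j<n. V' $$ (i, j) = V $$ (i, j)) \<and> (\<forall>i<n. \<forall>j<q. P' $$ (i, j) = P $$ (i, j))"
proof -
  obtain x l where x: "\<And>i. i < n \<Longrightarrow> (\<Sum>j<q. P $$ (i, j) * x j) = 0" and l: "l < q" "x l \<noteq> 0"
    using wide_system_has_solution[of "{..<n}" "{..<q}" "\<lambda>i j. P $$ (i, j)"] \<open>n < q\<close> by auto
  have PVe: "(\<Sum>j<q. P $$ (i, j) * V $$ (j, k)) = (if i = k then 1 else 0)" if "i < n" "k < n" for i k
    using mult_mat_entry[OF P V that] PV that by simp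
  \<comment> \<open>Row \<open>l\<close> of \<open>1 - V P\<close> divided by \<open>x l\<close>; as
    \<open>P x = 0\<close>, its value on \<open>x\<close> is \<open>x l / x l\<close>.\<close>
  define f where "f j = ((if j = l then 1 else 0) - (\<Sum>i<n. V $$ (l, i) * P $$ (i, j))) / x l" for j
  have fy: "(\<Sum>j<q. f j * y j) = (y l - (\<Sum>i<n. V $$ (l, i) * (\<Sum>j<q. P $$ (i, j) * y j))) / x l" for y
  proof -
    have "(\<Sum>j<q. f j * y j) = (\<Sum>j<q. ((if j = l then y j else 0)
        - (\<Sum>i<n. V $$ (l, i) * P $$ (i, j)) * y j) / x l)"
      unfolding f_def by (intro sum.cong) (auto simp: left_diff_distrib)
    also have "\<dots> = ((\<Sum>j<q. (if j = l then y j else 0))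
        - (\<Sum>j<q. (\<Sum>i<n. V $$ (l, i) * P $$ (i, j)) * y j)) / x l"
      by (simp only: sum_divide_distrib[symmetric] sum_subtractf)
    also have "(\<Sum>j<q. (\<Sum>i<n. V $$ (l, i) * P $$ (i, j)) * y j)
        = (\<Sum>i<n. V $$ (l, i) * (\<Sum>j<q. P $$ (i, j) * y j))"
      by (simp add: sum_distrib_left sum_distrib_right mult.assoc) (rule sum.swap)
    finally show ?thesis using l by simp
  qed
  have fx: "(\<Sum>j<q. f j * x j) = 1" using l by (simp add: fy x)
  have fV: "(\<Sum>j<q. f j * V $$ (j, k)) = 0" if "k < n" for k
  proof -
    have "(\<Sum>i<n. V $$ (l, i) * (\<Sum>j<q. P $$ (i, j) * V $$ (j, k))) = (\<Sum>i<n. if i = k then V $$ (l, i) else 0)"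
      using that by (intro sum.cong) (auto simp: PVe)
    then show ?thesis using that by (simp add: fy)
  qed
  define V' where "V' = mat q (Suc n) (\<lambda>(i, j). if j < n then V $$ (i, j) else x i)"
  define P' where "P' = mat (Suc n) q (\<lambda>(i, j). if i < n then P $$ (i, j) else f j)"
  have c: "V' \<in> carrier_mat q (Suc n)" "P' \<in> carrier_mat (Suc n) q" by (auto simp: V'_def P'_def)
  have "P' * V' = 1\<^sub>m (Suc n)"
  proof (rule eq_matI)
    fix i k assume "i < dim_row (1\<^sub>m (Suc n))" "k < dim_col (1\<^sub>m (Suc n))"
    then have ik: "i < Suc n" "k < Suc n" by auto
    have "(P' * V') $$ (i, k) = (\<Sum>j<q. (if i < n then P $$ (i, j) else f j) * (if k < n then V $$ (j, k) else x j))"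
      using ik by (subst mult_mat_entry[OF c(2,1)]) (auto simp: P'_def V'_def intro!: sum.cong)
    also have "\<dots> = (if i = k then 1 else 0)"
      using ik by (cases "i < n"; cases "k < n") (auto simp: PVe fV fx x)
    finally show "(P' * V') $$ (i, k) = 1\<^sub>m (Suc n) $$ (i, k)" using ik by simp
  qed (use c in auto)
  with c show ?thesis
    by (intro bexI[of _ V'] bexI[of _ P']) (auto simp: V'_def P'_def)
qed

lemma extend_left_inverse_square:
  fixes V :: "'a :: field mat"
  assumes "V \<in> carrier_mat q n" "P \<in> carrier_mat n q" "P * V = 1\<^sub>m n" "q = n + m"
  shows "\<exists>V'\<in>carrier_mat q q. \<exists>P'\<in>carrier_mat q q. P' * V' = 1\<^sub>m q \<and>
    (\<forall>i<q. \<forall>j<n. V' $$ (i, j) = V $$ (i, j)) \<and> (\<forall>i<n. \<forall>j<q. P' $$ (i, j) = P $$ (i, j))"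
  using assms
proof (induction m arbitrary: n V P)
  case 0
  then show ?case by (intro bexI[of _ V] bexI[of _ P]) auto
next
  case (Suc m)
  then obtain V1 P1 where 1: "V1 \<in> carrier_mat q (Suc n)" "P1 \<in> carrier_mat (Suc n) q" "P1 * V1 = 1\<^sub>m (Suc n)"
    "\<forall>i<q. \<forall>j<n. V1 $$ (i, j) = V $$ (i, j)" "\<forall>i<n. \<forall>j<q. P1 $$ (i, j) = P $$ (i, j)"
    using extend_left_inverse[of V q n P] by auto
  from Suc.IH[OF 1(1-3)] Suc.prems(4) obtain V' P' where
    "V' \<in> carrier_mat q q" "P' \<in> carrier_mat q q" "P' * V' = 1\<^sub>m q"
    "\<forall>i<q. \<forall>j<Suc n. V' $$ (i, j) = V1 $$ (i, j)" "\<forall>i<Suc n. \<forall>j<q. P' $$ (i, j) = P1 $$ (i, j)" by auto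
  with 1(4,5) show ?case by (intro bexI[of _ V'] bexI[of _ P']) auto
qed

text \<open>\<open>V\<close> and \<open>P\<close> are completed to mutually inverse square matrices;
  \<open>K\<close> spans the kernel of \<open>P\<close>, and \<open>Q\<close> gives the coordinates
  along \<open>K\<close>.\<close>

lemma complement_of_left_inverse:
  fixes V :: "'a :: field mat"
  assumes V: "V \<in> carrier_mat q n" and P: "P \<in> carrier_mat n q" and PV: "P * V = 1\<^sub>m n"
  shows "\<exists>K\<in>carrier_mat q (q - n). \<exists>Q\<in>carrier_mat (q - n) q.
    P * K = 0\<^sub>m n (q - n) \<and> Q * V = 0\<^sub>m (q - n) n \<and> Q * K = 1\<^sub>m (q - n)"
proof -
  have nq: "n \<le> q" using left_inverse_dim assms .
  then obtain V' P' where c: "V' \<in> carrier_mat q q" "P' \<in> carrier_mat q q" and PV': "P' * V' = 1\<^sub>m q"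
    and V': "\<And>i j. i < q \<Longrightarrow> j < n \<Longrightarrow> V' $$ (i, j) = V $$ (i, j)"
    and P': "\<And>i j. i < n \<Longrightarrow> j < q \<Longrightarrow> P' $$ (i, j) = P $$ (i, j)"
    using extend_left_inverse_square[OF assms, of "q - n"] by auto
  have e: "(\<Sum>l<q. P' $$ (i, l) * V' $$ (l, j)) = (if i = j then 1 else 0)" if "i < q" "j < q" for i j
    using mult_mat_entry[OF c(2,1) that] PV' that by simp
  define K where "K = mat q (q - n) (\<lambda>(i, j). V' $$ (i, n + j))"
  define Q where "Q = mat (q - n) q (\<lambda>(i, j). P' $$ (n + i, j))"
  have KQ: "K \<in> carrier_mat q (q - n)" "Q \<in> carrier_mat (q - n) q" by (auto simp: K_def Q_def)
  have "P * K = 0\<^sub>m n (q - n)"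
  proof (rule eq_matI)
    fix i j assume "i < dim_row (0\<^sub>m n (q - n))" "j < dim_col (0\<^sub>m n (q - n))"
    then have ij: "i < n" "j < q - n" by auto
    have "(P * K) $$ (i, j) = (\<Sum>l<q. P' $$ (i, l) * V' $$ (l, n + j))"
      using ij by (subst mult_mat_entry[OF P KQ(1)]) (auto simp: K_def P' intro!: sum.cong)
    then show "(P * K) $$ (i, j) = 0\<^sub>m n (q - n) $$ (i, j)" using e[of i "n + j"] ij nq by simp
  qed (use P KQ in auto)
  moreover have "Q * V = 0\<^sub>m (q - n) n"
  proof (rule eq_matI)
    fix i j assume "i < dim_row (0\<^sub>m (q - n) n)" "j < dim_col (0\<^sub>m (q - n) n)"
    then have ij: "i < q - n" "j < n" by auto
    have "(Q * V) $$ (i, j) = (\<Sum>l<q. P' $$ (n + i, l) * V' $$ (l, j))"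
      using ij by (subst mult_mat_entry[OF KQ(2) V]) (auto simp: Q_def V' intro!: sum.cong)
    then show "(Q * V) $$ (i, j) = 0\<^sub>m (q - n) n $$ (i, j)" using e[of "n + i" j] ij nq by simp
  qed (use V KQ in auto)
  moreover have "Q * K = 1\<^sub>m (q - n)"
  proof (rule eq_matI)
    fix i j assume "i < dim_row (1\<^sub>m (q - n))" "j < dim_col (1\<^sub>m (q - n))"
    then have ij: "i < q - n" "j < q - n" by auto
    have "(Q * K) $$ (i, j) = (\<Sum>l<q. P' $$ (n + i, l) * V' $$ (l, n + j))"
      using ij by (subst mult_mat_entry[OF KQ(2,1)]) (auto simp: Q_def K_def intro!: sum.cong)
    then show "(Q * K) $$ (i, j) = 1\<^sub>m (q - n) $$ (i, j)" using e[of "n + i" "n + j"] ij by simp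
  qed (use KQ in auto)
  ultimately show ?thesis using KQ by blast
qed

text \<open>In terms of representations of the Kronecker quiver, (V, W) is a morphism from
  \<open>Y\<close> to \<open>X\<close> and (P, U) a retraction of it; the kernel of the retraction
  is the complementary summand \<open>Z\<close>.\<close>

lemma retract_is_summand:
  assumes X: "X \<in> matrix_pairs p q" and Y: "Y \<in> matrix_pairs p' q'"
    and V: "V \<in> carrier_mat q q'" and P: "P \<in> carrier_mat q' q" and PV: "P * V = 1\<^sub>m q'"
    and W: "W \<in> carrier_mat p p'" and U: "U \<in> carrier_mat p' p" and UW: "U * W = 1\<^sub>m p'"
    and XV: "fst X * V = W * fst Y" "snd X * V = W * snd Y"
    and UX: "U * fst X = fst Y * P" "U * snd X = snd Y * P"
  shows "p' \<le> p \<and> q' \<le> q \<and> (\<exists>Z\<in>matrix_pairs (p - p') (q - q'). pair_equiv X (Y \<boxplus> Z))"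
proof -
  have le: "q' \<le> q" "p' \<le> p" using left_inverse_dim[OF V P PV] left_inverse_dim[OF W U UW] .
  define m n where mn: "m = p - p'" "n = q - q'"
  from complement_of_left_inverse[OF V P PV] obtain K Q where
    K: "K \<in> carrier_mat q n" and Q: "Q \<in> carrier_mat n q"
    and KQ: "P * K = 0\<^sub>m q' n" "Q * V = 0\<^sub>m n q'" "Q * K = 1\<^sub>m n" by (auto simp: mn)
  from complement_of_left_inverse[OF W U UW] obtain H T where
    H: "H \<in> carrier_mat p m" and T: "T \<in> carrier_mat m p"
    and HT: "U * H = 0\<^sub>m p' m" "T * W = 0\<^sub>m m p'" "T * H = 1\<^sub>m m" by (auto simp: mn)
  \<comment> \<open>The base changes [W H] and [V K], written as four blocks with an empty lower
    part.\<close>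
  define S where "S = four_block_mat W H (0\<^sub>m 0 p') (0\<^sub>m 0 m)"
  define S' where "S' = four_block_mat U (0\<^sub>m p' 0) T (0\<^sub>m m 0)"
  define R where "R = four_block_mat V K (0\<^sub>m 0 q') (0\<^sub>m 0 n)"
  define R' where "R' = four_block_mat P (0\<^sub>m q' 0) Q (0\<^sub>m n 0)"
  have pm: "p' + m = p" "q' + n = q" using le mn by auto
  have S: "S \<in> carrier_mat p p" "S' \<in> carrier_mat p p"
    unfolding S_def S'_def using four_block_carrier_mat[OF W, of "0\<^sub>m 0 m" 0 m]
      four_block_carrier_mat[OF U, of "0\<^sub>m m 0" m 0] pm by auto
  have R: "R \<in> carrier_mat q q" "R' \<in> carrier_mat q q"
    unfolding R_def R'_def using four_block_carrier_mat[OF V, of "0\<^sub>m 0 n" 0 n]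
      four_block_carrier_mat[OF P, of "0\<^sub>m n 0" n 0] pm by auto
  have "S' * S = 1\<^sub>m p" unfolding S_def S'_def pm(1)[symmetric]
    using W U H T UW HT by (subst mult_four_block_mat[of _ p' p _ 0 _ m _ _ p' _ m]) auto
  then have SS: "S * S' = 1\<^sub>m p" using mat_mult_left_right_inverse S by blast
  have "R' * R = 1\<^sub>m q" unfolding R_def R'_def pm(2)[symmetric]
    using V P K Q PV KQ by (subst mult_four_block_mat[of _ q' q _ 0 _ n _ _ q' _ n]) auto
  then have RR: "R * R' = 1\<^sub>m q" using mat_mult_left_right_inverse R by blast
  \<comment> \<open>The decomposition of the identity along the images of \<open>W\<close> and
    \<open>H\<close>, obtained by multiplying \<open>S\<close> and \<open>S'\<close> in the other
    order.\<close>
  have one: "W * U + H * T = 1\<^sub>m p"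
  proof -
    have "four_block_mat (W * U + H * T) (0\<^sub>m p 0) (0\<^sub>m 0 p) (0\<^sub>m 0 0) = S * S'"
      unfolding S_def S'_def
      using W U H T by (subst mult_four_block_mat[of _ p p' _ m _ 0 _ _ p _ 0]) auto
    moreover have "four_block_mat (W * U + H * T) (0\<^sub>m p 0) (0\<^sub>m 0 p) (0\<^sub>m 0 0) = W * U + H * T"
      using four_block_mat_empty(1)[of "W * U + H * T"] W U H T by auto
    ultimately show ?thesis using SS by simp
  qed
  define Z where "Z = (T * (fst X * K), T * (snd X * K))"
  have Z: "Z \<in> matrix_pairs m n" using X T K by (auto simp: Z_def matrix_pairs_iff)
  have block: "A * R = S * four_block_mat B (0\<^sub>m p' n) (0\<^sub>m m q') (T * (A * K))"
    if A: "A \<in> carrier_mat p q" and B: "B \<in> carrier_mat p' q'" and AV: "A * V = W * B" and UA: "U * A = B * P"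
    for A B
  proof -
    have AK: "A * K \<in> carrier_mat p n" using A K by auto
    \<comment> \<open>\<open>A\<close> sends kernel vectors of \<open>P\<close> to kernel vectors of
      \<open>U\<close>, that is, into the span of \<open>H\<close>; so the transformed matrix has no
      entry in the upper right block.\<close>
    have "U * (A * K) = U * A * K" using A U K by (intro assoc_mult_mat[symmetric]) auto
    also have "\<dots> = B * (P * K)" unfolding UA using B P K by (intro assoc_mult_mat) auto
    also have "\<dots> = 0\<^sub>m p' n" using KQ B by auto
    finally have "U * (A * K) = 0\<^sub>m p' n" .
    then have "W * (U * (A * K)) = 0\<^sub>m p n" using W by simp
    moreover have "A * K = (W * U + H * T) * (A * K)" unfolding one using AK by (rule left_mult_one_mat[symmetric])
    moreover have "(W * U + H * T) * (A * K) = W * (U * (A * K)) + H * (T * (A * K))"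
      using AK W U H T by (subst add_mult_distrib_mat[of _ p p]) (auto simp: assoc_mult_mat[of _ p _ _ p _ n])
    ultimately have AK': "A * K = H * (T * (A * K))" using H T AK by simp
    have "A = four_block_mat A (0\<^sub>m p 0) (0\<^sub>m 0 q) (0\<^sub>m 0 0)"
      using four_block_mat_empty(1)[of A] A by auto
    then have "A * R = four_block_mat A (0\<^sub>m p 0) (0\<^sub>m 0 q) (0\<^sub>m 0 0) * R" by simp
    also have "\<dots> = four_block_mat (A * V) (A * K) (0\<^sub>m 0 q') (0\<^sub>m 0 n)"
      unfolding R_def using A V K by (subst mult_four_block_mat[of _ p q _ 0 _ 0 _ _ q' _ n]) auto
    also have "\<dots> = four_block_mat (W * B) (H * (T * (A * K))) (0\<^sub>m 0 q') (0\<^sub>m 0 n)"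
      using AV AK' by simp
    also have "\<dots> = S * four_block_mat B (0\<^sub>m p' n) (0\<^sub>m m q') (T * (A * K))"
      unfolding S_def using W H B T AK
      by (subst mult_four_block_mat[of _ p p' _ m _ 0 _ _ q' _ n]) auto
    finally show ?thesis .
  qed
  have "pair_equiv X (Y \<boxplus> Z)"
  proof (rule pair_equiv_intro_comm[OF X _ S SS R RR])
    show "Y \<boxplus> Z \<in> matrix_pairs p q" using pair_sum_carrier[OF Y Z] pm by simp
    show "fst X * R = S * fst (Y \<boxplus> Z)"
      using block[of "fst X" "fst Y"] X Y Z XV UX K T by (auto simp: pair_sum_eq matrix_pairs_iff Z_def)
    show "snd X * R = S * snd (Y \<boxplus> Z)"
      using block[of "snd X" "snd Y"] X Y Z XV UX K T by (auto simp: pair_sum_eq matrix_pairs_iff Z_def)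
  qed
  with le Z show ?thesis by (auto simp: mn)
qed

section \<open>Polynomial null vectors of pencils\<close>

definition poly_app :: "complex mat \<Rightarrow> (nat \<Rightarrow> complex poly) \<Rightarrow> nat \<Rightarrow> complex poly" where
  "poly_app M f i = (\<Sum>j<dim_col M. Polynomial.smult (M $$ (i, j)) (f j))"

text \<open>As \<open>pCons 0\<close> multiplies by the indeterminate x, the equation for a pair (A,
  B) reads \<open>(B - x A) f = 0\<close>. The least such \<open>d\<close> is the smallest column
  minimal index of the pencil.\<close>

definition has_null :: "mpair \<Rightarrow> nat \<Rightarrow> bool" where
  "has_null X d \<longleftrightarrow> (\<exists>f. (\<forall>j<dim_col (fst X). degree (f j) \<le> d) \<and> (\<exists>j<dim_col (fst X). f j \<noteq> 0) \<and>
     (\<forall>i<dim_row (fst X). poly_app (snd X) f i = pCons 0 (poly_app (fst X) f i)))"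

lemma has_nullI:
  assumes "X \<in> matrix_pairs p q" "\<And>j. j < q \<Longrightarrow> degree (f j) \<le> d" "j < q" "f j \<noteq> 0"
    "\<And>i. i < p \<Longrightarrow> poly_app (snd X) f i = pCons 0 (poly_app (fst X) f i)"
  shows "has_null X d"
  using assms unfolding has_null_def by (intro exI[of _ f]) (auto simp: matrix_pairs_iff)

lemma has_nullD:
  assumes "has_null X d" "X \<in> matrix_pairs p q"
  shows "\<exists>f j. (\<forall>j<q. degree (f j) \<le> d) \<and> j < q \<and> f j \<noteq> 0 \<and>
    (\<forall>i<p. poly_app (snd X) f i = pCons 0 (poly_app (fst X) f i))"
proof -
  have c: "dim_col (fst X) = q" "dim_row (fst X) = p" using assms(2) by (auto simp: matrix_pairs_iff)
  from assms(1) show ?thesis unfolding has_null_def c by blast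
qed

lemma coeff_poly_app: "coeff (poly_app M f i) k = (\<Sum>j<dim_col M. M $$ (i, j) * coeff (f j) k)"
  by (simp add: poly_app_def coeff_sum)

lemma poly_app_cong:
  "dim_col M = n \<Longrightarrow> (\<And>j. j < n \<Longrightarrow> f j = g j) \<Longrightarrow> poly_app M f i = poly_app M g i"
  unfolding poly_app_def by (intro sum.cong) auto

lemma poly_app_mult:
  assumes "A \<in> carrier_mat a b" "B \<in> carrier_mat b c" "i < a"
  shows "poly_app (A * B) f i = poly_app A (poly_app B f) i"
proof (rule poly_eqI)
  fix k
  have "coeff (poly_app (A * B) f i) k = (\<Sum>j<c. (\<Sum>l<b. A $$ (i, l) * B $$ (l, j)) * coeff (f j) k)"
    using assms mult_mat_entry[OF assms(1,2,3)] by (auto simp: coeff_poly_app intro!: sum.cong)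
  also have "\<dots> = (\<Sum>l<b. A $$ (i, l) * (\<Sum>j<c. B $$ (l, j) * coeff (f j) k))"
    by (simp add: sum_distrib_left sum_distrib_right mult.assoc) (rule sum.swap)
  finally show "coeff (poly_app (A * B) f i) k = coeff (poly_app A (poly_app B f) i) k"
    using assms by (auto simp: coeff_poly_app)
qed

lemma poly_app_one: "i < n \<Longrightarrow> poly_app (1\<^sub>m n) f i = f i"
  proof -
  assume i: "i < n"
  have "poly_app (1\<^sub>m n) f i = (\<Sum>j<n. if j = i then f i else 0)"
    unfolding poly_app_def using i by (intro sum.cong) auto
  with i show ?thesis by simp
qed

lemma poly_app_pCons: "poly_app M (\<lambda>j. pCons 0 (f j)) i = pCons 0 (poly_app M f i)"
  by (rule poly_eqI) (auto simp: coeff_poly_app coeff_pCons split: nat.split)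

lemma degree_poly_app: "(\<And>j. j < dim_col M \<Longrightarrow> degree (f j) \<le> d) \<Longrightarrow> degree (poly_app M f i) \<le> d"
  unfolding poly_app_def by (intro degree_sum_le) (auto intro: order_trans[OF degree_smult_le])

lemma poly_app_0: "(\<And>j. j < dim_col M \<Longrightarrow> f j = 0) \<Longrightarrow> poly_app M f i = 0"
  unfolding poly_app_def by (intro sum.neutral) auto

lemma poly_app_four_block:
  assumes "A \<in> carrier_mat p q" "B \<in> carrier_mat p q'" "C \<in> carrier_mat p' q" "D \<in> carrier_mat p' q'"
  shows "i < p \<Longrightarrow> poly_app (four_block_mat A B C D) f i = poly_app A f i + poly_app B (\<lambda>j. f (q + j)) i"
    and "i < p' \<Longrightarrow> poly_app (four_block_mat A B C D) f (p + i) = poly_app C f i + poly_app D (\<lambda>j. f (q + j)) i"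
proof -
  have split: "(\<Sum>j<q + q'. g j) = (\<Sum>j<q. g j) + (\<Sum>j<q'. g (q + j))" for g :: "nat \<Rightarrow> complex poly"
    using sum.nat_diff_reindex by (induction q') (auto simp: add.assoc)
  show "i < p \<Longrightarrow> poly_app (four_block_mat A B C D) f i = poly_app A f i + poly_app B (\<lambda>j. f (q + j)) i"
    "i < p' \<Longrightarrow> poly_app (four_block_mat A B C D) f (p + i) = poly_app C f i + poly_app D (\<lambda>j. f (q + j)) i"
    using assms by (auto simp: poly_app_def split intro!: arg_cong2[of _ _ _ _ "(+)"] sum.cong)
qed

text \<open>Constant invertible matrices neither raise the degree nor kill a vector; a null vector
  \<open>f\<close> of \<open>X\<close> becomes the null vector \<open>R' f\<close> of
  \<open>Y\<close>.\<close>

lemma has_null_equiv: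
  assumes "pair_equiv X Y" "has_null X d" shows "has_null Y d"
proof -
  from assms(1) obtain p q S S' R R' where e:
    "X \<in> matrix_pairs p q" "Y \<in> matrix_pairs p q"
    "S \<in> carrier_mat p p" "S' \<in> carrier_mat p p" "S * S' = 1\<^sub>m p" "S' * S = 1\<^sub>m p"
    "R \<in> carrier_mat q q" "R' \<in> carrier_mat q q" "R * R' = 1\<^sub>m q" "R' * R = 1\<^sub>m q"
    "fst Y = S * fst X * R" "snd Y = S * snd X * R"
    by (elim pair_equiv_elim)
  from has_nullD[OF assms(2) e(1)] obtain f j where f: "\<And>j. j < q \<Longrightarrow> degree (f j) \<le> d" "j < q" "f j \<noteq> 0"
    "\<And>i. i < p \<Longrightarrow> poly_app (snd X) f i = pCons 0 (poly_app (fst X) f i)" by blast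
  define g where "g = poly_app R' f"
  have Rg: "poly_app R g i = f i" if "i < q" for i
    using poly_app_mult[OF e(7,8) that, of f] e(9) that by (simp add: g_def poly_app_one)
  have app: "poly_app (S * A * R) g i = poly_app S (poly_app A f) i" if A: "A \<in> carrier_mat p q" and i: "i < p" for A i
  proof -
    have "poly_app (S * A * R) g i = poly_app (S * A) (poly_app R g) i"
      using poly_app_mult[of "S * A" p q R q] e A i by auto
    also have "\<dots> = poly_app (S * A) f i" using Rg A by (intro poly_app_cong) auto
    also have "\<dots> = poly_app S (poly_app A f) i" using poly_app_mult[OF e(3) A i] .
    finally show ?thesis .
  qed
  have A: "fst X \<in> carrier_mat p q" "snd X \<in> carrier_mat p q" using e(1) by (auto simp: matrix_pairs_iff)
  have "\<exists>k<q. g k \<noteq> 0"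
  proof (rule ccontr)
    assume "\<not> (\<exists>k<q. g k \<noteq> 0)"
    then have "poly_app R g j = 0" using e(7) by (intro poly_app_0) auto
    then show False using Rg f by auto
  qed
  then obtain k where k: "k < q" "g k \<noteq> 0" by auto
  show ?thesis
  proof (rule has_nullI[where f = g, OF e(2) _ k])
    show "degree (g j) \<le> d" if "j < q" for j
      unfolding g_def using f(1) e(8) by (intro degree_poly_app) auto
    show "poly_app (snd Y) g i = pCons 0 (poly_app (fst Y) g i)" if i: "i < p" for i
    proof -
      have "poly_app (snd Y) g i = poly_app S (\<lambda>l. pCons 0 (poly_app (fst X) f l)) i"
        unfolding e(12) app[OF A(2) i] using f(4) e(3) by (intro poly_app_cong) auto
      then show ?thesis unfolding e(11) app[OF A(1) i] poly_app_pCons .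
    qed
  qed
qed

lemma has_null_pair_sum_right:
  assumes X: "X \<in> matrix_pairs p q" and Y: "Y \<in> matrix_pairs p' q'" and "has_null Y d"
  shows "has_null (X \<boxplus> Y) d"
proof -
  from has_nullD[OF assms(3) Y] obtain f j where f: "\<And>j. j < q' \<Longrightarrow> degree (f j) \<le> d" "j < q'" "f j \<noteq> 0"
    "\<And>i. i < p' \<Longrightarrow> poly_app (snd Y) f i = pCons 0 (poly_app (fst Y) f i)" by blast
  define g where "g j = (if j < q then 0 else f (j - q))" for j
  have app: "poly_app (four_block_mat A (0\<^sub>m p q') (0\<^sub>m p' q) B) g i
      = (if i < p then 0 else poly_app B f (i - p))"
    if A: "A \<in> carrier_mat p q" and B: "B \<in> carrier_mat p' q'" and i: "i < p + p'" for A B i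
  proof (cases "i < p")
    case True
    then show ?thesis using A
      by (subst poly_app_four_block(1)[OF A _ _ B]) (auto simp: g_def poly_app_0 poly_app_def)
  next
    case False
    then obtain l where l: "i = p + l" "l < p'" using i by (metis add_less_cancel_left le_iff_add not_less)
    have "poly_app (four_block_mat A (0\<^sub>m p q') (0\<^sub>m p' q) B) g (p + l) = poly_app (0\<^sub>m p' q) g l + poly_app B (\<lambda>j. g (q + j)) l"
      using l A B by (intro poly_app_four_block(2)) auto
    also have "poly_app (0\<^sub>m p' q) g l = 0" using l by (auto simp: poly_app_def g_def)
    also have "poly_app B (\<lambda>j. g (q + j)) l = poly_app B f l" by (intro poly_app_cong) (auto simp: g_def)
    finally show ?thesis using l by simp
  qed
  show ?thesis
  proof (rule has_nullI[OF pair_sum_carrier[OF X Y], of g d "q + j"])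
    show "degree (g j) \<le> d" if "j < q + q'" for j using that f(1)[of "j - q"] by (auto simp: g_def)
    show "poly_app (snd (X \<boxplus> Y)) g i = pCons 0 (poly_app (fst (X \<boxplus> Y)) g i)" if i: "i < p + p'" for i
      using X Y i f(4)[of "i - p"] app[of "fst X" "fst Y" i] app[of "snd X" "snd Y" i]
      by (auto simp: pair_sum_eq matrix_pairs_iff)
  qed (use f in \<open>auto simp: g_def\<close>)
qed

text \<open>The coefficient vectors of the null vectors of degree at most \<open>d\<close> are the solutions of a
  block Toeplitz system.\<close>

definition toeplitz :: "mpair \<Rightarrow> nat \<times> nat \<Rightarrow> nat \<times> nat \<Rightarrow> complex" where
  "toeplitz X = (\<lambda>(k, r) (t, j). (if k = t then snd X $$ (r, j) else 0) - (if k = Suc t then fst X $$ (r, j) else 0))"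

text \<open>Block row \<open>k\<close> compares \<open>B x(k)\<close> with \<open>A x(k-1)\<close>;
  the case distinctions cut the band off at its two ends.\<close>

lemma toeplitz_sum_right:
  "(\<Sum>tj\<in>{..<n} \<times> {..<q}. toeplitz X (k, r) tj * x tj) =
    (if k < n then \<Sum>j<q. snd X $$ (r, j) * x (k, j) else 0)
    - (if 0 < k \<and> k - 1 < n then \<Sum>j<q. fst X $$ (r, j) * x (k - 1, j) else 0)"
proof -
  have "(\<Sum>tj\<in>{..<n} \<times> {..<q}. toeplitz X (k, r) tj * x tj)
      = (\<Sum>t<n. \<Sum>j<q. toeplitz X (k, r) (t, j) * x (t, j))"
    by (simp add: sum.cartesian_product)
  also have "\<dots> = (\<Sum>t<n. (if t = k then \<Sum>j<q. snd X $$ (r, j) * x (k, j) else 0)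
       - (if k = Suc t then \<Sum>j<q. fst X $$ (r, j) * x (k - 1, j) else 0))"
    by (intro sum.cong refl) (auto simp: toeplitz_def sum_negf)
  also have "\<dots> = (\<Sum>t<n. (if t = k then \<Sum>j<q. snd X $$ (r, j) * x (k, j) else 0))
     - (\<Sum>t<n. (if k = Suc t then \<Sum>j<q. fst X $$ (r, j) * x (k - 1, j) else 0))"
    by (simp add: sum_subtractf)
  also have "(\<Sum>t<n. (if k = Suc t then \<Sum>j<q. fst X $$ (r, j) * x (k - 1, j) else 0))
     = (if 0 < k \<and> k - 1 < n then \<Sum>j<q. fst X $$ (r, j) * x (k - 1, j) else 0)"
    by (cases k) auto
  finally show ?thesis by simp
qed

lemma toeplitz_sum_left:
  assumes "Suc t < n"
  shows "(\<Sum>kr\<in>{..<n} \<times> {..<p}. y kr * toeplitz X kr (t, j)) =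
    (\<Sum>r<p. y (t, r) * snd X $$ (r, j)) - (\<Sum>r<p. y (Suc t, r) * fst X $$ (r, j))"
proof -
  have "(\<Sum>kr\<in>{..<n} \<times> {..<p}. y kr * toeplitz X kr (t, j))
      = (\<Sum>k<n. \<Sum>r<p. y (k, r) * toeplitz X (k, r) (t, j))"
    by (simp add: sum.cartesian_product)
  also have "\<dots> = (\<Sum>k<n. (if k = t then \<Sum>r<p. y (t, r) * snd X $$ (r, j) else 0)
       - (if k = Suc t then \<Sum>r<p. y (Suc t, r) * fst X $$ (r, j) else 0))"
    by (intro sum.cong refl) (auto simp: toeplitz_def sum_negf)
  finally show ?thesis using assms by (simp add: sum_subtractf)
qed

text \<open>Comparison of coefficients in \<open>B f = x A f\<close>: the constant term of the
  right-hand side vanishes, and its other coefficients are those of \<open>A f\<close> shifted by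
  one.\<close>

lemma has_null_iff_coeffs:
  assumes X: "X \<in> matrix_pairs p q"
  shows "has_null X d \<longleftrightarrow> (\<exists>c. (\<forall>k>d. \<forall>j<q. c k j = 0) \<and> (\<exists>k. \<exists>j<q. c k j \<noteq> 0) \<and>
    (\<forall>i<p. (\<Sum>j<q. snd X $$ (i, j) * c 0 j) = 0) \<and>
    (\<forall>k. \<forall>i<p. (\<Sum>j<q. snd X $$ (i, j) * c (Suc k) j) = (\<Sum>j<q. fst X $$ (i, j) * c k j)))"
    (is "?L \<longleftrightarrow> ?R")
proof
  assume L: ?L
  from has_nullD[OF L X] obtain f j where f: "\<And>j. j < q \<Longrightarrow> degree (f j) \<le> d" "j < q" "f j \<noteq> 0"
    "\<And>i. i < p \<Longrightarrow> poly_app (snd X) f i = pCons 0 (poly_app (fst X) f i)" by blast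
  have c: "coeff (poly_app (snd X) f i) k = (case k of 0 \<Rightarrow> 0 | Suc k \<Rightarrow> coeff (poly_app (fst X) f i) k)"
    if "i < p" for i k using f(4)[OF that] by (simp add: coeff_pCons)
  have z: "coeff (f j) k = 0" if "k > d" "j < q" for k j
    using f(1)[OF that(2)] that(1) by (intro coeff_eq_0) auto
  show ?R
  proof (intro exI[of _ "\<lambda>k j. coeff (f j) k"] conjI allI impI)
    show "\<exists>k. \<exists>j<q. coeff (f j) k \<noteq> 0" using f(2,3) by (intro exI[of _ "degree (f j)"] exI[of _ j]) auto
    show "(\<Sum>j<q. snd X $$ (i, j) * coeff (f j) 0) = 0" if "i < p" for i
      using c[OF that, of 0] X by (auto simp: coeff_poly_app matrix_pairs_iff)
    show "(\<Sum>j<q. snd X $$ (i, j) * coeff (f j) (Suc k)) = (\<Sum>j<q. fst X $$ (i, j) * coeff (f j) k)"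
      if "i < p" for i k
      using c[OF that, of "Suc k"] X by (auto simp: coeff_poly_app matrix_pairs_iff)
  qed (use z in auto)
next
  assume ?R
  then obtain c where cc: "\<forall>k>d. \<forall>j<q. c k j = 0" "\<exists>k. \<exists>j<q. c k j \<noteq> 0"
    "\<forall>i<p. (\<Sum>j<q. snd X $$ (i, j) * c 0 j) = 0"
    "\<forall>k. \<forall>i<p. (\<Sum>j<q. snd X $$ (i, j) * c (Suc k) j) = (\<Sum>j<q. fst X $$ (i, j) * c k j)" by blast
  from cc(2) obtain k j where kj: "j < q" "c k j \<noteq> 0" by blast
  have c: "\<And>k j. k > d \<Longrightarrow> j < q \<Longrightarrow> c k j = 0" "j < q" "c k j \<noteq> 0"
    "\<And>i. i < p \<Longrightarrow> (\<Sum>j<q. snd X $$ (i, j) * c 0 j) = 0"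
    "\<And>k i. i < p \<Longrightarrow> (\<Sum>j<q. snd X $$ (i, j) * c (Suc k) j) = (\<Sum>j<q. fst X $$ (i, j) * c k j)"
    using cc(1,3,4) kj by simp_all
  define f where "f j = (\<Sum>k\<le>d. Polynomial.monom (c k j) k)" for j
  have coeff: "coeff (f j) k = c k j" if "j < q" for j k
  proof -
    have "coeff (f j) k = (\<Sum>l\<le>d. if l = k then c l j else 0)"
      by (simp add: f_def coeff_sum coeff_monom)
    then show ?thesis using c(1)[of k j] that by (auto simp: not_le)
  qed
  show ?L
  proof (rule has_nullI[where f = f, OF X _ c(2)])
    show "degree (f j) \<le> d" for j
      unfolding f_def by (intro degree_sum_le) (auto intro: order_trans[OF degree_monom_le])
    show "f j \<noteq> 0" using coeff[OF c(2), of k] c(3) by auto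
    show "poly_app (snd X) f i = pCons 0 (poly_app (fst X) f i)" if "i < p" for i
      using X c(4,5)[OF that]
      by (intro poly_eqI) (auto simp: coeff_poly_app coeff_pCons matrix_pairs_iff coeff split: nat.split)
  qed
qed

text \<open>There are \<open>d + 1\<close> blocks of unknowns but \<open>d + 2\<close> blocks of
  equations, because \<open>x A f\<close> has degree up to \<open>d + 1\<close>; the last block says
  that \<open>A\<close> kills the leading coefficient.\<close>

lemma has_null_iff_toeplitz:
  assumes X: "X \<in> matrix_pairs p q"
  shows "has_null X d \<longleftrightarrow> \<not> injective_system ({..<d + 2} \<times> {..<p}) ({..<d + 1} \<times> {..<q}) (toeplitz X)"
    (is "?L \<longleftrightarrow> ?R")
proof
  assume ?L
  then obtain c where cc: "\<forall>k>d. \<forall>j<q. c k j = 0" "\<exists>k. \<exists>j<q. c k j \<noteq> 0"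
    "\<forall>i<p. (\<Sum>j<q. snd X $$ (i, j) * c 0 j) = 0"
    "\<forall>k. \<forall>i<p. (\<Sum>j<q. snd X $$ (i, j) * c (Suc k) j) = (\<Sum>j<q. fst X $$ (i, j) * c k j)"
    unfolding has_null_iff_coeffs[OF X] by blast
  from cc(2) obtain k j where kj: "j < q" "c k j \<noteq> 0" by blast
  have c: "\<And>k j. k > d \<Longrightarrow> j < q \<Longrightarrow> c k j = 0" "j < q" "c k j \<noteq> 0"
    "\<And>i. i < p \<Longrightarrow> (\<Sum>j<q. snd X $$ (i, j) * c 0 j) = 0"
    "\<And>k i. i < p \<Longrightarrow> (\<Sum>j<q. snd X $$ (i, j) * c (Suc k) j) = (\<Sum>j<q. fst X $$ (i, j) * c k j)"
    using cc(1,3,4) kj by simp_all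
  have "(\<Sum>tj\<in>{..<d + 1} \<times> {..<q}. toeplitz X (l, r) tj * (\<lambda>(k, j). c k j) tj) = 0" if "r < p" "l < d + 2" for l r
  proof (cases l)
    case 0
    then show ?thesis using c(4) that by (simp add: toeplitz_sum_right)
  next
    case (Suc l')
    have "(\<Sum>j<q. snd X $$ (r, j) * c l j) = 0" if "\<not> l < d + 1" using that c(1) by (intro sum.neutral) auto
    then show ?thesis using Suc that c(5)[of r l'] by (auto simp: toeplitz_sum_right)
  qed
  moreover have "(k, j) \<in> {..<d + 1} \<times> {..<q}" using c(1)[of k j] c(2,3) by (cases "k \<le> d") auto
  ultimately show ?R using c(3) unfolding injective_system_def by (auto intro!: exI[of _ "\<lambda>(k, j). c k j"])
next
  assume ?R
  then obtain x kj where x: "\<And>kr. kr \<in> {..<d + 2} \<times> {..<p} \<Longrightarrow> (\<Sum>tj\<in>{..<d + 1} \<times> {..<q}. toeplitz X kr tj * x tj) = 0"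
    and kj: "kj \<in> {..<d + 1} \<times> {..<q}" "x kj \<noteq> 0" unfolding injective_system_def by blast
  define c where "c k j = (if k \<le> d then x (k, j) else 0)" for k j
  have eq: "(if l < d + 1 then \<Sum>j<q. snd X $$ (r, j) * x (l, j) else 0)
    - (if 0 < l \<and> l - 1 < d + 1 then \<Sum>j<q. fst X $$ (r, j) * x (l - 1, j) else 0) = 0" if "l < d + 2" "r < p" for l r
    using x[of "(l, r)"] that by (simp add: toeplitz_sum_right)
  show ?L unfolding has_null_iff_coeffs[OF X]
  proof (intro exI[of _ c] conjI allI impI)
    show "\<exists>k. \<exists>j<q. c k j \<noteq> 0" using kj by (intro exI[of _ "fst kj"] exI[of _ "snd kj"]) (auto simp: c_def)
    show "(\<Sum>j<q. snd X $$ (i, j) * c 0 j) = 0" if "i < p" for i using eq[of 0 i] that by (simp add: c_def)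
    show "(\<Sum>j<q. snd X $$ (i, j) * c (Suc k) j) = (\<Sum>j<q. fst X $$ (i, j) * c k j)" if "i < p" for k i
      using eq[of "Suc k" i] that by (cases "k \<le> d"; cases "Suc k \<le> d") (auto simp: c_def)
  qed (auto simp: c_def)
qed

text \<open>For \<open>d = p\<close> the Toeplitz system has \<open>(p + 2) p\<close> equations and
  at least \<open>(p + 1) (p + 1)\<close> unknowns, which is at least one more.\<close>

lemma has_null_if_wide:
  assumes X: "X \<in> matrix_pairs p q" and "p < q"
  shows "\<exists>d. has_null X d"
proof -
  have "(p + 2) * p < (p + 1) * (p + 1)" by (simp add: algebra_simps)
  also have "\<dots> \<le> (p + 1) * q" using assms by (intro mult_le_mono2) auto
  finally have "card ({..<p + 2} \<times> {..<p}) < card ({..<p + 1} \<times> {..<q})" by (simp add: card_cartesian_product)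
  from wide_system_has_solution[OF _ _ this, of "toeplitz X"]
  have "\<not> injective_system ({..<p + 2} \<times> {..<p}) ({..<p + 1} \<times> {..<q}) (toeplitz X)"
    unfolding injective_system_def by auto
  then show ?thesis using has_null_iff_toeplitz[OF X] by blast
qed

section \<open>Splitting off a summand of least null degree\<close>

lemma kron_L_carrier [simp]: "kron_L n \<in> matrix_pairs (n - 1) n"
  by (auto simp: kron_L_def L_mat_def R_mat_def matrix_pairs_iff)

lemma L_mat_mult:
  assumes "M \<in> carrier_mat (Suc d) q"
  shows "L_mat (Suc d) * M = mat d q (\<lambda>(i, j). M $$ (i, j))"
    and "R_mat (Suc d) * M = mat d q (\<lambda>(i, j). M $$ (Suc i, j))"
proof -
  have c: "L_mat (Suc d) \<in> carrier_mat d (Suc d)" "R_mat (Suc d) \<in> carrier_mat d (Suc d)"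
    by (auto simp: L_mat_def R_mat_def)
  have "(L_mat (Suc d) * M) $$ (i, j) = M $$ (i, j)" if "i < d" "j < q" for i j
  proof -
    have "(L_mat (Suc d) * M) $$ (i, j) = (\<Sum>l<Suc d. if l = i then M $$ (i, j) else 0)"
      unfolding mult_mat_entry[OF c(1) assms that] using that by (intro sum.cong) (auto simp: L_mat_def)
    then show ?thesis using that by simp
  qed
  then show "L_mat (Suc d) * M = mat d q (\<lambda>(i, j). M $$ (i, j))"
    using c assms by (intro eq_matI) auto
  have "(R_mat (Suc d) * M) $$ (i, j) = M $$ (Suc i, j)" if "i < d" "j < q" for i j
  proof -
    have "(R_mat (Suc d) * M) $$ (i, j) = (\<Sum>l<Suc d. if l = Suc i then M $$ (Suc i, j) else 0)"
      unfolding mult_mat_entry[OF c(2) assms that] using that by (intro sum.cong) (auto simp: R_mat_def)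
    then show ?thesis using that by (simp del: sum.lessThan_Suc)
  qed
  then show "R_mat (Suc d) * M = mat d q (\<lambda>(i, j). M $$ (Suc i, j))"
    using c assms by (intro eq_matI) auto
qed

lemma mult_L_mat:
  assumes "M \<in> carrier_mat p d"
  shows "M * L_mat (Suc d) = mat p (Suc d) (\<lambda>(i, j). if j < d then M $$ (i, j) else 0)"
    and "M * R_mat (Suc d) = mat p (Suc d) (\<lambda>(i, j). if j = 0 then 0 else M $$ (i, j - 1))"
proof -
  have c: "L_mat (Suc d) \<in> carrier_mat d (Suc d)" "R_mat (Suc d) \<in> carrier_mat d (Suc d)"
    by (auto simp: L_mat_def R_mat_def)
  have "(M * L_mat (Suc d)) $$ (i, j) = (if j < d then M $$ (i, j) else 0)" if "i < p" "j < Suc d" for i j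
  proof -
    have "(M * L_mat (Suc d)) $$ (i, j) = (\<Sum>l<d. if l = j then M $$ (i, j) else 0)"
      unfolding mult_mat_entry[OF assms c(1) that] using that by (intro sum.cong) (auto simp: L_mat_def)
    then show ?thesis using that by simp
  qed
  then show "M * L_mat (Suc d) = mat p (Suc d) (\<lambda>(i, j). if j < d then M $$ (i, j) else 0)"
    using c assms by (intro eq_matI) auto
  have "(M * R_mat (Suc d)) $$ (i, j) = (if j = 0 then 0 else M $$ (i, j - 1))" if "i < p" "j < Suc d" for i j
  proof -
    have "(M * R_mat (Suc d)) $$ (i, j) = (\<Sum>l<d. if l = j - 1 \<and> j \<noteq> 0 then M $$ (i, j - 1) else 0)"
      unfolding mult_mat_entry[OF assms c(2) that] using that by (intro sum.cong) (auto simp: R_mat_def)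
    then show ?thesis using that by (cases j) auto
  qed
  then show "M * R_mat (Suc d) = mat p (Suc d) (\<lambda>(i, j). if j = 0 then 0 else M $$ (i, j - 1))"
    using c assms by (intro eq_matI) auto
qed

text \<open>If no functional \<open>f\<close> as below existed, the Fredholm alternative would turn \<open>A v\<^sub>0\<close> into
  the start of a null vector of smaller degree.\<close>

lemma minimal_null_dual_chain:
  assumes X: "X \<in> matrix_pairs p q" and min: "\<not> has_null X d"
    and v0: "\<And>i. i < p \<Longrightarrow> (\<Sum>j<q. snd X $$ (i, j) * v j) = 0" and l: "l < q" "v l \<noteq> 0"
  shows "\<exists>f. (\<forall>t<d. \<forall>j<q. (\<Sum>r<p. f (Suc t) r * fst X $$ (r, j)) = (\<Sum>r<p. f t r * snd X $$ (r, j))) \<and>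
    (\<Sum>r<p. f 0 r * (\<Sum>j<q. fst X $$ (r, j) * v j)) = (1 :: complex)"
proof -
  \<comment> \<open>The right-hand side is \<open>A v\<close> in block 0 and zero elsewhere; a
    solution would continue \<open>v\<close> by further coefficients.\<close>
  define y where "y = (\<lambda>(k :: nat, r). if k = 0 then \<Sum>j<q. fst X $$ (r, j) * v j else 0)"
  define I where "I = {..<Suc d} \<times> {..<p}"
  define J where "J = {..<d} \<times> {..<q}"
  have "\<not> (\<exists>x. \<forall>i\<in>I. (\<Sum>j\<in>J. toeplitz X i j * x j) = y i)"
  proof
    assume "\<exists>x. \<forall>i\<in>I. (\<Sum>j\<in>J. toeplitz X i j * x j) = y i"
    then obtain x where x: "\<And>i. i \<in> I \<Longrightarrow> (\<Sum>j\<in>J. toeplitz X i j * x j) = y i" by blast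
    have eq: "(if k < d then \<Sum>j<q. snd X $$ (r, j) * x (k, j) else 0)
      - (if 0 < k \<and> k - 1 < d then \<Sum>j<q. fst X $$ (r, j) * x (k - 1, j) else 0) =
      (if k = 0 then \<Sum>j<q. fst X $$ (r, j) * v j else 0)" if "k < Suc d" "r < p" for k r
      using x[of "(k, r)"] that by (simp add: toeplitz_sum_right I_def J_def y_def)
    \<comment> \<open>The solution, shifted by one place behind \<open>v\<close>, is a null vector
      of degree at most \<open>d\<close>.\<close>
    define c where "c k j = (if k = 0 then v j else if k \<le> d then x (k - 1, j) else 0)" for k j
    have "has_null X d" unfolding has_null_iff_coeffs[OF X]
    proof (intro exI[of _ c] conjI allI impI)
      show "\<exists>k. \<exists>j<q. c k j \<noteq> 0" using l by (intro exI[of _ 0] exI[of _ l]) (auto simp: c_def)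
      show "(\<Sum>j<q. snd X $$ (i, j) * c 0 j) = 0" if "i < p" for i using v0[OF that] by (simp add: c_def)
      show "(\<Sum>j<q. snd X $$ (i, j) * c (Suc k) j) = (\<Sum>j<q. fst X $$ (i, j) * c k j)" if "i < p" for k i
      proof (cases "k < Suc d")
        case True
        then show ?thesis using eq[OF True that] by (cases k) (auto simp: c_def split: if_splits)
      qed (auto simp: c_def)
    qed (auto simp: c_def)
    with min show False by blast
  qed
  moreover have "finite I" "finite J" by (auto simp: I_def J_def)
  ultimately obtain g where g: "\<And>j. j \<in> J \<Longrightarrow> (\<Sum>i\<in>I. g i * toeplitz X i j) = 0" "(\<Sum>i\<in>I. g i * y i) \<noteq> 0"
    using fredholm_alternative[of J I "toeplitz X" y] by blast
  define s where "s = (\<Sum>i\<in>I. g i * y i)"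
  have s: "s = (\<Sum>r<p. g (0, r) * (\<Sum>j<q. fst X $$ (r, j) * v j))"
  proof -
    have "s = (\<Sum>k<Suc d. \<Sum>r<p. g (k, r) * y (k, r))"
      by (simp add: s_def I_def sum.cartesian_product del: sum.lessThan_Suc)
    also have "\<dots> = (\<Sum>k<Suc d. if k = 0 then \<Sum>r<p. g (0, r) * (\<Sum>j<q. fst X $$ (r, j) * v j) else 0)"
      by (intro sum.cong) (auto simp: y_def)
    finally show ?thesis by (simp del: sum.lessThan_Suc)
  qed
  define f where "f k r = g (k, r) / s" for k r
  have f: "(\<Sum>r<p. f k r * z r) = (\<Sum>r<p. g (k, r) * z r) / s" for k z
    by (simp add: f_def sum_divide_distrib)
  show ?thesis
  proof (intro exI[of _ f] conjI allI impI)
    show "(\<Sum>r<p. f (Suc t) r * fst X $$ (r, j)) = (\<Sum>r<p. f t r * snd X $$ (r, j))" if "t < d" "j < q" for t j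
      using g(1)[of "(t, j)"] that by (simp add: f toeplitz_sum_left I_def J_def)
    show "(\<Sum>r<p. f 0 r * (\<Sum>j<q. fst X $$ (r, j) * v j)) = 1"
      using g(2) s by (simp add: f s_def[symmetric])
  qed
qed

text \<open>The coefficients \<open>c k\<close> of a null vector and their images \<open>w k\<close>
  form a copy of \<open>kron_L (Suc d)\<close> inside \<open>X\<close>; the dual chain
  \<open>f\<close> provides the retraction onto it.\<close>

lemma least_null_splits:
  assumes X: "X \<in> matrix_pairs p q" and null: "has_null X d" and min: "\<And>e. e < d \<Longrightarrow> \<not> has_null X e"
  shows "d \<le> p \<and> Suc d \<le> q \<and> (\<exists>Z\<in>matrix_pairs (p - d) (q - Suc d). pair_equiv X (kron_L (Suc d) \<boxplus> Z))"
proof -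
  define A B where "A = fst X" and "B = snd X"
  have AB: "A \<in> carrier_mat p q" "B \<in> carrier_mat p q" using X by (auto simp: A_def B_def matrix_pairs_iff)
  from null obtain c where cc: "\<forall>k>d. \<forall>j<q. c k j = 0" "\<exists>k. \<exists>j<q. c k j \<noteq> 0"
    and B0: "\<forall>i<p. (\<Sum>j<q. B $$ (i, j) * c 0 j) = 0"
    and BA: "\<forall>k. \<forall>i<p. (\<Sum>j<q. B $$ (i, j) * c (Suc k) j) = (\<Sum>j<q. A $$ (i, j) * c k j)"
    unfolding has_null_iff_coeffs[OF X] A_def B_def by blast
  \<comment> \<open>A null vector with zero constant term could be divided by x, contrary to
    minimality.\<close>
  have "\<exists>l<q. c 0 l \<noteq> 0"
  proof (rule ccontr)
    assume no: "\<not> (\<exists>l<q. c 0 l \<noteq> 0)"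
    from cc(2) obtain k j where kj: "j < q" "c k j \<noteq> 0" by blast
    with no obtain k' where k': "k = Suc k'" by (cases k) auto
    have "k \<le> d" using kj cc(1) by (metis not_less)
    then have d: "d - 1 < d" using k' by simp
    have "has_null X (d - 1)" unfolding has_null_iff_coeffs[OF X]
    proof (intro exI[of _ "\<lambda>k. c (Suc k)"] conjI allI impI)
      show "\<exists>k. \<exists>j<q. c (Suc k) j \<noteq> 0" using kj k' by blast
      show "c (Suc k) j = 0" if "d - 1 < k" "j < q" for k j using cc(1) that by auto
      show "(\<Sum>j<q. snd X $$ (i, j) * c (Suc 0) j) = 0" if "i < p" for i
        using BA[rule_format, OF that, of 0] no by (auto simp: A_def B_def)
      show "(\<Sum>j<q. snd X $$ (i, j) * c (Suc (Suc k)) j) = (\<Sum>j<q. fst X $$ (i, j) * c (Suc k) j)" if "i < p" for i k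
        using BA[rule_format, OF that] by (auto simp: A_def B_def)
    qed
    with min[OF d] show False by blast
  qed
  then obtain l where l: "l < q" "c 0 l \<noteq> 0" by blast
  \<comment> \<open>By the null vector equation \<open>w k\<close> is at once \<open>A c(k)\<close>
    and \<open>B c(k+1)\<close>, and \<open>w d\<close> vanishes; the earlier ones are the columns
    of \<open>W\<close>.\<close>
  define w where "w k r = (\<Sum>j<q. A $$ (r, j) * c k j)" for k r
  have wB: "(\<Sum>j<q. B $$ (r, j) * c (Suc k) j) = w k r" if "r < p" for k r
    using BA that by (simp add: w_def)
  have wd: "w d r = 0" if "r < p" for r
    using wB[OF that, of d] cc(1) by simp
  define V where "V = mat q (Suc d) (\<lambda>(j, k). c k j)"
  define W where "W = mat p d (\<lambda>(r, k). w k r)"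
  have V: "V \<in> carrier_mat q (Suc d)" and W: "W \<in> carrier_mat p d" by (auto simp: V_def W_def)
  have AV: "A * V = W * L_mat (Suc d)"
  proof (unfold mult_L_mat(1)[OF W], rule eq_matI)
    fix r k assume "r < dim_row (mat p (Suc d) (\<lambda>(i, j). if j < d then W $$ (i, j) else 0))"
      "k < dim_col (mat p (Suc d) (\<lambda>(i, j). if j < d then W $$ (i, j) else 0))"
    then have rk: "r < p" "k < Suc d" by auto
    have "(A * V) $$ (r, k) = w k r"
      unfolding mult_mat_entry[OF AB(1) V rk] w_def using rk by (intro sum.cong) (auto simp: V_def)
    then show "(A * V) $$ (r, k) = mat p (Suc d) (\<lambda>(i, j). if j < d then W $$ (i, j) else 0) $$ (r, k)"
      using rk wd by (cases "k = d") (auto simp: W_def)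
  qed (use AB V in auto)
  have BV: "B * V = W * R_mat (Suc d)"
  proof (unfold mult_L_mat(2)[OF W], rule eq_matI)
    fix r k assume "r < dim_row (mat p (Suc d) (\<lambda>(i, j). if j = 0 then 0 else W $$ (i, j - 1)))"
      "k < dim_col (mat p (Suc d) (\<lambda>(i, j). if j = 0 then 0 else W $$ (i, j - 1)))"
    then have rk: "r < p" "k < Suc d" by auto
    have "(B * V) $$ (r, k) = (\<Sum>j<q. B $$ (r, j) * c k j)"
      unfolding mult_mat_entry[OF AB(2) V rk] using rk by (intro sum.cong) (auto simp: V_def)
    then show "(B * V) $$ (r, k) = mat p (Suc d) (\<lambda>(i, j). if j = 0 then 0 else W $$ (i, j - 1)) $$ (r, k)"
      using rk wB B0 by (cases k) (auto simp: W_def)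
  qed (use AB V in auto)
  have "\<exists>P U. P \<in> carrier_mat (Suc d) q \<and> U \<in> carrier_mat d p \<and> P * V = 1\<^sub>m (Suc d) \<and> U * W = 1\<^sub>m d \<and>
    U * A = L_mat (Suc d) * P \<and> U * B = R_mat (Suc d) * P"
  proof (cases d)
    case 0
    \<comment> \<open>For \<open>d = 0\<close> the summand has no rows, and any functional with
      value 1 on \<open>c 0\<close> is a retraction.\<close>
    define P where "P = mat 1 q (\<lambda>(i, j). if j = l then 1 / c 0 l else 0)"
    have P: "P \<in> carrier_mat (Suc d) q" by (simp add: P_def 0)
    have "P * V = 1\<^sub>m (Suc d)"
    proof (rule eq_matI)
      fix i k assume "i < dim_row (1\<^sub>m (Suc d))" "k < dim_col (1\<^sub>m (Suc d))"
      then have ik: "i < Suc d" "k < Suc d" by auto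
      have "(P * V) $$ (i, k) = (\<Sum>j<q. if j = l then c k l / c 0 l else 0)"
        unfolding mult_mat_entry[OF P V ik] using ik by (intro sum.cong) (auto simp: P_def V_def 0)
      then show "(P * V) $$ (i, k) = 1\<^sub>m (Suc d) $$ (i, k)" using l ik 0 by simp
    qed (use P V in auto)
    then show ?thesis using P V W AB
      by (intro exI[of _ P] exI[of _ "0\<^sub>m d p"]) (auto simp: 0 L_mat_def R_mat_def intro!: eq_matI)
  next
    case (Suc e)
    \<comment> \<open>The dual chain is taken for the degree \<open>e = d - 1\<close>, which
      minimality excludes; it has the \<open>d\<close> members \<open>f 0\<close>, ...,
      \<open>f e\<close>.\<close>
    have "\<not> has_null X e" using min Suc by simp
    from minimal_null_dual_chain[OF X this, of "c 0", OF B0[rule_format, unfolded B_def] l]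
    obtain f where fe: "\<And>t j. t < e \<Longrightarrow> j < q \<Longrightarrow> (\<Sum>r<p. f (Suc t) r * A $$ (r, j)) = (\<Sum>r<p. f t r * B $$ (r, j))"
      and f0: "(\<Sum>r<p. f 0 r * w 0 r) = 1" unfolding A_def B_def w_def by blast
    \<comment> \<open>\<open>G\<close> turns out to be constant along diagonals with 1 at the
      corner; it vanishes below the diagonal by \<open>B c(0) = 0\<close> and above it by
      \<open>w d = 0\<close>. So it is the identity where it matters.\<close>
    define G where "G i k = (\<Sum>r<p. f i r * w k r)" for i k
    have GA: "(\<Sum>j<q. (\<Sum>r<p. f i r * A $$ (r, j)) * c k j) = G i k" for i k
      unfolding G_def w_def by (simp add: sum_distrib_left sum_distrib_right mult.assoc) (rule sum.swap)
    have GB: "(\<Sum>j<q. (\<Sum>r<p. f i r * B $$ (r, j)) * c k j) = (\<Sum>r<p. f i r * (\<Sum>j<q. B $$ (r, j) * c k j))" for i k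
      by (simp add: sum_distrib_left sum_distrib_right mult.assoc) (rule sum.swap)
    have GBS: "(\<Sum>j<q. (\<Sum>r<p. f i r * B $$ (r, j)) * c (Suc k) j) = G i k" for i k
      unfolding GB G_def by (intro sum.cong) (auto simp: wB)
    have GB0: "(\<Sum>j<q. (\<Sum>r<p. f i r * B $$ (r, j)) * c 0 j) = 0" for i
      unfolding GB using B0 by (intro sum.neutral) auto
    have step: "G (Suc i) (Suc k) = G i k" if "i < e" for i k
    proof -
      have "G (Suc i) (Suc k) = (\<Sum>j<q. (\<Sum>r<p. f i r * B $$ (r, j)) * c (Suc k) j)"
        unfolding GA[symmetric] using fe[OF that] by (intro sum.cong) auto
      then show ?thesis by (simp add: GBS)
    qed
    have low: "G (Suc i) 0 = 0" if "i < e" for i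
    proof -
      have "G (Suc i) 0 = (\<Sum>j<q. (\<Sum>r<p. f i r * B $$ (r, j)) * c 0 j)"
        unfolding GA[symmetric] using fe[OF that] by (intro sum.cong) auto
      then show ?thesis by (simp add: GB0)
    qed
    have steps: "i + t \<le> e \<Longrightarrow> G (i + t) (k + t) = G i k" for i k t
      by (induction t) (auto simp: step)
    have Gd: "G i d = 0" for i unfolding G_def using wd by simp
    have G: "G i k = (if i = k then 1 else 0)" if ik: "i \<le> e" "k \<le> d" for i k
    proof -
      consider "i = k" | "i > k" | "i < k" by linarith
      then show ?thesis
      proof cases
        case 1
        then show ?thesis using steps[of 0 k 0] ik f0 by (simp add: G_def)
      next
        case 2
        then show ?thesis using steps[of "i - k" k 0] low[of "i - k - 1"] ik by (simp add: Suc_diff_Suc)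
      next
        case 3
        then have "G i k = G (i + (d - k)) (k + (d - k))" using ik Suc by (intro steps[symmetric]) auto
        also have "k + (d - k) = d" using ik by simp
        finally show ?thesis using Gd 3 by simp
      qed
    qed
    define U where "U = mat d p (\<lambda>(i, r). f i r)"
    \<comment> \<open>The rows of \<open>P\<close> are forced by \<open>U A = L P\<close> and
      \<open>U B = R P\<close>: the first \<open>d\<close> are \<open>f i A\<close>, and the last
      one is \<open>f e B\<close>.\<close>
    define P where "P = mat (Suc d) q (\<lambda>(i, j). if i < d then \<Sum>r<p. f i r * A $$ (r, j) else \<Sum>r<p. f e r * B $$ (r, j))"
    have U: "U \<in> carrier_mat d p" and P: "P \<in> carrier_mat (Suc d) q" by (auto simp: U_def P_def)
    have "P * V = 1\<^sub>m (Suc d)"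
    proof (rule eq_matI)
      fix i k assume "i < dim_row (1\<^sub>m (Suc d))" "k < dim_col (1\<^sub>m (Suc d))"
      then have ik: "i < Suc d" "k < Suc d" by auto
      have "(P * V) $$ (i, k) = (\<Sum>j<q. (if i < d then \<Sum>r<p. f i r * A $$ (r, j) else \<Sum>r<p. f e r * B $$ (r, j)) * c k j)"
        unfolding mult_mat_entry[OF P V ik] using ik by (intro sum.cong) (auto simp: P_def V_def)
      also have "\<dots> = (if i = k then 1 else 0)"
      proof (cases "i < d")
        case True
        then show ?thesis using GA G[of i k] ik Suc by simp
      next
        case False
        then show ?thesis using GBS[of e] GB0[of e] G[of e "k - 1"] ik Suc by (cases k) auto
      qed
      finally show "(P * V) $$ (i, k) = 1\<^sub>m (Suc d) $$ (i, k)" using ik by simp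
    qed (use P V in auto)
    moreover have "U * W = 1\<^sub>m d"
    proof (rule eq_matI)
      fix i k assume "i < dim_row (1\<^sub>m d)" "k < dim_col (1\<^sub>m d)"
      then have ik: "i < d" "k < d" by auto
      have "(U * W) $$ (i, k) = G i k"
        unfolding mult_mat_entry[OF U W ik] G_def using ik by (intro sum.cong) (auto simp: U_def W_def)
      then show "(U * W) $$ (i, k) = 1\<^sub>m d $$ (i, k)" using ik G[of i k] Suc by simp
    qed (use U W in auto)
    moreover have "U * A = L_mat (Suc d) * P"
    proof (unfold L_mat_mult(1)[OF P], rule eq_matI)
      fix i j assume "i < dim_row (mat d q (\<lambda>(i, j). P $$ (i, j)))" "j < dim_col (mat d q (\<lambda>(i, j). P $$ (i, j)))"
      then have ij: "i < d" "j < q" by auto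
      have "(U * A) $$ (i, j) = (\<Sum>r<p. f i r * A $$ (r, j))"
        unfolding mult_mat_entry[OF U AB(1) ij] using ij by (intro sum.cong) (auto simp: U_def)
      then show "(U * A) $$ (i, j) = mat d q (\<lambda>(i, j). P $$ (i, j)) $$ (i, j)"
        using ij by (simp add: P_def)
    qed (use U AB in auto)
    moreover have "U * B = R_mat (Suc d) * P"
    proof (unfold L_mat_mult(2)[OF P], rule eq_matI)
      fix i j assume "i < dim_row (mat d q (\<lambda>(i, j). P $$ (Suc i, j)))" "j < dim_col (mat d q (\<lambda>(i, j). P $$ (Suc i, j)))"
      then have ij: "i < d" "j < q" by auto
      have "(U * B) $$ (i, j) = (\<Sum>r<p. f i r * B $$ (r, j))"
        unfolding mult_mat_entry[OF U AB(2) ij] using ij by (intro sum.cong) (auto simp: U_def)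
      then show "(U * B) $$ (i, j) = mat d q (\<lambda>(i, j). P $$ (Suc i, j)) $$ (i, j)"
        using ij fe[of i j] Suc by (cases "i = e") (auto simp: P_def)
    qed (use U AB in auto)
    ultimately show ?thesis using U P by blast
  qed
  then obtain P U where P: "P \<in> carrier_mat (Suc d) q" and U: "U \<in> carrier_mat d p"
    and PU: "P * V = 1\<^sub>m (Suc d)" "U * W = 1\<^sub>m d" "U * A = L_mat (Suc d) * P" "U * B = R_mat (Suc d) * P"
    by blast
  show ?thesis
    using retract_is_summand[of X p q "kron_L (Suc d)" d "Suc d" V P W U] X P U V W PU AV BV
    by (auto simp: kron_L_def A_def B_def L_mat_def R_mat_def matrix_pairs_iff)
qed

section \<open>Corank\<close>

definition mat_app :: "complex mat \<Rightarrow> (nat \<Rightarrow> complex) \<Rightarrow> nat \<Rightarrow> complex" where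
  "mat_app M x i = (\<Sum>j<dim_col M. M $$ (i, j) * x j)"

text \<open>The kernel has dimension at most \<open>c\<close> iff \<open>c\<close> functionals
  reduce it to zero. In this form the bound is the injectivity of a linear system, hence an open
  condition.\<close>

definition corank_le :: "nat \<Rightarrow> complex mat \<Rightarrow> bool" where
  "corank_le c M \<longleftrightarrow> (\<exists>F. finite F \<and> card F \<le> c \<and>
     (\<forall>x. (\<forall>i<dim_row M. mat_app M x i = 0) \<and> (\<forall>f\<in>F. (\<Sum>j<dim_col M. f j * x j) = 0) \<longrightarrow>
       (\<forall>j<dim_col M. x j = 0)))"

lemma corank_leI:
  assumes "M \<in> carrier_mat p q" "finite F" "card F \<le> c"
    "\<And>x j. (\<And>i. i < p \<Longrightarrow> mat_app M x i = 0) \<Longrightarrow> (\<And>f. f \<in> F \<Longrightarrow> (\<Sum>j<q. f j * x j) = 0) \<Longrightarrow>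
      j < q \<Longrightarrow> x j = 0"
  shows "corank_le c M"
  using assms unfolding corank_le_def by (intro exI[of _ F]) auto

lemma corank_leD:
  assumes "corank_le c M" "M \<in> carrier_mat p q"
  shows "\<exists>F. finite F \<and> card F \<le> c \<and> (\<forall>x. (\<forall>i<p. mat_app M x i = 0) \<longrightarrow>
    (\<forall>f\<in>F. (\<Sum>j<q. f j * x j) = 0) \<longrightarrow> (\<forall>j<q. x j = 0))"
proof -
  have c: "dim_row M = p" "dim_col M = q" using assms(2) by auto
  from assms(1) show ?thesis unfolding corank_le_def c by blast
qed

lemma corank_le_0_iff:
  assumes "M \<in> carrier_mat p q"
  shows "corank_le 0 M \<longleftrightarrow> (\<forall>x. (\<forall>i<p. mat_app M x i = 0) \<longrightarrow> (\<forall>j<q. x j = 0))"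
  using assms unfolding corank_le_def by auto

lemma corank_le_0I:
  assumes "M \<in> carrier_mat p q"
    "\<And>x j. (\<And>i. i < p \<Longrightarrow> mat_app M x i = 0) \<Longrightarrow> j < q \<Longrightarrow> x j = 0"
  shows "corank_le 0 M"
  using assms corank_le_0_iff by blast

lemma mat_app_cong:
  "dim_col M = n \<Longrightarrow> (\<And>j. j < n \<Longrightarrow> x j = y j) \<Longrightarrow> mat_app M x i = mat_app M y i"
  unfolding mat_app_def by (intro sum.cong) auto

lemma mat_app_mult:
  assumes "A \<in> carrier_mat a b" "B \<in> carrier_mat b c" "i < a"
  shows "mat_app (A * B) x i = mat_app A (mat_app B x) i"
proof -
  have "mat_app (A * B) x i = (\<Sum>j<c. (\<Sum>l<b. A $$ (i, l) * B $$ (l, j)) * x j)"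
    unfolding mat_app_def using assms mult_mat_entry[OF assms] by (intro sum.cong) auto
  also have "\<dots> = (\<Sum>l<b. A $$ (i, l) * (\<Sum>j<c. B $$ (l, j) * x j))"
    by (simp add: sum_distrib_left sum_distrib_right mult.assoc) (rule sum.swap)
  finally show ?thesis using assms by (auto simp: mat_app_def)
qed

lemma mat_app_one:
  assumes "i < n" shows "mat_app (1\<^sub>m n) x i = x i"
proof -
  have "mat_app (1\<^sub>m n) x i = (\<Sum>j<n. if j = i then x i else 0)"
    unfolding mat_app_def using assms by (intro sum.cong) auto
  with assms show ?thesis by simp
qed

lemma mat_app_eq_0: "(\<And>j. j < dim_col M \<Longrightarrow> x j = 0) \<Longrightarrow> mat_app M x i = 0"
  unfolding mat_app_def by (intro sum.neutral) auto

lemma sum_lessThan_add: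
  fixes g :: "nat \<Rightarrow> 'a :: comm_monoid_add"
  shows "(\<Sum>j<q + q'. g j) = (\<Sum>j<q. g j) + (\<Sum>j<q'. g (q + j))"
  by (induction q') (auto simp: add.assoc)

lemma mat_app_four_block:
  assumes "A \<in> carrier_mat p q" "B \<in> carrier_mat p q'" "C \<in> carrier_mat p' q" "D \<in> carrier_mat p' q'"
  shows "i < p \<Longrightarrow> mat_app (four_block_mat A B C D) f i = mat_app A f i + mat_app B (\<lambda>j. f (q + j)) i"
    and "i < p' \<Longrightarrow> mat_app (four_block_mat A B C D) f (p + i) = mat_app C f i + mat_app D (\<lambda>j. f (q + j)) i"
  using assms by (auto simp: mat_app_def sum_lessThan_add intro!: arg_cong2[of _ _ _ _ "(+)"] sum.cong)

lemma mat_app_zero: "i < p \<Longrightarrow> mat_app (0\<^sub>m p q) x i = 0"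
  by (simp add: mat_app_def)

lemma mat_app_diag:
  assumes "A \<in> carrier_mat p q" "D \<in> carrier_mat p' q'"
  shows "(\<forall>i<p + p'. mat_app (four_block_mat A (0\<^sub>m p q') (0\<^sub>m p' q) D) x i = 0) \<longleftrightarrow>
    (\<forall>i<p. mat_app A x i = 0) \<and> (\<forall>i<p'. mat_app D (\<lambda>j. x (q + j)) i = 0)" (is "(\<forall>i<p + p'. ?P i) \<longleftrightarrow> _")
proof -
  have "(\<forall>i<p + p'. ?P i) \<longleftrightarrow> (\<forall>i<p. ?P i) \<and> (\<forall>i<p'. ?P (p + i))"
    proof (intro iffI conjI allI impI)
    fix i assume a: "(\<forall>i<p. ?P i) \<and> (\<forall>i<p'. ?P (p + i))" and i: "i < p + p'"
    show "?P i"
    proof (cases "i < p")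
      case False
      have "?P (p + (i - p))"
        by (rule a[THEN conjunct2, rule_format]) (use i False in simp)
      then show ?thesis using False by simp
    qed (use a in blast)
  qed auto
  then show ?thesis
    using mat_app_four_block[OF assms(1) zero_carrier_mat zero_carrier_mat assms(2)]
    by (auto simp: mat_app_zero)
qed

text \<open>A kernel vector \<open>x\<close> of \<open>S M R\<close> gives the kernel vector
  \<open>R x\<close> of \<open>M\<close>, so the functionals are pulled back along
  \<open>R\<close>.\<close>

lemma corank_le_mult_invertible:
  assumes M: "M \<in> carrier_mat p q" and "corank_le c M"
    and S: "S \<in> carrier_mat p p" "S' \<in> carrier_mat p p" "S' * S = 1\<^sub>m p"
    and R: "R \<in> carrier_mat q q" "R' \<in> carrier_mat q q" "R' * R = 1\<^sub>m q"
  shows "corank_le c (S * M * R)"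
proof -
  from corank_leD[OF assms(2) M] obtain F where F: "finite F" "card F \<le> c"
    "\<And>x j. \<forall>i<p. mat_app M x i = 0 \<Longrightarrow> \<forall>f\<in>F. (\<Sum>j<q. f j * x j) = 0 \<Longrightarrow> j < q \<Longrightarrow> x j = 0"
    by blast
  define h where "h f = (\<lambda>j. \<Sum>l<q. f l * R $$ (l, j))" for f :: "nat \<Rightarrow> complex"
  show ?thesis
  proof (rule corank_leI[of _ p q "h ` F"])
    show "S * M * R \<in> carrier_mat p q" using M S R by auto
    show "card (h ` F) \<le> c" using card_image_le[OF F(1), of h] F(2) by linarith
    fix x j assume x: "\<And>i. i < p \<Longrightarrow> mat_app (S * M * R) x i = 0"
      "\<And>f. f \<in> h ` F \<Longrightarrow> (\<Sum>j<q. f j * x j) = 0" and j: "j < q"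
    define y where "y = mat_app R x"
    have SMR: "mat_app (S * M * R) x i = mat_app S (mat_app M y) i" if "i < p" for i
      using mat_app_mult[of "S * M" p q R q i x] mat_app_mult[OF S(1) M that, of y] S M R that
      by (auto simp: y_def)
    have "mat_app M y i = 0" if "i < p" for i
    proof -
      have "mat_app M y i = mat_app (S' * S) (mat_app M y) i" using S that by (simp add: mat_app_one)
      also have "\<dots> = mat_app S' (mat_app S (mat_app M y)) i" using mat_app_mult[OF S(2,1) that] .
      also have "\<dots> = 0" by (rule mat_app_eq_0) (use SMR x(1) S in auto)
      finally show ?thesis .
    qed
    moreover have "(\<Sum>l<q. f l * y l) = 0" if "f \<in> F" for f
    proof -
      have "(\<Sum>l<q. f l * y l) = (\<Sum>j<q. h f j * x j)"
        using R by (simp add: y_def mat_app_def h_def sum_distrib_left sum_distrib_right mult.assoc) (rule sum.swap)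
      then show ?thesis using x(2) that by simp
    qed
    ultimately have "y l = 0" if "l < q" for l using F(3) that by blast
    then have "mat_app R' y j = 0" using R by (auto intro: mat_app_eq_0)
    then show "x j = 0" using mat_app_mult[OF R(2,1) j, of x] R j by (simp add: y_def mat_app_one)
  qed (use F in auto)
qed

lemma corank_le_equiv:
  assumes "pair_equiv X Y" "corank_le c (pencil_at a b X)" shows "corank_le c (pencil_at a b Y)"
  using assms(1)
proof (elim pair_equiv_elim)
  fix p q S S' R R'
  assume e: "X \<in> matrix_pairs p q" "Y \<in> matrix_pairs p q"
    "S \<in> carrier_mat p p" "S' \<in> carrier_mat p p" "S * S' = 1\<^sub>m p" "S' * S = 1\<^sub>m p"
    "R \<in> carrier_mat q q" "R' \<in> carrier_mat q q" "R * R' = 1\<^sub>m q" "R' * R = 1\<^sub>m q"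
    "fst Y = S * fst X * R" "snd Y = S * snd X * R"
  show ?thesis unfolding pencil_at_equiv[OF e(1,3,7,11,12)]
    by (rule corank_le_mult_invertible[OF pencil_at_carrier[OF e(1)] assms(2) e(3,4,6,7,8,10)])
qed

lemma corank_le_diag:
  assumes A: "A \<in> carrier_mat p q" and D: "D \<in> carrier_mat p' q'" and "corank_le c A" "corank_le c' D"
  shows "corank_le (c + c') (four_block_mat A (0\<^sub>m p q') (0\<^sub>m p' q) D)"
proof -
  from corank_leD[OF assms(3) A] obtain F where F: "finite F" "card F \<le> c"
    "\<And>x j. \<forall>i<p. mat_app A x i = 0 \<Longrightarrow> \<forall>f\<in>F. (\<Sum>j<q. f j * x j) = 0 \<Longrightarrow> j < q \<Longrightarrow> x j = 0"
    by blast
  from corank_leD[OF assms(4) D] obtain G where G: "finite G" "card G \<le> c'"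
    "\<And>x j. \<forall>i<p'. mat_app D x i = 0 \<Longrightarrow> \<forall>f\<in>G. (\<Sum>j<q'. f j * x j) = 0 \<Longrightarrow> j < q' \<Longrightarrow> x j = 0"
    by blast
  define u where "u f = (\<lambda>j. if j < q then f j else 0)" for f :: "nat \<Rightarrow> complex"
  define w where "w f = (\<lambda>j. if j < q then 0 else f (j - q))" for f :: "nat \<Rightarrow> complex"
  have u: "(\<Sum>j<q + q'. u f j * x j) = (\<Sum>j<q. f j * x j)" for f x
    by (simp add: sum_lessThan_add u_def)
  have w: "(\<Sum>j<q + q'. w f j * x j) = (\<Sum>j<q'. f j * x (q + j))" for f x
    by (simp add: sum_lessThan_add w_def)
  show ?thesis
  proof (rule corank_leI[of _ "p + p'" "q + q'" "u ` F \<union> w ` G"])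
    show "card (u ` F \<union> w ` G) \<le> c + c'"
      using card_Un_le[of "u ` F" "w ` G"] card_image_le[OF F(1), of u] card_image_le[OF G(1), of w] F(2) G(2)
      by linarith
    fix x j assume x: "\<And>i. i < p + p' \<Longrightarrow> mat_app (four_block_mat A (0\<^sub>m p q') (0\<^sub>m p' q) D) x i = 0"
      "\<And>f. f \<in> u ` F \<union> w ` G \<Longrightarrow> (\<Sum>j<q + q'. f j * x j) = 0" and j: "j < q + q'"
    have k: "\<forall>i<p. mat_app A x i = 0" "\<forall>i<p'. mat_app D (\<lambda>j. x (q + j)) i = 0"
      using mat_app_diag[OF A D, of x] x(1) by blast+
    have "\<forall>f\<in>F. (\<Sum>j<q. f j * x j) = 0" using x(2)[OF UnI1[OF imageI]] unfolding u by blast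
    moreover have "\<forall>f\<in>G. (\<Sum>j<q'. f j * x (q + j)) = 0" using x(2)[OF UnI2[OF imageI]] unfolding w by blast
    ultimately show "x j = 0"
      using F(3)[OF k(1), of j] G(3)[OF k(2), of "j - q"] j by (cases "j < q") auto
  qed (use A D F G in auto)
qed

text \<open>The third claim: a nonzero kernel vector of the first block uses up one functional. Some
  \<open>g\<close> does not vanish on it and serves to clear the others, which leaves
  \<open>c - 1\<close> functionals for \<open>D\<close>.\<close>

lemma corank_le_summands:
  assumes A: "A \<in> carrier_mat p q" and D: "D \<in> carrier_mat p' q'"
    and "corank_le c (four_block_mat A (0\<^sub>m p q') (0\<^sub>m p' q) D)" (is "corank_le c ?M")
  shows "corank_le c A" "corank_le c D"
    "\<forall>i<p. mat_app A k i = 0 \<Longrightarrow> l < q \<Longrightarrow> k l \<noteq> 0 \<Longrightarrow> \<exists>e. c = Suc e \<and> corank_le e D"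
proof -
  have M: "?M \<in> carrier_mat (p + p') (q + q')" using A D by auto
  from corank_leD[OF assms(3) M] obtain F where F: "finite F" "card F \<le> c"
    "\<And>x j. \<forall>i<p + p'. mat_app ?M x i = 0 \<Longrightarrow> \<forall>f\<in>F. (\<Sum>j<q + q'. f j * x j) = 0 \<Longrightarrow> j < q + q' \<Longrightarrow> x j = 0"
    by blast
  define z where "z x y = (\<lambda>j. if j < q then x j else y (j - q))" for x y :: "nat \<Rightarrow> complex"
  have zk: "\<forall>i<p + p'. mat_app ?M (z x y) i = 0"
    if "\<forall>i<p. mat_app A x i = 0" "\<forall>i<p'. mat_app D y i = 0" for x y
  proof -
    have "mat_app A (z x y) i = mat_app A x i" for i using A by (intro mat_app_cong) (auto simp: z_def)
    moreover have "mat_app D (\<lambda>j. z x y (q + j)) i = mat_app D y i" for i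
      by (intro mat_app_cong) (auto simp: z_def)
    ultimately show ?thesis unfolding mat_app_diag[OF A D] using that by simp
  qed
  have zs: "(\<Sum>j<q + q'. f j * z x y j) = (\<Sum>j<q. f j * x j) + (\<Sum>j<q'. f (q + j) * y j)" for f x y
    by (simp add: sum_lessThan_add z_def)
  have zF: "(\<forall>j<q. x j = 0) \<and> (\<forall>j<q'. y j = 0)"
    if "\<forall>i<p. mat_app A x i = 0" "\<forall>i<p'. mat_app D y i = 0"
      "\<forall>f\<in>F. (\<Sum>j<q. f j * x j) + (\<Sum>j<q'. f (q + j) * y j) = 0" for x y
  proof (intro conjI allI impI)
    have F0: "\<forall>f\<in>F. (\<Sum>j<q + q'. f j * z x y j) = 0" using that(3) by (simp add: zs)
    show "x j = 0" if "j < q" for j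
      using F(3)[OF zk F0, of j] that \<open>\<forall>i<p. mat_app A x i = 0\<close> \<open>\<forall>i<p'. mat_app D y i = 0\<close> by (simp add: z_def)
    show "y j = 0" if "j < q'" for j
      using F(3)[OF zk F0, of "q + j"] that \<open>\<forall>i<p. mat_app A x i = 0\<close> \<open>\<forall>i<p'. mat_app D y i = 0\<close> by (simp add: z_def)
  qed
  have A0: "\<forall>i<p. mat_app A (\<lambda>_. 0) i = 0" and D0: "\<forall>i<p'. mat_app D (\<lambda>_. 0) i = 0"
    by (simp_all add: mat_app_eq_0)
  show "corank_le c A"
  proof (rule corank_leI[OF A F(1,2)])
    fix x j assume x: "\<And>i. i < p \<Longrightarrow> mat_app A x i = 0" "\<And>f. f \<in> F \<Longrightarrow> (\<Sum>j<q. f j * x j) = 0"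
      and j: "j < q"
    have "\<forall>i<p. mat_app A x i = 0" "\<forall>f\<in>F. (\<Sum>j<q. f j * x j) + (\<Sum>j<q'. f (q + j) * 0) = 0"
      using x by simp_all
    from zF[OF this(1) D0 this(2)] j show "x j = 0" by blast
  qed
  let ?s = "\<lambda>f j. f (q + j)"
  have "card (?s ` F) \<le> c" using card_image_le[OF F(1), of ?s] F(2) by linarith
  then show "corank_le c D"
    proof (rule corank_leI[OF D finite_imageI[OF F(1)]])
    fix y j assume y: "\<And>i. i < p' \<Longrightarrow> mat_app D y i = 0" "\<And>f. f \<in> ?s ` F \<Longrightarrow> (\<Sum>j<q'. f j * y j) = 0"
      and j: "j < q'"
    have "\<forall>i<p'. mat_app D y i = 0" "\<forall>f\<in>F. (\<Sum>j<q. f j * 0) + (\<Sum>j<q'. f (q + j) * y j) = 0"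
      using y by simp_all
    from zF[OF A0 this] j show "y j = 0" by blast
  qed
  assume k: "\<forall>i<p. mat_app A k i = 0" and l: "l < q" "k l \<noteq> 0"
  have "\<exists>g\<in>F. (\<Sum>j<q. g j * k j) \<noteq> 0"
    proof (rule ccontr)
    assume "\<not> (\<exists>g\<in>F. (\<Sum>j<q. g j * k j) \<noteq> 0)"
    then have "\<forall>f\<in>F. (\<Sum>j<q. f j * k j) + (\<Sum>j<q'. f (q + j) * 0) = 0" by simp
    from zF[OF k D0 this] l show False by blast
  qed
  then obtain g where g: "g \<in> F" "(\<Sum>j<q. g j * k j) \<noteq> 0" by blast
  define s where "s f = (\<Sum>j<q. f j * k j)" for f
  \<comment> \<open>The multiple of \<open>g\<close> is chosen so that the difference vanishes on
    \<open>k\<close>; \<open>h f\<close> is its part on the second block.\<close>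
  define h where "h f = (\<lambda>j. f (q + j) - s f / s g * g (q + j))" for f
  define e where "e = c - 1"
  have c: "c = Suc e" using g F by (cases c) (auto simp: e_def)
  have "card (h ` (F - {g})) \<le> e"
    using card_image_le[of "F - {g}" h] F(1,2) g(1) c by (simp add: card_Diff_singleton)
  then have "corank_le e D"
  proof (rule corank_leI[OF D, rotated])
    fix y j assume y: "\<And>i. i < p' \<Longrightarrow> mat_app D y i = 0"
      "\<And>f. f \<in> h ` (F - {g}) \<Longrightarrow> (\<Sum>j<q'. f j * y j) = 0" and j: "j < q'"
    define t where "t f = (\<Sum>j<q'. f (q + j) * y j)" for f
    have h: "(\<Sum>j<q'. h f j * y j) = t f - s f / s g * t g" for f
      by (simp add: h_def t_def left_diff_distrib sum_subtractf sum_distrib_left mult.assoc)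
    \<comment> \<open>The multiple of \<open>k\<close> in the first block for which \<open>g\<close>
      vanishes on the joint vector.\<close>
    define x where "x = (\<lambda>j. - t g / s g * k j)"
    have sx: "(\<Sum>j<q. f j * x j) = - t g / s g * s f" for f
      unfolding s_def[of f] sum_distrib_left x_def by (intro sum.cong refl) (simp only: ac_simps)
    have Ax: "mat_app A x i = - t g / s g * mat_app A k i" for i
      proof -
      have d: "dim_col A = q" using A by simp
      show ?thesis unfolding mat_app_def sum_distrib_left x_def by (intro sum.cong refl) (simp only: ac_simps)
    qed
    have "(\<Sum>j<q. f j * x j) + (\<Sum>j<q'. f (q + j) * y j) = 0" if "f \<in> F" for f
    proof (cases "f = g")
      case True
      have "(\<Sum>j<q. g j * x j) + (\<Sum>j<q'. g (q + j) * y j) = - t g / s g * s g + t g"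
        by (simp only: sx t_def)
      then show ?thesis using g(2) True by (simp add: s_def)
    next
      case False
      then have eq: "t f = s f / s g * t g" using y(2)[of "h f"] that by (simp add: h)
      have "(\<Sum>j<q. f j * x j) + (\<Sum>j<q'. f (q + j) * y j) = - t g / s g * s f + t f"
        by (simp only: sx t_def)
      also have "\<dots> = 0" unfolding eq by (simp add: mult.commute)
      finally show ?thesis .
    qed
    then have Fz: "\<forall>f\<in>F. (\<Sum>j<q. f j * x j) + (\<Sum>j<q'. f (q + j) * y j) = 0" by blast
    have "\<forall>i<p. mat_app A x i = 0" "\<forall>i<p'. mat_app D y i = 0" using Ax k y(1) by simp_all
    from zF[OF this Fz] j show "y j = 0" by blast
  qed (use F in auto)
  with c show "\<exists>e. c = Suc e \<and> corank_le e D" by blast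
qed

section \<open>Orbit closures\<close>

definition close_pairs :: "nat \<Rightarrow> nat \<Rightarrow> real \<Rightarrow> mpair \<Rightarrow> mpair \<Rightarrow> bool" where
  "close_pairs p q d X Z \<longleftrightarrow> (\<forall>i<p. \<forall>j<q.
     cmod (fst Z $$ (i, j) - fst X $$ (i, j)) < d \<and> cmod (snd Z $$ (i, j) - snd X $$ (i, j)) < d)"

text \<open>The relation \<open>orbit_le\<close> for representatives, with the topology spelled out:
  \<open>X\<close> is the degenerate pair, and the orbit of \<open>Y\<close> approximates
  it.\<close>

definition degenerates_from :: "mpair \<Rightarrow> mpair \<Rightarrow> bool" where
  "degenerates_from X Y \<longleftrightarrow> (\<exists>p q. X \<in> matrix_pairs p q \<and> Y \<in> matrix_pairs p q \<and>
     (\<forall>d>0. \<exists>Z. pair_equiv Y Z \<and> close_pairs p q d X Z))"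

text \<open>As there are finitely many entries, the boxes of balls with a common radius form a
  neighbourhood base of the pulled back product topology.\<close>

lemma in_closure_of_iff_close:
  "X \<in> matrix_pair_topology p q closure_of V \<longleftrightarrow>
    X \<in> matrix_pairs p q \<and> (\<forall>d>0. \<exists>Z\<in>V. Z \<in> matrix_pairs p q \<and> close_pairs p q d X Z)"
    (is "?L \<longleftrightarrow> ?R")
proof
  define I where "I = {..<p} \<times> {..<q}"
  define g where "g = (\<lambda>X :: mpair. \<lambda>ij. (fst X $$ ij, snd X $$ ij))"
  define f where "f = (\<lambda>X :: mpair. \<lambda>ij\<in>I. g X ij)"
  have f: "(\<lambda>(A, B). \<lambda>ij\<in>I. (A $$ ij, B $$ ij)) = f" by (auto simp: f_def g_def fun_eq_iff)
  let ?T = "product_topology (\<lambda>_. euclidean :: (complex \<times> complex) topology) I"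
  have topo: "openin (matrix_pair_topology p q) S \<longleftrightarrow> (\<exists>U. openin ?T U \<and> S = f -` U \<inter> matrix_pairs p q)" for S
    unfolding matrix_pair_topology_def openin_pullback_topology f[symmetric] I_def ..
  have space: "topspace (matrix_pair_topology p q) = matrix_pairs p q"
    unfolding matrix_pair_topology_def topspace_pullback_topology I_def[symmetric] f
    by (auto simp: f_def)
  {
    assume L: ?L
    then have X: "X \<in> matrix_pairs p q" using space by (auto simp: in_closure_of)
    moreover have "\<exists>Z\<in>V. Z \<in> matrix_pairs p q \<and> close_pairs p q d X Z" if d: "d > 0" for d
    proof -
      define U where "U = PiE I (\<lambda>ij. ball (g X ij) d)"
      have "openin ?T U" unfolding U_def by (subst openin_PiE_gen) (auto simp: I_def)
      then have "openin (matrix_pair_topology p q) (f -` U \<inter> matrix_pairs p q)" using topo by blast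
      moreover have "X \<in> f -` U \<inter> matrix_pairs p q" using X d by (auto simp: U_def f_def)
      ultimately have "\<exists>Z. Z \<in> V \<and> Z \<in> f -` U \<inter> matrix_pairs p q"
        using L[unfolded in_closure_of, THEN conjunct2, rule_format, of "f -` U \<inter> matrix_pairs p q"] by simp
      then obtain Z where Z: "Z \<in> V" "f Z \<in> U" "Z \<in> matrix_pairs p q" by auto
      have "close_pairs p q d X Z" unfolding close_pairs_def
      proof (intro allI impI)
        fix i j assume "i < p" "j < q"
        then have ij: "(i, j) \<in> I" by (simp add: I_def)
        then have "g Z (i, j) \<in> ball (g X (i, j)) d" using Z(2) by (auto simp: U_def f_def dest: PiE_mem)
        then have "dist (g Z (i, j)) (g X (i, j)) < d" by (simp add: dist_commute)
        then show "cmod (fst Z $$ (i, j) - fst X $$ (i, j)) < d \<and> cmod (snd Z $$ (i, j) - snd X $$ (i, j)) < d"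
          using dist_fst_le[of "g Z (i, j)" "g X (i, j)"] dist_snd_le[of "g Z (i, j)" "g X (i, j)"]
          by (simp add: g_def dist_norm)
      qed
      with Z show ?thesis by blast
    qed
    ultimately show ?R by blast
  }
  {
    assume R: ?R
    show ?L unfolding in_closure_of space
    proof (intro conjI allI impI)
      fix T assume "X \<in> T \<and> openin (matrix_pair_topology p q) T"
      then obtain U where U: "openin ?T U" "T = f -` U \<inter> matrix_pairs p q" "f X \<in> U" using topo by auto
      have "\<exists>W. finite {i \<in> I. W i \<noteq> topspace euclidean} \<and>
          (\<forall>i\<in>I. openin euclidean (W i)) \<and> f X \<in> PiE I W \<and> PiE I W \<subseteq> U"
        using U(1)[unfolded openin_product_topology_alt, rule_format, OF U(3)] by blast
      then obtain W where W: "\<And>i. i \<in> I \<Longrightarrow> open (W i)" "f X \<in> PiE I W" "PiE I W \<subseteq> U"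
        by (metis open_openin)
      have "\<exists>e. \<forall>ij\<in>I. e ij > 0 \<and> ball (g X ij) (e ij) \<subseteq> W ij"
      proof (rule bchoice, rule ballI)
        fix ij assume ij: "ij \<in> I"
        then have "g X ij \<in> W ij" using W(2) by (auto simp: f_def dest: PiE_mem)
        then show "\<exists>e>0. ball (g X ij) e \<subseteq> W ij" using W(1)[OF ij] open_contains_ball by blast
      qed
      then obtain e where e: "\<And>ij. ij \<in> I \<Longrightarrow> e ij > 0" "\<And>ij. ij \<in> I \<Longrightarrow> ball (g X ij) (e ij) \<subseteq> W ij" by blast
      \<comment> \<open>The 1 covers an empty set of entries; the factor 1/2 allows for the two
        components, whose distances add up.\<close>
      define d where "d = Min (insert 1 (e ` I)) / 2"
      have fin: "finite I" by (simp add: I_def)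
      have d: "d > 0" using e(1) fin by (auto simp: d_def)
      have de: "2 * d \<le> e ij" if "ij \<in> I" for ij using that fin by (auto simp: d_def)
      from R d obtain Z where Z: "Z \<in> V" "Z \<in> matrix_pairs p q" "close_pairs p q d X Z" by blast
      have "f Z \<in> PiE I W"
      proof (rule PiE_I)
        fix ij assume ij: "ij \<in> I"
        obtain i j where [simp]: "ij = (i, j)" by (cases ij)
        have lt: "i < p" "j < q" using ij by (auto simp: I_def)
        have "dist (g Z ij) (g X ij) \<le> cmod (fst Z $$ ij - fst X $$ ij) + cmod (snd Z $$ ij - snd X $$ ij)"
          unfolding dist_norm g_def minus_prod_def fst_conv snd_conv by (rule norm_Pair_le)
        also have "\<dots> < 2 * d" using Z(3) lt unfolding close_pairs_def by (auto intro: add_strict_mono[where b = d and d = d, simplified])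
        finally have "g Z ij \<in> ball (g X ij) (e ij)" using de[OF ij] by (simp add: dist_commute)
        then show "f Z ij \<in> W ij" using e(2)[OF ij] ij by (auto simp: f_def)
      qed (auto simp: f_def)
      then show "\<exists>y. y \<in> V \<and> y \<in> T" using Z W(3) U(2) by blast
    qed (use R in blast)
  }
qed

text \<open>Continuity of the multiplication by fixed \<open>S\<close> and \<open>R\<close>; an
  entry of the product changes by at most \<open>C\<close> times the largest change of an
  entry.\<close>

lemma close_pairs_mult:
  assumes X: "X \<in> matrix_pairs p q" and S: "S \<in> carrier_mat p p" and R: "R \<in> carrier_mat q q" and "d > 0"
  shows "\<exists>e>0. \<forall>Z\<in>matrix_pairs p q. close_pairs p q e X Z \<longrightarrow>
    close_pairs p q d (S * fst X * R, S * snd X * R) (S * fst Z * R, S * snd Z * R)"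
proof -
  define C where "C = (\<Sum>i<p. \<Sum>k<p. cmod (S $$ (i, k))) * (\<Sum>l<q. \<Sum>j<q. cmod (R $$ (l, j)))"
  have C: "C \<ge> 0" unfolding C_def by (intro mult_nonneg_nonneg sum_nonneg norm_ge_zero)
  define e where "e = d / (C + 1)"
  have e: "e > 0" "C * e < d" using C \<open>d > 0\<close> by (auto simp: e_def field_simps)
  have entry: "cmod ((S * B * R) $$ (i, j) - (S * A * R) $$ (i, j)) < d"
    if A: "A \<in> carrier_mat p q" and B: "B \<in> carrier_mat p q" and ij: "i < p" "j < q"
      and AB: "\<And>k l. k < p \<Longrightarrow> l < q \<Longrightarrow> cmod (B $$ (k, l) - A $$ (k, l)) < e" for A B i j
  proof -
    have SAR: "(S * A * R) $$ (i, j) = (\<Sum>l<q. \<Sum>k<p. S $$ (i, k) * A $$ (k, l) * R $$ (l, j))"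
      if A: "A \<in> carrier_mat p q" for A
    proof -
      have "(S * A * R) $$ (i, j) = (\<Sum>l<q. (S * A) $$ (i, l) * R $$ (l, j))"
        by (rule mult_mat_entry[OF _ R ij]) (use S A in auto)
      also have "\<dots> = (\<Sum>l<q. (\<Sum>k<p. S $$ (i, k) * A $$ (k, l)) * R $$ (l, j))"
        using mult_mat_entry[OF S A ij(1)] by (intro sum.cong) auto
      finally show ?thesis by (simp add: sum_distrib_right)
    qed
    have "(S * B * R) $$ (i, j) - (S * A * R) $$ (i, j)
        = (\<Sum>l<q. \<Sum>k<p. S $$ (i, k) * (B $$ (k, l) - A $$ (k, l)) * R $$ (l, j))"
      unfolding SAR[OF A] SAR[OF B] by (simp add: sum_subtractf[symmetric] algebra_simps)
    also have "cmod \<dots> \<le> (\<Sum>l<q. \<Sum>k<p. cmod (S $$ (i, k)) * e * cmod (R $$ (l, j)))"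
    proof (intro order_trans[OF norm_sum] sum_mono)
      fix l k assume lk: "l \<in> {..<q}" "k \<in> {..<p}"
      then have "cmod (B $$ (k, l) - A $$ (k, l)) \<le> e" using AB less_imp_le by auto
      then show "cmod (S $$ (i, k) * (B $$ (k, l) - A $$ (k, l)) * R $$ (l, j))
          \<le> cmod (S $$ (i, k)) * e * cmod (R $$ (l, j))"
        by (simp add: norm_mult mult_left_mono mult_right_mono)
    qed
    also have "\<dots> = (\<Sum>k<p. cmod (S $$ (i, k))) * (\<Sum>l<q. cmod (R $$ (l, j))) * e"
      by (simp add: sum_distrib_left sum_distrib_right mult_ac) (rule sum.swap)
    also have "\<dots> \<le> C * e"
    proof (intro mult_right_mono)
      have "(\<Sum>k<p. cmod (S $$ (i, k))) \<le> (\<Sum>i<p. \<Sum>k<p. cmod (S $$ (i, k)))"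
        using ij by (intro member_le_sum[of i "{..<p}" "\<lambda>i. \<Sum>k<p. cmod (S $$ (i, k))"]) (auto intro: sum_nonneg)
      moreover have "(\<Sum>l<q. cmod (R $$ (l, j))) \<le> (\<Sum>l<q. \<Sum>j<q. cmod (R $$ (l, j)))"
        using ij by (intro sum_mono member_le_sum[of j "{..<q}" "\<lambda>j. cmod (R $$ (_, j))"]) auto
      ultimately show "(\<Sum>k<p. cmod (S $$ (i, k))) * (\<Sum>l<q. cmod (R $$ (l, j))) \<le> C"
        unfolding C_def by (intro mult_mono sum_nonneg norm_ge_zero)
    qed (use e in auto)
    finally show ?thesis using e by simp
  qed
  show ?thesis
  proof (intro exI[of _ e] conjI ballI impI e(1))
    fix Z assume Z: "Z \<in> matrix_pairs p q" and cl: "close_pairs p q e X Z"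
    show "close_pairs p q d (S * fst X * R, S * snd X * R) (S * fst Z * R, S * snd Z * R)"
      unfolding close_pairs_def fst_conv snd_conv
    proof (intro allI impI conjI)
      fix i j assume ij: "i < p" "j < q"
      show "cmod ((S * fst Z * R) $$ (i, j) - (S * fst X * R) $$ (i, j)) < d"
        using X Z cl by (intro entry[OF _ _ ij]) (auto simp: matrix_pairs_iff close_pairs_def)
      show "cmod ((S * snd Z * R) $$ (i, j) - (S * snd X * R) $$ (i, j)) < d"
        using X Z cl by (intro entry[OF _ _ ij]) (auto simp: matrix_pairs_iff close_pairs_def)
    qed
  qed
qed

lemma degenerates_fromD:
  assumes "degenerates_from X Y" "X \<in> matrix_pairs p q"
  shows "Y \<in> matrix_pairs p q" "\<forall>d>0. \<exists>Z. pair_equiv Y Z \<and> close_pairs p q d X Z"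
proof -
  from assms(1) obtain p' q' where *: "X \<in> matrix_pairs p' q'" "Y \<in> matrix_pairs p' q'"
    "\<forall>d>0. \<exists>Z. pair_equiv Y Z \<and> close_pairs p' q' d X Z" unfolding degenerates_from_def by blast
  have "p' = p" "q' = q" using matrix_pairs_unique[OF assms(2)] *(1) by auto
  with * show "Y \<in> matrix_pairs p q" "\<forall>d>0. \<exists>Z. pair_equiv Y Z \<and> close_pairs p q d X Z" by auto
qed

text \<open>Equivalences act continuously: approximations of \<open>X\<close> from the orbit of
  \<open>Y\<close> are carried to approximations of \<open>X'\<close> from the same orbit.\<close>

lemma degenerates_from_equiv:
  assumes "degenerates_from X Y" "pair_equiv X X'" "pair_equiv Y Y'"
  shows "degenerates_from X' Y'"
proof -
  from assms(2) obtain p q S S' R R' where e: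
    "X \<in> matrix_pairs p q" "X' \<in> matrix_pairs p q"
    "S \<in> carrier_mat p p" "S' \<in> carrier_mat p p" "S * S' = 1\<^sub>m p" "S' * S = 1\<^sub>m p"
    "R \<in> carrier_mat q q" "R' \<in> carrier_mat q q" "R * R' = 1\<^sub>m q" "R' * R = 1\<^sub>m q"
    "fst X' = S * fst X * R" "snd X' = S * snd X * R"
    by (elim pair_equiv_elim)
  have Y: "Y \<in> matrix_pairs p q"
    and near: "\<And>d. d > 0 \<Longrightarrow> \<exists>Z. pair_equiv Y Z \<and> close_pairs p q d X Z"
    using degenerates_fromD[OF assms(1) e(1)] by auto
  have "\<exists>Z. pair_equiv Y' Z \<and> close_pairs p q d X' Z" if "d > 0" for d
  proof -
    from close_pairs_mult[OF e(1,3,7) that] obtain d' where d': "d' > 0"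
      "\<And>Z. Z \<in> matrix_pairs p q \<Longrightarrow> close_pairs p q d' X Z \<Longrightarrow>
        close_pairs p q d (S * fst X * R, S * snd X * R) (S * fst Z * R, S * snd Z * R)" by blast
    from near[OF d'(1)] obtain Z where Z: "pair_equiv Y Z" "close_pairs p q d' X Z" by blast
    have Zc: "Z \<in> matrix_pairs p q" using Z(1) Y pair_equiv_matrix_pairs by blast
    have "pair_equiv Z (S * fst Z * R, S * snd Z * R)"
      by (rule pair_equiv_intro[OF Zc e(3,4,5,7,8,9)]) auto
    then have "pair_equiv Y' (S * fst Z * R, S * snd Z * R)"
      using Z(1) assms(3) pair_equiv_sym pair_equiv_trans by blast
    moreover have "X' = (S * fst X * R, S * snd X * R)" using e(11,12) by (simp add: prod_eq_iff)
    ultimately show ?thesis using d'(2)[OF Zc Z(2)] by blast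
  qed
  moreover have "Y' \<in> matrix_pairs p q" using Y assms(3) pair_equiv_matrix_pairs by blast
  ultimately show ?thesis unfolding degenerates_from_def using e(2) by blast
qed

text \<open>The closure of an orbit is invariant under equivalence, so it contains the whole orbit
  of \<open>X\<close> as soon as it contains \<open>X\<close>.\<close>

lemma orbit_le_iff_degenerates_from:
  assumes "is_matrix_pair X" "is_matrix_pair Y"
  shows "orbit_le (pair_orbit X) (pair_orbit Y) \<longleftrightarrow> degenerates_from X Y"
proof
  assume "orbit_le (pair_orbit X) (pair_orbit Y)"
  then obtain p q where sub: "pair_orbit X \<subseteq> matrix_pair_topology p q closure_of (pair_orbit Y)"
    unfolding orbit_le_def by blast
  have "X \<in> pair_orbit X"
    using assms(1) pair_equiv_refl unfolding pair_orbit_def is_matrix_pair_def by blast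
  then have "X \<in> matrix_pair_topology p q closure_of (pair_orbit Y)" using sub by blast
  then have X: "X \<in> matrix_pairs p q"
    and "\<forall>d>0. \<exists>Z\<in>pair_orbit Y. Z \<in> matrix_pairs p q \<and> close_pairs p q d X Z"
    unfolding in_closure_of_iff_close by auto
  then have near: "\<And>d. d > 0 \<Longrightarrow> \<exists>Z. pair_equiv Y Z \<and> Z \<in> matrix_pairs p q \<and> close_pairs p q d X Z"
    unfolding pair_orbit_def by auto
  obtain Z where "pair_equiv Y Z" "Z \<in> matrix_pairs p q" using near[of 1, simplified] by blast
  then have "Y \<in> matrix_pairs p q" using pair_equiv_matrix_pairs[of Y Z] by blast
  with X near show "degenerates_from X Y" unfolding degenerates_from_def by blast
next
  assume deg: "degenerates_from X Y"
  then obtain p q where X: "X \<in> matrix_pairs p q" and Y: "Y \<in> matrix_pairs p q" unfolding degenerates_from_def by blast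
  have "pair_orbit X \<subseteq> matrix_pair_topology p q closure_of (pair_orbit Y)"
  proof
    fix X' assume "X' \<in> pair_orbit X"
    then have eq: "pair_equiv X X'" by (simp add: pair_orbit_def)
    have X': "X' \<in> matrix_pairs p q" using eq X pair_equiv_matrix_pairs by blast
    have "degenerates_from X' Y" using degenerates_from_equiv[OF deg eq pair_equiv_refl[OF Y]] .
    then have "\<forall>d>0. \<exists>Z. pair_equiv Y Z \<and> close_pairs p q d X' Z"
      using X' by (rule degenerates_fromD)
    then show "X' \<in> matrix_pair_topology p q closure_of (pair_orbit Y)"
      unfolding in_closure_of_iff_close pair_orbit_def using X' Y pair_equiv_matrix_pairs[of Y] by blast
  qed
  then show "orbit_le (pair_orbit X) (pair_orbit Y)" unfolding orbit_le_def by blast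
qed

lemma degenerates_from_refl:
  assumes "X \<in> matrix_pairs p q" shows "degenerates_from X X"
  unfolding degenerates_from_def
  using assms pair_equiv_refl[OF assms]
  by (intro exI[of _ p] exI[of _ q] conjI allI impI exI[of _ X]) (auto simp: close_pairs_def)

lemma degenerates_from_transpose:
  assumes "degenerates_from X Y" shows "degenerates_from (transpose_pair X) (transpose_pair Y)"
proof -
  from assms obtain p q where X: "X \<in> matrix_pairs p q" and Y: "Y \<in> matrix_pairs p q"
    and near: "\<And>d. d > 0 \<Longrightarrow> \<exists>Z. pair_equiv Y Z \<and> close_pairs p q d X Z" unfolding degenerates_from_def by blast
  have "\<exists>Z. pair_equiv (transpose_pair Y) Z \<and> close_pairs q p d (transpose_pair X) Z" if "d > 0" for d
  proof -
    from near[OF that] obtain Z where Z: "pair_equiv Y Z" "close_pairs p q d X Z" by blast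
    then have "Z \<in> matrix_pairs p q" using Y pair_equiv_matrix_pairs by blast
    then show ?thesis using X Z pair_equiv_transpose[OF Z(1)]
      by (intro exI[of _ "transpose_pair Z"]) (auto simp: close_pairs_def matrix_pairs_iff)
  qed
  then show ?thesis unfolding degenerates_from_def using X Y by (intro exI[of _ q] exI[of _ p]) simp
qed

lemma degenerates_from_swap:
  assumes "degenerates_from X Y" shows "degenerates_from (prod.swap X) (prod.swap Y)"
proof -
  from assms obtain p q where X: "X \<in> matrix_pairs p q" and Y: "Y \<in> matrix_pairs p q"
    and near: "\<And>d. d > 0 \<Longrightarrow> \<exists>Z. pair_equiv Y Z \<and> close_pairs p q d X Z" unfolding degenerates_from_def by blast
  have "\<exists>Z. pair_equiv (prod.swap Y) Z \<and> close_pairs p q d (prod.swap X) Z" if "d > 0" for d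
  proof -
    from near[OF that] obtain Z where Z: "pair_equiv Y Z" "close_pairs p q d X Z" by blast
    then show ?thesis using pair_equiv_swap[OF Z(1)]
      by (intro exI[of _ "prod.swap Z"]) (auto simp: close_pairs_def)
  qed
  then show ?thesis unfolding degenerates_from_def using X Y by (intro exI[of _ p] exI[of _ q]) simp
qed

text \<open>If \<open>X\<close> had no null vector of degree at most \<open>d\<close>, its Toeplitz
  system would be injective, and so would be that of a nearby pair equivalent to
  \<open>Y\<close>.\<close>

lemma has_null_semicontinuous:
  assumes deg: "degenerates_from X Y" and null: "has_null Y d" shows "has_null X d"
proof (rule ccontr)
  assume no: "\<not> has_null X d"
  from deg obtain p q where X: "X \<in> matrix_pairs p q" and Y: "Y \<in> matrix_pairs p q"
    and near: "\<And>d. d > 0 \<Longrightarrow> \<exists>Z. pair_equiv Y Z \<and> close_pairs p q d X Z" unfolding degenerates_from_def by blast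
  let ?I = "{..<d + 2} \<times> {..<p}" and ?J = "{..<d + 1} \<times> {..<q}"
  have "injective_system ?I ?J (toeplitz X)" using no has_null_iff_toeplitz[OF X] by blast
  from injective_system_open[OF _ _ this] obtain e where e: "e > 0"
    "\<And>b. \<forall>i\<in>?I. \<forall>j\<in>?J. cmod (b i j - toeplitz X i j) < e \<Longrightarrow> injective_system ?I ?J b" by auto
  from near[OF e(1)] obtain Z where Z: "pair_equiv Y Z" "close_pairs p q e X Z" by blast
  have "\<forall>i\<in>?I. \<forall>j\<in>?J. cmod (toeplitz Z i j - toeplitz X i j) < e"
    using Z(2) e(1) by (auto simp: toeplitz_def close_pairs_def norm_minus_commute)
  then have "injective_system ?I ?J (toeplitz Z)" by (rule e(2))
  moreover have "Z \<in> matrix_pairs p q" using Z(1) Y pair_equiv_matrix_pairs by blast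
  ultimately have "\<not> has_null Z d" using has_null_iff_toeplitz by blast
  then show False using has_null_equiv[OF Z(1) null] by blast
qed

text \<open>The functionals that bound the corank at \<open>X\<close> are kept fixed while the
  pencil varies; they still trivialize the kernel at a nearby pair.\<close>

lemma corank_le_semicontinuous:
  assumes deg: "degenerates_from X Y" and cor: "corank_le c (pencil_at a b X)"
  shows "corank_le c (pencil_at a b Y)"
proof -
  from deg obtain p q where X: "X \<in> matrix_pairs p q" and Y: "Y \<in> matrix_pairs p q"
    and near: "\<And>d. d > 0 \<Longrightarrow> \<exists>Z. pair_equiv Y Z \<and> close_pairs p q d X Z" unfolding degenerates_from_def by blast
  from corank_leD[OF cor pencil_at_carrier[OF X]] obtain F where F: "finite F" "card F \<le> c"
    "\<And>x j. \<forall>i<p. mat_app (pencil_at a b X) x i = 0 \<Longrightarrow> \<forall>f\<in>F. (\<Sum>j<q. f j * x j) = 0 \<Longrightarrow> j < q \<Longrightarrow> x j = 0"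
    by blast
  define u where "u Z i j = (case i of Inl i \<Rightarrow> pencil_at a b Z $$ (i, j) | Inr f \<Rightarrow> f j)"
    for Z and i :: "nat + (nat \<Rightarrow> complex)" and j :: nat
  let ?I = "Inl ` {..<p} \<union> Inr ` F"
  have sys: "injective_system ?I {..<q} (u Z) \<longleftrightarrow>
     (\<forall>x. (\<forall>i<p. mat_app (pencil_at a b Z) x i = 0) \<and> (\<forall>f\<in>F. (\<Sum>j<q. f j * x j) = 0) \<longrightarrow> (\<forall>j<q. x j = 0))"
    if "Z \<in> matrix_pairs p q" for Z
    using pencil_at_carrier[OF that, of a b] unfolding injective_system_def
    by (auto simp: ball_Un u_def mat_app_def)
  have "injective_system ?I {..<q} (u X)" using F(3) unfolding sys[OF X] by blast
  from injective_system_open[OF _ _ this] F(1) obtain e where e: "e > 0"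
    "\<And>b. \<forall>i\<in>?I. \<forall>j\<in>{..<q}. cmod (b i j - u X i j) < e \<Longrightarrow> injective_system ?I {..<q} b" by auto
  \<comment> \<open>An entry of \<open>a A + b B\<close> moves by at most
    \<open>(cmod a + cmod b) * d\<close>; the summand 1 avoids a zero denominator.\<close>
  define d where "d = e / (cmod a + cmod b + 1)"
  have d: "d > 0" "(cmod a + cmod b) * d < e" using e(1)
    by (auto simp: d_def field_simps add_pos_nonneg intro!: divide_pos_pos add_nonneg_pos)
  from near[OF d(1)] obtain Z where Z: "pair_equiv Y Z" "close_pairs p q d X Z" by blast
  have Zc: "Z \<in> matrix_pairs p q" using Z(1) Y pair_equiv_matrix_pairs by blast
  have "cmod (pencil_at a b Z $$ (i, j) - pencil_at a b X $$ (i, j)) < e" if ij: "i < p" "j < q" for i j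
  proof -
    have "pencil_at a b Z $$ (i, j) - pencil_at a b X $$ (i, j)
      = a * (fst Z $$ (i, j) - fst X $$ (i, j)) + b * (snd Z $$ (i, j) - snd X $$ (i, j))"
      using X Zc ij by (auto simp: pencil_at_def matrix_pairs_iff algebra_simps)
    also have "cmod \<dots> \<le> cmod a * d + cmod b * d"
      using Z(2) ij unfolding close_pairs_def
      by (intro order_trans[OF norm_triangle_ineq] add_mono) (simp_all add: norm_mult mult_left_mono less_imp_le)
    finally show ?thesis using d(2) by (simp add: algebra_simps)
  qed
  then have "\<forall>i\<in>?I. \<forall>j\<in>{..<q}. cmod (u Z i j - u X i j) < e" using e(1) by (auto simp: u_def)
  then have "injective_system ?I {..<q} (u Z)" by (rule e(2))
  then have "corank_le c (pencil_at a b Z)"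
    unfolding sys[OF Zc] by (intro corank_leI[OF pencil_at_carrier[OF Zc] F(1,2)]) blast
  then show ?thesis using corank_le_equiv[OF pair_equiv_sym[OF Z(1)]] by blast
qed

section \<open>Coranks of the Kronecker pairs\<close>

text \<open>Every member of the pencil of a \<open>kron_D\<close> pair has this form, and \<alpha>
  vanishes exactly at its eigenvalue.\<close>

definition bidiagonal :: "nat \<Rightarrow> complex \<Rightarrow> complex \<Rightarrow> complex mat" where
  "bidiagonal n \<alpha> \<beta> = mat n n (\<lambda>(i, j). if i = j then \<alpha> else if Suc i = j then \<beta> else 0)"

lemma bidiagonal_carrier [simp]: "bidiagonal n \<alpha> \<beta> \<in> carrier_mat n n"
  by (simp add: bidiagonal_def)

lemma mat_app_bidiagonal:
  assumes "i < n"
  shows "mat_app (bidiagonal n \<alpha> \<beta>) x i = \<alpha> * x i + (if Suc i < n then \<beta> * x (Suc i) else 0)"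
proof -
  have "mat_app (bidiagonal n \<alpha> \<beta>) x i =
      (\<Sum>j<n. (if j = i then \<alpha> * x i else 0) + (if j = Suc i then \<beta> * x (Suc i) else 0))"
    unfolding mat_app_def using assms by (intro sum.cong) (auto simp: bidiagonal_def)
  then show ?thesis using assms by (simp add: sum.distrib)
qed

lemma corank_le_mono: "corank_le c M \<Longrightarrow> c \<le> c' \<Longrightarrow> corank_le c' M"
  unfolding corank_le_def
  by (erule ex_forward, elim conjE, intro conjI, assumption, rule order_trans, assumption+)

lemma corank_le_0_bidiagonal:
  assumes "\<alpha> \<noteq> 0" shows "corank_le 0 (bidiagonal n \<alpha> \<beta>)"
proof (rule corank_le_0I[OF bidiagonal_carrier])
  fix x j assume x: "\<And>i. i < n \<Longrightarrow> mat_app (bidiagonal n \<alpha> \<beta>) x i = 0" and j: "j < n"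
  \<comment> \<open>Back substitution; \<open>t\<close> counts the coordinates from the last
    one.\<close>
  have "t < n \<Longrightarrow> x (n - Suc t) = 0" for t
  proof (induction t)
    case 0
    then show ?case using x[of "n - 1"] assms by (simp add: mat_app_bidiagonal)
  next
    case (Suc t)
    have "Suc (n - Suc (Suc t)) = n - Suc t" using Suc.prems by simp
    then show ?case using x[of "n - Suc (Suc t)"] Suc assms by (simp add: mat_app_bidiagonal)
  qed
  from this[of "n - Suc j"] j show "x j = 0" by simp
qed

lemma sum_single:
  fixes x :: "nat \<Rightarrow> 'a :: semiring_1"
  assumes "k < n" shows "(\<Sum>j<n. (if j = k then 1 else 0) * x j) = x k"
proof -
  have "(\<Sum>j<n. (if j = k then 1 else 0) * x j) = (\<Sum>j<n. if j = k then x j else 0)"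
    by (intro sum.cong) auto
  with assms show ?thesis by simp
qed

text \<open>For \<alpha> = 0 the rows annihilate all coordinates but the first, which the single
  functional takes care of.\<close>

lemma corank_le_1_bidiagonal:
  assumes "\<alpha> \<noteq> 0 \<or> \<beta> \<noteq> 0" shows "corank_le 1 (bidiagonal n \<alpha> \<beta>)"
proof (cases "\<alpha> = 0")
  case False
  then show ?thesis using corank_le_mono[OF corank_le_0_bidiagonal] by simp
next
  case True
  show ?thesis
  proof (rule corank_leI[OF bidiagonal_carrier, of "{\<lambda>j. if j = 0 then 1 else 0}"])
    fix x j assume x: "\<And>i. i < n \<Longrightarrow> mat_app (bidiagonal n \<alpha> \<beta>) x i = 0"
      "\<And>f. f \<in> {\<lambda>j. if j = 0 then 1 else 0} \<Longrightarrow> (\<Sum>j<n. f j * x j) = 0" and j: "j < n"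
    show "x j = 0"
    proof (cases j)
      case 0
      then show ?thesis using x(2)[OF singletonI] j by (simp add: sum_single[of 0 n x])
    next
      case (Suc i)
      then show ?thesis using x(1)[of i] j True assms by (simp add: mat_app_bidiagonal)
    qed
  qed auto
qed

lemma bidiagonal_kernel: "i < n \<Longrightarrow> mat_app (bidiagonal n 0 \<beta>) (\<lambda>j. if j = 0 then 1 else 0) i = 0"
  by (simp add: mat_app_bidiagonal)

lemma kron_D_carrier [simp]: "kron_D n \<mu> \<in> matrix_pairs n n"
  by (cases \<mu>) (auto simp: matrix_pairs_iff)

declare kron_D.simps [simp del]

lemma pencil_at_kron_D:
  "pencil_at a b (kron_D n (Fin z)) = bidiagonal n (a + b * z) b"
  "pencil_at a b (kron_D n Infty) = bidiagonal n b a"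
  by (auto intro!: eq_matI simp: pencil_at_def bidiagonal_def kron_D.simps)

lemma kron_D_0 [simp]: "kron_D 0 \<mu> = (0\<^sub>m 0 0, 0\<^sub>m 0 0)"
  by (cases \<mu>) (auto intro!: eq_matI simp: kron_D.simps)

text \<open>The point at which the pencil of \<open>kron_D n \<mu>\<close> is singular:
  \<open>z I - J\<close> for a finite eigenvalue, the first component for infinity.\<close>

fun eigen_point :: "ext_complex \<Rightarrow> complex \<times> complex" where
  "eigen_point (Fin z) = (z, - 1)"
| "eigen_point Infty = (1, 0)"

lemma kron_D_kernel:
  assumes "eigen_point \<mu> = (a, b)" "i < n"
  shows "mat_app (pencil_at a b (kron_D n \<mu>)) (\<lambda>j. if j = 0 then 1 else 0) i = 0"
  using assms by (cases \<mu>) (auto simp: pencil_at_kron_D bidiagonal_kernel)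

lemma corank_le_1_kron_D:
  assumes "a \<noteq> 0 \<or> b \<noteq> 0" shows "corank_le 1 (pencil_at a b (kron_D n \<mu>))"
  using assms unfolding One_nat_def[symmetric]
  by (cases \<mu>) (auto simp: pencil_at_kron_D simp del: One_nat_def intro!: corank_le_1_bidiagonal)

lemma kron_LT_eq: "kron_LT n = transpose_pair (kron_L n)"
  by (simp add: kron_LT_def kron_L_def transpose_pair_def)

lemma kron_LT_carrier [simp]: "kron_LT n \<in> matrix_pairs n (n - 1)"
  unfolding kron_LT_eq transpose_pair_carrier by (rule kron_L_carrier)

lemma mat_app_kron_LT:
  assumes "i < n"
  shows "mat_app (pencil_at a b (kron_LT n)) x i =
      (if i < n - 1 then a * x i else 0) + (if 0 < i then b * x (i - 1) else 0)"
proof -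
  have "mat_app (pencil_at a b (kron_LT n)) x i =
      (\<Sum>j<n - 1. (if j = i then a * x i else 0) + (if j = i - 1 \<and> 0 < i then b * x (i - 1) else 0))"
    unfolding mat_app_def using assms
    by (intro sum.cong) (auto simp: pencil_at_def kron_LT_def L_mat_def R_mat_def algebra_simps)
  also have "\<dots> = (if i < n - 1 then a * x i else 0) + (\<Sum>j<n - 1. if j = i - 1 \<and> 0 < i then b * x (i - 1) else 0)"
    by (simp add: sum.distrib)
  also have "(\<Sum>j<n - 1. if j = i - 1 \<and> 0 < i then b * x (i - 1) else 0) = (if 0 < i then b * x (i - 1) else 0)"
    using assms by (cases i) auto
  finally show ?thesis .
qed

lemma corank_le_0_kron_LT:
  assumes ab: "a \<noteq> 0 \<or> b \<noteq> 0" shows "corank_le 0 (pencil_at a b (kron_LT n))"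
proof (rule corank_le_0I[OF pencil_at_carrier[OF kron_LT_carrier]])
  fix x j assume x: "\<And>i. i < n \<Longrightarrow> mat_app (pencil_at a b (kron_LT n)) x i = 0" and j: "j < n - 1"
  note app = mat_app_kron_LT[of _ n a b x]
  show "x j = 0"
  \<comment> \<open>For \<open>a = 0\<close> row \<open>j + 1\<close> contains only
    \<open>b * x j\<close>; otherwise the coordinates vanish one after the other from the first row
    on.\<close>
  proof (cases "a = 0")
    case True
    have "Suc j < n" using j by simp
    then show ?thesis using x[of "Suc j"] app[of "Suc j"] True ab by (simp split: if_splits)
  next
    case False
    show ?thesis using j
    proof (induction j)
      case 0
      then show ?case using x[of 0] app[of 0] False by simp
    next
      case (Suc j)
      then show ?case using x[of "Suc j"] app[of "Suc j"] False by simp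
    qed
  qed
qed

lemma mat_app_kron_L:
  assumes "i < n - 1"
  shows "mat_app (pencil_at a b (kron_L n)) x i = a * x i + b * x (Suc i)"
proof -
  have "mat_app (pencil_at a b (kron_L n)) x i =
      (\<Sum>j<n. (if j = i then a * x i else 0) + (if j = Suc i then b * x (Suc i) else 0))"
    unfolding mat_app_def using assms
    by (intro sum.cong) (auto simp: pencil_at_def kron_L_def L_mat_def R_mat_def algebra_simps)
  moreover have "i < n" "Suc i < n" using assms by auto
  ultimately show ?thesis by (simp add: sum.distrib)
qed

text \<open>The kernel consists of geometric sequences with ratio - a / b. For \<open>b = 0\<close>
  only the last coordinate is free; otherwise the first one determines the rest.\<close>

lemma corank_le_1_kron_L:
  assumes ab: "a \<noteq> 0 \<or> b \<noteq> 0" shows "corank_le 1 (pencil_at a b (kron_L n))"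
proof (rule corank_leI[OF pencil_at_carrier[OF kron_L_carrier],
      of "{\<lambda>j. if j = (if b = 0 then n - 1 else 0) then 1 else 0}"])
  let ?F = "{\<lambda>j :: nat. if j = (if b = 0 then n - 1 else 0) then 1 else 0 :: complex}"
  fix x j assume x: "\<And>i. i < n - 1 \<Longrightarrow> mat_app (pencil_at a b (kron_L n)) x i = 0"
    "\<And>f. f \<in> ?F \<Longrightarrow> (\<Sum>j<n. f j * x j) = 0" and j: "j < n"
  have e: "a * x i + b * x (Suc i) = 0" if "i < n - 1" for i
    using x(1)[OF that] mat_app_kron_L[OF that] by simp
  have k: "x (if b = 0 then n - 1 else 0) = 0"
    using x(2)[OF singletonI] sum_single[of "if b = 0 then n - 1 else 0" n x] j by simp
  show "x j = 0"
  proof (cases "b = 0")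
    case True
    then show ?thesis using k e[of j] ab j by (cases "j = n - 1") auto
  next
    case False
    show ?thesis using j
    proof (induction j)
      case 0
      then show ?case using k False by simp
    next
      case (Suc j)
      then show ?case using e[of j] False by simp
    qed
  qed
qed auto

lemma kron_L_kernel:
  assumes ab: "a \<noteq> 0 \<or> b \<noteq> 0" and "0 < n"
  shows "\<exists>x l. (\<forall>i<n - 1. mat_app (pencil_at a b (kron_L n)) x i = 0) \<and> l < n \<and> x l \<noteq> 0"
proof (intro exI conjI allI impI)
  \<comment> \<open>The homogeneous geometric sequence; with 0 ^ 0 = 1 it covers
    \<open>a = 0\<close> and \<open>b = 0\<close> as well.\<close>
  let ?x = "\<lambda>i. (- a) ^ i * b ^ (n - 1 - i)"
  show "mat_app (pencil_at a b (kron_L n)) ?x i = 0" if "i < n - 1" for i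
  proof -
    have "n - 1 - i = Suc (n - 1 - Suc i)" using that by simp
    then show ?thesis unfolding mat_app_kron_L[OF that] by (simp only: power_Suc) (simp add: algebra_simps)
  qed
  show "(if b = 0 then n - 1 else 0) < n" using assms by simp
  show "?x (if b = 0 then n - 1 else 0) \<noteq> 0" using ab by auto
qed


section \<open>Canonical forms of pairs of small corank\<close>

lemma corank_le_0_iff_det:
  assumes A: "A \<in> carrier_mat n n"
  shows "corank_le 0 A \<longleftrightarrow> det A \<noteq> 0"
proof -
  have app: "(A *\<^sub>v v) $ i = mat_app A (\<lambda>j. v $ j) i" if "i < n" "v \<in> carrier_vec n" for i v
    using that A by (auto simp: mat_app_def scalar_prod_def atLeast0LessThan)
  have z: "A *\<^sub>v v = 0\<^sub>v n \<longleftrightarrow> (\<forall>i<n. mat_app A (\<lambda>j. v $ j) i = 0)" if "v \<in> carrier_vec n" for v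
    using app[OF _ that] A that by (auto simp: vec_eq_iff)
  show ?thesis
  proof
    assume L: "corank_le 0 A"
    show "det A \<noteq> 0"
    proof
      assume "det A = 0"
      then obtain v where v: "v \<in> carrier_vec n" "v \<noteq> 0\<^sub>v n" "A *\<^sub>v v = 0\<^sub>v n"
        using det_0_iff_vec_prod_zero_field[OF A] by blast
      then have "\<forall>j<n. v $ j = 0" using L z[OF v(1)] unfolding corank_le_0_iff[OF A] by blast
      then show False using v(1,2) by (auto simp: vec_eq_iff)
    qed
  next
    assume d: "det A \<noteq> 0"
    show "corank_le 0 A"
    proof (rule corank_le_0I[OF A])
      fix x j assume x: "\<And>i. i < n \<Longrightarrow> mat_app A x i = 0" and j: "j < n"
      have "mat_app A (\<lambda>j. vec n x $ j) i = mat_app A x i" for i using A by (intro mat_app_cong) auto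
      then have "A *\<^sub>v vec n x = 0\<^sub>v n" using z[of "vec n x"] x by simp
      then have "vec n x = 0\<^sub>v n" using d det_0_iff_vec_prod_zero_field[OF A] vec_carrier by blast
      then have "vec n x $ j = 0\<^sub>v n $ j" by simp
      then show "x j = 0" using j by simp
    qed
  qed
qed

lemma left_inverse_of_corank_le_0:
  assumes A: "A \<in> carrier_mat n n" and "corank_le 0 A"
  shows "\<exists>C\<in>carrier_mat n n. C * A = 1\<^sub>m n"
proof -
  have "det A \<noteq> 0" using assms corank_le_0_iff_det by blast
  from det_non_zero_imp_unit[OF A this, of undefined]
  show ?thesis unfolding Units_def ring_mat_def by auto
qed

lemma kron_D_list_eq:
  "direct_sum (map (\<lambda>(k, a). kron_D k (Fin a)) ks) = (1\<^sub>m (sum_list (map fst ks)), jordan_matrix ks)"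
proof -
  have 1: "map fst (map (\<lambda>(k, a). kron_D k (Fin a)) ks) = map (\<lambda>k. 1\<^sub>m k) (map fst ks)"
    and 2: "map snd (map (\<lambda>(k, a). kron_D k (Fin a)) ks) = map (\<lambda>(k, a). jordan_block k a) ks"
    by (auto simp: case_prod_beta kron_D.simps)
  have 3: "diag_block_mat (map (\<lambda>k. 1\<^sub>m k) ns) = (1\<^sub>m (sum_list ns) :: complex mat)" for ns
    by (induction ns) (auto simp: Let_def)
  show ?thesis unfolding direct_sum_def 1 2 3 jordan_matrix_def ..
qed

lemma kron_D_list_carrier:
  "direct_sum (map (\<lambda>(k, \<mu>). kron_D k \<mu>) rs) \<in> matrix_pairs (sum_list (map fst rs)) (sum_list (map fst rs))"
proof (induction rs)
  case Nil
  then show ?case by (auto simp: direct_sum_Nil matrix_pairs_iff)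
next
  case (Cons r rs)
  obtain k \<mu> where r: "r = (k, \<mu>)" by (cases r)
  show ?case using pair_sum_carrier[OF kron_D_carrier[of k \<mu>] Cons]
    direct_sum_Cons[of "kron_D k \<mu>" "map (\<lambda>(k, \<mu>). kron_D k \<mu>) rs"] by (simp add: r)
qed

text \<open>The inverse of the first component reduces the pair to (I, M); a similarity of
  \<open>M\<close> is an equivalence of such pairs, so the Jordan normal form of \<open>M\<close>
  gives the summands.\<close>

lemma invertible_pair_canonical_form:
  assumes Y: "Y \<in> matrix_pairs n n" and inv: "corank_le 0 (fst Y)"
  shows "\<exists>ks. (\<forall>(k, a)\<in>set ks. k \<ge> 1) \<and> sum_list (map fst ks) = n \<and>
    pair_equiv Y (direct_sum (map (\<lambda>(k, a). kron_D k (Fin a)) ks))"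
proof -
  have A: "fst Y \<in> carrier_mat n n" and B: "snd Y \<in> carrier_mat n n" using Y by (auto simp: matrix_pairs_iff)
  from left_inverse_of_corank_le_0[OF A inv] obtain C where C: "C \<in> carrier_mat n n" "C * fst Y = 1\<^sub>m n" by blast
  have AC: "fst Y * C = 1\<^sub>m n" using mat_mult_left_right_inverse[OF C(1) A C(2)] .
  define M where "M = C * snd Y"
  have M: "M \<in> carrier_mat n n" using C B by (auto simp: M_def)
  have Y1: "pair_equiv Y (1\<^sub>m n, M)"
    by (rule pair_equiv_intro[OF Y C(1) A C(2), of "1\<^sub>m n" "1\<^sub>m n"]) (use C M in \<open>auto simp: M_def\<close>)
  \<comment> \<open>Over the complex numbers the characteristic polynomial splits, so a Jordan
    normal form exists.\<close>
  obtain as where "char_poly M = (\<Prod>a\<leftarrow>as. [:- a, 1:])" using char_poly_factorized[OF M] by blast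
  from jordan_nf_exists[OF M this] obtain ks where ks: "0 \<notin> fst ` set ks" "similar_mat M (jordan_matrix ks)"
    unfolding jordan_nf_def by blast
  from similar_matD[OF similar_mat_sym[OF ks(2)]] obtain n' P Q where
    PQ': "{jordan_matrix ks, M, P, Q} \<subseteq> carrier_mat n' n'"
    and PQ: "P * Q = 1\<^sub>m n'" "Q * P = 1\<^sub>m n'" "jordan_matrix ks = P * M * Q" by blast
  have n': "n' = n" using PQ' M by auto
  note PQ = PQ[unfolded n'] and PQ' = PQ'[unfolded n']
  have dim: "sum_list (map fst ks) = n" using PQ' by (metis carrier_matD(1) insert_subset jordan_matrix_dim(1))
  have "pair_equiv (1\<^sub>m n, M) (1\<^sub>m n, jordan_matrix ks)"
    by (rule pair_equiv_intro[of _ n n P Q Q P]) (use PQ PQ' M in \<open>auto simp: matrix_pairs_iff\<close>)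
  then have "pair_equiv Y (direct_sum (map (\<lambda>(k, a). kron_D k (Fin a)) ks))"
    unfolding kron_D_list_eq dim using pair_equiv_trans[OF Y1] by blast
  moreover have "\<forall>(k, a)\<in>set ks. k \<ge> 1"
  proof clarify
    fix k a assume "(k, a) \<in> set ks"
    then have "k \<noteq> 0" using ks(1) by force
    then show "1 \<le> k" by simp
  qed
  ultimately show ?thesis using dim by blast
qed

lemma corank_le_pair_summands:
  assumes X: "X \<in> matrix_pairs p q" and Y: "Y \<in> matrix_pairs p' q'"
    and c: "corank_le c (pencil_at a b (X \<boxplus> Y))"
  shows "corank_le c (pencil_at a b X)" "corank_le c (pencil_at a b Y)"
    "\<forall>i<p. mat_app (pencil_at a b X) k i = 0 \<Longrightarrow> l < q \<Longrightarrow> k l \<noteq> 0 \<Longrightarrow>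
      \<exists>e. c = Suc e \<and> corank_le e (pencil_at a b Y)"
  using corank_le_summands[OF pencil_at_carrier[OF X] pencil_at_carrier[OF Y] c[unfolded pencil_at_pair_sum[OF X Y]]]
  by blast+

lemma corank_le_pair_sum:
  assumes X: "X \<in> matrix_pairs p q" and Y: "Y \<in> matrix_pairs p' q'"
    and "corank_le c (pencil_at a b X)" "corank_le c' (pencil_at a b Y)"
  shows "corank_le (c + c') (pencil_at a b (X \<boxplus> Y))"
  unfolding pencil_at_pair_sum[OF X Y]
  by (rule corank_le_diag[OF pencil_at_carrier[OF X] pencil_at_carrier[OF Y] assms(3,4)])

text \<open>A block \<open>kron_D k \<mu>\<close> is singular at its own point, so it consumes one
  unit of the corank there.\<close>

lemma kron_D_summand:
  assumes "0 < k" "eigen_point \<mu> = (a, b)" "Y \<in> matrix_pairs p q" "corank_le c (pencil_at a b (kron_D k \<mu> \<boxplus> Y))"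
  shows "\<exists>e. c = Suc e \<and> corank_le e (pencil_at a b Y)"
  by (rule corank_le_pair_summands(3)[OF kron_D_carrier assms(3,4), of "\<lambda>j. if j = 0 then 1 else 0" 0])
     (use assms kron_D_kernel in auto)

text \<open>At (1, 0) the pencil is regular, so the first component is nonsingular and a Jordan form
  exists. A block with another eigenvalue would be singular at a regular point, and each block at
  \<open>z\<close> costs one unit of \<open>c\<close>.\<close>

lemma single_eigenvalue_canonical_form:
  assumes Z: "Z \<in> matrix_pairs n n"
    and off: "\<And>a b. a + b * z \<noteq> 0 \<Longrightarrow> corank_le 0 (pencil_at a b Z)"
    and at: "corank_le c (pencil_at z (- 1) Z)"
  shows "\<exists>ks. length ks \<le> c \<and> (\<forall>k\<in>set ks. k \<ge> 1) \<and> sum_list ks = n \<and>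
    pair_equiv Z (direct_sum (map (\<lambda>k. kron_D k (Fin z)) ks))"
proof -
  have "pencil_at 1 0 Z = fst Z" using Z by (auto simp: pencil_at_def matrix_pairs_iff intro!: eq_matI)
  then have "corank_le 0 (fst Z)" using off[of 1 0] by simp
  from invertible_pair_canonical_form[OF Z this] obtain ks where ks: "\<forall>(k, a)\<in>set ks. k \<ge> 1"
    "sum_list (map fst ks) = n" "pair_equiv Z (direct_sum (map (\<lambda>(k, a). kron_D k (Fin a)) ks))" by blast
  have *: "(\<forall>(k, a)\<in>set ks. a = z) \<and> length ks \<le> c"
    if "\<forall>(k, a)\<in>set ks. k \<ge> 1"
      "\<And>a b. a + b * z \<noteq> 0 \<Longrightarrow> corank_le 0 (pencil_at a b (direct_sum (map (\<lambda>(k, a). kron_D k (Fin a)) ks)))"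
      "corank_le c (pencil_at z (- 1) (direct_sum (map (\<lambda>(k, a). kron_D k (Fin a)) ks)))" for ks c
    using that
  proof (induction ks arbitrary: c)
    case (Cons r ks)
    obtain k a where r: "r = (k, a)" by (cases r)
    let ?Y = "direct_sum (map (\<lambda>(k, a). kron_D k (Fin a)) ks)"
    have eq: "direct_sum (map (\<lambda>(k, a). kron_D k (Fin a)) (r # ks)) = kron_D k (Fin a) \<boxplus> ?Y"
      unfolding r list.map(2) prod.case by (rule direct_sum_Cons)
    have Yc: "?Y \<in> matrix_pairs (sum_list (map fst ks)) (sum_list (map fst ks))"
      unfolding kron_D_list_eq matrix_pairs_iff carrier_mat_def by simp
    note c = Cons.prems(2,3)[unfolded eq]
    have k: "0 < k" using Cons.prems(1) r by auto
    have a: "a = z"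
    proof (rule ccontr)
      assume "a \<noteq> z"
      then have "corank_le 0 (pencil_at a (- 1) (kron_D k (Fin a) \<boxplus> ?Y))" using c(1)[of a "- 1"] by simp
      from kron_D_summand[OF k _ Yc this] show False by simp
    qed
    from kron_D_summand[OF k _ Yc c(2)] obtain e where e: "c = Suc e" "corank_le e (pencil_at z (- 1) ?Y)"
      using a by auto
    have "(\<forall>(k, a)\<in>set ks. a = z) \<and> length ks \<le> e"
    proof (rule Cons.IH)
      show "\<forall>(k, a)\<in>set ks. 1 \<le> k" using Cons.prems(1) by simp
      show "corank_le 0 (pencil_at a b ?Y)" if "a + b * z \<noteq> 0" for a b
        using corank_le_pair_summands(2)[OF kron_D_carrier Yc c(1)[OF that]] .
    qed (rule e(2))
    then show ?case using a e(1) r by auto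
  qed simp
  have "(\<forall>(k, a)\<in>set ks. a = z) \<and> length ks \<le> c"
    using * ks(1) corank_le_equiv[OF ks(3)] off at by blast
  moreover from this have "map (\<lambda>(k, a). kron_D k (Fin a)) ks = map (\<lambda>k. kron_D k (Fin z)) (map fst ks)"
    by auto
  moreover have "\<forall>k\<in>set (map fst ks). k \<ge> 1" using ks(1) by auto
  ultimately show ?thesis using ks(2,3) by (intro exI[of _ "map fst ks"]) (simp del: map_map)
qed

section \<open>Pairs with one or two more rows than columns\<close>

definition least_left_null :: "mpair \<Rightarrow> nat \<Rightarrow> bool" where
  "least_left_null Y d \<longleftrightarrow> has_null (transpose_pair Y) d \<and> (\<forall>e<d. \<not> has_null (transpose_pair Y) e)"

lemma least_left_null_splits:
  assumes Y: "Y \<in> matrix_pairs p q" and d: "least_left_null Y d"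
  shows "d \<le> q \<and> Suc d \<le> p \<and> (\<exists>Z\<in>matrix_pairs (p - Suc d) (q - d). pair_equiv Y (kron_LT (Suc d) \<boxplus> Z))"
proof -
  have "transpose_pair Y \<in> matrix_pairs q p" using Y by simp
  from least_null_splits[OF this] d obtain Z where le: "d \<le> q" "Suc d \<le> p"
    and Z: "Z \<in> matrix_pairs (q - d) (p - Suc d)" "pair_equiv (transpose_pair Y) (kron_L (Suc d) \<boxplus> Z)"
    unfolding least_left_null_def by blast
  have "pair_equiv Y (kron_LT (Suc d) \<boxplus> transpose_pair Z)"
    using pair_equiv_transpose[OF Z(2)] unfolding transpose_pair_sum[OF kron_L_carrier Z(1)]
    by (simp add: kron_LT_eq)
  with le Z show ?thesis by (intro conjI bexI[of _ "transpose_pair Z"]) auto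
qed

lemma least_left_null_exists:
  assumes Y: "Y \<in> matrix_pairs p q" and "q < p"
  shows "\<exists>d. least_left_null Y d"
proof -
  have "\<exists>d. has_null (transpose_pair Y) d" using Y assms by (intro has_null_if_wide[of _ q p]) auto
  then show ?thesis unfolding least_left_null_def using exists_least_iff[of "has_null (transpose_pair Y)"] by blast
qed

text \<open>The transpose is wide, so a left null vector of least degree exists; what remains after
  its summand is split off is square with no eigenvalue other than \<open>z\<close>.\<close>

lemma tall_by_one_canonical_form:
  assumes Y: "Y \<in> matrix_pairs (Suc q) q"
    and off: "\<And>a b. a + b * z \<noteq> 0 \<Longrightarrow> corank_le 0 (pencil_at a b Y)"
    and at: "corank_le c (pencil_at z (- 1) Y)"
  shows "\<exists>d ks. least_left_null Y d \<and> d \<le> q \<and> length ks \<le> c \<and> (\<forall>k\<in>set ks. k \<ge> 1) \<and> sum_list ks = q - d \<and>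
    pair_equiv Y (kron_LT (Suc d) \<boxplus> direct_sum (map (\<lambda>k. kron_D k (Fin z)) ks))"
proof -
  from least_left_null_exists[OF Y] obtain d where d: "least_left_null Y d" by auto
  from least_left_null_splits[OF Y d] obtain Z where le: "d \<le> q" and Z: "Z \<in> matrix_pairs (q - d) (q - d)"
    and eq: "pair_equiv Y (kron_LT (Suc d) \<boxplus> Z)" by auto
  have cZ: "corank_le c (pencil_at a b Z)" if "corank_le c (pencil_at a b Y)" for a b c
    using corank_le_pair_summands(2)[OF kron_LT_carrier Z corank_le_equiv[OF eq that]] .
  from single_eigenvalue_canonical_form[OF Z cZ[OF off] cZ[OF at]] obtain ks where
    ks: "length ks \<le> c" "\<forall>k\<in>set ks. k \<ge> 1" "sum_list ks = q - d"
      "pair_equiv Z (direct_sum (map (\<lambda>k. kron_D k (Fin z)) ks))" by blast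
  have "pair_equiv Y (kron_LT (Suc d) \<boxplus> direct_sum (map (\<lambda>k. kron_D k (Fin z)) ks))"
    using pair_equiv_trans[OF eq pair_equiv_sum_right[OF ks(4) kron_LT_carrier]] .
  with d le ks show ?thesis by blast
qed

text \<open>Full column rank at every point leaves no room for \<open>kron_D\<close> blocks, so a
  single \<open>kron_LT\<close> fills the whole pair.\<close>

lemma injective_tall_by_one:
  assumes Y: "Y \<in> matrix_pairs (Suc q) q" and inj: "\<And>a b. a \<noteq> 0 \<or> b \<noteq> 0 \<Longrightarrow> corank_le 0 (pencil_at a b Y)"
  shows "least_left_null Y q" "pair_equiv Y (kron_LT (Suc q))"
proof -
  from tall_by_one_canonical_form[OF Y, of 0 0] inj obtain d ks where
    d: "least_left_null Y d" "d \<le> q" "length ks = 0" "sum_list ks = q - d"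
      "pair_equiv Y (kron_LT (Suc d) \<boxplus> direct_sum (map (\<lambda>k. kron_D k (Fin 0)) ks))" by auto
  then have "ks = []" "d = q" by auto
  with d show "least_left_null Y q" "pair_equiv Y (kron_LT (Suc q))" by (auto simp: direct_sum_Nil)
qed

text \<open>After one summand is split off, the rest is again of full column rank and has one row
  more than columns. Its null degree \<open>q - d\<close> is one of \<open>Y\<close> too, so
  minimality orders the two sizes.\<close>

lemma injective_tall_by_two:
  assumes Y: "Y \<in> matrix_pairs (Suc (Suc q)) q"
    and inj: "\<And>a b. a \<noteq> 0 \<or> b \<noteq> 0 \<Longrightarrow> corank_le 0 (pencil_at a b Y)"
  shows "\<exists>d. least_left_null Y d \<and> d \<le> q - d \<and> d \<le> q \<and> pair_equiv Y (kron_LT (Suc d) \<boxplus> kron_LT (Suc (q - d)))"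
proof -
  from least_left_null_exists[OF Y] obtain d where d: "least_left_null Y d" by auto
  from least_left_null_splits[OF Y d] obtain Z where le: "d \<le> q" and Z: "Z \<in> matrix_pairs (Suc (q - d)) (q - d)"
    and eq: "pair_equiv Y (kron_LT (Suc d) \<boxplus> Z)" by (auto simp: Suc_diff_le)
  have cZ: "corank_le 0 (pencil_at a b Z)" if "a \<noteq> 0 \<or> b \<noteq> 0" for a b
    using corank_le_pair_summands(2)[OF kron_LT_carrier Z corank_le_equiv[OF eq inj[OF that]]] .
  note ZL = injective_tall_by_one[OF Z cZ]
  have "has_null (transpose_pair Z) (q - d)" using ZL(1) by (simp add: least_left_null_def)
  then have "has_null (transpose_pair (kron_LT (Suc d) \<boxplus> Z)) (q - d)"
    unfolding transpose_pair_sum[OF kron_LT_carrier Z]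
    using Z by (intro has_null_pair_sum_right[of _ d "Suc d" _ "q - d" "Suc (q - d)"])
      (use kron_LT_carrier[of "Suc d"] in auto)
  then have "has_null (transpose_pair Y) (q - d)"
    using has_null_equiv[OF pair_equiv_transpose[OF pair_equiv_sym[OF eq]]] by blast
  then have "d \<le> q - d" using d unfolding least_left_null_def by (meson not_le)
  moreover have "pair_equiv Y (kron_LT (Suc d) \<boxplus> kron_LT (Suc (q - d)))"
    using pair_equiv_trans[OF eq pair_equiv_sum_right[OF ZL(2) kron_LT_carrier]] .
  ultimately show ?thesis using d le by (intro exI[of _ d] conjI)
qed

section \<open>Block triangular pairs\<close>

definition block_upper :: "mpair \<Rightarrow> mpair \<Rightarrow> mpair \<Rightarrow> mpair" where
  "block_upper X D Y =
    (four_block_mat (fst X) (fst D) (0\<^sub>m (dim_row (fst Y)) (dim_col (fst X))) (fst Y),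
     four_block_mat (snd X) (snd D) (0\<^sub>m (dim_row (snd Y)) (dim_col (snd X))) (snd Y))"

definition block_lower :: "mpair \<Rightarrow> mpair \<Rightarrow> mpair \<Rightarrow> mpair" where
  "block_lower X E Y =
    (four_block_mat (fst X) (0\<^sub>m (dim_row (fst X)) (dim_col (fst Y))) (fst E) (fst Y),
     four_block_mat (snd X) (0\<^sub>m (dim_row (snd X)) (dim_col (snd Y))) (snd E) (snd Y))"

lemma block_carrier:
  assumes "X \<in> matrix_pairs p q" "Y \<in> matrix_pairs p' q'"
  shows "block_upper X D Y \<in> matrix_pairs (p + p') (q + q')"
    "block_lower X E Y \<in> matrix_pairs (p + p') (q + q')"
  using assms by (auto simp: block_upper_def block_lower_def matrix_pairs_iff)

lemma transpose_block_upper: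
  assumes "X \<in> matrix_pairs p q" "Y \<in> matrix_pairs p' q'" "D \<in> matrix_pairs p q'"
  shows "transpose_pair (block_upper X D Y) = block_lower (transpose_pair X) (transpose_pair D) (transpose_pair Y)"
  using assms
  by (auto simp: block_upper_def block_lower_def transpose_pair_def matrix_pairs_iff transpose_four_block_mat)

lemma pair_sum_degenerates_from_block_upper:
  assumes X: "X \<in> matrix_pairs p q" and Y: "Y \<in> matrix_pairs p' q'" and D: "D \<in> matrix_pairs p q'"
  shows "degenerates_from (X \<boxplus> Y) (block_upper X D Y)"
proof -
  define Z where "Z t = block_upper X (t \<cdot>\<^sub>m fst D, t \<cdot>\<^sub>m snd D) Y" for t :: complex
  have scal: "pair_equiv (block_upper X D Y) (Z t)" if t: "t \<noteq> 0" for t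
  proof -
    \<comment> \<open>Left factor diag(t, 1) and right factor diag(1/t, 1): the diagonal blocks
      stay, and the upper right block is multiplied by \<open>t\<close>.\<close>
    let ?d = "\<lambda>t n m. four_block_mat (t \<cdot>\<^sub>m 1\<^sub>m n) (0\<^sub>m n m) (0\<^sub>m m n) (1\<^sub>m m) :: complex mat"
    have d: "?d t n m \<in> carrier_mat (n + m) (n + m)" for t n m by auto
    have inv: "?d t n m * ?d (1 / t) n m = 1\<^sub>m (n + m)" "?d (1 / t) n m * ?d t n m = 1\<^sub>m (n + m)" for n m
      using t by (auto simp: mult_diag_four_block[of _ n n _ m m _ n _ m] mult_smult_assoc_mat[of _ n n _ n]
        mult_smult_distrib[of _ n n _ n] intro!: eq_matI)
    have eq: "?d t p p' * four_block_mat A B (0\<^sub>m p' q) C * ?d (1 / t) q q' = four_block_mat A (t \<cdot>\<^sub>m B) (0\<^sub>m p' q) C"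
      if c: "A \<in> carrier_mat p q" "B \<in> carrier_mat p q'" "C \<in> carrier_mat p' q'" for A B C
    proof -
      have "?d t p p' * four_block_mat A B (0\<^sub>m p' q) C = four_block_mat (t \<cdot>\<^sub>m A) (t \<cdot>\<^sub>m B) (0\<^sub>m p' q) C"
        using c by (subst mult_four_block_mat[of _ p p _ p' _ p' _ _ q _ q'])
          (auto simp: mult_smult_assoc_mat[of _ p p _ _])
      also have "\<dots> * ?d (1 / t) q q' = four_block_mat A (t \<cdot>\<^sub>m B) (0\<^sub>m p' q) C"
        using c t by (subst mult_four_block_mat[of _ p q _ q' _ p' _ _ q _ q'])
          (auto simp: mult_smult_distrib[of _ p q _ q] intro!: arg_cong[where f = "\<lambda>A. four_block_mat A _ _ _"] eq_matI)
      finally show ?thesis .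
    qed
    show ?thesis
      by (rule pair_equiv_intro[OF block_carrier(1)[OF X Y] d d inv(1) d d inv(2)])
        (use X Y D in \<open>auto simp: Z_def block_upper_def matrix_pairs_iff eq simp del: assoc_mult_mat\<close>)
  qed
  show ?thesis unfolding degenerates_from_def
  proof (rule exI[of _ "p + p'"], rule exI[of _ "q + q'"], intro conjI allI impI)
    show "X \<boxplus> Y \<in> matrix_pairs (p + p') (q + q')" by (rule pair_sum_carrier[OF X Y])
    show "block_upper X D Y \<in> matrix_pairs (p + p') (q + q')" by (rule block_carrier(1)[OF X Y])
    fix d :: real assume d: "d > 0"
    \<comment> \<open>\<open>C\<close> bounds all entries of the upper right block, so that the
      scale \<open>t = d / (C + 1)\<close> brings them below \<open>d\<close>.\<close>
    define C where "C = (\<Sum>i<p. \<Sum>j<q'. cmod (fst D $$ (i, j)) + cmod (snd D $$ (i, j)))"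
    have C: "cmod (fst D $$ (i, j)) \<le> C \<and> cmod (snd D $$ (i, j)) \<le> C" if "i < p" "j < q'" for i j
    proof -
      have "cmod (fst D $$ (i, j)) + cmod (snd D $$ (i, j))
          \<le> (\<Sum>j<q'. cmod (fst D $$ (i, j)) + cmod (snd D $$ (i, j)))"
        using that by (intro member_le_sum[of j "{..<q'}" "\<lambda>j. cmod (fst D $$ (i, j)) + cmod (snd D $$ (i, j))"]) auto
      also have "\<dots> \<le> C" unfolding C_def using that
        by (intro member_le_sum[of i "{..<p}" "\<lambda>i. \<Sum>j<q'. cmod (fst D $$ (i, j)) + cmod (snd D $$ (i, j))"]
            sum_nonneg add_nonneg_nonneg norm_ge_zero) auto
      finally show ?thesis using norm_ge_zero[of "fst D $$ (i, j)"] norm_ge_zero[of "snd D $$ (i, j)"] by linarith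
    qed
    have C0: "C \<ge> 0" unfolding C_def by (intro sum_nonneg add_nonneg_nonneg norm_ge_zero)
    define t where "t = d / (C + 1)"
    have t: "t > 0" "t * C < d" using d C0 by (auto simp: t_def field_simps)
    have tC: "t * x < d" if "x \<le> C" for x using mult_left_mono[OF that, of t] t by linarith
    have "close_pairs (p + p') (q + q') d (X \<boxplus> Y) (Z (complex_of_real t))"
      unfolding close_pairs_def Z_def using X Y D C d t(1)
      by (auto simp: pair_sum_eq block_upper_def matrix_pairs_iff norm_mult intro!: tC)
    then show "\<exists>Z. pair_equiv (block_upper X D Y) Z \<and> close_pairs (p + p') (q + q') d (X \<boxplus> Y) Z"
      by (intro exI[of _ "Z (complex_of_real t)"] conjI scal) (use t(1) in simp)
  qed
qed

lemma pair_sum_degenerates_from_block_lower: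
  assumes X: "X \<in> matrix_pairs p q" and Y: "Y \<in> matrix_pairs p' q'" and E: "E \<in> matrix_pairs p' q"
  shows "degenerates_from (X \<boxplus> Y) (block_lower X E Y)"
proof -
  have "degenerates_from (transpose_pair X \<boxplus> transpose_pair Y)
      (block_upper (transpose_pair X) (transpose_pair E) (transpose_pair Y))"
    using X Y E by (intro pair_sum_degenerates_from_block_upper[of _ q p _ q' p']) auto
  from degenerates_from_transpose[OF this] show ?thesis
    using X Y E transpose_pair_sum[of "transpose_pair X" q p "transpose_pair Y" q' p']
      transpose_block_upper[of "transpose_pair X" q p "transpose_pair Y" q' p' "transpose_pair E"] by simp
qed


section \<open>Null degrees of the block triangular pairs\<close>

lemma poly_app_L_mat:
  assumes "i < n - 1"
  shows "poly_app (L_mat n) f i = f i" "poly_app (R_mat n) f i = f (Suc i)"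
proof -
  have "poly_app (L_mat n) f i = (\<Sum>j<n. if j = i then f i else 0)"
    unfolding poly_app_def using assms by (intro sum.cong) (auto simp: L_mat_def)
  then show "poly_app (L_mat n) f i = f i" using assms by simp
  have "poly_app (R_mat n) f i = (\<Sum>j<n. if j = Suc i then f (Suc i) else 0)"
    unfolding poly_app_def using assms by (intro sum.cong) (auto simp: R_mat_def)
  then show "poly_app (R_mat n) f i = f (Suc i)" using assms by simp
qed

lemma poly_app_L_mat_transpose:
  assumes "i < n"
  shows "poly_app (L_mat n)\<^sup>T f i = (if i < n - 1 then f i else 0)"
    "poly_app (R_mat n)\<^sup>T f i = (if 0 < i then f (i - 1) else 0)"
proof -
  have "poly_app (L_mat n)\<^sup>T f i = (\<Sum>j<n - 1. if j = i then f i else 0)"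
    unfolding poly_app_def using assms by (intro sum.cong) (auto simp: L_mat_def)
  then show "poly_app (L_mat n)\<^sup>T f i = (if i < n - 1 then f i else 0)" by simp
  have "poly_app (R_mat n)\<^sup>T f i = (\<Sum>j<n - 1. if j = i - 1 \<and> 0 < i then f (i - 1) else 0)"
    unfolding poly_app_def using assms by (intro sum.cong) (auto simp: R_mat_def)
  then show "poly_app (R_mat n)\<^sup>T f i = (if 0 < i then f (i - 1) else 0)" using assms by (cases i) auto
qed

lemma poly_app_jordan_block:
  assumes "i < n"
  shows "poly_app (jordan_block n z) f i = Polynomial.smult z (f i) + (if Suc i < n then f (Suc i) else 0)"
    "poly_app (jordan_block n z)\<^sup>T f i = Polynomial.smult z (f i) + (if 0 < i then f (i - 1) else 0)"
proof -
  have "poly_app (jordan_block n z) f i =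
      (\<Sum>j<n. (if j = i then Polynomial.smult z (f i) else 0) + (if j = Suc i then f (Suc i) else 0))"
    unfolding poly_app_def using assms by (intro sum.cong) (auto simp: jordan_block_def)
  then show "poly_app (jordan_block n z) f i = Polynomial.smult z (f i) + (if Suc i < n then f (Suc i) else 0)"
    using assms by (simp add: sum.distrib)
  have "poly_app (jordan_block n z)\<^sup>T f i =
      (\<Sum>j<n. (if j = i then Polynomial.smult z (f i) else 0) + (if j = i - 1 \<and> 0 < i then f (i - 1) else 0))"
    unfolding poly_app_def using assms by (intro sum.cong) (auto simp: jordan_block_def)
  also have "\<dots> = Polynomial.smult z (f i) + (\<Sum>j<n. if j = i - 1 \<and> 0 < i then f (i - 1) else 0)"
    using assms by (simp add: sum.distrib)
  also have "(\<Sum>j<n. if j = i - 1 \<and> 0 < i then f (i - 1) else 0) = (if 0 < i then f (i - 1) else 0)"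
    using assms by (cases i) auto
  finally show "poly_app (jordan_block n z)\<^sup>T f i = Polynomial.smult z (f i) + (if 0 < i then f (i - 1) else 0)" .
qed

lemma poly_app_Delta_mat:
  assumes "l < n" "0 < m"
  shows "poly_app (Delta_mat m n r \<epsilon>)\<^sup>T f l = (if Suc l = r then Polynomial.smult \<epsilon> (f 0) else 0)"
    "poly_app (Nabla_mat m n r \<epsilon>)\<^sup>T f l = (if Suc l = r then Polynomial.smult \<epsilon> (f (m - 1)) else 0)"
proof -
  have "poly_app (Delta_mat m n r \<epsilon>)\<^sup>T f l = (\<Sum>j<m. if j = 0 then (if Suc l = r then Polynomial.smult \<epsilon> (f 0) else 0) else 0)"
    unfolding poly_app_def using assms by (intro sum.cong) (auto simp: Delta_mat_def)
  then show "poly_app (Delta_mat m n r \<epsilon>)\<^sup>T f l = (if Suc l = r then Polynomial.smult \<epsilon> (f 0) else 0)"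
    using assms by simp
  have "poly_app (Nabla_mat m n r \<epsilon>)\<^sup>T f l = (\<Sum>j<m. if j = m - 1 then (if Suc l = r then Polynomial.smult \<epsilon> (f (m - 1)) else 0) else 0)"
    unfolding poly_app_def using assms by (intro sum.cong) (auto simp: Nabla_mat_def)
  then show "poly_app (Nabla_mat m n r \<epsilon>)\<^sup>T f l = (if Suc l = r then Polynomial.smult \<epsilon> (f (m - 1)) else 0)"
    using assms by simp
qed

lemma poly_app_zero: "poly_app (0\<^sub>m p q) f i = 0" if "i < p"
  using that by (simp add: poly_app_def)

text \<open>The lower block form decouples the equations: \<open>f\<close> satisfies those of
  \<open>X\<close> alone and then enters those for \<open>g\<close> as an inhomogeneity.\<close>

lemma has_null_block_lower_iff:
  assumes X: "X \<in> matrix_pairs p q" and Y: "Y \<in> matrix_pairs p' q'" and E: "E \<in> matrix_pairs p' q"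
  shows "has_null (block_lower X E Y) d \<longleftrightarrow> (\<exists>f g. (\<forall>j<q. degree (f j) \<le> d) \<and> (\<forall>j<q'. degree (g j) \<le> d) \<and>
    ((\<exists>j<q. f j \<noteq> 0) \<or> (\<exists>j<q'. g j \<noteq> 0)) \<and>
    (\<forall>i<p. poly_app (snd X) f i = pCons 0 (poly_app (fst X) f i)) \<and>
    (\<forall>i<p'. poly_app (snd E) f i + poly_app (snd Y) g i = pCons 0 (poly_app (fst E) f i + poly_app (fst Y) g i)))"
    (is "?L \<longleftrightarrow> (\<exists>f g. ?P f g)")
proof -
  have c: "fst X \<in> carrier_mat p q" "snd X \<in> carrier_mat p q" "fst Y \<in> carrier_mat p' q'" "snd Y \<in> carrier_mat p' q'"
    "fst E \<in> carrier_mat p' q" "snd E \<in> carrier_mat p' q" using assms by (auto simp: matrix_pairs_iff)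
  have T: "block_lower X E Y \<in> matrix_pairs (p + p') (q + q')" using block_carrier(2)[OF X Y] .
  have e: "fst (block_lower X E Y) = four_block_mat (fst X) (0\<^sub>m p q') (fst E) (fst Y)"
    "snd (block_lower X E Y) = four_block_mat (snd X) (0\<^sub>m p q') (snd E) (snd Y)"
    using c by (auto simp: block_lower_def)
  have 1: "poly_app (fst (block_lower X E Y)) h i = poly_app (fst X) h i"
    "poly_app (snd (block_lower X E Y)) h i = poly_app (snd X) h i" if "i < p" for h i
    unfolding e using that poly_app_four_block(1)[OF c(1) zero_carrier_mat c(5) c(3) that]
      poly_app_four_block(1)[OF c(2) zero_carrier_mat c(6) c(4) that] by (simp_all add: poly_app_zero)
  have 2: "poly_app (fst (block_lower X E Y)) h (p + i) = poly_app (fst E) h i + poly_app (fst Y) (\<lambda>j. h (q + j)) i"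
    "poly_app (snd (block_lower X E Y)) h (p + i) = poly_app (snd E) h i + poly_app (snd Y) (\<lambda>j. h (q + j)) i"
    if "i < p'" for h i
    unfolding e using that poly_app_four_block(2)[OF c(1) zero_carrier_mat c(5) c(3) that]
      poly_app_four_block(2)[OF c(2) zero_carrier_mat c(6) c(4) that] by simp_all
  show ?thesis
  proof
    assume L: ?L
    from has_nullD[OF L T] obtain h j where h: "\<And>j. j < q + q' \<Longrightarrow> degree (h j) \<le> d" "j < q + q'" "h j \<noteq> 0"
      "\<And>i. i < p + p' \<Longrightarrow> poly_app (snd (block_lower X E Y)) h i = pCons 0 (poly_app (fst (block_lower X E Y)) h i)"
      by blast
    have "?P h (\<lambda>j. h (q + j))"
    proof (intro conjI allI impI)
      show "(\<exists>j<q. h j \<noteq> 0) \<or> (\<exists>j<q'. h (q + j) \<noteq> 0)"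
      proof (cases "j < q")
        case False
        then have "j - q < q'" "h (q + (j - q)) \<noteq> 0" using h(2,3) by auto
        then show ?thesis by blast
      qed (use h in blast)
      show "poly_app (snd X) h i = pCons 0 (poly_app (fst X) h i)" if "i < p" for i
        using h(4)[of i] that 1[OF that] by simp
      show "poly_app (snd E) h i + poly_app (snd Y) (\<lambda>j. h (q + j)) i =
          pCons 0 (poly_app (fst E) h i + poly_app (fst Y) (\<lambda>j. h (q + j)) i)" if "i < p'" for i
        using h(4)[of "p + i"] that 2[OF that] by simp
    qed (use h(1) in auto)
    then show "\<exists>f g. ?P f g" by (rule_tac exI, rule_tac exI)
  next
    assume "\<exists>f g. ?P f g"
    then obtain f g where fg: "?P f g" by (elim exE)
    define h where "h j = (if j < q then f j else g (j - q))" for j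
    have hf: "poly_app M h i = poly_app M f i" if "dim_col M = q" for M i
      by (rule poly_app_cong[OF that]) (simp add: h_def)
    have hg: "poly_app M (\<lambda>j. h (q + j)) i = poly_app M g i" for M i
      by (rule poly_app_cong[OF refl]) (simp add: h_def)
    obtain j where j: "j < q + q'" "h j \<noteq> 0"
    proof -
      from fg consider j where "j < q" "f j \<noteq> 0" | j where "j < q'" "g j \<noteq> 0" by blast
      then show ?thesis
      proof cases
        case (1 j)
        then show ?thesis using that[of j] by (simp add: h_def)
      next
        case (2 j)
        then show ?thesis using that[of "q + j"] by (simp add: h_def)
      qed
    qed
    show ?L
    proof (rule has_nullI[where f = h, OF T _ j])
      show "degree (h j) \<le> d" if "j < q + q'" for j
        using fg that by (cases "j < q") (auto simp: h_def)
      show "poly_app (snd (block_lower X E Y)) h i = pCons 0 (poly_app (fst (block_lower X E Y)) h i)"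
        if i: "i < p + p'" for i
      proof (cases "i < p")
        case True
        then show ?thesis using fg c by (simp add: 1 hf)
      next
        case False
        then have "i = p + (i - p)" "i - p < p'" using i by auto
        then show ?thesis using fg c 2[of "i - p" h] by (simp add: hf hg)
      qed
    qed
  qed
qed

text \<open>Null vectors of \<open>kron_L m\<close> are multiples of (1, x, ..., x^(m-1)); this is
  how the degree \<open>m - 1\<close> arises.\<close>

lemma geometric_poly_sequence:
  fixes f :: "nat \<Rightarrow> complex poly"
  assumes "\<And>i. Suc i < m \<Longrightarrow> f (Suc i) = pCons 0 (f i)" "i < m"
  shows "f i = [:0, 1:] ^ i * f 0"
  using assms(2)
proof (induction i)
  case (Suc i)
  then have "f (Suc i) = pCons 0 (f i)" using assms(1) by simp
  also have "\<dots> = [:0, 1:] * f i" by simp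
  finally show ?case using Suc by (simp only: power_Suc) (simp only: mult.assoc Suc_lessD)
qed simp

lemma degree_linear_power_mult:
  fixes p :: "complex poly"
  shows "p \<noteq> 0 \<Longrightarrow> degree ([:c, 1:] ^ k * p) = k + degree p"
  by (subst degree_mult_eq) (auto simp: degree_power_eq)

text \<open>Where \<open>Delta_mat\<close> feeds \<open>f\<close> into the geometric chain of
  \<open>g\<close>, the chain restarts with \<open>h = x^r g(0) - \<epsilon> f(0)\<close>. Below the
  claimed degree \<open>h\<close> must vanish, so \<open>x^r\<close> divides \<open>f 0\<close>, and
  then \<open>f (m - 1)\<close> has degree at least \<open>m - 1 + r\<close>.\<close>

lemma null_degree_two_L:
  assumes m: "1 \<le> m" and r: "m + r \<le> n - r" and \<epsilon>: "\<epsilon> \<noteq> 0"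
  defines "T \<equiv> block_lower (kron_L m) (0\<^sub>m (n - 1) m, (Delta_mat m (n - 1) r \<epsilon>)\<^sup>T) (kron_L n)"
  shows "has_null T (m + r - 1)" "d < m + r - 1 \<Longrightarrow> \<not> has_null T d"
proof -
  have D: "(0\<^sub>m (n - 1) m, (Delta_mat m (n - 1) r \<epsilon>)\<^sup>T) \<in> matrix_pairs (n - 1) m"
    by (auto simp: matrix_pairs_iff Delta_mat_def)
  have nul: "has_null T d \<longleftrightarrow> (\<exists>f g. (\<forall>j<m. degree (f j) \<le> d) \<and> (\<forall>j<n. degree (g j) \<le> d) \<and>
    ((\<exists>j<m. f j \<noteq> 0) \<or> (\<exists>j<n. g j \<noteq> 0)) \<and> (\<forall>i<m - 1. f (Suc i) = pCons 0 (f i)) \<and>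
    (\<forall>i<n - 1. (if Suc i = r then Polynomial.smult \<epsilon> (f 0) else 0) + g (Suc i) = pCons 0 (g i)))" for d
    unfolding T_def has_null_block_lower_iff[OF kron_L_carrier kron_L_carrier D]
    unfolding fst_conv snd_conv kron_L_def
    using m by (simp add: poly_app_L_mat poly_app_Delta_mat poly_app_zero)
  let ?X = "[:0, 1:] :: complex poly"
  show "has_null T (m + r - 1)" unfolding nul
  \<comment> \<open>The witness makes \<open>h\<close> vanish: for \<open>r > 0\<close> it has
    \<open>f 0 = x^r\<close> and \<open>g 0 = \<epsilon>\<close>, and the chain of \<open>g\<close>
    stops before the index \<open>r\<close>.\<close>
  proof (rule exI[of _ "\<lambda>j. ?X ^ (j + r)"],
      rule exI[of _ "\<lambda>l. if l < r then Polynomial.smult \<epsilon> (?X ^ l) else 0"], intro conjI allI impI)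
    show "degree (if j < r then Polynomial.smult \<epsilon> (?X ^ j) else 0) \<le> m + r - 1" for j
      using m by (auto simp: degree_power_eq)
    show "(\<exists>j<m. ?X ^ (j + r) \<noteq> 0) \<or> (\<exists>j<n. (if j < r then Polynomial.smult \<epsilon> (?X ^ j) else 0) \<noteq> 0)"
      using m by (intro disjI1 exI[of _ 0]) auto
    show "(if Suc i = r then Polynomial.smult \<epsilon> (?X ^ (0 + r)) else 0) +
        (if Suc i < r then Polynomial.smult \<epsilon> (?X ^ Suc i) else 0) =
        pCons 0 (if i < r then Polynomial.smult \<epsilon> (?X ^ i) else 0)" for i
      by (cases "Suc i = r") auto
  qed (use m in \<open>auto simp: degree_power_eq\<close>)
  assume d: "d < m + r - 1"
  show "\<not> has_null T d"
  proof
    assume "has_null T d"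
    then obtain f g where deg: "\<And>j. j < m \<Longrightarrow> degree (f j) \<le> d" "\<And>j. j < n \<Longrightarrow> degree (g j) \<le> d"
      and ne: "(\<exists>j<m. f j \<noteq> 0) \<or> (\<exists>j<n. g j \<noteq> 0)" and f: "\<And>i. i < m - 1 \<Longrightarrow> f (Suc i) = pCons 0 (f i)"
      and g: "\<And>i. i < n - 1 \<Longrightarrow> (if Suc i = r then Polynomial.smult \<epsilon> (f 0) else 0) + g (Suc i) = pCons 0 (g i)"
      unfolding nul by blast
    have fi: "f i = ?X ^ i * f 0" if "i < m" for i
      using f that by (intro geometric_poly_sequence[of m]) auto
    have fd: "f 0 = 0 \<or> m - 1 + degree (f 0) \<le> d"
    proof (cases "f 0 = 0")
    case False
    have "f (m - 1) = ?X ^ (m - 1) * f 0" using m by (intro fi) simp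
    then have "degree (f (m - 1)) = m - 1 + degree (f 0)"
      using degree_linear_power_mult[OF False, of 0 "m - 1"] by simp
    then show ?thesis using deg(1)[of "m - 1"] m by simp
  qed simp
    have "f 0 = 0 \<and> (\<forall>l<n. g l = 0)"
    proof (cases "r = 0")
      case True
      have gi: "g i = ?X ^ i * g 0" if "i < n" for i
        using g that True by (intro geometric_poly_sequence[of n]) auto
      have "g 0 = 0"
      proof (rule ccontr)
        assume "g 0 \<noteq> 0"
        then have "n - 1 \<le> d" using deg(2)[of "n - 1"] m r gi[of "n - 1"] degree_linear_power_mult[of "g 0" 0 "n - 1"] by auto
        then show False using d r True by simp
      qed
      then show ?thesis using gi fd d True by auto
    next
      case False
      have g1: "g i = ?X ^ i * g 0" if "i < r" for i
        proof (rule geometric_poly_sequence[OF _ that])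
        show "g (Suc k) = pCons 0 (g k)" if "Suc k < r" for k using g[of k] that r m by auto
      qed
      define h where "h = ?X ^ r * g 0 - Polynomial.smult \<epsilon> (f 0)"
      have gr: "g r = h"
      proof -
        have "Polynomial.smult \<epsilon> (f 0) + g r = pCons 0 (g (r - 1))" using g[of "r - 1"] False r m by auto
        also have "\<dots> = ?X * (?X ^ (r - 1) * g 0)" using g1[of "r - 1"] False by simp
        also have "\<dots> = ?X ^ r * g 0" using False by (simp add: power_eq_if mult.assoc)
        finally show ?thesis by (simp add: h_def algebra_simps)
      qed
      have g2: "g (r + i) = ?X ^ i * h" if "i < n - r" for i
        proof -
        have "g (r + Suc k) = pCons 0 (g (r + k))" if "Suc k < n - r" for k using g[of "r + k"] that by auto
        from geometric_poly_sequence[of "n - r" "\<lambda>i. g (r + i)" i, OF this that] show ?thesis by (simp add: gr)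
      qed
      \<comment> \<open>A nonzero \<open>h\<close> would give \<open>g (n - 1)\<close> a degree of
        at least \<open>n - r - 1\<close>, hence of at least \<open>m + r - 1\<close>.\<close>
      have h0: "h = 0"
      proof (rule ccontr)
        assume "h \<noteq> 0"
        then have "n - r - 1 \<le> d"
          using deg(2)[of "r + (n - r - 1)"] g2[of "n - r - 1"] m r degree_linear_power_mult[of h 0 "n - r - 1"] by auto
        then show False using d r by simp
      qed
      then have eq: "?X ^ r * g 0 = Polynomial.smult \<epsilon> (f 0)" by (simp add: h_def)
      have g0: "g 0 = 0"
      proof (rule ccontr)
        assume g0: "g 0 \<noteq> 0"
        then have "f 0 \<noteq> 0" using eq by auto
        moreover have "degree (f 0) = r + degree (g 0)"
          using arg_cong[OF eq, of degree] degree_linear_power_mult[OF g0, of 0 r] \<epsilon> by simp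
        ultimately show False using fd d by auto
      qed
      then have "f 0 = 0" using eq \<epsilon> by simp
      moreover have "g l = 0" if "l < n" for l
      proof (cases "l < r")
        case True
        then show ?thesis using g1 g0 by simp
      next
        case False
        then show ?thesis using g2[of "l - r"] that h0 by auto
      qed
      ultimately show ?thesis by blast
    qed
    then show False using ne fi by auto
  qed
qed

text \<open>The null vectors of the pairs in (iii) and (iv) consist of a geometric sequence \<open>f\<close> and of a
  sequence \<open>h\<close> that is driven by \<open>f\<close>; in the two definitions the eigenvalue is \<open>z\<close> and \<open>\<infinity>\<close>.\<close>

definition finite_chain :: "nat \<Rightarrow> nat \<Rightarrow> nat \<Rightarrow> complex \<Rightarrow> complex \<Rightarrow> nat \<Rightarrow> (nat \<Rightarrow> complex poly) \<Rightarrow> (nat \<Rightarrow> complex poly) \<Rightarrow> bool" where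
  "finite_chain m n r z \<epsilon> d f h \<longleftrightarrow> (\<forall>j<m. degree (f j) \<le> d) \<and> (\<forall>j<n. degree (h j) \<le> d) \<and>
    ((\<exists>j<m. f j \<noteq> 0) \<or> (\<exists>j<n. h j \<noteq> 0)) \<and> (\<forall>i<m - 1. f (Suc i) = pCons 0 (f i)) \<and>
    (\<forall>t<n. [:- z, 1:] * h t = (if 0 < t then h (t - 1) else 0) + (if t = n - r then Polynomial.smult \<epsilon> (f 0) else 0))"

definition infinite_chain :: "nat \<Rightarrow> nat \<Rightarrow> nat \<Rightarrow> complex \<Rightarrow> nat \<Rightarrow> (nat \<Rightarrow> complex poly) \<Rightarrow> (nat \<Rightarrow> complex poly) \<Rightarrow> bool" where
  "infinite_chain m n r \<epsilon> d f h \<longleftrightarrow> (\<forall>j<m. degree (f j) \<le> d) \<and> (\<forall>j<n. degree (h j) \<le> d) \<and>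
    ((\<exists>j<m. f j \<noteq> 0) \<or> (\<exists>j<n. h j \<noteq> 0)) \<and> (\<forall>i<m - 1. f (Suc i) = pCons 0 (f i)) \<and>
    (\<forall>t<n. h t = pCons 0 ((if 0 < t then h (t - 1) else 0) + (if t = n - r then Polynomial.smult \<epsilon> (f (m - 1)) else 0)))"

text \<open>The chain \<open>h\<close> is zero until it meets \<open>f\<close>; from there on,
  \<open>(x - z)^(t+1)\<close> times its member at \<open>n - r + t\<close> is
  \<open>\<epsilon> f(0)\<close>. So \<open>(x - z)^r\<close> divides \<open>f 0\<close>, and
  \<open>f (m - 1)\<close> has degree at least \<open>m - 1 + r\<close>.\<close>

lemma finite_chain_least:
  assumes m: "1 \<le> m" and r: "r \<le> n" and \<epsilon>: "\<epsilon> \<noteq> 0"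
  shows "\<exists>f h. finite_chain m n r z \<epsilon> (m + r - 1) f h" "finite_chain m n r z \<epsilon> d f h \<Longrightarrow> m + r - 1 \<le> d"
proof -
  let ?X = "[:0, 1:] :: complex poly" and ?P = "[:- z, 1:]"
  \<comment> \<open>The extreme case \<open>f 0 = (x - z)^r\<close>, whose factors are taken off one
    at a time along \<open>h\<close>.\<close>
  define h' where "h' t = (if t < n - r then 0 else Polynomial.smult \<epsilon> (?P ^ (n - 1 - t)))" for t
  have "finite_chain m n r z \<epsilon> (m + r - 1) (\<lambda>j. ?X ^ j * ?P ^ r) h'"
    unfolding finite_chain_def
  proof (intro conjI allI impI)
    fix t assume t: "t < n"
    show "?P * h' t = (if 0 < t then h' (t - 1) else 0) + (if t = n - r then Polynomial.smult \<epsilon> (?X ^ 0 * ?P ^ r) else 0)"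
    proof (cases "t < n - r")
      case True
      then show ?thesis by (auto simp: h'_def)
    next
      case False
      have *: "?P * h' t = Polynomial.smult \<epsilon> (?P ^ (n - t))"
        using False t by (simp add: h'_def power_eq_if[of ?P "n - t"])
      show ?thesis
      proof (cases "t = n - r")
        case True
        then have "n - t = r" using r by simp
        then show ?thesis unfolding * using True by (auto simp: h'_def)
      next
        case f: False
        then have "n - 1 - (t - 1) = n - t" "0 < t" "\<not> t - 1 < n - r" using False t by auto
        then show ?thesis unfolding * using f by (simp add: h'_def)
      qed
    qed
  next
    show "degree (h' j) \<le> m + r - 1" if "j < n" for j
      using m r that by (auto simp: h'_def degree_power_eq)
    show "degree (?X ^ j * ?P ^ r) \<le> m + r - 1" if "j < m" for j
      using that by (subst degree_linear_power_mult) (auto simp: degree_power_eq)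
    show "(\<exists>j<m. ?X ^ j * ?P ^ r \<noteq> 0) \<or> (\<exists>j<n. h' j \<noteq> 0)"
      using m by (intro disjI1 exI[of _ 0]) auto
  qed (simp add: mult.assoc)
  then show "\<exists>f h. finite_chain m n r z \<epsilon> (m + r - 1) f h" by blast
  assume "finite_chain m n r z \<epsilon> d f h"
  then have deg: "\<And>j. j < m \<Longrightarrow> degree (f j) \<le> d"
    and ne: "(\<exists>j<m. f j \<noteq> 0) \<or> (\<exists>j<n. h j \<noteq> 0)" and f: "\<And>i. i < m - 1 \<Longrightarrow> f (Suc i) = pCons 0 (f i)"
    and h: "\<And>t. t < n \<Longrightarrow> ?P * h t = (if 0 < t then h (t - 1) else 0) + (if t = n - r then Polynomial.smult \<epsilon> (f 0) else 0)"
    unfolding finite_chain_def by blast+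
  have fi: "f i = ?X ^ i * f 0" if "i < m" for i
    using f that by (intro geometric_poly_sequence[of m]) auto
  have fd: "f 0 = 0 \<or> m - 1 + degree (f 0) \<le> d"
  proof (cases "f 0 = 0")
    case False
    have "f (m - 1) = ?X ^ (m - 1) * f 0" using m by (intro fi) simp
    then have "degree (f (m - 1)) = m - 1 + degree (f 0)"
      using degree_linear_power_mult[OF False, of 0 "m - 1"] by simp
    then show ?thesis using deg[of "m - 1"] m by simp
  qed simp
  have low: "t < n - r \<Longrightarrow> h t = 0" for t
  proof (induction t)
    case 0
    then have "?P * h 0 = 0" using h[of 0] by simp
    then have "?P = 0 \<or> h 0 = 0" by (simp only: mult_eq_0_iff)
    then show ?case by simp
  next
    case (Suc t)
    then have "?P * h (Suc t) = 0" using h[of "Suc t"] by simp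
    then have "?P = 0 \<or> h (Suc t) = 0" by (simp only: mult_eq_0_iff)
    then show ?case by simp
  qed
  have high: "n - r + t < n \<Longrightarrow> ?P ^ Suc t * h (n - r + t) = Polynomial.smult \<epsilon> (f 0)" for t
  proof (induction t)
    case 0
    have "(if 0 < n - r then h (n - r - 1) else 0) = 0" using low by simp
    then show ?case using h[of "n - r"] 0 by simp
  next
    case (Suc t)
    have "?P ^ Suc (Suc t) * h (n - r + Suc t) = ?P ^ Suc t * (?P * h (n - r + Suc t))" by (simp only: power_Suc ac_simps)
    also have "?P * h (n - r + Suc t) = h (n - r + t)" using h[of "n - r + Suc t"] Suc.prems by simp
    finally show ?case using Suc by simp
  qed
  have f0: "f 0 \<noteq> 0"
  proof
    assume z: "f 0 = 0"
    have "h t = 0" if t: "t < n" for t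
    proof (cases "t < n - r")
      case False
      then have "?P ^ Suc (t - (n - r)) * h t = 0" using high[of "t - (n - r)"] t z by (simp del: power_Suc)
      then have "?P ^ Suc (t - (n - r)) = 0 \<or> h t = 0" by (simp only: mult_eq_0_iff)
      moreover have "?P ^ Suc (t - (n - r)) \<noteq> 0" by (rule power_not_zero) simp
      ultimately show ?thesis by blast
    qed (use low in auto)
    then show False using ne fi z by auto
  qed
  show "m + r - 1 \<le> d"
  proof (cases r)
    case 0
    then show ?thesis using fd f0 by simp
  next
    case (Suc s)
    have e: "?P ^ r * h (n - 1) = Polynomial.smult \<epsilon> (f 0)" using high[of s] r Suc by simp
    then have "h (n - 1) \<noteq> 0" using f0 \<epsilon> by auto
    then have "r \<le> degree (f 0)" using arg_cong[OF e, of degree] \<epsilon> by (simp add: degree_linear_power_mult)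
    then show ?thesis using fd f0 by simp
  qed
qed

text \<open>At infinity the chain multiplies instead of dividing: its member at
  \<open>n - r + t\<close> is \<open>\<epsilon> x^(t+m) f(0)\<close>. So for \<open>r > 0\<close>
  the degree is decided by the last member \<open>h (n - 1)\<close> rather than by
  \<open>f\<close>.\<close>

lemma infinite_chain_least:
  assumes m: "1 \<le> m" and r: "r \<le> n" and \<epsilon>: "\<epsilon> \<noteq> 0"
  shows "\<exists>f h. infinite_chain m n r \<epsilon> (m + r - 1) f h" "infinite_chain m n r \<epsilon> d f h \<Longrightarrow> m + r - 1 \<le> d"
proof -
  let ?X = "[:0, 1:] :: complex poly"
  have XS: "pCons 0 (Polynomial.smult a (?X ^ k)) = Polynomial.smult a (?X ^ Suc k)" for a k by simp
  define h' where "h' t = (if t < n - r then 0 else Polynomial.smult \<epsilon> (?X ^ (t - (n - r) + m)))" for t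
  have "infinite_chain m n r \<epsilon> (m + r - 1) (\<lambda>j. ?X ^ j) h'"
    unfolding infinite_chain_def
  proof (intro conjI allI impI)
    fix t assume t: "t < n"
    show "h' t = pCons 0 ((if 0 < t then h' (t - 1) else 0) + (if t = n - r then Polynomial.smult \<epsilon> (?X ^ (m - 1)) else 0))"
    proof (cases "t < n - r")
      case True
      then show ?thesis by (auto simp: h'_def)
    next
      case False
      show ?thesis
      proof (cases "t = n - r")
        case True
        then have "(if 0 < t then h' (t - 1) else 0) = 0" by (auto simp: h'_def)
        moreover have "Suc (m - 1) = m" using m by simp
        ultimately show ?thesis using True XS[of \<epsilon> "m - 1"] by (simp add: h'_def del: power_Suc)
      next
        case f: False
        then have "Suc (t - 1 - (n - r) + m) = t - (n - r) + m" "0 < t" "\<not> t - 1 < n - r" using False t by auto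
        then show ?thesis using f False XS[of \<epsilon> "t - 1 - (n - r) + m"] by (simp add: h'_def del: power_Suc)
      qed
    qed
  next
    show "degree (h' j) \<le> m + r - 1" if "j < n" for j
      using m r that by (auto simp: h'_def degree_power_eq)
    show "(\<exists>j<m. ?X ^ j \<noteq> 0) \<or> (\<exists>j<n. h' j \<noteq> 0)"
      using m by (intro disjI1 exI[of _ 0]) auto
  qed (auto simp: degree_power_eq)
  then show "\<exists>f h. infinite_chain m n r \<epsilon> (m + r - 1) f h" by blast
  assume "infinite_chain m n r \<epsilon> d f h"
  then have deg: "\<And>j. j < m \<Longrightarrow> degree (f j) \<le> d" "\<And>j. j < n \<Longrightarrow> degree (h j) \<le> d"
    and ne: "(\<exists>j<m. f j \<noteq> 0) \<or> (\<exists>j<n. h j \<noteq> 0)" and f: "\<And>i. i < m - 1 \<Longrightarrow> f (Suc i) = pCons 0 (f i)"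
    and h: "\<And>t. t < n \<Longrightarrow> h t = pCons 0 ((if 0 < t then h (t - 1) else 0) + (if t = n - r then Polynomial.smult \<epsilon> (f (m - 1)) else 0))"
    unfolding infinite_chain_def by blast+
  have fi: "f i = ?X ^ i * f 0" if "i < m" for i
    using f that by (intro geometric_poly_sequence[of m]) auto
  have fd: "f 0 = 0 \<or> m - 1 + degree (f 0) \<le> d"
  proof (cases "f 0 = 0")
    case False
    have "f (m - 1) = ?X ^ (m - 1) * f 0" using m by (intro fi) simp
    then have "degree (f (m - 1)) = m - 1 + degree (f 0)"
      using degree_linear_power_mult[OF False, of 0 "m - 1"] by simp
    then show ?thesis using deg(1)[of "m - 1"] m by simp
  qed simp
  have low: "t < n - r \<Longrightarrow> h t = 0" for t
  proof (induction t)
    case 0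
    then show ?case using h[of 0] by simp
  next
    case (Suc t)
    then show ?case using h[of "Suc t"] by simp
  qed
  have high: "n - r + t < n \<Longrightarrow> h (n - r + t) = ?X ^ (t + m) * Polynomial.smult \<epsilon> (f 0)" for t
  proof (induction t)
    case 0
    have "(if 0 < n - r then h (n - r - 1) else 0) = 0" using low by simp
    then have "h (n - r) = ?X * Polynomial.smult \<epsilon> (?X ^ (m - 1) * f 0)"
      using h[of "n - r"] 0 fi[of "m - 1"] m by simp
    also have "\<dots> = ?X * ?X ^ (m - 1) * Polynomial.smult \<epsilon> (f 0)" by (simp add: mult.assoc)
    also have "?X * ?X ^ (m - 1) = ?X ^ m" using m by (simp add: power_eq_if)
    finally show ?case by simp
  next
    case (Suc t)
    have "h (n - r + Suc t) = ?X * h (n - r + t)" using h[of "n - r + Suc t"] Suc.prems by simp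
    also have "\<dots> = ?X * (?X ^ (t + m) * Polynomial.smult \<epsilon> (f 0))" using Suc by simp
    finally show ?case by (simp only: power_Suc add_Suc mult.assoc)
  qed
  have f0: "f 0 \<noteq> 0"
  proof
    assume z: "f 0 = 0"
    have "h t = 0" if t: "t < n" for t
    proof (cases "t < n - r")
      case False
      then show ?thesis using high[of "t - (n - r)"] t z by simp
    qed (use low in auto)
    then show False using ne fi z by auto
  qed
  show "m + r - 1 \<le> d"
  proof (cases r)
    case 0
    then show ?thesis using fd f0 by simp
  next
    case (Suc s)
    have "h (n - 1) = ?X ^ (s + m) * Polynomial.smult \<epsilon> (f 0)" using high[of s] r Suc by simp
    moreover have "Polynomial.smult \<epsilon> (f 0) \<noteq> 0" using f0 \<epsilon> by simp
    ultimately have "degree (h (n - 1)) = s + m + degree (Polynomial.smult \<epsilon> (f 0))"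
      using degree_linear_power_mult[of "Polynomial.smult \<epsilon> (f 0)" 0 "s + m"] by simp
    then show ?thesis using deg(2)[of "n - 1"] r Suc by simp
  qed
qed

section \<open>Least null degrees of the explicit pairs\<close>

lemma Delta_carrier [simp]: "Delta_mat p q r \<epsilon> \<in> carrier_mat p q" "Nabla_mat p q r \<epsilon> \<in> carrier_mat p q"
  by (simp_all add: Delta_mat_def Nabla_mat_def)

text \<open>Out of range the perturbation vanishes. The unperturbed case \<open>r = 0\<close> has
  the index 0 in (i), (ii) and (iv), but the index \<open>n + 1\<close> in (iii).\<close>

lemma Delta_0: "q < r \<or> r = 0 \<Longrightarrow> Delta_mat p q r \<epsilon> = 0\<^sub>m p q"
  "q < r \<or> r = 0 \<Longrightarrow> Nabla_mat p q r \<epsilon> = 0\<^sub>m p q"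
  by (auto simp: Delta_mat_def Nabla_mat_def intro!: eq_matI)

lemma block_lower_zero:
  assumes "X \<in> matrix_pairs p q" "Y \<in> matrix_pairs p' q'"
  shows "block_lower X (0\<^sub>m p' q, 0\<^sub>m p' q) Y = X \<boxplus> Y" "block_upper X (0\<^sub>m p q', 0\<^sub>m p q') Y = X \<boxplus> Y"
  using assms by (auto simp: block_lower_def block_upper_def pair_sum_eq matrix_pairs_iff)

definition least_null :: "mpair \<Rightarrow> nat \<Rightarrow> bool" where
  "least_null X d \<longleftrightarrow> has_null X d \<and> (\<forall>e<d. \<not> has_null X e)"

lemma least_left_null_eq: "least_left_null X d \<longleftrightarrow> least_null (transpose_pair X) d"
  by (simp add: least_left_null_def least_null_def)

lemma least_null_unique: "least_null X d \<Longrightarrow> least_null X e \<Longrightarrow> d = e"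
  unfolding least_null_def by (meson linorder_neqE_nat)

lemma least_null_equiv: "pair_equiv X Y \<Longrightarrow> least_null X d \<Longrightarrow> least_null Y d"
  unfolding least_null_def using has_null_equiv[of X Y] has_null_equiv[OF pair_equiv_sym, of X Y] by auto

lemma least_nullI:
  "\<exists>f h. P d f h \<Longrightarrow> (\<And>e f h. P e f h \<Longrightarrow> d \<le> e) \<Longrightarrow> (\<And>e. has_null X e \<longleftrightarrow> (\<exists>f h. P e f h)) \<Longrightarrow> least_null X d"
  unfolding least_null_def by (meson not_le)

lemma all_rev_iff: "(\<forall>l<n. P l (n - 1 - l)) \<longleftrightarrow> (\<forall>t<n. P (n - 1 - t) (t :: nat))"
proof -
  have "n - 1 - (n - 1 - l) = l" "n - 1 - l < n" if "l < n" for l using that by auto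
  then show ?thesis by metis
qed

lemma rev_less: "(\<forall>j<n. Q (n - 1 - j)) \<longleftrightarrow> (\<forall>j<n. Q (j :: nat))" "(\<exists>j<n. Q (n - 1 - j)) \<longleftrightarrow> (\<exists>j<n. Q j)"
  using all_rev_iff[of n "\<lambda>_. Q"] all_rev_iff[of n "\<lambda>_ l. \<not> Q l"] by auto

text \<open>The index \<open>n - r + 1\<close>, counted from 1, is the position \<open>n - r\<close>
  at which \<open>finite_chain\<close> is driven; the transposed Jordan block makes the chain
  ascend.\<close>

lemma least_left_null_LT_D_finite:
  assumes m: "1 \<le> m" and r: "r \<le> n" and \<epsilon>: "\<epsilon> \<noteq> 0"
  shows "least_left_null (block_upper (kron_LT m) (0\<^sub>m m n, Delta_mat m n (n - r + 1) \<epsilon>) (kron_D n (Fin z))) (m + r - 1)"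
proof -
  have D: "(0\<^sub>m m n, Delta_mat m n (n - r + 1) \<epsilon>) \<in> matrix_pairs m n" by (auto simp: matrix_pairs_iff)
  have E: "transpose_pair (0\<^sub>m m n, Delta_mat m n (n - r + 1) \<epsilon>) \<in> matrix_pairs n m" using D by simp
  have J: "transpose_pair (kron_D n (Fin z)) \<in> matrix_pairs n n" by simp
  \<comment> \<open>This rewrites a row of the null vector equation with coupling term
    \<open>c\<close> as one step of the chain.\<close>
  have eq: "c + (Polynomial.smult z g + y) = pCons 0 g \<longleftrightarrow> [:- z, 1:] * g = y + c" for c y g :: "complex poly"
    by (auto simp: algebra_simps)
  show ?thesis unfolding least_left_null_eq transpose_block_upper[OF kron_LT_carrier kron_D_carrier D]
    unfolding kron_LT_eq transpose_pair_simps(3)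
  proof (rule least_nullI[where P = "finite_chain m n r z \<epsilon>"])
    show "has_null (block_lower (kron_L m) (transpose_pair (0\<^sub>m m n, Delta_mat m n (n - r + 1) \<epsilon>))
        (transpose_pair (kron_D n (Fin z)))) e \<longleftrightarrow> (\<exists>f h. finite_chain m n r z \<epsilon> e f h)" for e
      unfolding has_null_block_lower_iff[OF kron_L_carrier J E] finite_chain_def
      unfolding transpose_pair_simps fst_conv snd_conv kron_L_def kron_D.simps
      using m by (simp add: poly_app_L_mat poly_app_Delta_mat poly_app_jordan_block poly_app_zero poly_app_one eq cong: all_cong)
  qed (use finite_chain_least[OF m r \<epsilon>] in blast)+
qed

text \<open>\<open>Nabla_mat\<close> has its entry in the last row, so its transpose reads
  \<open>f (m - 1)\<close>; the coupling sits in the first component and hence comes with a factor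
  x.\<close>

lemma least_left_null_LT_D_infinite:
  assumes m: "1 \<le> m" and r: "r \<le> n" and \<epsilon>: "\<epsilon> \<noteq> 0"
  shows "least_left_null (block_upper (kron_LT m) (Nabla_mat m n (n - r + 1) \<epsilon>, 0\<^sub>m m n) (kron_D n Infty)) (m + r - 1)"
proof -
  have D: "(Nabla_mat m n (n - r + 1) \<epsilon>, 0\<^sub>m m n) \<in> matrix_pairs m n" by (auto simp: matrix_pairs_iff)
  have E: "transpose_pair (Nabla_mat m n (n - r + 1) \<epsilon>, 0\<^sub>m m n) \<in> matrix_pairs n m" using D by simp
  have J: "transpose_pair (kron_D n Infty) \<in> matrix_pairs n n" by simp
  show ?thesis unfolding least_left_null_eq transpose_block_upper[OF kron_LT_carrier kron_D_carrier D]
    unfolding kron_LT_eq transpose_pair_simps(3)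
  proof (rule least_nullI[where P = "infinite_chain m n r \<epsilon>"])
    show "has_null (block_lower (kron_L m) (transpose_pair (Nabla_mat m n (n - r + 1) \<epsilon>, 0\<^sub>m m n))
        (transpose_pair (kron_D n Infty))) e \<longleftrightarrow> (\<exists>f h. infinite_chain m n r \<epsilon> e f h)" for e
      unfolding has_null_block_lower_iff[OF kron_L_carrier J E] infinite_chain_def
      unfolding transpose_pair_simps fst_conv snd_conv kron_L_def kron_D.simps
      using m by (simp add: poly_app_L_mat poly_app_Delta_mat poly_app_jordan_block poly_app_zero poly_app_one
          add.commute cong: all_cong)
  qed (use infinite_chain_least[OF m r \<epsilon>] in blast)+
qed

lemma reversed_index:
  assumes "l < n" "r \<le> n"
  shows "0 < n - 1 - l \<longleftrightarrow> Suc l < n" "n - 1 - l = n - r \<longleftrightarrow> Suc l = r"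
    "Suc l < n \<Longrightarrow> n - 1 - (n - 1 - l - 1) = Suc l" "n - 1 - (n - 1 - l) = l" "n - 1 - l < n"
    "Suc l < n \<Longrightarrow> n - 1 - l - 1 = n - 1 - Suc l"
  using assms by auto

text \<open>Without transposition the Jordan block makes the chain descend. The reversal of
  \<open>l\<close> to \<open>n - 1 - l\<close> takes the position \<open>r - 1\<close> to
  \<open>n - r\<close>, so that one degree computation serves both (iii) and (iv).\<close>

lemma chain_reversed:
  assumes r: "r \<le> n"
  shows "(\<exists>f h. finite_chain m n r z \<epsilon> d f h) \<longleftrightarrow> (\<exists>f g. (\<forall>j<m. degree (f j) \<le> d) \<and> (\<forall>j<n. degree (g j) \<le> d) \<and>
    ((\<exists>j<m. f j \<noteq> 0) \<or> (\<exists>j<n. g j \<noteq> 0)) \<and> (\<forall>i<m - 1. f (Suc i) = pCons 0 (f i)) \<and>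
    (\<forall>l<n. [:- z, 1:] * g l = (if Suc l < n then g (Suc l) else 0) + (if Suc l = r then Polynomial.smult \<epsilon> (f 0) else 0)))"
    (is "_ \<longleftrightarrow> (\<exists>f g. ?P f g)")
    and "(\<exists>f h. infinite_chain m n r \<epsilon> d f h) \<longleftrightarrow> (\<exists>f g. (\<forall>j<m. degree (f j) \<le> d) \<and> (\<forall>j<n. degree (g j) \<le> d) \<and>
    ((\<exists>j<m. f j \<noteq> 0) \<or> (\<exists>j<n. g j \<noteq> 0)) \<and> (\<forall>i<m - 1. f (Suc i) = pCons 0 (f i)) \<and>
    (\<forall>l<n. g l = pCons 0 ((if Suc l < n then g (Suc l) else 0) + (if Suc l = r then Polynomial.smult \<epsilon> (f (m - 1)) else 0))))"
    (is "_ \<longleftrightarrow> (\<exists>f g. ?Q f g)")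
proof -
  have 1: "(\<forall>t<n. [:- z, 1:] * g (n - 1 - t) = (if 0 < t then g (n - 1 - (t - 1)) else 0) + (if t = n - r then c else 0)) \<longleftrightarrow>
    (\<forall>l<n. [:- z, 1:] * g l = (if Suc l < n then g (Suc l) else 0) + (if Suc l = r then c else 0))" for g c
    unfolding all_rev_iff[symmetric, of n "\<lambda>x t. [:- z, 1:] * g x = (if 0 < t then g (n - 1 - (t - 1)) else 0) + (if t = n - r then c else 0)"]
    using reversed_index[OF _ r] by (intro all_cong) auto
  have 2: "(\<forall>l<n. [:- z, 1:] * g (n - 1 - l) = (if Suc l < n then g (n - 1 - Suc l) else 0) + (if Suc l = r then c else 0)) \<longleftrightarrow>
    (\<forall>t<n. [:- z, 1:] * g t = (if 0 < t then g (t - 1) else 0) + (if t = n - r then c else 0))" for g c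
    unfolding all_rev_iff[of n "\<lambda>x t. [:- z, 1:] * g t = (if Suc x < n then g (n - 1 - Suc x) else 0) + (if Suc x = r then c else 0)"]
    using reversed_index[OF reversed_index(5)[OF _ r] r] reversed_index[OF _ r] by (intro all_cong) auto
  have 3: "(\<forall>t<n. g (n - 1 - t) = pCons 0 ((if 0 < t then g (n - 1 - (t - 1)) else 0) + (if t = n - r then c else 0))) \<longleftrightarrow>
    (\<forall>l<n. g l = pCons 0 ((if Suc l < n then g (Suc l) else 0) + (if Suc l = r then c else 0)))" for g and c :: "complex poly"
    unfolding all_rev_iff[symmetric, of n "\<lambda>x t. g x = pCons 0 ((if 0 < t then g (n - 1 - (t - 1)) else 0) + (if t = n - r then c else 0))"]
    using reversed_index[OF _ r] by (intro all_cong) auto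
  have 4: "(\<forall>l<n. g (n - 1 - l) = pCons 0 ((if Suc l < n then g (n - 1 - Suc l) else 0) + (if Suc l = r then c else 0))) \<longleftrightarrow>
    (\<forall>t<n. g t = pCons 0 ((if 0 < t then g (t - 1) else 0) + (if t = n - r then c else 0)))" for g and c :: "complex poly"
    unfolding all_rev_iff[of n "\<lambda>x t. g t = pCons 0 ((if Suc x < n then g (n - 1 - Suc x) else 0) + (if Suc x = r then c else 0))"]
    using reversed_index[OF reversed_index(5)[OF _ r] r] reversed_index[OF _ r] by (intro all_cong) auto
  have a: "finite_chain m n r z \<epsilon> d f (\<lambda>t. g (n - 1 - t)) \<longleftrightarrow> ?P f g" for f g
    unfolding finite_chain_def 1 rev_less[of n "\<lambda>j. degree (g j) \<le> d"] rev_less[of n "\<lambda>j. g j \<noteq> 0"] ..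
  have b: "?P f (\<lambda>t. g (n - 1 - t)) \<longleftrightarrow> finite_chain m n r z \<epsilon> d f g" for f g
    unfolding finite_chain_def 2 rev_less[of n "\<lambda>j. degree (g j) \<le> d"] rev_less[of n "\<lambda>j. g j \<noteq> 0"] ..
  show "(\<exists>f h. finite_chain m n r z \<epsilon> d f h) \<longleftrightarrow> (\<exists>f g. ?P f g)"
    by (intro iffI; elim exE) (rule_tac exI, rule_tac exI, erule a[THEN iffD2] b[THEN iffD2])+
  have a: "infinite_chain m n r \<epsilon> d f (\<lambda>t. g (n - 1 - t)) \<longleftrightarrow> ?Q f g" for f g
    unfolding infinite_chain_def 3 rev_less[of n "\<lambda>j. degree (g j) \<le> d"] rev_less[of n "\<lambda>j. g j \<noteq> 0"] ..
  have b: "?Q f (\<lambda>t. g (n - 1 - t)) \<longleftrightarrow> infinite_chain m n r \<epsilon> d f g" for f g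
    unfolding infinite_chain_def 4 rev_less[of n "\<lambda>j. degree (g j) \<le> d"] rev_less[of n "\<lambda>j. g j \<noteq> 0"] ..
  show "(\<exists>f h. infinite_chain m n r \<epsilon> d f h) \<longleftrightarrow> (\<exists>f g. ?Q f g)"
    by (intro iffI; elim exE) (rule_tac exI, rule_tac exI, erule a[THEN iffD2] b[THEN iffD2])+
qed

lemma least_null_L_D_finite:
  assumes m: "1 \<le> m" and r: "r \<le> n" and \<epsilon>: "\<epsilon> \<noteq> 0"
  shows "least_null (block_lower (kron_L m) (0\<^sub>m n m, (Delta_mat m n r \<epsilon>)\<^sup>T) (kron_D n (Fin z))) (m + r - 1)"
proof -
  have E: "(0\<^sub>m n m, (Delta_mat m n r \<epsilon>)\<^sup>T) \<in> matrix_pairs n m" by (auto simp: matrix_pairs_iff)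
  have eq: "c + (Polynomial.smult z g + y) = pCons 0 g \<longleftrightarrow> [:- z, 1:] * g = y + c" for c y g :: "complex poly"
    by (auto simp: algebra_simps)
  show ?thesis
  proof (rule least_nullI[where P = "finite_chain m n r z \<epsilon>"])
    show "has_null (block_lower (kron_L m) (0\<^sub>m n m, (Delta_mat m n r \<epsilon>)\<^sup>T) (kron_D n (Fin z))) e \<longleftrightarrow>
        (\<exists>f h. finite_chain m n r z \<epsilon> e f h)" for e
      unfolding has_null_block_lower_iff[OF kron_L_carrier kron_D_carrier E] chain_reversed(1)[OF r]
      unfolding fst_conv snd_conv kron_L_def kron_D.simps
      using m by (simp add: poly_app_L_mat poly_app_Delta_mat poly_app_jordan_block poly_app_zero poly_app_one eq cong: all_cong)
  qed (use finite_chain_least[OF m r \<epsilon>] in blast)+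
qed

lemma least_null_L_D_infinite:
  assumes m: "1 \<le> m" and r: "r \<le> n" and \<epsilon>: "\<epsilon> \<noteq> 0"
  shows "least_null (block_lower (kron_L m) ((Nabla_mat m n r \<epsilon>)\<^sup>T, 0\<^sub>m n m) (kron_D n Infty)) (m + r - 1)"
proof -
  have E: "((Nabla_mat m n r \<epsilon>)\<^sup>T, 0\<^sub>m n m) \<in> matrix_pairs n m" by (auto simp: matrix_pairs_iff)
  show ?thesis
  proof (rule least_nullI[where P = "infinite_chain m n r \<epsilon>"])
    show "has_null (block_lower (kron_L m) ((Nabla_mat m n r \<epsilon>)\<^sup>T, 0\<^sub>m n m) (kron_D n Infty)) e \<longleftrightarrow>
        (\<exists>f h. infinite_chain m n r \<epsilon> e f h)" for e
      unfolding has_null_block_lower_iff[OF kron_L_carrier kron_D_carrier E] chain_reversed(2)[OF r]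
      unfolding fst_conv snd_conv kron_L_def kron_D.simps
      using m by (simp add: poly_app_L_mat poly_app_Delta_mat poly_app_jordan_block poly_app_zero poly_app_one
          add.commute cong: all_cong)
  qed (use infinite_chain_least[OF m r \<epsilon>] in blast)+
qed

text \<open>Exchange of the two index blocks; the pair for the eigenvalue infinity in (iv) is
  written with the \<open>kron_D\<close> block first.\<close>

lemma block_upper_equiv_block_lower:
  assumes X: "X \<in> matrix_pairs p q" and Y: "Y \<in> matrix_pairs p' q'" and D: "D \<in> matrix_pairs p q'"
  shows "pair_equiv (block_upper X D Y) (block_lower Y D X)"
proof -
  define E where "E = (\<lambda>m n. four_block_mat (0\<^sub>m m n) (1\<^sub>m m) (1\<^sub>m n) (0\<^sub>m n m) :: complex mat)"
  have E: "E m n \<in> carrier_mat (m + n) (n + m)" for m n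
    unfolding E_def by (rule four_block_carrier_mat) auto
  have EE: "E m n * E n m = 1\<^sub>m (m + n)" for m n
    unfolding E_def by (subst mult_four_block_mat[of _ m n _ m _ n _ _ m _ n]) auto
  have c: "four_block_mat A C (0\<^sub>m p' q) B * E q q' = E p p' * four_block_mat B (0\<^sub>m p' q) C A"
    if "A \<in> carrier_mat p q" "B \<in> carrier_mat p' q'" "C \<in> carrier_mat p q'" for A B C
    using that unfolding E_def
    by (subst mult_four_block_mat[of _ p q _ q' _ p' _ _ q' _ q], simp_all)
       (subst mult_four_block_mat[of _ p p' _ p _ p' _ _ q' _ q], simp_all)
  show ?thesis
    by (rule pair_equiv_intro_comm[of _ "p + p'" "q + q'" _ "E p p'" "E p' p" "E q q'" "E q' q"])
       (use assms E[of p p'] E[of p' p] E[of q q'] E[of q' q] EE block_carrier[OF X Y] block_carrier[OF Y X]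
        in \<open>auto simp: add.commute[of p' p] add.commute[of q' q] c block_upper_def block_lower_def matrix_pairs_iff\<close>)
qed

lemma least_left_null_two_LT:
  assumes m: "1 \<le> m" and r: "m + r \<le> n - r" and \<epsilon>: "\<epsilon> \<noteq> 0"
  shows "least_left_null (block_upper (kron_LT m) (0\<^sub>m m (n - 1), Delta_mat m (n - 1) r \<epsilon>) (kron_LT n)) (m + r - 1)"
proof -
  have D: "(0\<^sub>m m (n - 1), Delta_mat m (n - 1) r \<epsilon>) \<in> matrix_pairs m (n - 1)" by (auto simp: matrix_pairs_iff)
  have "transpose_pair (0\<^sub>m m (n - 1), Delta_mat m (n - 1) r \<epsilon>) = (0\<^sub>m (n - 1) m, (Delta_mat m (n - 1) r \<epsilon>)\<^sup>T)"
    by (simp add: transpose_pair_def)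
  then show ?thesis
    unfolding least_left_null_eq transpose_block_upper[OF kron_LT_carrier kron_LT_carrier D]
    unfolding kron_LT_eq transpose_pair_simps(3) least_null_def
    using null_degree_two_L[OF assms] by simp
qed

text \<open>The case \<open>r = 0\<close> of the degree computations, in which the coupling block is
  zero.\<close>

lemma least_left_null_members:
  assumes a: "1 \<le> a"
  shows "a \<le> b \<Longrightarrow> least_left_null (kron_LT a \<boxplus> kron_LT b) (a - 1)"
    "least_left_null (kron_LT a \<boxplus> kron_D b \<mu>) (a - 1)"
    "least_null (kron_L a \<boxplus> kron_D b \<mu>) (a - 1)"
proof -
  show "a \<le> b \<Longrightarrow> least_left_null (kron_LT a \<boxplus> kron_LT b) (a - 1)"
    using least_left_null_two_LT[of a 0 b 1] a
    unfolding Delta_0(1)[OF disjI2[OF refl]] block_lower_zero(2)[OF kron_LT_carrier kron_LT_carrier] by simp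
  show "least_left_null (kron_LT a \<boxplus> kron_D b \<mu>) (a - 1)"
    using least_left_null_LT_D_finite[of a 0 b 1] least_left_null_LT_D_infinite[of a 0 b 1] a
    by (cases \<mu>) (simp_all add: Delta_0 block_lower_zero(2)[OF kron_LT_carrier kron_D_carrier])
  show "least_null (kron_L a \<boxplus> kron_D b \<mu>) (a - 1)"
    using least_null_L_D_finite[of a 0 b 1] least_null_L_D_infinite[of a 0 b 1] a
    by (cases \<mu>) (simp_all add: Delta_0 block_lower_zero(1)[OF kron_L_carrier kron_D_carrier])
qed

text \<open>The transpose of \<open>kron_L n\<close> has no nonzero null vector, so the component
  \<open>f\<close> that belongs to \<open>kron_L m\<close> is nonzero; being geometric, it reaches
  the degree \<open>m - 1\<close>.\<close>

lemma null_degree_LT_L: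
  assumes m: "1 \<le> m" and n: "1 \<le> n" and null: "has_null (transpose_pair (kron_LT m \<boxplus> kron_L n)) d"
  shows "m - 1 \<le> d"
proof -
  have LT: "transpose_pair (kron_L n) \<in> matrix_pairs n (n - 1)" unfolding transpose_pair_carrier by (rule kron_L_carrier)
  have E: "(0\<^sub>m n m, 0\<^sub>m n m) \<in> matrix_pairs n m" by (simp add: matrix_pairs_iff)
  have eq: "transpose_pair (kron_LT m \<boxplus> kron_L n) = block_lower (kron_L m) (0\<^sub>m n m, 0\<^sub>m n m) (transpose_pair (kron_L n))"
    unfolding transpose_pair_sum[OF kron_LT_carrier kron_L_carrier] block_lower_zero(1)[OF kron_L_carrier LT]
    by (simp add: kron_LT_eq)
  from null[unfolded eq has_null_block_lower_iff[OF kron_L_carrier LT E]] obtain f g where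
    deg: "\<forall>j<m. degree (f j) \<le> d" and ne: "(\<exists>j<m. f j \<noteq> 0) \<or> (\<exists>j<n - 1. g j \<noteq> 0)"
    and f': "\<forall>i<m - 1. poly_app (snd (kron_L m)) f i = pCons 0 (poly_app (fst (kron_L m)) f i)"
    and g': "\<forall>i<n. poly_app (0\<^sub>m n m) f i + poly_app (snd (transpose_pair (kron_L n))) g i =
      pCons 0 (poly_app (0\<^sub>m n m) f i + poly_app (fst (transpose_pair (kron_L n))) g i)"
    unfolding fst_conv snd_conv by (elim exE conjE)
  have f: "f (Suc i) = pCons 0 (f i)" if "i < m - 1" for i
    using f'[rule_format, OF that] that by (simp add: kron_L_def poly_app_L_mat)
  have g: "(if 0 < i then g (i - 1) else 0) = pCons 0 (if i < n - 1 then g i else 0)" if "i < n" for i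
    using g'[rule_format, OF that] that by (simp add: kron_L_def poly_app_L_mat_transpose poly_app_zero)
  have g0: "i < n - 1 \<Longrightarrow> g i = 0" for i
  proof (induction i)
    case 0
    then show ?case using g[of 0] by simp
  next
    case (Suc i)
    then show ?case using g[of "Suc i"] by simp
  qed
  have fi: "f i = [:0, 1:] ^ i * f 0" if "i < m" for i
    using f that by (intro geometric_poly_sequence[of m]) auto
  have f0: "f 0 \<noteq> 0" using ne g0 fi by (metis mult_zero_right)
  have "f (m - 1) = [:0, 1:] ^ (m - 1) * f 0" using m by (intro fi) simp
  then have "degree (f (m - 1)) = m - 1 + degree (f 0)"
    using degree_linear_power_mult[OF f0, of 0 "m - 1"] by simp
  then show ?thesis using deg[rule_format, of "m - 1"] m by simp
qed

section \<open>Cones\<close>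

text \<open>The lower cone in terms of representatives, so that transposition and swapping act on
  \<open>X\<close> and \<open>K\<close> alike.\<close>

definition cone_is :: "mpair \<Rightarrow> mpair set \<Rightarrow> bool" where
  "cone_is X K \<longleftrightarrow> is_matrix_pair X \<and> (\<forall>Z\<in>K. is_matrix_pair Z) \<and>
     (\<forall>Y. degenerates_from X Y \<longleftrightarrow> (\<exists>Z\<in>K. pair_equiv Y Z))"

lemma lower_cone_eq:
  assumes "cone_is X K" shows "lower_cone (pair_orbit X) = pair_orbit ` K"
proof -
  have X: "is_matrix_pair X" and K: "\<And>Z. Z \<in> K \<Longrightarrow> is_matrix_pair Z"
    and deg: "\<And>Y. degenerates_from X Y \<longleftrightarrow> (\<exists>Z\<in>K. pair_equiv Y Z)"
    using assms unfolding cone_is_def by blast+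
  show ?thesis
  proof (intro equalityI subsetI)
    fix U assume "U \<in> lower_cone (pair_orbit X)"
    then obtain Y where Y: "U = pair_orbit Y" "is_matrix_pair Y" "orbit_le (pair_orbit X) (pair_orbit Y)"
      unfolding lower_cone_def by blast
    then have "degenerates_from X Y" using orbit_le_iff_degenerates_from[OF X Y(2)] by blast
    then obtain Z where "Z \<in> K" "pair_equiv Y Z" using deg by blast
    then show "U \<in> pair_orbit ` K" using Y pair_orbit_eq_iff[OF Y(2)] by blast
  next
    fix U assume "U \<in> pair_orbit ` K"
    then obtain Z where Z: "Z \<in> K" "U = pair_orbit Z" by blast
    have Zm: "is_matrix_pair Z" using K Z(1) .
    then obtain p q where "Z \<in> matrix_pairs p q" unfolding is_matrix_pair_def by blast
    then have "pair_equiv Z Z" by (rule pair_equiv_refl)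
    then have "degenerates_from X Z" using deg Z(1) by blast
    then have "orbit_le (pair_orbit X) (pair_orbit Z)" using orbit_le_iff_degenerates_from[OF X Zm] by blast
    then show "U \<in> lower_cone (pair_orbit X)" unfolding lower_cone_def using Z Zm by blast
  qed
qed

text \<open>Invariance under equivalence reduces the inclusion of the listed orbits to the listed
  pairs themselves.\<close>

lemma cone_isI:
  assumes X: "X \<in> matrix_pairs p q"
    and sub: "\<And>Y. degenerates_from X Y \<Longrightarrow> \<exists>r. P r \<and> pair_equiv Y (K r)"
    and sup: "\<And>r. P r \<Longrightarrow> degenerates_from X (K r)"
  shows "cone_is X (K ` {r. P r})"
proof -
  have deg: "degenerates_from X Y \<longleftrightarrow> (\<exists>Z\<in>K ` {r. P r}. pair_equiv Y Z)" for Y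
  proof
    assume "\<exists>Z\<in>K ` {r. P r}. pair_equiv Y Z"
    then obtain r where r: "P r" "pair_equiv Y (K r)" by blast
    show "degenerates_from X Y"
      by (rule degenerates_from_equiv[OF sup[OF r(1)] pair_equiv_refl[OF X] pair_equiv_sym[OF r(2)]])
  qed (use sub in blast)
  have "K r \<in> matrix_pairs p q" if "P r" for r
    using degenerates_fromD(1)[OF sup[OF that] X] .
  then have "\<forall>Z\<in>K ` {r. P r}. is_matrix_pair Z" unfolding is_matrix_pair_def by blast
  moreover have "is_matrix_pair X" using X unfolding is_matrix_pair_def by blast
  ultimately show ?thesis unfolding cone_is_def using deg by blast
qed

lemma is_matrix_pair_transpose: "is_matrix_pair X \<Longrightarrow> is_matrix_pair (transpose_pair X)"
  unfolding is_matrix_pair_def using transpose_pair_carrier by blast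

lemma is_matrix_pair_swap: "is_matrix_pair X \<Longrightarrow> is_matrix_pair (prod.swap X)"
  unfolding is_matrix_pair_def using swap_carrier by blast

lemma cone_is_transpose:
  assumes "cone_is X K" shows "cone_is (transpose_pair X) (transpose_pair ` K)"
proof -
  have "degenerates_from (transpose_pair X) Y \<longleftrightarrow> degenerates_from X (transpose_pair Y)" for Y
    using degenerates_from_transpose[of X "transpose_pair Y"] degenerates_from_transpose[of "transpose_pair X" Y]
    by (auto simp del: transpose_pair_simps(1,2))
  moreover have "pair_equiv (transpose_pair Y) Z \<longleftrightarrow> pair_equiv Y (transpose_pair Z)" for Y Z
    using pair_equiv_transpose[of "transpose_pair Y" Z] pair_equiv_transpose[of Y "transpose_pair Z"] by auto
  ultimately show ?thesis using assms is_matrix_pair_transpose unfolding cone_is_def by simp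
qed

lemma cone_is_swap:
  assumes "cone_is X K" shows "cone_is (prod.swap X) (prod.swap ` K)"
proof -
  have "degenerates_from (prod.swap X) Y \<longleftrightarrow> degenerates_from X (prod.swap Y)" for Y
    using degenerates_from_swap[of X "prod.swap Y"] degenerates_from_swap[of "prod.swap X" Y]
    by (auto simp only: swap_swap)
  moreover have "pair_equiv (prod.swap Y) Z \<longleftrightarrow> pair_equiv Y (prod.swap Z)" for Y Z
    using pair_equiv_swap[of "prod.swap Y" Z] pair_equiv_swap[of Y "prod.swap Z"] by (auto simp only: swap_swap)
  ultimately show ?thesis using assms is_matrix_pair_swap unfolding cone_is_def by (simp only: ball_simps bex_simps) blast
qed

section \<open>Kronecker pairs under swapping and transposition\<close>

lemma pencil_at_swap:
  assumes "X \<in> matrix_pairs p q" shows "pencil_at a b (prod.swap X) = pencil_at b a X"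
  using assms by (auto simp: pencil_at_def matrix_pairs_iff intro!: comm_add_mat)

lemma pencil_at_transpose:
  assumes "X \<in> matrix_pairs p q" shows "pencil_at a b (transpose_pair X) = (pencil_at a b X)\<^sup>T"
  using assms by (auto simp: pencil_at_def matrix_pairs_iff intro!: eq_matI)

text \<open>The size and the full column rank at every point, which swapping preserves, determine
  the canonical form.\<close>

lemma swap_kron_LT_equiv: "1 \<le> m \<Longrightarrow> pair_equiv (prod.swap (kron_LT m)) (kron_LT m)"
  proof -
  assume "1 \<le> m"
  then have s: "Suc (m - 1) = m" by simp
  show ?thesis
  proof (rule injective_tall_by_one(2)[of _ "m - 1", unfolded s])
    show "prod.swap (kron_LT m) \<in> matrix_pairs m (m - 1)" unfolding swap_carrier by (rule kron_LT_carrier)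
    show "corank_le 0 (pencil_at a b (prod.swap (kron_LT m)))" if "a \<noteq> 0 \<or> b \<noteq> 0" for a b
      unfolding pencil_at_swap[OF kron_LT_carrier] using that by (intro corank_le_0_kron_LT) auto
  qed
qed

lemma swap_kron_D: "prod.swap (kron_D n (Fin 0)) = kron_D n Infty" "prod.swap (kron_D n Infty) = kron_D n (Fin 0)"
  by (simp_all add: kron_D.simps)

text \<open>Corank at most 1 at the only eigenvalue leaves room for one Jordan block.\<close>

lemma kron_D_canonical_form:
  assumes Z: "Z \<in> matrix_pairs n n"
    and off: "\<And>a b. a + b * z \<noteq> 0 \<Longrightarrow> corank_le 0 (pencil_at a b Z)"
    and at: "corank_le 1 (pencil_at z (- 1) Z)"
  shows "pair_equiv Z (kron_D n (Fin z))"
proof -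
  from single_eigenvalue_canonical_form[OF Z off at] obtain ks where ks: "length ks \<le> 1" "sum_list ks = n"
    "pair_equiv Z (direct_sum (map (\<lambda>k. kron_D k (Fin z)) ks))" by blast
  then show ?thesis by (cases ks) (auto simp: direct_sum_Nil)
qed

lemma kron_D_off_eigenvalue: "a + b * z \<noteq> 0 \<Longrightarrow> corank_le 0 (pencil_at a b (kron_D n (Fin z)))"
  by (simp add: pencil_at_kron_D corank_le_0_bidiagonal)

text \<open>A square matrix and its transpose have the same corank, and here the coranks along the
  pencil determine the canonical form; this replaces an explicit reversal of the basis.\<close>

lemma transpose_kron_D_equiv: "pair_equiv (transpose_pair (kron_D n \<mu>)) (kron_D n \<mu>)"
proof -
  have fin: "pair_equiv (transpose_pair (kron_D n (Fin z))) (kron_D n (Fin z))" for z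
  proof (rule kron_D_canonical_form)
    show "transpose_pair (kron_D n (Fin z)) \<in> matrix_pairs n n" by simp
    show "corank_le 0 (pencil_at a b (transpose_pair (kron_D n (Fin z))))" if "a + b * z \<noteq> 0" for a b
      using kron_D_off_eigenvalue[OF that, of n] pencil_at_carrier[OF kron_D_carrier, of a b n "Fin z"]
      unfolding pencil_at_transpose[OF kron_D_carrier]
      by (subst corank_le_0_iff_det[of _ n]) (auto simp: det_transpose corank_le_0_iff_det)
    have app: "mat_app (bidiagonal n 0 (- 1))\<^sup>T x i = (if 0 < i then - x (i - 1) else 0)" if "i < n" for x i
    proof -
      have "mat_app (bidiagonal n 0 (- 1))\<^sup>T x i = (\<Sum>j<n. if j = i - 1 \<and> 0 < i then - x (i - 1) else 0)"
        unfolding mat_app_def using that by (intro sum.cong) (auto simp: bidiagonal_def)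
      then show ?thesis using that by (cases i) auto
    qed
    \<comment> \<open>The transposed nilpotent block shifts towards larger indices, so the free
      coordinate is the last one.\<close>
    have "corank_le 1 (bidiagonal n 0 (- 1))\<^sup>T"
    proof (rule corank_leI[of _ n n "{\<lambda>j. if j = n - 1 then 1 else 0}"])
      fix x j assume x: "\<And>i. i < n \<Longrightarrow> mat_app (bidiagonal n 0 (- 1))\<^sup>T x i = 0"
        "\<And>f. f \<in> {\<lambda>j. if j = n - 1 then 1 else 0} \<Longrightarrow> (\<Sum>j<n. f j * x j) = 0" and j: "j < n"
      show "x j = 0"
      proof (cases "j = n - 1")
        case True
        then show ?thesis using x(2)[OF singletonI] j sum_single[of "n - 1" n x] by simp
      next
        case False
        then have "Suc j < n" using j by simp
        then show ?thesis using x(1)[of "Suc j"] app[of "Suc j" x] by simp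
      qed
    qed auto
    then show "corank_le 1 (pencil_at z (- 1) (transpose_pair (kron_D n (Fin z))))"
      by (simp add: pencil_at_transpose[OF kron_D_carrier] pencil_at_kron_D)
  qed
  have sw: "transpose_pair (prod.swap X) = prod.swap (transpose_pair X)" for X
    by (simp add: transpose_pair_def)
  show ?thesis
  proof (cases \<mu>)
    case Infty
    then show ?thesis using pair_equiv_swap[OF fin[of 0]] by (simp only: sw[symmetric] swap_kron_D)
  qed (use fin in simp)
qed

section \<open>Cones of the indecomposable pairs\<close>

lemma cone_kron_LT:
  assumes "1 \<le> n" shows "cone_is (kron_LT n) {kron_LT n}"
proof -
  \<comment> \<open>The index \<open>r\<close> is a dummy that brings the one-element cone into the
    shape of \<open>cone_isI\<close>.\<close>
  have "cone_is (kron_LT n) ((\<lambda>_. kron_LT n) ` {r :: nat. True})"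
  proof (rule cone_isI[OF kron_LT_carrier])
    fix Y assume d: "degenerates_from (kron_LT n) Y"
    have "Y \<in> matrix_pairs (Suc (n - 1)) (n - 1)" using degenerates_fromD(1)[OF d kron_LT_carrier] assms by simp
    from injective_tall_by_one(2)[OF this corank_le_semicontinuous[OF d corank_le_0_kron_LT]]
    show "\<exists>r. True \<and> pair_equiv Y (kron_LT n)" using assms by simp
  qed (rule degenerates_from_refl[OF kron_LT_carrier])
  then show ?thesis by (simp add: image_constant_conv)
qed

lemma cone_kron_L:
  assumes "1 \<le> n" shows "cone_is (kron_L n) {kron_L n}"
  using cone_is_transpose[OF cone_kron_LT[OF assms]] by (simp add: kron_LT_eq)

lemma cone_kron_D: "cone_is (kron_D n \<mu>) {kron_D n \<mu>}"
proof -
  have fin: "cone_is (kron_D n (Fin z)) {kron_D n (Fin z)}" for z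
  proof -
    have "cone_is (kron_D n (Fin z)) ((\<lambda>_. kron_D n (Fin z)) ` {r :: nat. True})"
    proof (rule cone_isI[OF kron_D_carrier])
      fix Y assume d: "degenerates_from (kron_D n (Fin z)) Y"
      have Y: "Y \<in> matrix_pairs n n" using degenerates_fromD(1)[OF d kron_D_carrier] .
      have "corank_le 1 (pencil_at z (- 1) Y)"
        using corank_le_semicontinuous[OF d corank_le_1_kron_D] by simp
      then show "\<exists>r. True \<and> pair_equiv Y (kron_D n (Fin z))"
        using kron_D_canonical_form[OF Y corank_le_semicontinuous[OF d kron_D_off_eigenvalue]] by blast
    qed (rule degenerates_from_refl[OF kron_D_carrier])
    then show ?thesis by (simp add: image_constant_conv)
  qed
  show ?thesis
  proof (cases \<mu>)
    case Infty
    then show ?thesis using cone_is_swap[OF fin[of 0]] by (simp only: image_insert image_empty swap_kron_D)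
  qed (use fin in simp)
qed

section \<open>Degenerations in (i), (iii) and (iv)\<close>

text \<open>Full column rank everywhere forces two \<open>kron_LT\<close> summands. The least left
  null degree of \<open>Y\<close> is also a null degree of the degenerate pair, hence at least
  \<open>m - 1\<close>.\<close>

lemma degenerates_from_two_LT:
  assumes m: "1 \<le> m" and mn: "m \<le> n" and d: "degenerates_from (kron_LT m \<boxplus> kron_LT n) Y"
  shows "\<exists>r. m + r \<le> n - r \<and> pair_equiv Y (kron_LT (m + r) \<boxplus> kron_LT (n - r))"
proof -
  define q where "q = m + n - 2"
  have X: "kron_LT m \<boxplus> kron_LT n \<in> matrix_pairs (Suc (Suc q)) q"
    proof -
    have "Suc (Suc q) = m + n" "q = m - 1 + (n - 1)" using m mn by (auto simp: q_def)
    then show ?thesis using pair_sum_carrier[OF kron_LT_carrier[of m] kron_LT_carrier[of n]] by (simp only:)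
  qed
  have Y: "Y \<in> matrix_pairs (Suc (Suc q)) q" using degenerates_fromD(1)[OF d X] .
  have inj: "corank_le 0 (pencil_at a b Y)" if "a \<noteq> 0 \<or> b \<noteq> 0" for a b
    using corank_le_semicontinuous[OF d corank_le_pair_sum[OF kron_LT_carrier kron_LT_carrier
      corank_le_0_kron_LT[OF that] corank_le_0_kron_LT[OF that]]] by simp
  from injective_tall_by_two[OF Y inj] obtain k where k: "least_left_null Y k" "k \<le> q - k" "k \<le> q"
    "pair_equiv Y (kron_LT (Suc k) \<boxplus> kron_LT (Suc (q - k)))" by blast
  have "has_null (transpose_pair (kron_LT m \<boxplus> kron_LT n)) k"
    using has_null_semicontinuous[OF degenerates_from_transpose[OF d]] k(1) unfolding least_left_null_def by blast
  then have mk: "m - 1 \<le> k" using least_left_null_members(1)[OF m mn] unfolding least_left_null_def by (meson not_le)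
  \<comment> \<open>The smaller summand has index \<open>Suc k = m + r\<close>; the other one
    follows from the size.\<close>
  define r where "r = Suc k - m"
  have e: "m + r = Suc k" "n - r = Suc (q - k)" "m + r \<le> n - r" using mk k(2,3) m mn by (auto simp: r_def q_def)
  show ?thesis by (rule exI[of _ r], rule conjI, rule e(3), unfold e(1,2), rule k(4))
qed

text \<open>Off the eigenvalue the column rank is full, and at the eigenvalue at most one block may
  remain; the null degree bound orders the sizes as in (i). Infinity is moved to 0 by swapping the
  components.\<close>

lemma degenerates_from_LT_D:
  assumes m: "1 \<le> m" and d: "degenerates_from (kron_LT m \<boxplus> kron_D n \<mu>) Y"
  shows "\<exists>r\<le>n. pair_equiv Y (kron_LT (m + r) \<boxplus> kron_D (n - r) \<mu>)"
proof -
  have fin: "\<exists>r\<le>n. pair_equiv Y (kron_LT (m + r) \<boxplus> kron_D (n - r) (Fin z))"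
    if d: "degenerates_from (kron_LT m \<boxplus> kron_D n (Fin z)) Y" for Y z
  proof -
    define q where "q = m + n - 1"
    have X: "kron_LT m \<boxplus> kron_D n (Fin z) \<in> matrix_pairs (Suc q) q"
      using pair_sum_carrier[OF kron_LT_carrier[of m] kron_D_carrier[of n "Fin z"]] m by (auto simp: q_def)
    have Y: "Y \<in> matrix_pairs (Suc q) q" using degenerates_fromD(1)[OF d X] .
    have off: "corank_le 0 (pencil_at a b Y)" if "a + b * z \<noteq> 0" for a b
    proof -
      have "a \<noteq> 0 \<or> b \<noteq> 0" using that by auto
      then show ?thesis
        using corank_le_semicontinuous[OF d corank_le_pair_sum[OF kron_LT_carrier kron_D_carrier
          corank_le_0_kron_LT kron_D_off_eigenvalue[OF that]]] by simp
    qed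
    have at: "corank_le 1 (pencil_at z (- 1) Y)"
      using corank_le_semicontinuous[OF d corank_le_pair_sum[OF kron_LT_carrier kron_D_carrier
          corank_le_0_kron_LT corank_le_1_kron_D]] by simp
    from tall_by_one_canonical_form[OF Y off at] obtain k ks where k: "least_left_null Y k" "k \<le> q"
      "length ks \<le> 1" "sum_list ks = q - k" "pair_equiv Y (kron_LT (Suc k) \<boxplus> direct_sum (map (\<lambda>k. kron_D k (Fin z)) ks))"
      by blast
    \<comment> \<open>At most one block is left; an empty list counts as a block of size 0.\<close>
    have D: "direct_sum (map (\<lambda>k. kron_D k (Fin z)) ks) = kron_D (q - k) (Fin z)"
      using k(3,4) by (cases ks) (auto simp: direct_sum_Nil)
    have "has_null (transpose_pair (kron_LT m \<boxplus> kron_D n (Fin z))) k"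
      using has_null_semicontinuous[OF degenerates_from_transpose[OF d]] k(1) unfolding least_left_null_def by blast
    then have mk: "m - 1 \<le> k" using least_left_null_members(2)[OF m] unfolding least_left_null_def by (meson not_le)
    define r where "r = Suc k - m"
    have e: "m + r = Suc k" "n - r = q - k" "r \<le> n" using mk k(2) m by (auto simp: r_def q_def)
    show ?thesis by (rule exI[of _ r], rule conjI, rule e(3), unfold e(1,2), rule k(5)[unfolded D])
  qed
  show ?thesis
  proof (cases \<mu>)
    case (Fin z)
    then show ?thesis using fin d by blast
  next
    case Infty
    have sw: "prod.swap (kron_LT m \<boxplus> kron_D n Infty) = prod.swap (kron_LT m) \<boxplus> kron_D n (Fin 0)"
      unfolding swap_direct_sum by (simp add: swap_kron_D)
    have "degenerates_from (prod.swap (kron_LT m) \<boxplus> kron_D n (Fin 0)) (prod.swap Y)"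
      using degenerates_from_swap[OF d] unfolding Infty sw .
    moreover have "pair_equiv (prod.swap (kron_LT m) \<boxplus> kron_D n (Fin 0)) (kron_LT m \<boxplus> kron_D n (Fin 0))"
      by (rule pair_equiv_sum_left[OF swap_kron_LT_equiv[OF m] kron_D_carrier])
    moreover obtain p q where "prod.swap Y \<in> matrix_pairs p q" using calculation(1) unfolding degenerates_from_def by blast
    ultimately have "degenerates_from (kron_LT m \<boxplus> kron_D n (Fin 0)) (prod.swap Y)"
      using degenerates_from_equiv pair_equiv_refl by blast
    from fin[OF this] obtain r where r: "r \<le> n" "pair_equiv (prod.swap Y) (kron_LT (m + r) \<boxplus> kron_D (n - r) (Fin 0))" by blast
    have "prod.swap (kron_LT (m + r) \<boxplus> kron_D (n - r) (Fin 0)) = prod.swap (kron_LT (m + r)) \<boxplus> kron_D (n - r) Infty"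
      unfolding swap_direct_sum by (simp add: swap_kron_D)
    then have "pair_equiv Y (prod.swap (kron_LT (m + r)) \<boxplus> kron_D (n - r) Infty)"
      using pair_equiv_swap[OF r(2)] by simp
    moreover have "pair_equiv (prod.swap (kron_LT (m + r)) \<boxplus> kron_D (n - r) Infty) (kron_LT (m + r) \<boxplus> kron_D (n - r) Infty)"
      using m by (intro pair_equiv_sum_left[OF swap_kron_LT_equiv kron_D_carrier]) simp
    ultimately show ?thesis using r(1) pair_equiv_trans Infty by blast
  qed
qed

lemma transpose_LT_D_equiv: "pair_equiv (transpose_pair (kron_LT m \<boxplus> kron_D n \<mu>)) (kron_L m \<boxplus> kron_D n \<mu>)"
  unfolding transpose_pair_sum[OF kron_LT_carrier kron_D_carrier]
  using pair_equiv_sum_right[OF transpose_kron_D_equiv kron_L_carrier] by (simp add: kron_LT_eq)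

text \<open>The transposed form of \<open>degenerates_from_LT_D\<close>, as \<open>kron_D\<close> is
  equivalent to its transpose.\<close>

lemma degenerates_from_L_D:
  assumes m: "1 \<le> m" and d: "degenerates_from (kron_L m \<boxplus> kron_D n \<mu>) Y"
  shows "\<exists>r\<le>n. pair_equiv Y (kron_L (m + r) \<boxplus> kron_D (n - r) \<mu>)"
proof -
  obtain p q where Y: "Y \<in> matrix_pairs p q" using d unfolding degenerates_from_def by blast
  have "pair_equiv (transpose_pair (kron_L m \<boxplus> kron_D n \<mu>)) (kron_LT m \<boxplus> kron_D n \<mu>)"
    using pair_equiv_transpose[OF pair_equiv_sym[OF transpose_LT_D_equiv]] by simp
  from degenerates_from_equiv[OF degenerates_from_transpose[OF d] this pair_equiv_refl[of _ q p]]
  have "degenerates_from (kron_LT m \<boxplus> kron_D n \<mu>) (transpose_pair Y)" using Y by simp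
  from degenerates_from_LT_D[OF m this] obtain r where r: "r \<le> n"
    "pair_equiv (transpose_pair Y) (kron_LT (m + r) \<boxplus> kron_D (n - r) \<mu>)" by blast
  have "pair_equiv Y (transpose_pair (kron_LT (m + r) \<boxplus> kron_D (n - r) \<mu>))"
    using pair_equiv_transpose[OF r(2)] by simp
  then show ?thesis using pair_equiv_trans[OF _ transpose_LT_D_equiv] r(1) by blast
qed

section \<open>Canonical forms of the explicit pairs and cones in (i) to (iv)\<close>

lemma two_LT_explicit:
  assumes m: "1 \<le> m" and r: "m + r \<le> n - r" and \<epsilon>: "\<epsilon> \<noteq> 0"
  defines "T \<equiv> block_upper (kron_LT m) (0\<^sub>m m (n - 1), Delta_mat m (n - 1) r \<epsilon>) (kron_LT n)"
  shows "pair_equiv T (kron_LT (m + r) \<boxplus> kron_LT (n - r))" "degenerates_from (kron_LT m \<boxplus> kron_LT n) T"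
proof -
  have D: "(0\<^sub>m m (n - 1), Delta_mat m (n - 1) r \<epsilon>) \<in> matrix_pairs m (n - 1)" by (simp add: matrix_pairs_iff)
  show d: "degenerates_from (kron_LT m \<boxplus> kron_LT n) T"
    unfolding T_def by (rule pair_sum_degenerates_from_block_upper[OF kron_LT_carrier kron_LT_carrier D])
  have mn: "m \<le> n" using r by simp
  from degenerates_from_two_LT[OF m mn d] obtain s where s: "m + s \<le> n - s"
    "pair_equiv T (kron_LT (m + s) \<boxplus> kron_LT (n - s))" by blast
  \<comment> \<open>The least left null degree is an invariant of equivalence that separates the
    candidates for \<open>s\<close>.\<close>
  have "least_left_null T (m + r - 1)" unfolding T_def by (rule least_left_null_two_LT[OF m r \<epsilon>])
  then have "least_left_null (kron_LT (m + s) \<boxplus> kron_LT (n - s)) (m + r - 1)"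
    unfolding least_left_null_eq using least_null_equiv[OF pair_equiv_transpose[OF s(2)]] by blast
  moreover have "least_left_null (kron_LT (m + s) \<boxplus> kron_LT (n - s)) (m + s - 1)"
    using s(1) m by (intro least_left_null_members(1)) auto
  ultimately have "m + r - 1 = m + s - 1" unfolding least_left_null_eq by (rule least_null_unique)
  then have "s = r" using m by simp
  with s(2) show "pair_equiv T (kron_LT (m + r) \<boxplus> kron_LT (n - r))" by simp
qed

lemma LT_D_explicit:
  assumes m: "1 \<le> m" and r: "r \<le> n"
    and d: "degenerates_from (kron_LT m \<boxplus> kron_D n \<mu>) T" and T: "least_left_null T (m + r - 1)"
  shows "pair_equiv T (kron_LT (m + r) \<boxplus> kron_D (n - r) \<mu>)"
proof -
  from degenerates_from_LT_D[OF m d] obtain s where s: "s \<le> n"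
    "pair_equiv T (kron_LT (m + s) \<boxplus> kron_D (n - s) \<mu>)" by blast
  have "least_left_null (kron_LT (m + s) \<boxplus> kron_D (n - s) \<mu>) (m + r - 1)"
    using T unfolding least_left_null_eq using least_null_equiv[OF pair_equiv_transpose[OF s(2)]] by blast
  moreover have "least_left_null (kron_LT (m + s) \<boxplus> kron_D (n - s) \<mu>) (m + s - 1)"
    using m by (intro least_left_null_members(2)) auto
  ultimately have "m + r - 1 = m + s - 1" unfolding least_left_null_eq by (rule least_null_unique)
  then have "s = r" using m by simp
  with s(2) show ?thesis by simp
qed

lemma L_D_explicit:
  assumes m: "1 \<le> m" and r: "r \<le> n"
    and d: "degenerates_from (kron_L m \<boxplus> kron_D n \<mu>) T" and T: "least_null T (m + r - 1)"
  shows "pair_equiv T (kron_L (m + r) \<boxplus> kron_D (n - r) \<mu>)"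
proof -
  from degenerates_from_L_D[OF m d] obtain s where s: "s \<le> n"
    "pair_equiv T (kron_L (m + s) \<boxplus> kron_D (n - s) \<mu>)" by blast
  have "least_null (kron_L (m + s) \<boxplus> kron_D (n - s) \<mu>) (m + r - 1)"
    using T least_null_equiv[OF s(2)] by blast
  moreover have "least_null (kron_L (m + s) \<boxplus> kron_D (n - s) \<mu>) (m + s - 1)"
    using m by (intro least_left_null_members(3)) auto
  ultimately have "m + r - 1 = m + s - 1" by (rule least_null_unique)
  then have "s = r" using m by simp
  with s(2) show ?thesis by simp
qed

fun perturbed_LT_D :: "nat \<Rightarrow> nat \<Rightarrow> ext_complex \<Rightarrow> nat \<Rightarrow> complex \<Rightarrow> mpair" where
  "perturbed_LT_D m n (Fin z) r \<epsilon> =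
     block_upper (kron_LT m) (0\<^sub>m m n, Delta_mat m n (n - r + 1) \<epsilon>) (kron_D n (Fin z))"
| "perturbed_LT_D m n Infty r \<epsilon> =
     block_upper (kron_LT m) (Nabla_mat m n (n - r + 1) \<epsilon>, 0\<^sub>m m n) (kron_D n Infty)"

fun perturbed_L_D :: "nat \<Rightarrow> nat \<Rightarrow> ext_complex \<Rightarrow> nat \<Rightarrow> complex \<Rightarrow> mpair" where
  "perturbed_L_D m n (Fin z) r \<epsilon> = block_lower (kron_L m) (0\<^sub>m n m, (Delta_mat m n r \<epsilon>)\<^sup>T) (kron_D n (Fin z))"
| "perturbed_L_D m n Infty r \<epsilon> = block_upper (kron_D n Infty) ((Nabla_mat m n r \<epsilon>)\<^sup>T, 0\<^sub>m n m) (kron_L m)"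

lemma perturbed_LT_D:
  assumes m: "1 \<le> m" and r: "r \<le> n" and \<epsilon>: "\<epsilon> \<noteq> 0"
  shows "pair_equiv (perturbed_LT_D m n \<mu> r \<epsilon>) (kron_LT (m + r) \<boxplus> kron_D (n - r) \<mu>)"
    "degenerates_from (kron_LT m \<boxplus> kron_D n \<mu>) (perturbed_LT_D m n \<mu> r \<epsilon>)"
proof -
  show d: "degenerates_from (kron_LT m \<boxplus> kron_D n \<mu>) (perturbed_LT_D m n \<mu> r \<epsilon>)"
    by (cases \<mu>) (auto simp: matrix_pairs_iff intro!: pair_sum_degenerates_from_block_upper[OF kron_LT_carrier kron_D_carrier])
  have "least_left_null (perturbed_LT_D m n \<mu> r \<epsilon>) (m + r - 1)"
    using least_left_null_LT_D_finite[OF assms] least_left_null_LT_D_infinite[OF assms]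
    by (cases \<mu>) (auto simp only: perturbed_LT_D.simps)
  from LT_D_explicit[OF m r d this]
  show "pair_equiv (perturbed_LT_D m n \<mu> r \<epsilon>) (kron_LT (m + r) \<boxplus> kron_D (n - r) \<mu>)" .
qed

lemma perturbed_L_D:
  assumes m: "1 \<le> m" and r: "r \<le> n" and \<epsilon>: "\<epsilon> \<noteq> 0"
  shows "pair_equiv (perturbed_L_D m n \<mu> r \<epsilon>) (kron_L (m + r) \<boxplus> kron_D (n - r) \<mu>)"
    "degenerates_from (kron_L m \<boxplus> kron_D n \<mu>) (perturbed_L_D m n \<mu> r \<epsilon>)"
proof -
  have N: "((Nabla_mat m n r \<epsilon>)\<^sup>T, 0\<^sub>m n m) \<in> matrix_pairs n m" by (auto simp: matrix_pairs_iff)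
  show d: "degenerates_from (kron_L m \<boxplus> kron_D n \<mu>) (perturbed_L_D m n \<mu> r \<epsilon>)"
  proof (cases \<mu>)
    case (Fin z)
    then show ?thesis
      by (auto simp: matrix_pairs_iff intro!: pair_sum_degenerates_from_block_lower[OF kron_L_carrier kron_D_carrier])
  next
    case Infty
    \<comment> \<open>The explicit pair has the two blocks in the opposite order, so the direct sum
      is commuted afterwards.\<close>
    have "degenerates_from (kron_D n Infty \<boxplus> kron_L m) (perturbed_L_D m n \<mu> r \<epsilon>)"
      unfolding Infty perturbed_L_D.simps
      by (rule pair_sum_degenerates_from_block_upper[OF kron_D_carrier kron_L_carrier N])
    then show ?thesis unfolding Infty perturbed_L_D.simps
      by (rule degenerates_from_equiv[OF _ pair_sum_commute[OF kron_D_carrier kron_L_carrier]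
        pair_equiv_refl[OF block_carrier(1)[OF kron_D_carrier kron_L_carrier]]])
  qed
  have "least_null (perturbed_L_D m n \<mu> r \<epsilon>) (m + r - 1)"
  proof (cases \<mu>)
    case (Fin z)
    then show ?thesis using least_null_L_D_finite[OF assms] by simp
  next
    case Infty
    show ?thesis unfolding Infty perturbed_L_D.simps
      by (rule least_null_equiv[OF pair_equiv_sym[OF block_upper_equiv_block_lower[OF kron_D_carrier kron_L_carrier N]]
          least_null_L_D_infinite[OF assms]])
  qed
  from L_D_explicit[OF m r d this]
  show "pair_equiv (perturbed_L_D m n \<mu> r \<epsilon>) (kron_L (m + r) \<boxplus> kron_D (n - r) \<mu>)" .
qed

lemma cone_two_LT:
  assumes m: "1 \<le> m" and mn: "m \<le> n"
  shows "cone_is (kron_LT m \<boxplus> kron_LT n) ((\<lambda>r. kron_LT (m + r) \<boxplus> kron_LT (n - r)) ` {r. m + r \<le> n - r})"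
proof (rule cone_isI[OF pair_sum_carrier[OF kron_LT_carrier kron_LT_carrier] degenerates_from_two_LT[OF m mn]])
  fix r assume r: "m + r \<le> n - r"
  show "degenerates_from (kron_LT m \<boxplus> kron_LT n) (kron_LT (m + r) \<boxplus> kron_LT (n - r))"
    \<comment> \<open>The explicit pair for \<epsilon> = 1 witnesses the degeneration; any nonzero
      value would serve.\<close>
    by (rule degenerates_from_equiv[OF two_LT_explicit(2)[OF m r, of 1] pair_equiv_refl two_LT_explicit(1)[OF m r, of 1]])
      (auto intro: pair_sum_carrier[OF kron_LT_carrier kron_LT_carrier])
qed

lemma cone_LT_D:
  assumes m: "1 \<le> m"
  shows "cone_is (kron_LT m \<boxplus> kron_D n \<mu>) ((\<lambda>r. kron_LT (m + r) \<boxplus> kron_D (n - r) \<mu>) ` {r. r \<le> n})"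
proof (rule cone_isI[OF pair_sum_carrier[OF kron_LT_carrier kron_D_carrier] degenerates_from_LT_D[OF m]])
  fix r assume r: "r \<le> n"
  show "degenerates_from (kron_LT m \<boxplus> kron_D n \<mu>) (kron_LT (m + r) \<boxplus> kron_D (n - r) \<mu>)"
    by (rule degenerates_from_equiv[OF perturbed_LT_D(2)[OF m r, of 1] pair_equiv_refl perturbed_LT_D(1)[OF m r, of 1]])
      (auto intro: pair_sum_carrier[OF kron_LT_carrier kron_D_carrier])
qed

lemma cone_L_D:
  assumes m: "1 \<le> m"
  shows "cone_is (kron_L m \<boxplus> kron_D n \<mu>) ((\<lambda>r. kron_L (m + r) \<boxplus> kron_D (n - r) \<mu>) ` {r. r \<le> n})"
proof (rule cone_isI[OF pair_sum_carrier[OF kron_L_carrier kron_D_carrier] degenerates_from_L_D[OF m]])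
  fix r assume r: "r \<le> n"
  show "degenerates_from (kron_L m \<boxplus> kron_D n \<mu>) (kron_L (m + r) \<boxplus> kron_D (n - r) \<mu>)"
    by (rule degenerates_from_equiv[OF perturbed_L_D(2)[OF m r, of 1] pair_equiv_refl perturbed_L_D(1)[OF m r, of 1]])
      (auto intro: pair_sum_carrier[OF kron_L_carrier kron_D_carrier])
qed

lemma cone_two_L:
  assumes m: "1 \<le> m" and mn: "m \<le> n"
  shows "cone_is (kron_L m \<boxplus> kron_L n) ((\<lambda>r. kron_L (m + r) \<boxplus> kron_L (n - r)) ` {r. m + r \<le> n - r})"
proof -
  have t: "transpose_pair (kron_LT a \<boxplus> kron_LT b) = kron_L a \<boxplus> kron_L b" for a b
    unfolding transpose_pair_sum[OF kron_LT_carrier kron_LT_carrier] by (simp add: kron_LT_eq)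
  from cone_is_transpose[OF cone_two_LT[OF assms]] show ?thesis unfolding image_image t .
qed

section \<open>Nilpotency at an eigenvalue\<close>

text \<open>For a pair \<open>(I, M)\<close> this says \<open>(M - z I)\<^sup>k = 0\<close>; the formulation by chains needs no inverse.\<close>

definition nilpotent_at :: "nat \<Rightarrow> mpair \<Rightarrow> complex \<Rightarrow> nat \<Rightarrow> bool" where
  "nilpotent_at n X z k \<longleftrightarrow> (\<forall>w. (\<forall>i<k. \<forall>r<n. mat_app (fst X) (w (Suc i)) r = mat_app (pencil_at (- z) 1 X) (w i) r) \<longrightarrow>
     (\<forall>j<n. w k j = 0))"

text \<open>A chain \<open>w\<close> for \<open>Y\<close> becomes the chain \<open>R w\<close> for
  \<open>X\<close>, because the invertible \<open>S\<close> cancels on the left.\<close>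

lemma nilpotent_at_equiv:
  assumes "pair_equiv X Y" "X \<in> matrix_pairs n n" "nilpotent_at n X z k"
  shows "nilpotent_at n Y z k"
proof -
  from assms(1) obtain p q S S' R R' where e:
    "X \<in> matrix_pairs p q" "Y \<in> matrix_pairs p q"
    "S \<in> carrier_mat p p" "S' \<in> carrier_mat p p" "S * S' = 1\<^sub>m p" "S' * S = 1\<^sub>m p"
    "R \<in> carrier_mat q q" "R' \<in> carrier_mat q q" "R * R' = 1\<^sub>m q" "R' * R = 1\<^sub>m q"
    "fst Y = S * fst X * R" "snd Y = S * snd X * R"
    by (elim pair_equiv_elim)
  have [simp]: "p = n" "q = n" using matrix_pairs_unique[OF assms(2), of p q] e(1) by auto
  note e = e[unfolded \<open>p = n\<close> \<open>q = n\<close>]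
  have app: "mat_app (S * A * R) y r = mat_app S (mat_app A (mat_app R y)) r" if "A \<in> carrier_mat n n" "r < n" for A y r
    using mat_app_mult[of "S * A" n n R n r y] mat_app_mult[OF e(3) that, of "mat_app R y"] that e by auto
  have canc: "u r = v r" if "\<And>r. r < n \<Longrightarrow> mat_app S u r = mat_app S v r" "r < n" for u v r
  proof -
    have "u r = mat_app S' (mat_app S u) r" using mat_app_mult[OF e(4,3) that(2), of u] e(6) that(2) by (simp add: mat_app_one)
    also have "\<dots> = mat_app S' (mat_app S v) r" by (rule mat_app_cong[of _ n]) (use e(4) that(1) in auto)
    also have "\<dots> = v r" using mat_app_mult[OF e(4,3) that(2), of v] e(6) that(2) by (simp add: mat_app_one)
    finally show ?thesis .
  qed
  have c: "fst X \<in> carrier_mat n n" "pencil_at (- z) 1 X \<in> carrier_mat n n"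
    using assms(2) pencil_at_carrier by (auto simp: matrix_pairs_iff)
  show ?thesis unfolding nilpotent_at_def
  proof (intro allI impI)
    fix w j assume w: "\<forall>i<k. \<forall>r<n. mat_app (fst Y) (w (Suc i)) r = mat_app (pencil_at (- z) 1 Y) (w i) r" and j: "j < n"
    have "\<forall>i<k. \<forall>r<n. mat_app (fst X) (mat_app R (w (Suc i))) r = mat_app (pencil_at (- z) 1 X) (mat_app R (w i)) r"
    proof (intro allI impI, rule canc)
      fix i r s assume "i < k" "s < n"
      then show "mat_app S (mat_app (fst X) (mat_app R (w (Suc i)))) s = mat_app S (mat_app (pencil_at (- z) 1 X) (mat_app R (w i))) s"
        using w app[OF c(1)] app[OF c(2)] unfolding e(11) pencil_at_equiv[OF e(1,3,7,11,12)] by simp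
    qed
    then have "\<forall>j<n. mat_app R (w k) j = 0" using assms(3) unfolding nilpotent_at_def
      by (elim allE[of _ "\<lambda>i. mat_app R (w i)"]) simp
    then have "mat_app R' (mat_app R (w k)) j = 0" using e(8) by (auto intro: mat_app_eq_0)
    then show "w k j = 0" using mat_app_mult[OF e(8,7) j, of "w k"] e(10) j by (simp add: mat_app_one)
  qed
qed

lemma nilpotent_at_monic_pair:
  assumes "fst X = 1\<^sub>m n"
  shows "nilpotent_at n X z k \<longleftrightarrow>
    (\<forall>w. (\<forall>i<k. \<forall>r<n. w (Suc i) r = mat_app (pencil_at (- z) 1 X) (w i) r) \<longrightarrow> (\<forall>j<n. w k j = 0))"
  unfolding nilpotent_at_def assms by (simp add: mat_app_one)

lemma all_less_add_iff: "(\<forall>i<p + p'. P i) \<longleftrightarrow> (\<forall>i<p. P i) \<and> (\<forall>i<p'. P (p + i :: nat))"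
proof (intro iffI conjI allI impI)
  fix i assume a: "(\<forall>i<p. P i) \<and> (\<forall>i<p'. P (p + i))" and i: "i < p + p'"
  show "P i"
  proof (cases "i < p")
    case False
    have "P (p + (i - p))"
      by (rule a[THEN conjunct2, rule_format]) (use i False in simp)
    then show ?thesis using False by simp
  qed (use a in blast)
qed auto

lemma nilpotent_at_block_upper:
  assumes D: "D \<in> carrier_mat m n"
  shows "nilpotent_at (m + n) (block_upper (kron_D m (Fin z)) (0\<^sub>m m n, D) (kron_D n (Fin z))) z k \<longleftrightarrow>
    (\<forall>f g. (\<forall>i<k. (\<forall>r<m. f (Suc i) r = (if Suc r < m then f i (Suc r) else 0) + mat_app D (g i) r) \<and>
        (\<forall>r<n. g (Suc i) r = (if Suc r < n then g i (Suc r) else 0))) \<longrightarrow>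
      (\<forall>j<m. f k j = 0) \<and> (\<forall>j<n. g k j = 0))" (is "nilpotent_at _ ?T _ _ \<longleftrightarrow> ?R")
proof -
  have 1: "fst ?T = 1\<^sub>m (m + n)" by (simp add: block_upper_def kron_D.simps)
  have "pencil_at (- z) 1 ?T = four_block_mat (bidiagonal m 0 1) D (0\<^sub>m n m) (bidiagonal n 0 1)"
    using D by (intro eq_matI) (auto simp: pencil_at_def block_upper_def kron_D.simps bidiagonal_def)
  then have app: "mat_app (pencil_at (- z) 1 ?T) w r = mat_app (bidiagonal m 0 1) w r + mat_app D (\<lambda>j. w (m + j)) r"
    if "r < m" for w r
    using mat_app_four_block(1)[OF bidiagonal_carrier D zero_carrier_mat bidiagonal_carrier that] by simp
  have app': "mat_app (pencil_at (- z) 1 ?T) w (m + r) = mat_app (bidiagonal n 0 1) (\<lambda>j. w (m + j)) r"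
    if "r < n" for w r
    using mat_app_four_block(2)[OF bidiagonal_carrier D zero_carrier_mat bidiagonal_carrier that]
      \<open>pencil_at (- z) 1 ?T = _\<close> that by (simp add: mat_app_zero)
  have nil: "nilpotent_at (m + n) ?T z k \<longleftrightarrow>
    (\<forall>w. (\<forall>i<k. (\<forall>r<m. w (Suc i) r = (if Suc r < m then w i (Suc r) else 0) + mat_app D (\<lambda>j. w i (m + j)) r) \<and>
        (\<forall>r<n. w (Suc i) (m + r) = (if Suc r < n then w i (m + Suc r) else 0))) \<longrightarrow>
      (\<forall>j<m. w k j = 0) \<and> (\<forall>j<n. w k (m + j) = 0))"
    unfolding nilpotent_at_monic_pair[OF 1] all_less_add_iff by (simp add: app app' mat_app_bidiagonal)
  show ?thesis
  proof
    assume L: "nilpotent_at (m + n) ?T z k"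
    show ?R
    proof (intro allI impI)
      fix f g assume a: "\<forall>i<k. (\<forall>r<m. f (Suc i) r = (if Suc r < m then f i (Suc r) else 0) + mat_app D (g i) r) \<and>
        (\<forall>r<n. g (Suc i) r = (if Suc r < n then g i (Suc r) else 0))"
      define w where "w i j = (if j < m then f i j else g i (j - m))" for i j
      have "mat_app D (\<lambda>j. w i (m + j)) r = mat_app D (g i) r" for i r
        by (rule mat_app_cong[OF refl]) (simp add: w_def)
      then show "(\<forall>j<m. f k j = 0) \<and> (\<forall>j<n. g k j = 0)"
        using L[unfolded nil, rule_format, of w] a by (simp add: w_def)
    qed
  next
    assume R: ?R
    show "nilpotent_at (m + n) ?T z k" unfolding nil
    proof (intro allI impI)
      fix w assume "\<forall>i<k. (\<forall>r<m. w (Suc i) r = (if Suc r < m then w i (Suc r) else 0) + mat_app D (\<lambda>j. w i (m + j)) r) \<and>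
        (\<forall>r<n. w (Suc i) (m + r) = (if Suc r < n then w i (m + Suc r) else 0))"
      then show "(\<forall>j<m. w k j = 0) \<and> (\<forall>j<n. w k (m + j) = 0)"
        by (intro R[rule_format, of w "\<lambda>i j. w i (m + j)"]) simp
    qed
  qed
qed

text \<open>A vector of the second Jordan chain passes through \<open>n\<close> coordinates; on
  leaving the coordinate 0 it is fed into coordinate \<open>r - 1\<close> of the first block and
  lives for \<open>r\<close> further steps.\<close>

lemma nilpotent_at_perturbed:
  assumes mn: "m \<le> n" and r: "1 \<le> r" "r \<le> m" and \<epsilon>: "\<epsilon> \<noteq> 0"
  shows "nilpotent_at (m + n) (block_upper (kron_D m (Fin z)) (0\<^sub>m m n, (Delta_mat n m r \<epsilon>)\<^sup>T) (kron_D n (Fin z))) z k \<longleftrightarrow> n + r \<le> k"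
proof -
  have D: "(Delta_mat n m r \<epsilon>)\<^sup>T \<in> carrier_mat m n" by simp
  have app: "mat_app (Delta_mat n m r \<epsilon>)\<^sup>T g l = (if Suc l = r then \<epsilon> * g 0 else 0)" if "l < m" for g l
  proof -
    have "mat_app (Delta_mat n m r \<epsilon>)\<^sup>T g l = (\<Sum>j<n. if j = 0 then (if Suc l = r then \<epsilon> * g 0 else 0) else 0)"
      unfolding mat_app_def using that by (intro sum.cong) (auto simp: Delta_mat_def)
    then show ?thesis using mn r by simp
  qed
  show ?thesis unfolding nilpotent_at_block_upper[OF D]
  proof
    assume k: "n + r \<le> k"
    show "\<forall>f g. (\<forall>i<k. (\<forall>l<m. f (Suc i) l = (if Suc l < m then f i (Suc l) else 0) + mat_app (Delta_mat n m r \<epsilon>)\<^sup>T (g i) l) \<and>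
        (\<forall>l<n. g (Suc i) l = (if Suc l < n then g i (Suc l) else 0))) \<longrightarrow>
      (\<forall>j<m. f k j = 0) \<and> (\<forall>j<n. g k j = 0)"
    proof (intro allI impI)
      fix f g :: "nat \<Rightarrow> nat \<Rightarrow> complex"
      assume a: "\<forall>i<k. (\<forall>l<m. f (Suc i) l = (if Suc l < m then f i (Suc l) else 0) + mat_app (Delta_mat n m r \<epsilon>)\<^sup>T (g i) l) \<and>
        (\<forall>l<n. g (Suc i) l = (if Suc l < n then g i (Suc l) else 0))"
      \<comment> \<open>After \<open>i\<close> steps only the coordinates of \<open>g\<close> below
        \<open>n - i\<close> and those of \<open>f\<close> below \<open>n + r - i\<close> can be
        nonzero.\<close>
      have g: "l < n \<Longrightarrow> n \<le> i + l \<Longrightarrow> i \<le> k \<Longrightarrow> g i l = 0" for i l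
        using a by (induction i arbitrary: l) auto
      have f: "l < m \<Longrightarrow> n + r \<le> i + l \<Longrightarrow> i \<le> k \<Longrightarrow> f i l = 0" for i l
      proof (induction i arbitrary: l)
        case 0
        then show ?case using mn by simp
      next
        case (Suc i)
        have "f (Suc i) l = (if Suc l < m then f i (Suc l) else 0) + (if Suc l = r then \<epsilon> * g i 0 else 0)"
          using a Suc.prems app by simp
        moreover have "Suc l < m \<Longrightarrow> f i (Suc l) = 0" using Suc by simp
        moreover have "Suc l = r \<Longrightarrow> g i 0 = 0" using Suc.prems mn r by (intro g) auto
        ultimately show ?case by auto
      qed
      show "(\<forall>j<m. f k j = 0) \<and> (\<forall>j<n. g k j = 0)" using f g k by simp
    qed
  next
    assume R: "\<forall>f g. (\<forall>i<k. (\<forall>l<m. f (Suc i) l = (if Suc l < m then f i (Suc l) else 0) + mat_app (Delta_mat n m r \<epsilon>)\<^sup>T (g i) l) \<and>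
        (\<forall>l<n. g (Suc i) l = (if Suc l < n then g i (Suc l) else 0))) \<longrightarrow>
      (\<forall>j<m. f k j = 0) \<and> (\<forall>j<n. g k j = 0)"
    \<comment> \<open>The longest chain: it starts at the last coordinate of the second block,
      descends to 0 and continues from coordinate \<open>r - 1\<close> of the first block.\<close>
    define f where "f i j = (if Suc (i + j) = n + r \<and> j < r then \<epsilon> else 0)" for i j
    define g where "g i l = (if Suc (i + l) = n then 1 else 0 :: complex)" for i l
    have "(\<forall>l<m. f (Suc i) l = (if Suc l < m then f i (Suc l) else 0) + mat_app (Delta_mat n m r \<epsilon>)\<^sup>T (g i) l) \<and>
        (\<forall>l<n. g (Suc i) l = (if Suc l < n then g i (Suc l) else 0))" for i
      using r by (auto simp: app f_def g_def)
    then have z: "(\<forall>j<m. f k j = 0) \<and> (\<forall>j<n. g k j = 0)" using R by blast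
    show "n + r \<le> k"
    proof (rule ccontr)
      assume k: "\<not> n + r \<le> k"
      show False
      proof (cases "k < n")
        case True
        then have "g k (n - 1 - k) = 1" by (simp add: g_def)
        moreover have "n - 1 - k < n" using True by simp
        ultimately show False using z by auto
      next
        case False
        then have "f k (n + r - 1 - k) = \<epsilon>" "n + r - 1 - k < m" using k r by (auto simp: f_def)
        then show False using z \<epsilon> by auto
      qed
    qed
  qed
qed

text \<open>The index is the size of the larger block; the first block may be empty.\<close>

lemma nilpotent_at_two_D:
  assumes "m \<le> n" "1 \<le> n"
  shows "nilpotent_at (m + n) (kron_D m (Fin z) \<boxplus> kron_D n (Fin z)) z k \<longleftrightarrow> n \<le> k"
proof -
  have "nilpotent_at (m + n) (block_upper (kron_D m (Fin z)) (0\<^sub>m m n, 0\<^sub>m m n) (kron_D n (Fin z))) z k \<longleftrightarrow> n \<le> k"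
    unfolding nilpotent_at_block_upper[OF zero_carrier_mat]
  proof
    assume k: "n \<le> k"
    show "\<forall>f g. (\<forall>i<k. (\<forall>l<m. f (Suc i) l = (if Suc l < m then f i (Suc l) else 0) + mat_app (0\<^sub>m m n) (g i) l) \<and>
        (\<forall>l<n. g (Suc i) l = (if Suc l < n then g i (Suc l) else 0))) \<longrightarrow>
      (\<forall>j<m. f k j = 0) \<and> (\<forall>j<n. g k j = 0)"
    proof (intro allI impI)
      fix f g :: "nat \<Rightarrow> nat \<Rightarrow> complex"
      assume a: "\<forall>i<k. (\<forall>l<m. f (Suc i) l = (if Suc l < m then f i (Suc l) else 0) + mat_app (0\<^sub>m m n) (g i) l) \<and>
        (\<forall>l<n. g (Suc i) l = (if Suc l < n then g i (Suc l) else 0))"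
      have g: "l < n \<Longrightarrow> n \<le> i + l \<Longrightarrow> i \<le> k \<Longrightarrow> g i l = 0" for i l
        using a by (induction i arbitrary: l) auto
      have f: "l < m \<Longrightarrow> n \<le> i + l \<Longrightarrow> i \<le> k \<Longrightarrow> f i l = 0" for i l
        using a assms(1) by (induction i arbitrary: l) (auto simp: mat_app_zero)
      show "(\<forall>j<m. f k j = 0) \<and> (\<forall>j<n. g k j = 0)" using f g k by simp
    qed
  next
    assume R: "\<forall>f g. (\<forall>i<k. (\<forall>l<m. f (Suc i) l = (if Suc l < m then f i (Suc l) else 0) + mat_app (0\<^sub>m m n) (g i) l) \<and>
        (\<forall>l<n. g (Suc i) l = (if Suc l < n then g i (Suc l) else 0))) \<longrightarrow>
      (\<forall>j<m. f k j = 0) \<and> (\<forall>j<n. g k j = (0 :: complex))"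
    define g where "g i l = (if Suc (i + l) = n then 1 else 0 :: complex)" for i l
    have z: "\<forall>j<n. g k j = 0"
      using R[rule_format, of "\<lambda>_ _. 0" g] by (auto simp: mat_app_zero g_def)
    show "n \<le> k"
    proof (rule ccontr)
      assume "\<not> n \<le> k"
      then have "g k (n - 1 - k) = 1" "n - 1 - k < n" by (auto simp: g_def)
      then show False using z by auto
    qed
  qed
  then show ?thesis by (simp only: block_lower_zero(2)[OF kron_D_carrier kron_D_carrier])
qed

text \<open>A chain \<open>v\<close> that refutes nilpotency at \<open>X\<close> is built into a
  linear system: its solutions are the chains that start proportionally to \<open>v 0\<close> and
  end with a zero at \<open>l\<close>. It is injective for \<open>X\<close>, hence for a nearby
  \<open>Z\<close> equivalent to \<open>Y\<close>; but there the chain from \<open>v 0\<close>,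
  which ends in zero, solves it.\<close>

lemma nilpotent_at_semicontinuous:
  assumes deg: "degenerates_from X Y" and X: "X \<in> matrix_pairs n n" and inv: "corank_le 0 (fst X)"
    and nil: "nilpotent_at n Y z k"
  shows "nilpotent_at n X z k"
proof (rule ccontr)
  assume "\<not> nilpotent_at n X z k"
  then obtain v l where v: "\<And>i r. i < k \<Longrightarrow> r < n \<Longrightarrow> mat_app (fst X) (v (Suc i)) r = mat_app (pencil_at (- z) 1 X) (v i) r"
    and l: "l < n" "v k l \<noteq> 0" unfolding nilpotent_at_def by blast
  have A: "fst X \<in> carrier_mat n n" using X by (simp add: matrix_pairs_iff)
  have Ainj: "y j = 0" if "\<And>r. r < n \<Longrightarrow> mat_app (fst X) y r = 0" "j < n" for y j
    using inv that unfolding corank_le_0_iff[OF A] by blast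
  have Y: "Y \<in> matrix_pairs n n" and near: "\<And>d. d > 0 \<Longrightarrow> \<exists>Z. pair_equiv Y Z \<and> close_pairs n n d X Z"
    using degenerates_fromD[OF deg X] by auto
  have pfst: "pencil_at 1 0 Z = fst Z" if "Z \<in> matrix_pairs n n" for Z
    using that by (auto simp: pencil_at_def matrix_pairs_iff intro!: eq_matI)
  have linC: "mat_app M (\<lambda>j. x j - t * y j) r = mat_app M x r - t * mat_app M y r" for M x y t r
    by (simp add: mat_app_def right_diff_distrib sum_subtractf sum_distrib_left mult.left_commute)
  \<comment> \<open>A chain that starts with zero stays zero, as the first component is
    injective.\<close>
  have "\<exists>s<n. v 0 s \<noteq> 0"
  proof (rule ccontr)
    assume no: "\<not> (\<exists>s<n. v 0 s \<noteq> 0)"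
    have "i \<le> k \<Longrightarrow> \<forall>j<n. v i j = 0" for i
    proof (induction i)
      case (Suc i)
      have "mat_app (pencil_at (- z) 1 X) (v i) r = 0" if "r < n" for r
        using Suc pencil_at_carrier[OF X, of "- z" 1] by (intro mat_app_eq_0) auto
      then show ?case using Ainj[of "v (Suc i)"] v[of i] Suc.prems by simp
    qed (use no in blast)
    then show False using l by blast
  qed
  then obtain s where s: "s < n" "v 0 s \<noteq> 0" by blast
  \<comment> \<open>\<open>Inl\<close> holds the chain equations, \<open>Inr (Some c)\<close> the
    minors that make the start proportional to \<open>v 0\<close>, and \<open>Inr None\<close> the
    end condition.\<close>
  define u where "u Z e tj = (case e of
      Inl (i, r) \<Rightarrow> (case tj of (t, j) \<Rightarrow> (if t = Suc i then fst Z $$ (r, j) else 0)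
        - (if t = i then pencil_at (- z) 1 Z $$ (r, j) else 0))
    | Inr (Some c) \<Rightarrow> (case tj of (t, j) \<Rightarrow> if t = 0 then (if j = c then v 0 s else 0) - (if j = s then v 0 c else 0) else 0)
    | Inr None \<Rightarrow> (if tj = (k, l) then 1 else 0))"
    for Z :: mpair and e :: "nat \<times> nat + nat option" and tj :: "nat \<times> nat"
  define I where "I = Inl ` ({..<k} \<times> {..<n}) \<union> Inr ` (insert None (Some ` {..<n}))"
  define J where "J = {..<Suc k} \<times> {..<n}"
  have fin: "finite I" "finite J" by (auto simp: I_def J_def)
  have s1: "(\<Sum>tj\<in>J. u Z (Inl (i, r)) tj * x tj) = mat_app (fst Z) (\<lambda>j. x (Suc i, j)) r - mat_app (pencil_at (- z) 1 Z) (\<lambda>j. x (i, j)) r"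
    if "i < k" "Z \<in> matrix_pairs n n" for Z i r x
  proof -
    have c: "dim_col (fst Z) = n" "dim_col (pencil_at (- z) 1 Z) = n"
      using that(2) pencil_at_carrier[OF that(2), of "- z" 1] by (auto simp: matrix_pairs_iff)
    have "(\<Sum>tj\<in>J. u Z (Inl (i, r)) tj * x tj) = (\<Sum>t<Suc k. \<Sum>j<n. u Z (Inl (i, r)) (t, j) * x (t, j))"
      unfolding J_def by (simp add: sum.cartesian_product del: sum.lessThan_Suc)
    also have "\<dots> = (\<Sum>t<Suc k. (if t = Suc i then mat_app (fst Z) (\<lambda>j. x (Suc i, j)) r else 0)
        - (if t = i then mat_app (pencil_at (- z) 1 Z) (\<lambda>j. x (i, j)) r else 0))"
      by (intro sum.cong refl) (auto simp: u_def mat_app_def c sum_negf)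
    finally show ?thesis using that(1) by (simp add: sum_subtractf del: sum.lessThan_Suc)
  qed
  have s2: "(\<Sum>tj\<in>J. u Z (Inr (Some c)) tj * x tj) = v 0 s * x (0, c) - v 0 c * x (0, s)" if "c < n" for Z c x
  proof -
    have "(\<Sum>tj\<in>J. u Z (Inr (Some c)) tj * x tj) = (\<Sum>t<Suc k. \<Sum>j<n. u Z (Inr (Some c)) (t, j) * x (t, j))"
      unfolding J_def by (simp add: sum.cartesian_product del: sum.lessThan_Suc)
    also have "\<dots> = (\<Sum>t<Suc k. if t = 0 then (\<Sum>j<n. (if j = c then v 0 s * x (0, c) else 0) - (if j = s then v 0 c * x (0, s) else 0)) else 0)"
      by (intro sum.cong refl) (auto simp: u_def intro!: sum.cong)
    also have "\<dots> = (\<Sum>j<n. (if j = c then v 0 s * x (0, c) else 0) - (if j = s then v 0 c * x (0, s) else 0))"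
      by (simp del: sum.lessThan_Suc)
    finally show ?thesis using that s by (simp add: sum_subtractf)
  qed
  have s3: "(\<Sum>tj\<in>J. u Z (Inr None) tj * x tj) = x (k, l)" for Z x
  proof -
    have "(\<Sum>tj\<in>J. u Z (Inr None) tj * x tj) = (\<Sum>tj\<in>J. if tj = (k, l) then x (k, l) else 0)"
      by (intro sum.cong) (auto simp: u_def)
    then show ?thesis using fin l by (simp add: J_def)
  qed
  have sys: "(\<forall>e\<in>I. (\<Sum>tj\<in>J. u Z e tj * x tj) = 0) \<longleftrightarrow>
     (\<forall>i<k. \<forall>r<n. mat_app (fst Z) (\<lambda>j. x (Suc i, j)) r = mat_app (pencil_at (- z) 1 Z) (\<lambda>j. x (i, j)) r) \<and>
     (\<forall>c<n. v 0 s * x (0, c) = v 0 c * x (0, s)) \<and> x (k, l) = 0"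
    if "Z \<in> matrix_pairs n n" for Z x
    unfolding I_def using that by (auto simp: ball_Un s1 s2 s3)
  \<comment> \<open>A solution is a multiple \<open>c\<close> of \<open>v\<close>, and the end
    condition gives \<open>c * v k l = 0\<close>.\<close>
  have "injective_system I J (u X)" unfolding injective_system_def sys[OF X]
  proof (intro allI impI ballI)
    fix x tj assume x: "(\<forall>i<k. \<forall>r<n. mat_app (fst X) (\<lambda>j. x (Suc i, j)) r = mat_app (pencil_at (- z) 1 X) (\<lambda>j. x (i, j)) r) \<and>
     (\<forall>c<n. v 0 s * x (0, c) = v 0 c * x (0, s)) \<and> x (k, l) = 0" and tj: "tj \<in> J"
    define c where "c = x (0, s) / v 0 s"
    have xi: "i \<le> k \<Longrightarrow> \<forall>j<n. x (i, j) - c * v i j = 0" for i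
    proof (induction i)
      case 0
      show ?case using x s(2) by (auto simp: c_def field_simps)
    next
      case (Suc i)
      have "mat_app (fst X) (\<lambda>j. x (Suc i, j) - c * v (Suc i) j) r = 0" if r: "r < n" for r
      proof -
        have "mat_app (fst X) (\<lambda>j. x (Suc i, j) - c * v (Suc i) j) r = mat_app (pencil_at (- z) 1 X) (\<lambda>j. x (i, j) - c * v i j) r"
          unfolding linC using x v[of i r] r Suc.prems by simp
        also have "\<dots> = 0" using Suc pencil_at_carrier[OF X, of "- z" 1] by (intro mat_app_eq_0) auto
        finally show ?thesis .
      qed
      then show ?case using Ainj[of "\<lambda>j. x (Suc i, j) - c * v (Suc i) j"] by blast
    qed
    have "c * v k l = 0" using xi[of k] l(1) x by simp
    then have "c = 0" using l(2) by simp
    then show "x tj = 0" using xi[of "fst tj"] tj by (auto simp: J_def)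
  qed
  from injective_system_open[OF fin this] obtain e where e: "e > 0"
    "\<And>b. \<forall>i\<in>I. \<forall>j\<in>J. cmod (b i j - u X i j) < e \<Longrightarrow> injective_system I J b" by blast
  \<comment> \<open>An entry of the first component moves by less than \<open>d\<close>, one of
    \<open>B - z A\<close> by at most \<open>cmod z * d + d\<close>; together this makes
    \<open>e\<close>.\<close>
  define d where "d = e / (cmod z + 2)"
  have zp: "cmod z + 2 > 0" using norm_ge_zero[of z] by linarith
  have "(cmod z + 2) * d = e" using zp by (simp add: d_def)
  moreover have "d > 0" using e(1) zp by (simp add: d_def)
  ultimately have d: "d > 0" "d + (cmod z * d + d) = e" by (simp_all add: distrib_right)
  from near[OF d(1)] obtain Z where Z: "pair_equiv Y Z" "close_pairs n n d X Z" by blast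
  have Zc: "Z \<in> matrix_pairs n n" using pair_equiv_matrix_pairs[OF Z(1)] Y by blast
  have e1: "cmod (fst Z $$ (r, j) - fst X $$ (r, j)) < d" if "r < n" "j < n" for r j
    using Z(2) that unfolding close_pairs_def by blast
  have e2: "cmod (pencil_at (- z) 1 Z $$ (r, j) - pencil_at (- z) 1 X $$ (r, j)) \<le> cmod z * d + d" if rj: "r < n" "j < n" for r j
  proof -
    have "pencil_at (- z) 1 Z $$ (r, j) - pencil_at (- z) 1 X $$ (r, j)
      = - z * (fst Z $$ (r, j) - fst X $$ (r, j)) + (snd Z $$ (r, j) - snd X $$ (r, j))"
      using X Zc rj by (auto simp: pencil_at_def matrix_pairs_iff algebra_simps)
    also have "cmod \<dots> \<le> cmod z * d + d"
      using Z(2) rj unfolding close_pairs_def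
      by (intro order_trans[OF norm_triangle_ineq] add_mono) (simp_all add: norm_mult mult_left_mono less_imp_le)
    finally show ?thesis .
  qed
  have "\<forall>i\<in>I. \<forall>j\<in>J. cmod (u Z i j - u X i j) < e"
  proof (intro ballI)
    fix i tj assume i: "i \<in> I" and tj: "tj \<in> J"
    show "cmod (u Z i tj - u X i tj) < e"
    proof (cases i)
      case (Inl ir)
      obtain a r where ir: "ir = (a, r)" by (cases ir)
      obtain t j where tj': "tj = (t, j)" by (cases tj)
      have rj: "r < n" "j < n" using i tj Inl ir tj' by (auto simp: I_def J_def)
      have nn: "cmod z * d \<ge> 0" using d(1) by simp
      have f1: "cmod (fst Z $$ (r, j) - fst X $$ (r, j)) < e" using e1[OF rj] nn d by linarith
      have f2: "cmod (pencil_at (- z) 1 Z $$ (r, j) - pencil_at (- z) 1 X $$ (r, j)) < e" using e2[OF rj] d by linarith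
      show ?thesis using f1 f2 e(1)
        by (auto simp: u_def Inl ir tj' norm_minus_commute)
    next
      case (Inr c)
      then have "u Z i tj - u X i tj = 0" by (cases c) (simp_all add: u_def)
      then show ?thesis using e(1) by simp
    qed
  qed
  then have injZ: "injective_system I J (u Z)" by (rule e(2))
  \<comment> \<open>Semicontinuity of the corank makes the first component of \<open>Z\<close>
    nonsingular, so the chain from \<open>v 0\<close> exists in \<open>Z\<close>.\<close>
  have "corank_le 0 (fst Z)"
    using corank_le_equiv[OF Z(1) corank_le_semicontinuous[OF deg, of 0 1 0]] inv pfst[OF X] pfst[OF Zc] by simp
  from left_inverse_of_corank_le_0[OF _ this] obtain C where C: "C \<in> carrier_mat n n" "C * fst Z = 1\<^sub>m n"
    using Zc by (auto simp: matrix_pairs_iff)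
  have Zf: "fst Z \<in> carrier_mat n n" using Zc by (simp add: matrix_pairs_iff)
  have ZC: "fst Z * C = 1\<^sub>m n" using mat_mult_left_right_inverse[OF C(1) Zf C(2)] .
  define w where "w i = ((\<lambda>y. mat_app C (mat_app (pencil_at (- z) 1 Z) y)) ^^ i) (v 0)" for i
  have w: "mat_app (fst Z) (w (Suc i)) r = mat_app (pencil_at (- z) 1 Z) (w i) r" if "r < n" for i r
    using mat_app_mult[OF Zf C(1) that, of "mat_app (pencil_at (- z) 1 Z) (w i)"] ZC that
    by (simp add: w_def mat_app_one)
  have "nilpotent_at n Z z k" using nilpotent_at_equiv[OF Z(1) Y nil] .
  then have "\<forall>j<n. w k j = 0" unfolding nilpotent_at_def using w by blast
  \<comment> \<open>This chain solves the injective system although its start \<open>v 0\<close> is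
    not zero.\<close>
  then have "\<forall>e\<in>I. (\<Sum>tj\<in>J. u Z e tj * (\<lambda>(i, j). w i j) tj) = 0"
    unfolding sys[OF Zc] using w l(1) by (auto simp: w_def)
  then have "(\<lambda>(i, j). w i j) (0, s) = 0" using injZ s(1) unfolding injective_system_def by (auto simp: J_def)
  then show False using s(2) by (simp add: w_def)
qed

section \<open>Degenerations and explicit pairs in (v)\<close>

text \<open>The coranks leave at most two blocks, of total size \<open>m + n\<close>, but cannot
  tell how the size is shared. The larger block is the nilpotency index, and this does not drop
  below \<open>n\<close>.\<close>

lemma degenerates_from_two_D:
  assumes m: "1 \<le> m" and mn: "m \<le> n" and d: "degenerates_from (kron_D m \<mu> \<boxplus> kron_D n \<mu>) Y"
  shows "\<exists>r\<le>m. pair_equiv Y (kron_D (m - r) \<mu> \<boxplus> kron_D (n + r) \<mu>)"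
proof -
  have fin: "\<exists>r\<le>m. pair_equiv Y (kron_D (m - r) (Fin z) \<boxplus> kron_D (n + r) (Fin z))"
    if d: "degenerates_from (kron_D m (Fin z) \<boxplus> kron_D n (Fin z)) Y" for Y z
  proof -
    let ?X = "kron_D m (Fin z) \<boxplus> kron_D n (Fin z)"
    have X: "?X \<in> matrix_pairs (m + n) (m + n)" by (rule pair_sum_carrier[OF kron_D_carrier kron_D_carrier])
    have Y: "Y \<in> matrix_pairs (m + n) (m + n)" using degenerates_fromD(1)[OF d X] .
    have off: "corank_le 0 (pencil_at a b Y)" if "a + b * z \<noteq> 0" for a b
      using corank_le_semicontinuous[OF d corank_le_pair_sum[OF kron_D_carrier kron_D_carrier
        kron_D_off_eigenvalue[OF that] kron_D_off_eigenvalue[OF that]]] by simp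
    have at: "corank_le (1 + 1) (pencil_at z (- 1) Y)"
      using corank_le_semicontinuous[OF d corank_le_pair_sum[OF kron_D_carrier kron_D_carrier
        corank_le_1_kron_D corank_le_1_kron_D]] by simp
    from single_eigenvalue_canonical_form[OF Y off at] obtain ks where ks: "length ks \<le> 1 + 1" "sum_list ks = m + n"
      "pair_equiv Y (direct_sum (map (\<lambda>k. kron_D k (Fin z)) ks))" by blast
    have "\<exists>a b. a \<le> b \<and> a + b = m + n \<and> pair_equiv Y (kron_D a (Fin z) \<boxplus> kron_D b (Fin z))"
    proof -
      consider "ks = []" | k where "ks = [k]" | k1 k2 where "ks = [k1, k2]"
        using ks(1) by (cases ks rule: list.exhaust[case_product list.exhaust[of "tl ks"]]) (cases ks; cases "tl ks"; auto)+
      then show ?thesis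
      proof cases
        case 1
        then show ?thesis using ks(2) m by simp
      next
        \<comment> \<open>A single block is completed by \<open>kron_D 0\<close>, the empty
          pair.\<close>
        case (2 k)
        then show ?thesis using ks(2,3) by (intro exI[of _ 0] exI[of _ k]) simp
      next
        case (3 k1 k2)
        then have p: "pair_equiv Y (kron_D k1 (Fin z) \<boxplus> kron_D k2 (Fin z))" using ks(3) by simp
        show ?thesis
        proof (cases "k1 \<le> k2")
          case True
          then show ?thesis using p 3 ks(2) by (intro exI[of _ k1] exI[of _ k2]) simp
        next
          case False
          then show ?thesis using pair_equiv_trans[OF p pair_sum_commute[OF kron_D_carrier kron_D_carrier]] 3 ks(2)
            by (intro exI[of _ k2] exI[of _ k1]) simp
        qed
      qed
    qed
    then obtain a b where ab: "a \<le> b" "a + b = m + n" and eq: "pair_equiv Y (kron_D a (Fin z) \<boxplus> kron_D b (Fin z))"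
      by blast
    \<comment> \<open>If both blocks were smaller than \<open>n\<close>, the power
      \<open>n - 1\<close> would vanish for \<open>Y\<close> and then for the degenerate pair, whose
      larger block has size \<open>n\<close>.\<close>
    have "n \<le> b"
    proof (rule ccontr)
      assume b: "\<not> n \<le> b"
      have "nilpotent_at (a + b) (kron_D a (Fin z) \<boxplus> kron_D b (Fin z)) z (n - 1)"
        using nilpotent_at_two_D[OF ab(1), of z "n - 1"] ab b m by simp
      then have nY: "nilpotent_at (m + n) Y z (n - 1)"
        using nilpotent_at_equiv[OF pair_equiv_sym[OF eq] pair_sum_carrier[OF kron_D_carrier kron_D_carrier]] ab(2) by simp
      have "fst ?X = pencil_at 1 0 ?X" using X by (auto simp: pencil_at_def matrix_pairs_iff intro!: eq_matI)
      then have "corank_le 0 (fst ?X)"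
        using corank_le_pair_sum[OF kron_D_carrier kron_D_carrier kron_D_off_eigenvalue[of 1 0 z m] kron_D_off_eigenvalue[of 1 0 z n]] by simp
      from nilpotent_at_semicontinuous[OF d X this nY] have "n \<le> n - 1"
        using nilpotent_at_two_D[OF mn, of z "n - 1"] m mn by simp
      then show False using m mn by simp
    qed
    define r where "r = b - n"
    have e: "m - r = a" "n + r = b" "r \<le> m" using \<open>n \<le> b\<close> ab by (auto simp: r_def)
    show ?thesis by (rule exI[of _ r], rule conjI, rule e(3), unfold e(1,2), rule eq)
  qed
  show ?thesis
  proof (cases \<mu>)
    case (Fin z)
    then show ?thesis using fin d by blast
  next
    case Infty
    have sw: "prod.swap (kron_D a Infty \<boxplus> kron_D b Infty) = kron_D a (Fin 0) \<boxplus> kron_D b (Fin 0)"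
      "prod.swap (kron_D a (Fin 0) \<boxplus> kron_D b (Fin 0)) = kron_D a Infty \<boxplus> kron_D b Infty" for a b
      unfolding swap_direct_sum by (simp_all add: swap_kron_D)
    from fin[OF degenerates_from_swap[OF d, unfolded Infty sw]] obtain r where
      r: "r \<le> m" "pair_equiv (prod.swap Y) (kron_D (m - r) (Fin 0) \<boxplus> kron_D (n + r) (Fin 0))" by blast
    have "pair_equiv Y (kron_D (m - r) Infty \<boxplus> kron_D (n + r) Infty)"
      using pair_equiv_swap[OF r(2)] unfolding sw by simp
    then show ?thesis using r(1) Infty by blast
  qed
qed

fun perturbed_two_D :: "nat \<Rightarrow> nat \<Rightarrow> ext_complex \<Rightarrow> nat \<Rightarrow> complex \<Rightarrow> mpair" where
  "perturbed_two_D m n (Fin z) r \<epsilon> = block_upper (kron_D m (Fin z)) (0\<^sub>m m n, (Delta_mat n m r \<epsilon>)\<^sup>T) (kron_D n (Fin z))"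
| "perturbed_two_D m n Infty r \<epsilon> = prod.swap (block_upper (kron_D m (Fin 0)) (0\<^sub>m m n, (Delta_mat n m r \<epsilon>)\<^sup>T) (kron_D n (Fin 0)))"

lemma perturbed_two_D:
  assumes m: "1 \<le> m" "m \<le> n" and r: "1 \<le> r" "r \<le> m" and \<epsilon>: "\<epsilon> \<noteq> 0"
  shows "pair_equiv (perturbed_two_D m n \<mu> r \<epsilon>) (kron_D (m - r) \<mu> \<boxplus> kron_D (n + r) \<mu>)"
    "degenerates_from (kron_D m \<mu> \<boxplus> kron_D n \<mu>) (perturbed_two_D m n \<mu> r \<epsilon>)"
proof -
  have D: "(0\<^sub>m m n, (Delta_mat n m r \<epsilon>)\<^sup>T) \<in> matrix_pairs m n" by (simp add: matrix_pairs_iff)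
  have dfin: "degenerates_from (kron_D m (Fin z) \<boxplus> kron_D n (Fin z)) (perturbed_two_D m n (Fin z) r \<epsilon>)" for z
    unfolding perturbed_two_D.simps by (rule pair_sum_degenerates_from_block_upper[OF kron_D_carrier kron_D_carrier D])
  have fin: "pair_equiv (perturbed_two_D m n (Fin z) r \<epsilon>) (kron_D (m - r) (Fin z) \<boxplus> kron_D (n + r) (Fin z))" for z
  proof -
    from degenerates_from_two_D[OF m dfin] obtain s where s: "s \<le> m"
      "pair_equiv (perturbed_two_D m n (Fin z) r \<epsilon>) (kron_D (m - s) (Fin z) \<boxplus> kron_D (n + s) (Fin z))" by blast
    have T: "perturbed_two_D m n (Fin z) r \<epsilon> \<in> matrix_pairs (m + n) (m + n)"
      unfolding perturbed_two_D.simps by (rule block_carrier(1)[OF kron_D_carrier kron_D_carrier])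
    have S: "kron_D (m - s) (Fin z) \<boxplus> kron_D (n + s) (Fin z) \<in> matrix_pairs (m + n) (m + n)"
      using pair_sum_carrier[OF kron_D_carrier[of "m - s" "Fin z"] kron_D_carrier[of "n + s" "Fin z"]] s(1) by simp
    have "nilpotent_at (m + n) (perturbed_two_D m n (Fin z) r \<epsilon>) z k \<longleftrightarrow>
        nilpotent_at (m + n) (kron_D (m - s) (Fin z) \<boxplus> kron_D (n + s) (Fin z)) z k" for k
      using nilpotent_at_equiv[OF s(2) T] nilpotent_at_equiv[OF pair_equiv_sym[OF s(2)] S] by blast
    \<comment> \<open>The two nilpotency indices \<open>n + r\<close> and \<open>n + s\<close>
      belong to equivalent pairs, which identifies \<open>s\<close>.\<close>
    then have "n + r \<le> k \<longleftrightarrow> n + s \<le> k" for k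
      using nilpotent_at_perturbed[OF m(2) r \<epsilon>] nilpotent_at_two_D[of "m - s" "n + s" z] s(1) m by simp
    from this[of "n + r"] this[of "n + s"] have "r = s" by simp
    then show ?thesis using s(2) by simp
  qed
  have sw: "prod.swap (kron_D a (Fin 0) \<boxplus> kron_D b (Fin 0)) = kron_D a Infty \<boxplus> kron_D b Infty" for a b
    unfolding swap_direct_sum by (simp add: swap_kron_D)
  have inf: "perturbed_two_D m n Infty r \<epsilon> = prod.swap (perturbed_two_D m n (Fin 0) r \<epsilon>)" by simp
  show "pair_equiv (perturbed_two_D m n \<mu> r \<epsilon>) (kron_D (m - r) \<mu> \<boxplus> kron_D (n + r) \<mu>)"
    using fin pair_equiv_swap[OF fin[of 0]] unfolding sw inf[symmetric] by (cases \<mu>) blast+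
  show "degenerates_from (kron_D m \<mu> \<boxplus> kron_D n \<mu>) (perturbed_two_D m n \<mu> r \<epsilon>)"
    using dfin degenerates_from_swap[OF dfin[of 0]] unfolding sw inf[symmetric] by (cases \<mu>) blast+
qed

lemma cone_two_D:
  assumes m: "1 \<le> m" and mn: "m \<le> n"
  shows "cone_is (kron_D m \<mu> \<boxplus> kron_D n \<mu>) ((\<lambda>r. kron_D (m - r) \<mu> \<boxplus> kron_D (n + r) \<mu>) ` {r. r \<le> m})"
proof (rule cone_isI[OF pair_sum_carrier[OF kron_D_carrier kron_D_carrier] degenerates_from_two_D[OF m mn]])
  fix r assume r: "r \<le> m"
  have refl: "pair_equiv (kron_D m \<mu> \<boxplus> kron_D n \<mu>) (kron_D m \<mu> \<boxplus> kron_D n \<mu>)"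
    by (rule pair_equiv_refl[OF pair_sum_carrier[OF kron_D_carrier kron_D_carrier]])
  show "degenerates_from (kron_D m \<mu> \<boxplus> kron_D n \<mu>) (kron_D (m - r) \<mu> \<boxplus> kron_D (n + r) \<mu>)"
  \<comment> \<open>The member for \<open>r = 0\<close> is the pair itself; explicit pairs are at
    hand from \<open>r = 1\<close> on.\<close>
  proof (cases "r = 0")
    case True
    then show ?thesis using degenerates_from_refl[OF pair_sum_carrier[OF kron_D_carrier kron_D_carrier]] by simp
  next
    case False
    then have "1 \<le> r" by simp
    from degenerates_from_equiv[OF perturbed_two_D(2)[OF m mn this r one_neq_zero] refl perturbed_two_D(1)[OF m mn this r one_neq_zero]]
    show ?thesis .
  qed
qed

section \<open>Square pairs of corank one\<close>

text \<open>The determinant of \<open>B - x A\<close> is a polynomial that vanishes everywhere,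
  hence zero, and a singular matrix over an integral domain has a nonzero kernel vector with entries
  in that domain.\<close>

lemma singular_square_has_null:
  assumes Y: "Y \<in> matrix_pairs n n" and sing: "\<And>s. \<not> corank_le 0 (pencil_at s 1 Y)"
  shows "\<exists>d. has_null Y d"
proof -
  define M where "M = mat n n (\<lambda>(i, j). [:snd Y $$ (i, j), - fst Y $$ (i, j):])"
  have M: "M \<in> carrier_mat n n" by (simp add: M_def)
  have "poly (det M) s = 0" for s
  proof -
    have c: "pencil_at (- s) 1 Y \<in> carrier_mat n n" using pencil_at_carrier[OF Y] .
    have "poly (det M) s = det (pencil_at (- s) 1 Y)"
      using Y by (intro poly_det_cong[OF c M]) (auto simp: M_def pencil_at_def matrix_pairs_iff algebra_simps)
    then show ?thesis using sing[of "- s"] corank_le_0_iff_det[OF c] by simp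
  qed
  then have "det M = 0" using poly_all_0_iff_0 by blast
  then obtain v where v: "v \<in> carrier_vec n" "v \<noteq> 0\<^sub>v n" "M *\<^sub>v v = 0\<^sub>v n"
    using det_0_iff_vec_prod_zero[OF M] by blast
  \<comment> \<open>The sum serves as a crude common bound for the degrees.\<close>
  define d where "d = (\<Sum>j<n. degree (v $ j))"
  have "\<exists>j<n. v $ j \<noteq> 0"
  proof (rule ccontr)
    assume "\<not> (\<exists>j<n. v $ j \<noteq> 0)"
    then have "v = 0\<^sub>v n" using v(1) by (intro eq_vecI) auto
    then show False using v(2) by blast
  qed
  then obtain j where j: "j < n" "v $ j \<noteq> 0" by blast
  have "has_null Y d"
  proof (rule has_nullI[where f = "\<lambda>j. v $ j", OF Y _ j])
    show "degree (v $ j) \<le> d" if "j < n" for j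
      unfolding d_def using that by (intro member_le_sum[of j "{..<n}" "\<lambda>j. degree (v $ j)"]) auto
    show "poly_app (snd Y) (\<lambda>j. v $ j) i = pCons 0 (poly_app (fst Y) (\<lambda>j. v $ j) i)" if i: "i < n" for i
    proof -
      have "0 = (M *\<^sub>v v) $ i" using v(3) i by simp
      also have "\<dots> = (\<Sum>j<n. [:snd Y $$ (i, j), - fst Y $$ (i, j):] * v $ j)"
        using i v(1) by (auto simp: M_def scalar_prod_def atLeast0LessThan intro!: sum.cong)
      also have "\<dots> = (\<Sum>j<n. Polynomial.smult (snd Y $$ (i, j)) (v $ j) - pCons 0 (Polynomial.smult (fst Y $$ (i, j)) (v $ j)))"
        by (intro sum.cong refl) simp
      also have "\<dots> = (\<Sum>j<n. Polynomial.smult (snd Y $$ (i, j)) (v $ j)) - (\<Sum>j<n. pCons 0 (Polynomial.smult (fst Y $$ (i, j)) (v $ j)))"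
        by (simp only: sum_subtractf)
      also have "(\<Sum>j<n. pCons 0 (Polynomial.smult (fst Y $$ (i, j)) (v $ j))) = pCons 0 (\<Sum>j<n. Polynomial.smult (fst Y $$ (i, j)) (v $ j))"
        by (rule poly_eqI) (simp add: coeff_sum coeff_pCons split: nat.split)
      finally show ?thesis using Y by (auto simp: poly_app_def matrix_pairs_iff)
    qed
  qed
  then show ?thesis by blast
qed

text \<open>The substitution turns (I, J) into (J, I - s J). For \<nu> = 0 the first component is
  nilpotent, which gives infinity; otherwise the eigenvalue becomes (1 - s \<nu>) / \<nu>.\<close>

lemma moebius_kron_D:
  assumes "1 \<le> k"
  shows "\<exists>\<mu>. pair_equiv (pair_lincomb 0 1 1 (- s) (kron_D k (Fin \<nu>))) (kron_D k \<mu>)"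
proof -
  let ?P = "pair_lincomb 0 1 1 (- s) (kron_D k (Fin \<nu>))"
  have P: "?P \<in> matrix_pairs k k" by (rule lincomb_carrier[OF kron_D_carrier])
  have pen: "pencil_at a b ?P = bidiagonal k (a * \<nu> + b * (1 - s * \<nu>)) (a - b * s)" for a b
    by (intro eq_matI) (auto simp: pencil_at_def pair_lincomb_def kron_D.simps bidiagonal_def algebra_simps)
  show ?thesis
  proof (cases "\<nu> = 0")
    case True
    have S: "prod.swap ?P \<in> matrix_pairs k k" using P by simp
    have "pair_equiv (prod.swap ?P) (kron_D k (Fin 0))"
    proof (rule kron_D_canonical_form[OF S])
      show "corank_le 0 (pencil_at a b (prod.swap ?P))" if "a + b * 0 \<noteq> 0" for a b
        unfolding pencil_at_swap[OF P] pen using that True by (intro corank_le_0_bidiagonal) simp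
      show "corank_le 1 (pencil_at 0 (- 1) (prod.swap ?P))"
        unfolding pencil_at_swap[OF P] pen using True by (intro corank_le_1_bidiagonal) simp
    qed
    from pair_equiv_swap[OF this] show ?thesis unfolding swap_kron_D swap_swap by blast
  next
    case False
    have "pair_equiv ?P (kron_D k (Fin ((1 - s * \<nu>) / \<nu>)))"
    proof (rule kron_D_canonical_form[OF P])
      show "corank_le 0 (pencil_at a b ?P)" if "a + b * ((1 - s * \<nu>) / \<nu>) \<noteq> 0" for a b
      proof -
        have "a * \<nu> + b * (1 - s * \<nu>) = \<nu> * (a + b * ((1 - s * \<nu>) / \<nu>))" using False by (simp add: field_simps)
        then show ?thesis unfolding pen using that False by (intro corank_le_0_bidiagonal) simp
      qed
      have "(1 - s * \<nu>) / \<nu> + s = 1 / \<nu>" using False by (simp add: field_simps)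
      then have "(1 - s * \<nu>) / \<nu> - (- 1) * s \<noteq> 0" using False by simp
      then show "corank_le 1 (pencil_at ((1 - s * \<nu>) / \<nu>) (- 1) ?P)"
        unfolding pen by (intro corank_le_1_bidiagonal) blast
    qed
    then show ?thesis by blast
  qed
qed

lemma kron_D_sum_carrier: "kron_D_sum rs \<in> matrix_pairs (sum_list (map fst rs)) (sum_list (map fst rs))"
  unfolding kron_D_sum_def by (rule kron_D_list_carrier)

lemma kron_D_sum_Cons: "kron_D_sum ((k, \<mu>) # rs) = kron_D k \<mu> \<boxplus> kron_D_sum rs"
  unfolding kron_D_sum_def list.map prod.case by (rule direct_sum_Cons)

lemma lincomb_kron_D_list:
  assumes "\<forall>(k, a)\<in>set ks. k \<ge> 1"
  shows "\<exists>rs. (\<forall>(k, \<mu>)\<in>set rs. k \<ge> 1) \<and> sum_list (map fst rs) = sum_list (map fst ks) \<and>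
    pair_equiv (pair_lincomb 0 1 1 (- s) (direct_sum (map (\<lambda>(k, a). kron_D k (Fin a)) ks))) (kron_D_sum rs)"
  using assms
proof (induction ks)
  case Nil
  have "pair_lincomb 0 1 1 (- s) (direct_sum []) = kron_D_sum []"
    by (auto simp: kron_D_sum_def direct_sum_Nil pair_lincomb_def intro!: eq_matI)
  then show ?case using pair_equiv_refl[OF kron_D_sum_carrier, of "[]"] by (intro exI[of _ "[]"]) simp
next
  case (Cons r ks)
  obtain k a where r: "r = (k, a)" by (cases r)
  from Cons obtain rs where rs: "\<forall>(k, \<mu>)\<in>set rs. k \<ge> 1" "sum_list (map fst rs) = sum_list (map fst ks)"
    "pair_equiv (pair_lincomb 0 1 1 (- s) (direct_sum (map (\<lambda>(k, a). kron_D k (Fin a)) ks))) (kron_D_sum rs)" by auto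
  have k: "1 \<le> k" using Cons.prems r by simp
  from moebius_kron_D[OF k] obtain \<mu> where \<mu>: "pair_equiv (pair_lincomb 0 1 1 (- s) (kron_D k (Fin a))) (kron_D k \<mu>)" by blast
  have c: "direct_sum (map (\<lambda>(k, a). kron_D k (Fin a)) ks) \<in> matrix_pairs (sum_list (map fst ks)) (sum_list (map fst ks))"
    unfolding kron_D_list_eq matrix_pairs_iff carrier_mat_def by simp
  have "direct_sum (map (\<lambda>(k, a). kron_D k (Fin a)) (r # ks)) = kron_D k (Fin a) \<boxplus> direct_sum (map (\<lambda>(k, a). kron_D k (Fin a)) ks)"
    unfolding r list.map prod.case by (rule direct_sum_Cons)
  then have "pair_equiv (pair_lincomb 0 1 1 (- s) (direct_sum (map (\<lambda>(k, a). kron_D k (Fin a)) (r # ks)))) (kron_D_sum ((k, \<mu>) # rs))"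
    using pair_equiv_pair_sum[OF \<mu> rs(3)] lincomb_pair_sum[OF kron_D_carrier c] by (simp only: kron_D_sum_Cons)
  then show ?case using rs k r by (intro exI[of _ "(k, \<mu>) # rs"]) simp
qed

text \<open>Two blocks with a common eigenvalue would have corank 2 at its point.\<close>

lemma corank_one_distinct:
  assumes "\<forall>(k, \<mu>)\<in>set rs. k \<ge> 1" "\<And>a b. a \<noteq> 0 \<or> b \<noteq> 0 \<Longrightarrow> corank_le 1 (pencil_at a b (kron_D_sum rs))"
  shows "distinct (map snd rs)"
  using assms
proof (induction rs)
  case (Cons r rs)
  obtain k \<mu> where r: "r = (k, \<mu>)" by (cases r)
  have k: "0 < k" using Cons.prems(1) r by auto
  obtain a b where ab: "eigen_point \<mu> = (a, b)" by (cases "eigen_point \<mu>")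
  have ab0: "a \<noteq> 0 \<or> b \<noteq> 0" using ab by (cases \<mu>) auto
  note c = Cons.prems(2)[unfolded r kron_D_sum_Cons]
  have inj: "corank_le 0 (pencil_at a b (kron_D_sum rs))"
    using kron_D_summand[OF k ab kron_D_sum_carrier c[OF ab0]] by auto
  \<comment> \<open>The first block has used up the corank at its point, so no further block may be
    singular there.\<close>
  have "\<mu> \<notin> snd ` set qs" if "corank_le 0 (pencil_at a b (kron_D_sum qs))" "\<forall>(k, \<mu>)\<in>set qs. k \<ge> 1" for qs
    using that
  proof (induction qs)
    case (Cons q qs)
    obtain l \<nu> where q: "q = (l, \<nu>)" by (cases q)
    note c = Cons.prems(1)[unfolded q kron_D_sum_Cons]
    have "corank_le 0 (pencil_at a b (kron_D_sum qs))"
      using corank_le_pair_summands(2)[OF kron_D_carrier kron_D_sum_carrier c] .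
    moreover have "\<nu> \<noteq> \<mu>" using kron_D_summand[OF _ ab kron_D_sum_carrier, of l] c Cons.prems(2) q by auto
    ultimately show ?case using Cons q by auto
  qed simp
  then have "\<mu> \<notin> snd ` set rs" using inj Cons.prems(1) by simp
  moreover have "distinct (map snd rs)"
    using Cons.prems(1) corank_le_pair_summands(2)[OF kron_D_carrier kron_D_sum_carrier c] by (intro Cons.IH) auto
  ultimately show ?case using r by simp
qed simp

text \<open>Passing from (A, B) to (s A + B, A) makes the first component nonsingular, so the Jordan
  form applies; the inverse change, from (C, D) to (D, C - s D), carries its blocks back, possibly
  to infinity.\<close>

lemma regular_corank_one_canonical_form:
  assumes Y: "Y \<in> matrix_pairs n n" and reg: "corank_le 0 (pencil_at s 1 Y)"
    and one: "\<And>a b. a \<noteq> 0 \<or> b \<noteq> 0 \<Longrightarrow> corank_le 1 (pencil_at a b Y)"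
  shows "\<exists>rs. distinct_eigenvalue_data n rs \<and> pair_equiv Y (kron_D_sum rs)"
proof -
  define Z where "Z = pair_lincomb s 1 1 0 Y"
  have Z: "Z \<in> matrix_pairs n n" unfolding Z_def by (rule lincomb_carrier[OF Y])
  have "fst Z = pencil_at s 1 Y" by (simp add: Z_def pair_lincomb_def pencil_at_def)
  with invertible_pair_canonical_form[OF Z] reg obtain ks where ks: "\<forall>(k, a)\<in>set ks. k \<ge> 1"
    "sum_list (map fst ks) = n" "pair_equiv Z (direct_sum (map (\<lambda>(k, a). kron_D k (Fin a)) ks))" by auto
  have YZ: "pair_lincomb 0 1 1 (- s) Z = Y"
    using Y by (auto simp: Z_def pair_lincomb_def matrix_pairs_iff prod_eq_iff intro!: eq_matI)
  from lincomb_kron_D_list[OF ks(1)] obtain rs where rs: "\<forall>(k, \<mu>)\<in>set rs. k \<ge> 1" "sum_list (map fst rs) = n"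
    "pair_equiv (pair_lincomb 0 1 1 (- s) (direct_sum (map (\<lambda>(k, a). kron_D k (Fin a)) ks))) (kron_D_sum rs)"
    unfolding ks(2) by blast
  have eq: "pair_equiv Y (kron_D_sum rs)"
    using pair_equiv_trans[OF pair_equiv_lincomb[OF ks(3), of 0 1 1 "- s"] rs(3)] unfolding YZ .
  have "distinct (map snd rs)"
    using corank_one_distinct[OF rs(1)] corank_le_equiv[OF eq one] by blast
  then show ?thesis using rs eq unfolding distinct_eigenvalue_data_def by blast
qed

text \<open>A regular \<open>Y\<close> has corank at most 1 everywhere, hence distinct eigenvalues.
  A singular \<open>Y\<close> splits into one \<open>kron_L\<close> and one \<open>kron_LT\<close>,
  whose null degrees are bounded below and have a sum that is fixed by the size.\<close>

lemma degenerates_from_LT_L: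
  assumes m: "1 \<le> m" and n: "1 \<le> n" and d: "degenerates_from (kron_LT m \<boxplus> kron_L n) Y"
  shows "pair_equiv Y (kron_LT m \<boxplus> kron_L n) \<or>
    (\<exists>rs. distinct_eigenvalue_data (m + n - 1) rs \<and> pair_equiv Y (kron_D_sum rs))"
proof -
  define N where "N = m + n - 1"
  have X: "kron_LT m \<boxplus> kron_L n \<in> matrix_pairs N N"
    using pair_sum_carrier[OF kron_LT_carrier[of m] kron_L_carrier[of n]] m n by (simp add: N_def)
  have Y: "Y \<in> matrix_pairs N N" using degenerates_fromD(1)[OF d X] .
  have one: "corank_le 1 (pencil_at a b Y)" if "a \<noteq> 0 \<or> b \<noteq> 0" for a b
    using corank_le_semicontinuous[OF d corank_le_pair_sum[OF kron_LT_carrier kron_L_carrier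
      corank_le_0_kron_LT[OF that] corank_le_1_kron_L[OF that]]] by simp
  show ?thesis
  proof (cases "\<exists>s. corank_le 0 (pencil_at s 1 Y)")
    case True
    then show ?thesis using regular_corank_one_canonical_form[OF Y _ one] unfolding N_def by blast
  next
    case False
    then have "\<exists>k. has_null Y k" using singular_square_has_null[OF Y] by blast
    then obtain k where k: "has_null Y k" "\<And>e. e < k \<Longrightarrow> \<not> has_null Y e"
      using exists_least_iff[of "has_null Y"] by blast
    from least_null_splits[OF Y k] obtain Z where le: "Suc k \<le> N"
      and Z: "Z \<in> matrix_pairs (N - k) (N - Suc k)" and eq: "pair_equiv Y (kron_L (Suc k) \<boxplus> Z)" by blast
    \<comment> \<open>The kernel of \<open>kron_L (Suc k)\<close> takes up the whole corank 1 at
      every point.\<close>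
    have injZ: "corank_le 0 (pencil_at a b Z)" if ab: "a \<noteq> 0 \<or> b \<noteq> 0" for a b
    proof -
      from kron_L_kernel[OF ab, of "Suc k"] obtain x l where
        x: "\<forall>i<Suc k - 1. mat_app (pencil_at a b (kron_L (Suc k))) x i = 0" "l < Suc k" "x l \<noteq> 0" by blast
      from corank_le_pair_summands(3)[OF kron_L_carrier Z corank_le_equiv[OF eq one[OF ab]] x] show ?thesis by auto
    qed
    have Z': "Z \<in> matrix_pairs (Suc (N - Suc k)) (N - Suc k)" using Z le by (simp add: Suc_diff_Suc)
    note ZL = injective_tall_by_one[OF Z' injZ]
    define b where "b = Suc (N - Suc k)"
    have Yb: "pair_equiv Y (kron_L (Suc k) \<boxplus> kron_LT b)"
      unfolding b_def using pair_equiv_trans[OF eq pair_equiv_sum_right[OF ZL(2) kron_L_carrier]] .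
    have "has_null (transpose_pair Z) (b - 1)" using ZL(1) unfolding least_left_null_def b_def by simp
    then have "has_null (transpose_pair (kron_L (Suc k) \<boxplus> Z)) (b - 1)"
      unfolding transpose_pair_sum[OF kron_L_carrier Z']
      using Z' kron_L_carrier[of "Suc k"]
      by (intro has_null_pair_sum_right[of _ "Suc k" "Suc k - 1" _ "N - Suc k" "Suc (N - Suc k)"]) auto
    then have "has_null (transpose_pair Y) (b - 1)"
      using has_null_equiv[OF pair_equiv_transpose[OF pair_equiv_sym[OF eq]]] by blast
    then have "m - 1 \<le> b - 1"
      using null_degree_LT_L[OF m n has_null_semicontinuous[OF degenerates_from_transpose[OF d]]] by blast
    moreover have "n - 1 \<le> k"
    proof -
      \<comment> \<open>The bound on the right null degree is the same lemma for the transpose, with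
        \<open>m\<close> and \<open>n\<close> exchanged.\<close>
      have t: "transpose_pair (kron_LT n \<boxplus> kron_L m) = kron_L n \<boxplus> kron_LT m"
        unfolding transpose_pair_sum[OF kron_LT_carrier kron_L_carrier] by (simp add: kron_LT_eq)
      have "has_null (kron_LT m \<boxplus> kron_L n) k" using has_null_semicontinuous[OF d k(1)] .
      then have "has_null (kron_L n \<boxplus> kron_LT m) k"
        using has_null_equiv[OF pair_sum_commute[OF kron_LT_carrier kron_L_carrier]] by blast
      then show ?thesis using null_degree_LT_L[OF n m] unfolding t by blast
    qed
    \<comment> \<open>Here \<open>k + b = m + n - 1\<close>, whereas \<open>k \<ge> n - 1\<close>
      and \<open>b \<ge> m\<close>.\<close>
    ultimately have "Suc k = n" "b = m" using le m n by (auto simp: N_def b_def)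
    then show ?thesis using pair_equiv_trans[OF Yb pair_sum_commute[OF kron_L_carrier kron_LT_carrier]] by simp
  qed
qed


section \<open>Determinants of pencils\<close>

lemma det_bidiagonal: "det (bidiagonal n \<alpha> \<beta>) = \<alpha> ^ n"
proof -
  have "upper_triangular (bidiagonal n \<alpha> \<beta>)" by (auto simp: bidiagonal_def)
  moreover have "diag_mat (bidiagonal n \<alpha> \<beta>) = replicate n \<alpha>"
    by (auto simp: diag_mat_def bidiagonal_def intro!: nth_equalityI)
  ultimately show ?thesis using det_upper_triangular[OF _ bidiagonal_carrier] by simp
qed

lemma det_pencil_pair_sum:
  assumes "X \<in> matrix_pairs p p" "Y \<in> matrix_pairs q q"
  shows "det (pencil_at a b (X \<boxplus> Y)) = det (pencil_at a b X) * det (pencil_at a b Y)"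
  unfolding pencil_at_pair_sum[OF assms]
  by (rule det_four_block_mat_lower_left_zero[OF pencil_at_carrier[OF assms(1)] zero_carrier_mat refl pencil_at_carrier[OF assms(2)]])

lemma finite_part_poly_Cons:
  "finite_part_poly ((k, Fin z) # rs) = [:- z, 1:] ^ k * finite_part_poly rs"
  "finite_part_poly ((k, Infty) # rs) = finite_part_poly rs"
  by (simp_all add: finite_part_poly_def)

text \<open>At the point (s, -1) a block with finite eigenvalue z contributes (s - z)^k, and a block
  at infinity only a sign.\<close>

lemma det_pencil_kron_D_sum:
  "\<exists>c. c \<noteq> 0 \<and> (\<forall>s. det (pencil_at s (- 1) (kron_D_sum rs)) = c * poly (finite_part_poly rs) s)"
proof (induction rs)
  case Nil
  have "pencil_at s (- 1) (kron_D_sum []) \<in> carrier_mat 0 0" for s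
    using pencil_at_carrier[OF kron_D_sum_carrier[of "[]"]] by simp
  then have "det (pencil_at s (- 1) (kron_D_sum [])) = 1" for s by (intro det_dim_zero)
  then show ?case by (intro exI[of _ 1]) (simp add: finite_part_poly_def)
next
  case (Cons r rs)
  obtain k \<mu> where r: "r = (k, \<mu>)" by (cases r)
  from Cons obtain c where c: "c \<noteq> 0" "\<And>s. det (pencil_at s (- 1) (kron_D_sum rs)) = c * poly (finite_part_poly rs) s" by blast
  have det: "det (pencil_at s (- 1) (kron_D_sum (r # rs))) = det (pencil_at s (- 1) (kron_D k \<mu>)) * (c * poly (finite_part_poly rs) s)" for s
    unfolding r kron_D_sum_Cons det_pencil_pair_sum[OF kron_D_carrier kron_D_sum_carrier] c(2) ..
  show ?case
  proof (cases \<mu>)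
    case (Fin z)
    show ?thesis unfolding det unfolding Fin pencil_at_kron_D det_bidiagonal r finite_part_poly_Cons
      using c(1) by (intro exI[of _ c]) (simp add: poly_power)
  next
    case Infty
    show ?thesis unfolding det unfolding Infty pencil_at_kron_D det_bidiagonal r finite_part_poly_Cons
      using c(1) by (intro exI[of _ "(- 1) ^ k * c"]) simp
  qed
qed

lemma det_pencil_equiv:
  assumes "pair_equiv X Y" "X \<in> matrix_pairs n n"
  shows "\<exists>c. c \<noteq> 0 \<and> (\<forall>a b. det (pencil_at a b Y) = c * det (pencil_at a b X))"
proof -
  from assms(1) obtain p q S S' R R' where e:
    "X \<in> matrix_pairs p q" "Y \<in> matrix_pairs p q"
    "S \<in> carrier_mat p p" "S' \<in> carrier_mat p p" "S * S' = 1\<^sub>m p" "S' * S = 1\<^sub>m p"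
    "R \<in> carrier_mat q q" "R' \<in> carrier_mat q q" "R * R' = 1\<^sub>m q" "R' * R = 1\<^sub>m q"
    "fst Y = S * fst X * R" "snd Y = S * snd X * R"
    by (elim pair_equiv_elim)
  have pq: "p = n" "q = n" using matrix_pairs_unique[OF assms(2), of p q] e(1) by auto
  note e = e[unfolded pq]
  have "det S * det S' = 1" using det_mult[OF e(3,4)] e(5) by simp
  moreover have "det R * det R' = 1" using det_mult[OF e(7,8)] e(9) by simp
  ultimately have nz: "det S * det R \<noteq> 0" by auto
  have "det (pencil_at a b Y) = det S * det R * det (pencil_at a b X)" for a b
  proof -
    have c: "pencil_at a b X \<in> carrier_mat n n" using pencil_at_carrier[OF assms(2)] .
    have "det (S * pencil_at a b X * R) = det (S * pencil_at a b X) * det R"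
      using e(3,7) c by (intro det_mult[of _ n]) auto
    also have "det (S * pencil_at a b X) = det S * det (pencil_at a b X)" by (rule det_mult[OF e(3) c])
    finally show ?thesis unfolding pencil_at_equiv[OF e(1,3,7,11,12)] by (simp add: mult_ac)
  qed
  then show ?thesis using nz by blast
qed

lemma finite_part_poly_nonzero: "finite_part_poly rs \<noteq> 0"
proof (induction rs)
  case (Cons r rs)
  then show ?case by (cases r; cases "snd r") (auto simp: finite_part_poly_Cons)
qed (simp add: finite_part_poly_def)

lemma degree_finite_part_poly: "degree (finite_part_poly rs) \<le> sum_list (map fst rs)"
proof (induction rs)
  case (Cons r rs)
  obtain k \<mu> where r: "r = (k, \<mu>)" by (cases r)
  show ?case
  proof (cases \<mu>)
    case (Fin z)
    then show ?thesis
      using Cons degree_linear_power_mult[OF finite_part_poly_nonzero, of "- z" k rs] by (simp add: r finite_part_poly_Cons)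
  qed (use Cons r in \<open>simp add: finite_part_poly_Cons\<close>)
qed (simp add: finite_part_poly_def)

text \<open>As the eigenvalues are distinct, only one block contributes to the multiplicity of a
  given root.\<close>

lemma order_finite_part_poly:
  assumes "distinct (map snd rs)"
  shows "(k, Fin z) \<in> set rs \<Longrightarrow> order z (finite_part_poly rs) = k"
    "Fin z \<notin> snd ` set rs \<Longrightarrow> order z (finite_part_poly rs) = 0"
proof -
  have mult: "order z ([:- y, 1:] ^ l * finite_part_poly rs) = (if y = z then l else 0) + order z (finite_part_poly rs)"
    for y l rs
  proof -
    have "order z ([:- y, 1:] ^ l) = (if y = z then l else 0)"
      by (auto simp: order_power_n_n poly_power intro!: order_0I)
    then show ?thesis using finite_part_poly_nonzero by (subst order_mult) auto
  qed
  show no: "Fin z \<notin> snd ` set rs \<Longrightarrow> order z (finite_part_poly rs) = 0" for rs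
  proof (induction rs)
    case (Cons r rs)
    obtain l \<nu> where r: "r = (l, \<nu>)" by (cases r)
    show ?case using Cons by (cases \<nu>) (auto simp: r finite_part_poly_Cons mult)
  qed (simp add: finite_part_poly_def order_0I)
  show "(k, Fin z) \<in> set rs \<Longrightarrow> order z (finite_part_poly rs) = k"
    using assms
  proof (induction rs)
    case (Cons r rs)
    obtain l \<nu> where r: "r = (l, \<nu>)" by (cases r)
    show ?case
    proof (cases "r = (k, Fin z)")
      case True
      then show ?thesis using Cons.prems no[of rs] by (simp add: finite_part_poly_Cons mult)
    next
      case False
      then have in_rs: "(k, Fin z) \<in> set rs" using Cons.prems by auto
      then have "\<nu> \<noteq> Fin z" using Cons.prems(2) r by force
      then show ?thesis using Cons in_rs by (cases \<nu>) (auto simp: r finite_part_poly_Cons mult)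
    qed
  qed simp
qed

text \<open>Root multiplicities give the blocks with finite eigenvalues. The block at infinity does
  not show in the polynomial and is recovered from the total size \<open>N\<close>.\<close>

lemma eigenvalue_data_determined:
  assumes rs: "distinct_eigenvalue_data N rs" and qs: "distinct_eigenvalue_data N qs"
    and p: "finite_part_poly qs = Polynomial.smult c (finite_part_poly rs)" "c \<noteq> 0"
  shows "mset rs = mset qs"
proof -
  have fin: "(k, Fin z) \<in> set xs \<longleftrightarrow> order z (finite_part_poly xs) = k \<and> 1 \<le> k"
    if "distinct_eigenvalue_data N xs" for xs k z
  proof -
    have d: "distinct (map snd xs)" and pos: "\<forall>(k, \<mu>)\<in>set xs. 1 \<le> k"
      using that unfolding distinct_eigenvalue_data_def by blast+
    show ?thesis
    proof
      assume "(k, Fin z) \<in> set xs"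
      then show "order z (finite_part_poly xs) = k \<and> 1 \<le> k" using order_finite_part_poly(1)[OF d] pos by blast
    next
      assume o: "order z (finite_part_poly xs) = k \<and> 1 \<le> k"
      then have "Fin z \<in> snd ` set xs" using order_finite_part_poly(2)[OF d, of z] by fastforce
      then obtain l where l: "(l, Fin z) \<in> set xs" by force
      then show "(k, Fin z) \<in> set xs" using order_finite_part_poly(1)[OF d l] o by simp
    qed
  qed
  define F where "F xs = {(k, \<mu>) \<in> set xs. \<mu> \<noteq> Infty}" for xs :: "(nat \<times> ext_complex) list"
  have Feq: "F rs = F qs"
  proof -
    have "order z (finite_part_poly qs) = order z (finite_part_poly rs)" for z
      using p by (simp add: order_smult)
    then have "(k, Fin z) \<in> set rs \<longleftrightarrow> (k, Fin z) \<in> set qs" for k z using fin[OF rs] fin[OF qs] by simp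
    then have "(k, \<mu>) \<in> F rs \<longleftrightarrow> (k, \<mu>) \<in> F qs" for k \<mu> by (cases \<mu>) (auto simp: F_def)
    then show ?thesis by auto
  qed
  have dist: "distinct xs" if "distinct_eigenvalue_data N xs" for xs
    using that unfolding distinct_eigenvalue_data_def by (simp add: distinct_map)
  \<comment> \<open>A block at infinity is present iff the finite ones do not exhaust
    \<open>N\<close>, and its size is the difference.\<close>
  have inf: "(k, Infty) \<in> set xs \<longleftrightarrow> 1 \<le> k \<and> N = sum fst (F xs) + k" if xs: "distinct_eigenvalue_data N xs" for xs k
  proof -
    have d: "distinct (map snd xs)" and pos: "\<forall>(k, \<mu>)\<in>set xs. 1 \<le> k" and N: "sum_list (map fst xs) = N"
      using xs unfolding distinct_eigenvalue_data_def by blast+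
    have N': "N = sum fst (set xs)" using sum_list_distinct_conv_sum_set[OF dist[OF xs], of fst] N by simp
    have fF: "finite (F xs)" unfolding F_def by (rule finite_subset[of _ "set xs"]) auto
    have in_set: "N = sum fst (F xs) + l" if l: "(l, Infty) \<in> set xs" for l
    proof -
      have "inj_on snd (set xs)" using d by (simp add: distinct_map)
      then have "j = l" if "(j, Infty) \<in> set xs" for j using inj_onD[of snd "set xs" "(j, Infty)" "(l, Infty)"] that l by simp
      then have "set xs \<subseteq> insert (l, Infty) (F xs)" unfolding F_def by blast
      moreover have "insert (l, Infty) (F xs) \<subseteq> set xs" using l by (auto simp: F_def)
      ultimately have "set xs = insert (l, Infty) (F xs)" by (rule equalityI)
      moreover have "(l, Infty) \<notin> F xs" by (simp add: F_def)
      ultimately show ?thesis using N' fF by simp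
    qed
    show ?thesis
    proof
      assume "(k, Infty) \<in> set xs"
      then show "1 \<le> k \<and> N = sum fst (F xs) + k" using in_set pos by blast
    next
      assume k: "1 \<le> k \<and> N = sum fst (F xs) + k"
      have "\<exists>l. (l, Infty) \<in> set xs"
      proof (rule ccontr)
        assume "\<not> (\<exists>l. (l, Infty) \<in> set xs)"
        then have "F xs = set xs" by (auto simp: F_def)
        then show False using N' k by simp
      qed
      then obtain l where l: "(l, Infty) \<in> set xs" by blast
      then show "(k, Infty) \<in> set xs" using in_set[OF l] k by simp
    qed
  qed
  have "(k, \<mu>) \<in> set rs \<longleftrightarrow> (k, \<mu>) \<in> set qs" for k \<mu>
  proof (cases \<mu>)
    case (Fin z)
    have "(k, \<mu>) \<in> F rs \<longleftrightarrow> (k, \<mu>) \<in> F qs" by (simp only: Feq)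
    then show ?thesis using Fin by (simp add: F_def)
  next
    case Infty
    then show ?thesis using inf[OF rs] inf[OF qs] Feq by simp
  qed
  then have "set rs = set qs" by auto
  then show ?thesis using set_eq_iff_mset_eq_distinct[OF dist[OF rs] dist[OF qs]] by blast
qed

lemma mat_app_pencil_at:
  assumes "X \<in> matrix_pairs p q" "i < p"
  shows "mat_app (pencil_at a b X) x i = a * mat_app (fst X) x i + b * mat_app (snd X) x i"
  using assms unfolding mat_app_def pencil_at_def matrix_pairs_iff
  by (auto simp: sum_distrib_left sum.distrib algebra_simps)

lemma pencil_at_block_upper:
  assumes "X \<in> matrix_pairs p q" "D \<in> matrix_pairs p q'" "Y \<in> matrix_pairs p' q'"
  shows "pencil_at a b (block_upper X D Y) =
    four_block_mat (pencil_at a b X) (pencil_at a b D) (0\<^sub>m p' q) (pencil_at a b Y)"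
  using assms by (auto simp: pencil_at_def block_upper_def matrix_pairs_iff intro!: eq_matI)

text \<open>This explains the shape of the perturbation: up to sign the determinant is the
  polynomial in s with the freely prescribed coefficients - \<beta> 0, ..., - \<beta> b, \<alpha> 0,
  ..., \<alpha> a. The sizes are written with \<open>Suc\<close> to avoid subtractions.\<close>

lemma det_pencil_block_upper_LT_L:
  "det (pencil_at s (- 1) (block_upper (kron_LT (Suc a))
      (last_col_mat (Suc a) (Suc b) \<alpha>, first_row_mat (Suc a) (Suc b) \<beta>) (kron_L (Suc b)))) =
    (- 1) ^ b * ((\<Sum>t<Suc a. \<alpha> t * s ^ (Suc b + t)) - (\<Sum>l<Suc b. \<beta> l * s ^ l))"
proof -
  let ?D = "(last_col_mat (Suc a) (Suc b) \<alpha>, first_row_mat (Suc a) (Suc b) \<beta>)"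
  let ?N = "Suc (a + b)"
  let ?v = "(\<Sum>t<Suc a. \<alpha> t * s ^ (Suc b + t)) - (\<Sum>l<Suc b. \<beta> l * s ^ l)"
  have D: "?D \<in> matrix_pairs (Suc a) (Suc b)"
    by (simp add: matrix_pairs_iff last_col_mat_def first_row_mat_def)
  have LT: "kron_LT (Suc a) \<in> matrix_pairs (Suc a) a" and L: "kron_L (Suc b) \<in> matrix_pairs b (Suc b)"
    using kron_LT_carrier[of "Suc a"] kron_L_carrier[of "Suc b"] by simp_all
  define M where "M = four_block_mat (pencil_at s (- 1) (kron_LT (Suc a))) (pencil_at s (- 1) ?D)
    (0\<^sub>m b a) (pencil_at s (- 1) (kron_L (Suc b)))"
  have cs: "pencil_at s (- 1) (kron_LT (Suc a)) \<in> carrier_mat (Suc a) a"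
    "pencil_at s (- 1) ?D \<in> carrier_mat (Suc a) (Suc b)" "0\<^sub>m b a \<in> carrier_mat b a"
    "pencil_at s (- 1) (kron_L (Suc b)) \<in> carrier_mat b (Suc b)"
    using pencil_at_carrier[OF LT] pencil_at_carrier[OF D] pencil_at_carrier[OF L] by auto
  have M: "M \<in> carrier_mat ?N ?N" unfolding M_def using cs by auto
  \<comment> \<open>A column vector annihilated by all rows of \<open>M\<close> but the first one, with entry 1 at the index \<open>a\<close>;
    so Cramer's rule evaluates the determinant.\<close>
  define x where "x i = (if i < a then \<Sum>t\<in>{Suc i..<Suc a}. \<alpha> t * s ^ (Suc b + t - Suc i) else s ^ (i - a))" for i
  have xs: "x i = s * x (Suc i) + \<alpha> (Suc i) * s ^ Suc b" if "Suc i < a" for i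
  proof -
    have "(\<Sum>t\<in>{Suc i..<Suc a}. \<alpha> t * s ^ (Suc b + t - Suc i))
      = \<alpha> (Suc i) * s ^ Suc b + (\<Sum>t\<in>{Suc (Suc i)..<Suc a}. \<alpha> t * s ^ (Suc b + t - Suc i))"
      using that by (subst sum.atLeast_Suc_lessThan) simp_all
    also have "(\<Sum>t\<in>{Suc (Suc i)..<Suc a}. \<alpha> t * s ^ (Suc b + t - Suc i))
      = s * (\<Sum>t\<in>{Suc (Suc i)..<Suc a}. \<alpha> t * s ^ (Suc b + t - Suc (Suc i)))"
      unfolding sum_distrib_left
    proof (rule sum.cong[OF refl])
      fix t assume "t \<in> {Suc (Suc i)..<Suc a}"
      then have "Suc b + t - Suc i = Suc (Suc b + t - Suc (Suc i))" by auto
      then show "\<alpha> t * s ^ (Suc b + t - Suc i) = s * (\<alpha> t * s ^ (Suc b + t - Suc (Suc i)))" by simp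
    qed
    finally show ?thesis using that by (simp add: x_def)
  qed
  have xl: "x i = \<alpha> a * s ^ Suc b" if "Suc i = a" for i
    using that by (auto simp: x_def)
  have x0: "(if 0 < a then s * x 0 else 0) + \<alpha> 0 * s ^ Suc b = (\<Sum>t<Suc a. \<alpha> t * s ^ (Suc b + t))"
  proof (cases "0 < a")
    case True
    have "(\<Sum>t<Suc a. \<alpha> t * s ^ (Suc b + t)) = \<alpha> 0 * s ^ Suc b + (\<Sum>t\<in>{Suc 0..<Suc a}. \<alpha> t * s ^ (Suc b + t))"
      unfolding lessThan_atLeast0 by (subst sum.atLeast_Suc_lessThan) simp_all
    also have "(\<Sum>t\<in>{Suc 0..<Suc a}. \<alpha> t * s ^ (Suc b + t)) = s * x 0"
      using True by (simp add: x_def sum_distrib_left mult_ac del: sum.op_ivl_Suc)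
    finally show ?thesis using True by simp
  qed simp
  have appD: "mat_app (pencil_at s (- 1) ?D) (\<lambda>j. x (a + j)) i =
    \<alpha> i * s ^ Suc b - (if i = 0 then (\<Sum>l<Suc b. \<beta> l * s ^ l) else 0)" if i: "i < Suc a" for i
  proof -
    have "mat_app (last_col_mat (Suc a) (Suc b) \<alpha>) (\<lambda>j. x (a + j)) i = (\<Sum>j<Suc b. if j = b then \<alpha> i * s ^ b else 0)"
      unfolding mat_app_def using i by (intro sum.cong) (auto simp: last_col_mat_def x_def)
    then have 1: "mat_app (last_col_mat (Suc a) (Suc b) \<alpha>) (\<lambda>j. x (a + j)) i = \<alpha> i * s ^ b" by simp
    have "mat_app (first_row_mat (Suc a) (Suc b) \<beta>) (\<lambda>j. x (a + j)) i = (\<Sum>l<Suc b. if i = 0 then \<beta> l * s ^ l else 0)"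
      unfolding mat_app_def using i by (intro sum.cong) (auto simp: first_row_mat_def x_def)
    then show ?thesis unfolding mat_app_pencil_at[OF D i] fst_conv snd_conv 1 by simp
  qed
  have row: "mat_app M x i = (if i = 0 then ?v else 0)" if i: "i < ?N" for i
  proof (cases "i < Suc a")
    case True
    have e: "mat_app M x i = (if i < a then s * x i else 0) + (if 0 < i then - x (i - 1) else 0)
      + (\<alpha> i * s ^ Suc b - (if i = 0 then (\<Sum>l<Suc b. \<beta> l * s ^ l) else 0))"
      unfolding M_def mat_app_four_block(1)[OF cs True] mat_app_kron_LT[OF True] appD[OF True] by simp
    show ?thesis
    proof (cases i)
      case 0
      show ?thesis unfolding e unfolding 0 x0[symmetric] by simp
    next
      case (Suc k)
      then show ?thesis using e xs[of k] xl[of k] True by (cases "i = a") auto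
    qed
  next
    case False
    then obtain k where k: "i = Suc a + k" "k < b" using i by (metis add_Suc less_SucI add_diff_inverse_nat nat_add_left_cancel_less)
    have kb: "k < Suc b - 1" using k by simp
    have "mat_app (0\<^sub>m b a) x k = 0" using k by (intro mat_app_zero)
    then show ?thesis unfolding k(1) M_def mat_app_four_block(2)[OF cs k(2)] mat_app_kron_L[OF kb] by (simp add: x_def)
  qed
  have xv: "M *\<^sub>v vec ?N x = vec ?N (\<lambda>i. if i = 0 then ?v else 0)"
  proof (rule eq_vecI)
    fix i assume "i < dim_vec (vec ?N (\<lambda>i. if i = 0 then ?v else 0))"
    then have i: "i < ?N" by simp
    have "(M *\<^sub>v vec ?N x) $ i = mat_app M x i"
      using i M by (auto simp: mat_app_def scalar_prod_def atLeast0LessThan)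
    then show "(M *\<^sub>v vec ?N x) $ i = vec ?N (\<lambda>i. if i = 0 then ?v else 0) $ i" using row[OF i] i by simp
  qed (use M in auto)
  define C where "C = replace_col M (vec ?N (\<lambda>i. if i = 0 then ?v else 0)) a"
  have C: "C \<in> carrier_mat ?N ?N" using M by (auto simp: C_def replace_col_def)
  \<comment> \<open>Column \<open>a\<close> of \<open>M\<close> is replaced by \<open>M x\<close>,
    which multiplies the determinant by the entry 1 of \<open>x\<close> at \<open>a\<close>.\<close>
  have d1: "det C = det M"
    using cramer_lemma_mat[OF M, of "vec ?N x" a] unfolding xv C_def by (simp add: x_def)
  have d2: "det C = (\<Sum>i<?N. C $$ (i, a) * cofactor C i a)"
    by (rule laplace_expansion_column[OF C]) simp
  have d3: "(\<Sum>i<?N. C $$ (i, a) * cofactor C i a) = (\<Sum>i<?N. if i = 0 then ?v * cofactor C 0 a else 0)"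
    using M by (intro sum.cong) (auto simp: C_def replace_col_def)
  have d4: "(\<Sum>i<?N. if i = 0 then ?v * cofactor C 0 a else 0) = ?v * cofactor C 0 a"
    by (simp del: sum.lessThan_Suc)
  \<comment> \<open>Deletion of the first row and of column \<open>a\<close> leaves a block
    triangular matrix with determinant (-1)^(a+b); the sign (-1)^a of the cofactor cancels the part
    from the first block.\<close>
  have d5: "cofactor C 0 a = (- 1) ^ b"
  proof -
    define B where "B = mat a b (\<lambda>(i, j). pencil_at s (- 1) ?D $$ (Suc i, Suc j))"
    have "mat_delete C 0 a = four_block_mat (bidiagonal a (- 1) s) B (0\<^sub>m b a) (bidiagonal b (- 1) s)\<^sup>T"
    proof (rule eq_matI)
      fix i j assume ij: "i < dim_row (four_block_mat (bidiagonal a (- 1) s) B (0\<^sub>m b a) (bidiagonal b (- 1) s)\<^sup>T)"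
        "j < dim_col (four_block_mat (bidiagonal a (- 1) s) B (0\<^sub>m b a) (bidiagonal b (- 1) s)\<^sup>T)"
      then have ij: "i < a + b" "j < a + b" by (auto simp: B_def bidiagonal_def)
      have "mat_delete C 0 a $$ (i, j) = M $$ (Suc i, if j < a then j else Suc j)"
        using ij M C by (auto simp: mat_delete_def C_def replace_col_def)
      also have "\<dots> = four_block_mat (bidiagonal a (- 1) s) B (0\<^sub>m b a) (bidiagonal b (- 1) s)\<^sup>T $$ (i, j)"
        using ij cs by (auto simp: M_def B_def bidiagonal_def pencil_at_def kron_LT_def kron_L_def L_mat_def R_mat_def
          last_col_mat_def first_row_mat_def Suc_diff_le)
      finally show "mat_delete C 0 a $$ (i, j) = four_block_mat (bidiagonal a (- 1) s) B (0\<^sub>m b a) (bidiagonal b (- 1) s)\<^sup>T $$ (i, j)" .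
    qed (use C in \<open>auto simp: B_def bidiagonal_def\<close>)
    then have "det (mat_delete C 0 a) = det (bidiagonal a (- 1) s) * det ((bidiagonal b (- 1) s)\<^sup>T)"
      by (simp only:) (rule det_four_block_mat_lower_left_zero[of _ a _ b], simp_all add: B_def)
    then have "det (mat_delete C 0 a) = (- 1) ^ a * (- 1) ^ b"
      by (simp add: det_transpose[OF bidiagonal_carrier] det_bidiagonal)
    moreover have "(- 1) ^ a * (- 1) ^ a = (1 :: complex)" by (simp flip: power_mult_distrib)
    ultimately show ?thesis by (simp add: cofactor_def flip: mult.assoc)
  qed
  have "det M = ?v * (- 1) ^ b"
    using trans[OF d1[symmetric] trans[OF d2 trans[OF d3 d4]]] unfolding d5 .
  then show ?thesis unfolding pencil_at_block_upper[OF LT D L] M_def by (simp only: mult.commute)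
qed


lemma in_kron_D_list: "X \<in> set (map (\<lambda>(k, \<mu>). kron_D k \<mu>) rs) \<Longrightarrow> \<exists>k \<mu>. X = kron_D k \<mu>"
proof -
  assume "X \<in> set (map (\<lambda>(k, \<mu>). kron_D k \<mu>) rs)"
  then obtain r where "X = (case r of (k, \<mu>) \<Rightarrow> kron_D k \<mu>)" unfolding set_map by blast
  then show ?thesis by (cases r) (simp only: prod.case, blast)
qed

lemma poly_eq_sum_lessThan:
  fixes p :: "'a :: comm_semiring_1 poly"
  assumes "degree p < n" shows "poly p x = (\<Sum>i<n. coeff p i * x ^ i)"
  unfolding poly_altdef using assms by (intro sum.mono_neutral_left) (auto simp: coeff_eq_0)

text \<open>The determinant of the pencil is, up to a factor, the prescribed polynomial, and this
  determines the eigenvalue data among the regular members of the cone.\<close>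

lemma perturbed_LT_L:
  assumes m: "1 \<le> m" and n: "1 \<le> n" and rs: "distinct_eigenvalue_data (m + n - 1) rs" and \<epsilon>: "\<epsilon> \<noteq> 0"
    and \<beta>: "\<forall>j<n. - \<beta> j = \<epsilon> * coeff (finite_part_poly rs) j"
    and \<alpha>: "\<forall>i<m. \<alpha> i = \<epsilon> * coeff (finite_part_poly rs) (n + i)"
  defines "T \<equiv> block_upper (kron_LT m) (last_col_mat m n \<alpha>, first_row_mat m n \<beta>) (kron_L n)"
  shows "pair_equiv T (kron_D_sum rs)" "degenerates_from (kron_LT m \<boxplus> kron_L n) T"
proof -
  have D: "(last_col_mat m n \<alpha>, first_row_mat m n \<beta>) \<in> matrix_pairs m n"
    by (simp add: matrix_pairs_iff last_col_mat_def first_row_mat_def)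
  show d: "degenerates_from (kron_LT m \<boxplus> kron_L n) T"
    unfolding T_def by (rule pair_sum_degenerates_from_block_upper[OF kron_LT_carrier kron_L_carrier D])
  obtain a b where ab: "m = Suc a" "n = Suc b" using m n by (metis Suc_le_D One_nat_def)
  have T: "T \<in> matrix_pairs (m + n - 1) (m + n - 1)"
    using block_carrier(1)[OF kron_LT_carrier[of m] kron_L_carrier[of n]] ab by (simp add: T_def)
  \<comment> \<open>The degree is at most \<open>m + n - 1\<close>, so the \<open>n + m\<close>
    numbers \<alpha> and \<beta> hold all coefficients.\<close>
  have deg: "degree (finite_part_poly rs) < n + m"
    using degree_finite_part_poly[of rs] rs m unfolding distinct_eigenvalue_data_def by simp
  have det: "det (pencil_at s (- 1) T) = (- 1) ^ b * \<epsilon> * poly (finite_part_poly rs) s" for s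
  proof -
    have "\<epsilon> * poly (finite_part_poly rs) s = (\<Sum>i<n + m. \<epsilon> * coeff (finite_part_poly rs) i * s ^ i)"
      unfolding poly_eq_sum_lessThan[OF deg] by (simp add: sum_distrib_left mult_ac)
    also have "\<dots> = (\<Sum>i<n. - \<beta> i * s ^ i) + (\<Sum>i<m. \<alpha> i * s ^ (n + i))"
      unfolding sum_lessThan_add using \<alpha> \<beta> by simp
    also have "\<dots> = (\<Sum>i<m. \<alpha> i * s ^ (n + i)) - (\<Sum>i<n. \<beta> i * s ^ i)"
      by (simp add: sum_negf)
    finally show ?thesis unfolding T_def ab det_pencil_block_upper_LT_L mult.assoc by simp
  qed
  have "\<exists>s. poly (finite_part_poly rs) s \<noteq> 0"
    using finite_part_poly_nonzero[of rs] poly_all_0_iff_0 by blast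
  then obtain s where "poly (finite_part_poly rs) s \<noteq> 0" by blast
  then have reg: "corank_le 0 (pencil_at s (- 1) T)"
    using corank_le_0_iff_det[OF pencil_at_carrier[OF T]] det \<epsilon> by simp
  \<comment> \<open>A nonzero determinant at \<open>s\<close> excludes the singular member of the
    cone.\<close>
  have "\<not> pair_equiv T (kron_LT m \<boxplus> kron_L n)"
  proof
    assume "pair_equiv T (kron_LT m \<boxplus> kron_L n)"
    from pair_equiv_trans[OF this pair_sum_commute[OF kron_LT_carrier kron_L_carrier]]
    have c: "corank_le 0 (pencil_at s (- 1) (kron_L n \<boxplus> kron_LT m))" using corank_le_equiv reg by blast
    have "0 < n" "s \<noteq> 0 \<or> - 1 \<noteq> (0 :: complex)" using n by auto
    from kron_L_kernel[OF this(2,1)] obtain x l where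
      "\<forall>i<n - 1. mat_app (pencil_at s (- 1) (kron_L n)) x i = 0" "l < n" "x l \<noteq> 0" by blast
    from corank_le_pair_summands(3)[OF kron_L_carrier kron_LT_carrier c this] show False by simp
  qed
  then obtain qs where qs: "distinct_eigenvalue_data (m + n - 1) qs" "pair_equiv T (kron_D_sum qs)"
    using degenerates_from_LT_L[OF m n d] by blast
  obtain c where c: "c \<noteq> 0" "\<And>s. det (pencil_at s (- 1) (kron_D_sum qs)) = c * det (pencil_at s (- 1) T)"
    using det_pencil_equiv[OF qs(2) T] by blast
  obtain e where e: "e \<noteq> 0" "\<And>s. det (pencil_at s (- 1) (kron_D_sum qs)) = e * poly (finite_part_poly qs) s"
    using det_pencil_kron_D_sum by blast
  \<comment> \<open>Both polynomials are nonzero multiples of determinants of equivalent pencils;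
    \<open>k\<close> collects the factors.\<close>
  define k where "k = c * (- 1) ^ b * \<epsilon> / e"
  have k: "k \<noteq> 0" using c(1) e(1) \<epsilon> by (simp add: k_def)
  have "poly (finite_part_poly qs) s = poly (Polynomial.smult k (finite_part_poly rs)) s" for s
  proof -
    have "e * poly (finite_part_poly qs) s = c * ((- 1) ^ b * \<epsilon> * poly (finite_part_poly rs) s)"
      using c(2)[of s] e(2)[of s] det[of s] by simp
    then show ?thesis using e(1) by (simp add: k_def field_simps)
  qed
  then have "finite_part_poly qs = Polynomial.smult k (finite_part_poly rs)"
    unfolding poly_eq_poly_eq_iff[symmetric] by blast
  from eigenvalue_data_determined[OF rs qs(1) this k] have "mset qs = mset rs" by simp
  then have "mset (map (\<lambda>(k, \<mu>). kron_D k \<mu>) qs) = mset (map (\<lambda>(k, \<mu>). kron_D k \<mu>) rs)" by simp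
  then have "pair_equiv (kron_D_sum qs) (kron_D_sum rs)"
    unfolding kron_D_sum_def
  proof (rule pair_equiv_direct_sum_permute)
    fix X assume "X \<in> set (map (\<lambda>(k, \<mu>). kron_D k \<mu>) qs)"
    then show "is_matrix_pair X" using in_kron_D_list kron_D_carrier unfolding is_matrix_pair_def by blast
  qed
  then show "pair_equiv T (kron_D_sum rs)" using pair_equiv_trans[OF qs(2)] by blast
qed

lemma cone_LT_L:
  assumes m: "1 \<le> m" and n: "1 \<le> n"
  shows "cone_is (kron_LT m \<boxplus> kron_L n)
    ({kron_LT m \<boxplus> kron_L n} \<union> {kron_D_sum rs | rs. distinct_eigenvalue_data (m + n - 1) rs})"
proof -
  let ?X = "kron_LT m \<boxplus> kron_L n"
  \<comment> \<open>\<open>None\<close> stands for the singular member of the cone,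
    \<open>Some rs\<close> for the regular ones.\<close>
  define K where "K r = (case r of None \<Rightarrow> ?X | Some rs \<Rightarrow> kron_D_sum rs)" for r
  define P where "P r = (case r of None \<Rightarrow> True | Some rs \<Rightarrow> distinct_eigenvalue_data (m + n - 1) rs)" for r
  have X: "?X \<in> matrix_pairs (m + (n - 1)) (m - 1 + n)" by (rule pair_sum_carrier[OF kron_LT_carrier kron_L_carrier])
  have "cone_is ?X (K ` {r. P r})"
  proof (rule cone_isI[OF X])
    fix Y assume "degenerates_from ?X Y"
    from degenerates_from_LT_L[OF m n this] show "\<exists>r. P r \<and> pair_equiv Y (K r)"
    proof
      assume "pair_equiv Y ?X"
      then show ?thesis by (intro exI[of _ None]) (simp add: P_def K_def)
    next
      assume "\<exists>rs. distinct_eigenvalue_data (m + n - 1) rs \<and> pair_equiv Y (kron_D_sum rs)"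
      then obtain rs where "distinct_eigenvalue_data (m + n - 1) rs" "pair_equiv Y (kron_D_sum rs)" by blast
      then show ?thesis by (intro exI[of _ "Some rs"]) (simp add: P_def K_def)
    qed
  next
    fix r assume r: "P r"
    show "degenerates_from ?X (K r)"
    proof (cases r)
      case None
      then show ?thesis using degenerates_from_refl[OF X] by (simp add: K_def)
    next
      case (Some rs)
      \<comment> \<open>The coefficients of the explicit pair for \<epsilon> = 1.\<close>
      define \<alpha> \<beta> where "\<alpha> i = coeff (finite_part_poly rs) (n + i)" and "\<beta> j = - coeff (finite_part_poly rs) j" for i j
      have rs: "distinct_eigenvalue_data (m + n - 1) rs" using r Some by (simp add: P_def)
      have "\<forall>j<n. - \<beta> j = 1 * coeff (finite_part_poly rs) j" "\<forall>i<m. \<alpha> i = 1 * coeff (finite_part_poly rs) (n + i)"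
        by (simp_all add: \<alpha>_def \<beta>_def)
      note p = perturbed_LT_L[OF m n rs one_neq_zero this]
      show ?thesis using degenerates_from_equiv[OF p(2) pair_equiv_refl[OF X] p(1)] Some by (simp add: K_def)
    qed
  qed
  moreover have "K ` {r. P r} = {?X} \<union> {kron_D_sum rs | rs. distinct_eigenvalue_data (m + n - 1) rs}" (is "?L = ?R")
  proof
    show "?L \<subseteq> ?R" by (auto simp: K_def P_def simp del: prod.case split: option.splits)
    have "?X \<in> ?L" by (rule image_eqI[of _ _ None]) (simp_all add: K_def P_def)
    moreover have "kron_D_sum rs \<in> ?L" if "distinct_eigenvalue_data (m + n - 1) rs" for rs
      using that by (intro image_eqI[of _ _ "Some rs"]) (simp_all add: K_def P_def)
    ultimately show "?R \<subseteq> ?L" by blast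
  qed
  ultimately show ?thesis by simp
qed


section \<open>Canonical forms and lower cones\<close>

lemma lower_cone_eq_Collect:
  assumes "cone_is X ((\<lambda>r. K r) ` {r. P r})"
  shows "lower_cone (pair_orbit X) = {pair_orbit (K r) | r. P r}"
  unfolding lower_cone_eq[OF assms] by blast

lemma direct_sum_omit_empty: "direct_sum (filter (\<lambda>K. K \<noteq> (0\<^sub>m 0 0, 0\<^sub>m 0 0)) Ks) = direct_sum Ks"
proof (induction Ks)
  case (Cons K Ks)
  then show ?case using direct_sum_Cons[of K Ks] direct_sum_Cons[of K "filter (\<lambda>K. K \<noteq> (0\<^sub>m 0 0, 0\<^sub>m 0 0)) Ks"] by simp
qed simp

text \<open>Empty summands \<open>kron_D 0\<close> may occur in the list, since dropping them does
  not change the sum.\<close>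

lemma is_kronecker_canonical_form_ofI:
  assumes "\<And>K. K \<in> set Ks \<Longrightarrow> K \<in> insert (0\<^sub>m 0 0, 0\<^sub>m 0 0) indecomposable_kronecker_pairs"
    and "pair_equiv X (direct_sum Ks)"
  shows "is_kronecker_canonical_form_of (direct_sum Ks) X"
  unfolding is_kronecker_canonical_form_of_def
  using assms direct_sum_omit_empty[of Ks]
  by (intro conjI exI[of _ "filter (\<lambda>K. K \<noteq> (0\<^sub>m 0 0, 0\<^sub>m 0 0)) Ks"]) auto

lemma indecomposable_or_empty:
  "1 \<le> n \<Longrightarrow> kron_L n \<in> insert (0\<^sub>m 0 0, 0\<^sub>m 0 0) indecomposable_kronecker_pairs"
  "1 \<le> n \<Longrightarrow> kron_LT n \<in> insert (0\<^sub>m 0 0, 0\<^sub>m 0 0) indecomposable_kronecker_pairs"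
  "kron_D k \<mu> \<in> insert (0\<^sub>m 0 0, 0\<^sub>m 0 0) indecomposable_kronecker_pairs"
proof -
  show "kron_D k \<mu> \<in> insert (0\<^sub>m 0 0, 0\<^sub>m 0 0) indecomposable_kronecker_pairs"
  proof (cases "k = 0")
    case False
    then have "1 \<le> k" by simp
    then show ?thesis unfolding indecomposable_kronecker_pairs_def by blast
  qed simp
qed (unfold indecomposable_kronecker_pairs_def, blast+)

lemma lower_cone_indecomposable:
  assumes "X \<in> indecomposable_kronecker_pairs" shows "lower_cone (pair_orbit X) = {pair_orbit X}"
proof -
  have "cone_is X {X}"
    using assms cone_kron_L cone_kron_LT cone_kron_D unfolding indecomposable_kronecker_pairs_def by blast
  then show ?thesis using lower_cone_eq by blast
qed

lemma two_LT_canonical_form: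
  assumes "1 \<le> m" "m + r \<le> n - r" "\<epsilon> \<noteq> 0"
  shows "is_kronecker_canonical_form_of (direct_sum [kron_LT (m + r), kron_LT (n - r)])
    (four_block_mat (L_mat m)\<^sup>T (0\<^sub>m m (n - 1)) (0\<^sub>m n (m - 1)) (L_mat n)\<^sup>T,
     four_block_mat (R_mat m)\<^sup>T (Delta_mat m (n - 1) r \<epsilon>) (0\<^sub>m n (m - 1)) (R_mat n)\<^sup>T)"
proof (rule is_kronecker_canonical_form_ofI)
  have "(four_block_mat (L_mat m)\<^sup>T (0\<^sub>m m (n - 1)) (0\<^sub>m n (m - 1)) (L_mat n)\<^sup>T,
     four_block_mat (R_mat m)\<^sup>T (Delta_mat m (n - 1) r \<epsilon>) (0\<^sub>m n (m - 1)) (R_mat n)\<^sup>T)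
    = block_upper (kron_LT m) (0\<^sub>m m (n - 1), Delta_mat m (n - 1) r \<epsilon>) (kron_LT n)"
    by (simp add: block_upper_def kron_LT_def L_mat_def R_mat_def)
  then show "pair_equiv (four_block_mat (L_mat m)\<^sup>T (0\<^sub>m m (n - 1)) (0\<^sub>m n (m - 1)) (L_mat n)\<^sup>T,
     four_block_mat (R_mat m)\<^sup>T (Delta_mat m (n - 1) r \<epsilon>) (0\<^sub>m n (m - 1)) (R_mat n)\<^sup>T)
     (kron_LT (m + r) \<boxplus> kron_LT (n - r))" using two_LT_explicit(1)[OF assms] by simp
qed (use assms indecomposable_or_empty(2)[of "m + r"] indecomposable_or_empty(2)[of "n - r"] in \<open>auto simp del: insert_iff\<close>)

lemma two_L_canonical_form:
  assumes "1 \<le> m" "m + r \<le> n - r" "\<epsilon> \<noteq> 0"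
  shows "is_kronecker_canonical_form_of (direct_sum [kron_L (m + r), kron_L (n - r)])
    (four_block_mat (L_mat m) (0\<^sub>m (m - 1) n) (0\<^sub>m (n - 1) m) (L_mat n),
     four_block_mat (R_mat m) (0\<^sub>m (m - 1) n) (Delta_mat m (n - 1) r \<epsilon>)\<^sup>T (R_mat n))"
proof (rule is_kronecker_canonical_form_ofI)
  have D: "(0\<^sub>m m (n - 1), Delta_mat m (n - 1) r \<epsilon>) \<in> matrix_pairs m (n - 1)" by (simp add: matrix_pairs_iff Delta_mat_def)
  \<comment> \<open>The pair is the transpose of the explicit pair in (i).\<close>
  have "(four_block_mat (L_mat m) (0\<^sub>m (m - 1) n) (0\<^sub>m (n - 1) m) (L_mat n),
     four_block_mat (R_mat m) (0\<^sub>m (m - 1) n) (Delta_mat m (n - 1) r \<epsilon>)\<^sup>T (R_mat n))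
    = transpose_pair (block_upper (kron_LT m) (0\<^sub>m m (n - 1), Delta_mat m (n - 1) r \<epsilon>) (kron_LT n))"
    unfolding transpose_block_upper[OF kron_LT_carrier kron_LT_carrier D]
    by (simp add: block_lower_def kron_LT_eq transpose_pair_def kron_L_def L_mat_def R_mat_def)
  then show "pair_equiv (four_block_mat (L_mat m) (0\<^sub>m (m - 1) n) (0\<^sub>m (n - 1) m) (L_mat n),
     four_block_mat (R_mat m) (0\<^sub>m (m - 1) n) (Delta_mat m (n - 1) r \<epsilon>)\<^sup>T (R_mat n))
     (kron_L (m + r) \<boxplus> kron_L (n - r))"
    using pair_equiv_transpose[OF two_LT_explicit(1)[OF assms]]
    unfolding transpose_pair_sum[OF kron_LT_carrier kron_LT_carrier] by (simp add: kron_LT_eq)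
qed (use assms indecomposable_or_empty(1)[of "m + r"] indecomposable_or_empty(1)[of "n - r"] in \<open>auto simp del: insert_iff\<close>)

lemma LT_D_canonical_form:
  assumes "1 \<le> m" "r \<le> n" "\<epsilon> \<noteq> 0"
  shows "is_kronecker_canonical_form_of (direct_sum [kron_LT (m + r), kron_D (n - r) \<mu>])
    (case \<mu> of
       Fin z \<Rightarrow>
         (four_block_mat (L_mat m)\<^sup>T (0\<^sub>m m n) (0\<^sub>m n (m - 1)) (1\<^sub>m n),
          four_block_mat (R_mat m)\<^sup>T (Delta_mat m n (n - r + 1) \<epsilon>) (0\<^sub>m n (m - 1)) (jordan_block n z))
     | Infty \<Rightarrow>
         (four_block_mat (L_mat m)\<^sup>T (Nabla_mat m n (n - r + 1) \<epsilon>) (0\<^sub>m n (m - 1)) (jordan_block n 0),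
          four_block_mat (R_mat m)\<^sup>T (0\<^sub>m m n) (0\<^sub>m n (m - 1)) (1\<^sub>m n)))" (is "is_kronecker_canonical_form_of _ ?T")
proof (rule is_kronecker_canonical_form_ofI)
  have "?T = perturbed_LT_D m n \<mu> r \<epsilon>"
    by (cases \<mu>) (simp_all add: block_upper_def kron_LT_def L_mat_def R_mat_def kron_D.simps)
  then show "pair_equiv ?T (kron_LT (m + r) \<boxplus> kron_D (n - r) \<mu>)" using perturbed_LT_D(1)[OF assms] by (simp only:)
qed (use assms indecomposable_or_empty(2)[of "m + r"] indecomposable_or_empty(3)[of "n - r" \<mu>] in \<open>auto simp del: insert_iff\<close>)

lemma L_D_canonical_form:
  assumes "1 \<le> m" "r \<le> n" "\<epsilon> \<noteq> 0"
  shows "is_kronecker_canonical_form_of (direct_sum [kron_L (m + r), kron_D (n - r) \<mu>])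
    (case \<mu> of
       Fin z \<Rightarrow>
         (four_block_mat (L_mat m) (0\<^sub>m (m - 1) n) (0\<^sub>m n m) (1\<^sub>m n),
          four_block_mat (R_mat m) (0\<^sub>m (m - 1) n) (Delta_mat m n r \<epsilon>)\<^sup>T (jordan_block n z))
     | Infty \<Rightarrow>
         (four_block_mat (jordan_block n 0) (Nabla_mat m n r \<epsilon>)\<^sup>T (0\<^sub>m (m - 1) n) (L_mat m),
          four_block_mat (1\<^sub>m n) (0\<^sub>m n m) (0\<^sub>m (m - 1) n) (R_mat m)))" (is "is_kronecker_canonical_form_of _ ?T")
proof (rule is_kronecker_canonical_form_ofI)
  have "?T = perturbed_L_D m n \<mu> r \<epsilon>"
    by (cases \<mu>) (simp_all add: block_upper_def block_lower_def kron_L_def L_mat_def R_mat_def kron_D.simps)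
  then show "pair_equiv ?T (kron_L (m + r) \<boxplus> kron_D (n - r) \<mu>)" using perturbed_L_D(1)[OF assms] by (simp only:)
qed (use assms indecomposable_or_empty(1)[of "m + r"] indecomposable_or_empty(3)[of "n - r" \<mu>] in \<open>auto simp del: insert_iff\<close>)

lemma two_D_canonical_form:
  assumes "1 \<le> m" "m \<le> n" "1 \<le> r" "r \<le> m" "\<epsilon> \<noteq> 0"
  shows "is_kronecker_canonical_form_of (direct_sum [kron_D (m - r) \<mu>, kron_D (n + r) \<mu>])
    (case \<mu> of
       Fin z \<Rightarrow>
         (1\<^sub>m (m + n),
          four_block_mat (jordan_block m z) (Delta_mat n m r \<epsilon>)\<^sup>T (0\<^sub>m n m) (jordan_block n z))
     | Infty \<Rightarrow>
         (four_block_mat (jordan_block m 0) (Delta_mat n m r \<epsilon>)\<^sup>T (0\<^sub>m n m) (jordan_block n 0),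
          1\<^sub>m (m + n)))" (is "is_kronecker_canonical_form_of _ ?T")
proof (rule is_kronecker_canonical_form_ofI)
  have "four_block_mat (1\<^sub>m m) (0\<^sub>m m n) (0\<^sub>m n m) (1\<^sub>m n) = (1\<^sub>m (m + n) :: complex mat)" by (intro eq_matI) auto
  then have "?T = perturbed_two_D m n \<mu> r \<epsilon>"
    by (cases \<mu>) (simp_all add: block_upper_def kron_D.simps)
  then show "pair_equiv ?T (kron_D (m - r) \<mu> \<boxplus> kron_D (n + r) \<mu>)" using perturbed_two_D(1)[OF assms] by (simp only:)
qed (use indecomposable_or_empty(3)[of "m - r" \<mu>] indecomposable_or_empty(3)[of "n + r" \<mu>] in \<open>auto simp del: insert_iff\<close>)

lemma LT_L_canonical_form:
  assumes "1 \<le> m" "1 \<le> n" "distinct_eigenvalue_data (m + n - 1) rs" "\<epsilon> \<noteq> 0"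
    "\<forall>j<n. - \<beta> j = \<epsilon> * coeff (finite_part_poly rs) j"
    "\<forall>i<m. \<alpha> i = \<epsilon> * coeff (finite_part_poly rs) (n + i)"
  shows "is_kronecker_canonical_form_of (kron_D_sum rs)
    (four_block_mat (L_mat m)\<^sup>T (last_col_mat m n \<alpha>) (0\<^sub>m (n - 1) (m - 1)) (L_mat n),
     four_block_mat (R_mat m)\<^sup>T (first_row_mat m n \<beta>) (0\<^sub>m (n - 1) (m - 1)) (R_mat n))" (is "is_kronecker_canonical_form_of _ ?T")
  unfolding kron_D_sum_def
proof (rule is_kronecker_canonical_form_ofI)
  have "?T = block_upper (kron_LT m) (last_col_mat m n \<alpha>, first_row_mat m n \<beta>) (kron_L n)"
    by (simp add: block_upper_def kron_LT_def kron_L_def L_mat_def R_mat_def)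
  then show "pair_equiv ?T (direct_sum (map (\<lambda>(k, \<mu>). kron_D k \<mu>) rs))"
    using perturbed_LT_L(1)[OF assms] unfolding kron_D_sum_def by (simp only:)
qed (use indecomposable_or_empty(3) in_kron_D_list in blast)

theorem mainTheorem3:
  shows
   "(\<forall>X \<in> indecomposable_kronecker_pairs. lower_cone (pair_orbit X) = {pair_orbit X})
  \<and> \<comment> \<open>(i)\<close>
    (\<forall>m n. 1 \<le> m \<and> m \<le> n \<longrightarrow>
       lower_cone (pair_orbit (direct_sum [kron_LT m, kron_LT n]))
         = {pair_orbit (direct_sum [kron_LT (m + r), kron_LT (n - r)]) | r. m + r \<le> n - r}
     \<and> (\<forall>r \<epsilon>. m + r \<le> n - r \<and> \<epsilon> \<noteq> 0 \<longrightarrow>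
          is_kronecker_canonical_form_of (direct_sum [kron_LT (m + r), kron_LT (n - r)])
            (four_block_mat (L_mat m)\<^sup>T (0\<^sub>m m (n - 1)) (0\<^sub>m n (m - 1)) (L_mat n)\<^sup>T,
             four_block_mat (R_mat m)\<^sup>T (Delta_mat m (n - 1) r \<epsilon>) (0\<^sub>m n (m - 1)) (R_mat n)\<^sup>T)))
  \<and> \<comment> \<open>(ii)\<close>
    (\<forall>m n. 1 \<le> m \<and> m \<le> n \<longrightarrow>
       lower_cone (pair_orbit (direct_sum [kron_L m, kron_L n]))
         = {pair_orbit (direct_sum [kron_L (m + r), kron_L (n - r)]) | r. m + r \<le> n - r}
     \<and> (\<forall>r \<epsilon>. m + r \<le> n - r \<and> \<epsilon> \<noteq> 0 \<longrightarrow>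
          is_kronecker_canonical_form_of (direct_sum [kron_L (m + r), kron_L (n - r)])
            (four_block_mat (L_mat m) (0\<^sub>m (m - 1) n) (0\<^sub>m (n - 1) m) (L_mat n),
             four_block_mat (R_mat m) (0\<^sub>m (m - 1) n) (Delta_mat m (n - 1) r \<epsilon>)\<^sup>T (R_mat n))))
  \<and> \<comment> \<open>(iii)\<close>
    (\<forall>m n \<mu>. 1 \<le> m \<and> 1 \<le> n \<longrightarrow>
       lower_cone (pair_orbit (direct_sum [kron_LT m, kron_D n \<mu>]))
         = {pair_orbit (direct_sum [kron_LT (m + r), kron_D (n - r) \<mu>]) | r. r \<le> n}
     \<and> (\<forall>r \<epsilon>. 0 < r \<and> r \<le> n \<and> \<epsilon> \<noteq> 0 \<longrightarrow>
          is_kronecker_canonical_form_of (direct_sum [kron_LT (m + r), kron_D (n - r) \<mu>])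
            (case \<mu> of
               Fin z \<Rightarrow>
                 (four_block_mat (L_mat m)\<^sup>T (0\<^sub>m m n) (0\<^sub>m n (m - 1)) (1\<^sub>m n),
                  four_block_mat (R_mat m)\<^sup>T (Delta_mat m n (n - r + 1) \<epsilon>)
                                 (0\<^sub>m n (m - 1)) (jordan_block n z))
             | Infty \<Rightarrow>
                 (four_block_mat (L_mat m)\<^sup>T (Nabla_mat m n (n - r + 1) \<epsilon>)
                                 (0\<^sub>m n (m - 1)) (jordan_block n 0),
                  four_block_mat (R_mat m)\<^sup>T (0\<^sub>m m n) (0\<^sub>m n (m - 1)) (1\<^sub>m n)))))
  \<and> \<comment> \<open>(iv)\<close>
    (\<forall>m n \<mu>. 1 \<le> m \<and> 1 \<le> n \<longrightarrow>
       lower_cone (pair_orbit (direct_sum [kron_L m, kron_D n \<mu>]))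
         = {pair_orbit (direct_sum [kron_L (m + r), kron_D (n - r) \<mu>]) | r. r \<le> n}
     \<and> (\<forall>r \<epsilon>. 0 < r \<and> r \<le> n \<and> \<epsilon> \<noteq> 0 \<longrightarrow>
          is_kronecker_canonical_form_of (direct_sum [kron_L (m + r), kron_D (n - r) \<mu>])
            (case \<mu> of
               Fin z \<Rightarrow>
                 (four_block_mat (L_mat m) (0\<^sub>m (m - 1) n) (0\<^sub>m n m) (1\<^sub>m n),
                  four_block_mat (R_mat m) (0\<^sub>m (m - 1) n)
                                 (Delta_mat m n r \<epsilon>)\<^sup>T (jordan_block n z))
             | Infty \<Rightarrow>
                 (four_block_mat (jordan_block n 0) (Nabla_mat m n r \<epsilon>)\<^sup>T
                                 (0\<^sub>m (m - 1) n) (L_mat m),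
                  four_block_mat (1\<^sub>m n) (0\<^sub>m n m) (0\<^sub>m (m - 1) n) (R_mat m)))))
  \<and> \<comment> \<open>(v)\<close>
    (\<forall>m n \<mu>. 1 \<le> m \<and> m \<le> n \<longrightarrow>
       lower_cone (pair_orbit (direct_sum [kron_D m \<mu>, kron_D n \<mu>]))
         = {pair_orbit (direct_sum [kron_D (m - r) \<mu>, kron_D (n + r) \<mu>]) | r. r \<le> m}
     \<and> (\<forall>r \<epsilon>. 0 < r \<and> r \<le> m \<and> \<epsilon> \<noteq> 0 \<longrightarrow>
          is_kronecker_canonical_form_of (direct_sum [kron_D (m - r) \<mu>, kron_D (n + r) \<mu>])
            (case \<mu> of
               Fin z \<Rightarrow>
                 (1\<^sub>m (m + n),
                  four_block_mat (jordan_block m z) (Delta_mat n m r \<epsilon>)\<^sup>T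
                                 (0\<^sub>m n m) (jordan_block n z))
             | Infty \<Rightarrow>
                 (four_block_mat (jordan_block m 0) (Delta_mat n m r \<epsilon>)\<^sup>T
                                 (0\<^sub>m n m) (jordan_block n 0),
                  1\<^sub>m (m + n)))))
  \<and> \<comment> \<open>(vi)\<close>
    (\<forall>m n. 1 \<le> m \<and> 1 \<le> n \<longrightarrow>
       lower_cone (pair_orbit (direct_sum [kron_LT m, kron_L n]))
         = {pair_orbit (direct_sum [kron_LT m, kron_L n])}
           \<union> {pair_orbit (kron_D_sum rs) | rs. distinct_eigenvalue_data (m + n - 1) rs}
     \<and> (\<forall>rs \<epsilon> \<alpha> \<beta>.
          distinct_eigenvalue_data (m + n - 1) rs \<and> \<epsilon> \<noteq> 0
          \<and> (\<forall>j<n. - \<beta> j = \<epsilon> * coeff (finite_part_poly rs) j)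
          \<and> (\<forall>i<m. \<alpha> i = \<epsilon> * coeff (finite_part_poly rs) (n + i)) \<longrightarrow>
          is_kronecker_canonical_form_of (kron_D_sum rs)
            (four_block_mat (L_mat m)\<^sup>T (last_col_mat m n \<alpha>) (0\<^sub>m (n - 1) (m - 1)) (L_mat n),
             four_block_mat (R_mat m)\<^sup>T (first_row_mat m n \<beta>) (0\<^sub>m (n - 1) (m - 1)) (R_mat n))))"
proof (intro conjI ballI allI impI, goal_cases)
  case (1 X)
  then show ?case by (rule lower_cone_indecomposable)
next
  case (2 m n)
  then show ?case by (intro lower_cone_eq_Collect cone_two_LT) auto
next
  case (3 m n r \<epsilon>)
  then show ?case by (intro two_LT_canonical_form) auto
next
  case (4 m n)
  then show ?case by (intro lower_cone_eq_Collect cone_two_L) auto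
next
  case (5 m n r \<epsilon>)
  then show ?case by (intro two_L_canonical_form) auto
next
  case (6 m n \<mu>)
  then show ?case by (intro lower_cone_eq_Collect cone_LT_D) auto
next
  case (7 m n \<mu> r \<epsilon>)
  then show ?case by (intro LT_D_canonical_form) auto
next
  case (8 m n \<mu>)
  then show ?case by (intro lower_cone_eq_Collect cone_L_D) auto
next
  case (9 m n \<mu> r \<epsilon>)
  then show ?case by (intro L_D_canonical_form) auto
next
  case (10 m n \<mu>)
  then show ?case by (intro lower_cone_eq_Collect cone_two_D) auto
next
  case (11 m n \<mu> r \<epsilon>)
  then show ?case by (intro two_D_canonical_form) auto
next
  case (12 m n)
  then have "1 \<le> m" "1 \<le> n" by auto
  from lower_cone_eq[OF cone_LT_L[OF this]] show ?case by (simp add: image_Un setcompr_eq_image image_image)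
next
  case (13 m n rs \<epsilon> \<alpha> \<beta>)
  then show ?case by (intro LT_L_canonical_form[of m n rs \<epsilon>]) auto
qed

end
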